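(* Define the constant $$C_0:=384\,c'\ln(2)\big(1+\|u_x^{(0)}\|_\infty^2\big)^3,\qquad c'=2(2\pi\sigma^2)^{-1/2},$$ and suppose $\mu$ satisfies equation (ii) of the linear system (L) of the context (with $\mu(x,0)=0$ and $\mu(0,t)=0$) with $\Phi\in L^\infty_t(L^1_x)$. If $\lambda>C_0$, then $$\int_0^Te^{-\lambda t}\Big(\int_0^\infty|\mu|\,dx\Big)^2dt\le\frac{C_1\|\Phi\|_{L^\infty_t(L^1_x)}^2}{C_0}+C_2\int_0^Te^{-\lambda t}\int_0^\infty w_x^2m^{(0)}\,dx\,dt,$$ where the constants $C_1,C_2\in(0,\infty)$ depend only on $\|u_x^{(0)}\|_\infty$. In particular, if $T<\infty$, then there is no restriction on $\lambda$, and for $\lambda\in(0,C_0]$, $$\int_0^Te^{-\lambda t}\Big(\int_0^\infty|\mu|\,dx\Big)^2dt\le\frac{C_1\|\Phi\|_{L^\infty_t(L^1_x)}^2e^{2C_0T}}{C_0}+C_2e^{2C_0T}\int_0^Te^{-\lambda t}\int_0^\infty w_x^2m^{(0)}\,dx\,dt,$$ with the same $C_1$ and $C_2$.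
   Context: **Data and nonlinear system.** $T>0$; constants $\sigma>0$, $r>0$; a smooth $\xi:[0,T]\to[0,1]$ with $\xi(T)=0$; a smooth probability density $m_0$ on $[0,\infty)$ with $\int_0^\infty x\,m_0\,dx<\infty$; a smooth function $u_T$ on $[0,\infty)$; a parameter $\varepsilon\ge0$. Consider, for $0\le x<\infty$, $0\le t\le T$, $$u_t+\tfrac{\sigma^2}{2}u_{xx}-ru+F(t,u_x,m;\varepsilon)^2=0,\qquad m_t-\tfrac{\sigma^2}{2}m_{xx}-[F(t,u_x,m;\varepsilon)m]_x=0,$$ $m(x,0)=m_0(x)$, $u(x,T)=u_T(x)$, $u(0,t)=m(0,t)=0$, where $$F(t,u_x,m;\varepsilon)=\tfrac12\Big(\tfrac{2}{2+\varepsilon\xi(t)}+\tfrac{\varepsilon\xi(t)}{2+\varepsilon\xi(t)}\int_0^\infty u_x m\,dx-u_x\Big).$$ Standing assumption: the data satisfy conditions ensuring this system has a unique solution with $u,m$ in the parabolic Hölder space $\mathcal{C}^{2+\alpha,1+\alpha/2}([0,\infty)\times[0,T])$ for some $\alpha\in(0,1)$; it is denoted $(u^{(0)},m^{(0)})$, and $F^{(0)}:=F(t,u^{(0)}_x,m^{(0)};\varepsilon)$. **Linear system (L)** with given functions $\Psi,\Phi$, for $0\le x<\infty$, $0\le t\le T$: (i) $w_t+\frac{\sigma^2}{2}w_{xx}-rw+\Psi+F^{(0)}\big(G-w_x\big)=0$; (ii) $\mu_t-\frac{\sigma^2}{2}\mu_{xx}-\big(F^{(0)}\mu\big)_x=\big[\Phi+\frac12(G-w_x)m^{(0)}\big]_x$;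 (iii) $\mu(x,0)=0$, $w(x,T)=0$; (iv) $w(0,t)=\mu(0,t)=0$; where $G=G(t,w_x,\mu;\varepsilon)=\beta(\varepsilon\xi(t))\int_0^\infty\big(u_x^{(0)}\mu+m^{(0)}w_x\big)dx$ and $\beta(s)=\frac{s}{2+s}$. $\|f\|_{L^\infty_t(L^1_x)}$ is the $L^\infty(0,T)$ norm of $t\mapsto\int_0^\infty|f(x,t)|dx$; $\|\cdot\|_\infty$ is the sup norm.
   Formalization: C_1 and C_2 depend on ‖u_x‖_∞ and also on the fixed constant σ (constants uniform as σ→0 are impossible: take ε=0, Φ=0, m_0 a narrow bump); (ii) is taken in the weak sense with μ integrable over (0,∞)×(0,T), without which uniqueness fails. *)

theory Defs
  imports "HOL-Analysis.Analysis" "HOL-Probability.Essential_Supremum"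
begin

text \<open>Functions of space and time take their arguments in the order \<open>f x t\<close>, with \<open>x \<ge> 0\<close>
  and \<open>0 \<le> t \<le> T\<close>.  Derivatives are one-sided at the boundary of this strip.\<close>

definition smooth_on :: "real set \<Rightarrow> (real \<Rightarrow> real) \<Rightarrow> bool" where
  "smooth_on S f \<longleftrightarrow> (\<exists>D :: nat \<Rightarrow> real \<Rightarrow> real. (\<forall>x\<in>S. D 0 x = f x) \<and>
     (\<forall>k. \<forall>x\<in>S. (D k has_real_derivative D (Suc k) x) (at x within S)))"

definition D_x :: "(real \<Rightarrow> real \<Rightarrow> real) \<Rightarrow> real \<Rightarrow> real \<Rightarrow> real" where
  "D_x f x t = vector_derivative (\<lambda>y. f y t) (at x within {0..})"

abbreviation D_xx :: "(real \<Rightarrow> real \<Rightarrow> real) \<Rightarrow> real \<Rightarrow> real \<Rightarrow> real" where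
  "D_xx f \<equiv> D_x (D_x f)"

definition D_t :: "real \<Rightarrow> (real \<Rightarrow> real \<Rightarrow> real) \<Rightarrow> real \<Rightarrow> real \<Rightarrow> real" where
  "D_t T f x t = vector_derivative (\<lambda>s. f x s) (at t within {0..T})"

definition differentiable_21 :: "real \<Rightarrow> (real \<Rightarrow> real \<Rightarrow> real) \<Rightarrow> bool" where
  "differentiable_21 T f \<longleftrightarrow> (\<forall>x\<ge>0. \<forall>t\<in>{0..T}.
     (\<lambda>y. f y t) differentiable (at x within {0..}) \<and>
     (\<lambda>y. D_x f y t) differentiable (at x within {0..}) \<and>
     (\<lambda>s. f x s) differentiable (at t within {0..T}))"

definition bounded_strip :: "real \<Rightarrow> (real \<Rightarrow> real \<Rightarrow> real) \<Rightarrow> bool" where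
  "bounded_strip T g \<longleftrightarrow> (\<exists>C. \<forall>x\<ge>0. \<forall>t\<in>{0..T}. \<bar>g x t\<bar> \<le> C)"

definition holder_x :: "real \<Rightarrow> real \<Rightarrow> (real \<Rightarrow> real \<Rightarrow> real) \<Rightarrow> bool" where
  "holder_x a T g \<longleftrightarrow>
     (\<exists>C. \<forall>x\<ge>0. \<forall>y\<ge>0. \<forall>t\<in>{0..T}. \<bar>g x t - g y t\<bar> \<le> C * \<bar>x - y\<bar> powr a)"

definition holder_t :: "real \<Rightarrow> real \<Rightarrow> (real \<Rightarrow> real \<Rightarrow> real) \<Rightarrow> bool" where
  "holder_t a T g \<longleftrightarrow>
     (\<exists>C. \<forall>x\<ge>0. \<forall>s\<in>{0..T}. \<forall>t\<in>{0..T}. \<bar>g x s - g x t\<bar> \<le> C * \<bar>s - t\<bar> powr a)"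

text \<open>The space $C^{2+a,1+a/2}([0,\infty)\times[0,T])$ as in Ladyzhenskaya, Solonnikov and
  Uraltseva: the terms of its norm are the sup norms of the derivatives below, the Hoelder
  seminorms of \<open>f\<^sub>x\<^sub>x\<close> and \<open>f\<^sub>t\<close>, and the time seminorm of order \<open>(1+a)/2\<close> of \<open>f\<^sub>x\<close>.\<close>

definition parabolic_holder :: "real \<Rightarrow> real \<Rightarrow> (real \<Rightarrow> real \<Rightarrow> real) \<Rightarrow> bool" where
  "parabolic_holder a T f \<longleftrightarrow> differentiable_21 T f \<and>
     bounded_strip T f \<and> bounded_strip T (D_x f) \<and>
     bounded_strip T (D_xx f) \<and> bounded_strip T (D_t T f) \<and>
     holder_x a T (D_xx f) \<and> holder_t (a/2) T (D_xx f) \<and>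
     holder_x a T (D_t T f) \<and> holder_t (a/2) T (D_t T f) \<and>
     holder_t ((1+a)/2) T (D_x f)"

definition sup_norm :: "real \<Rightarrow> (real \<Rightarrow> real \<Rightarrow> real) \<Rightarrow> real" where
  "sup_norm T g = (SUP (x,t)\<in>{0..} \<times> {0..T}. \<bar>g x t\<bar>)"

definition mfg_data ::
  "real \<Rightarrow> real \<Rightarrow> (real \<Rightarrow> real) \<Rightarrow> (real \<Rightarrow> real) \<Rightarrow> (real \<Rightarrow> real) \<Rightarrow> real \<Rightarrow> bool" where
  "mfg_data r T \<xi> m\<^sub>0 u\<^sub>T \<epsilon> \<longleftrightarrow> r > 0 \<and> T > 0 \<and> \<epsilon> \<ge> 0 \<and>
     smooth_on {0..T} \<xi> \<and> \<xi> ` {0..T} \<subseteq> {0..1} \<and> \<xi> T = 0 \<and>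
     smooth_on {0..} m\<^sub>0 \<and> (\<forall>x\<ge>0. m\<^sub>0 x \<ge> 0) \<and>
     set_integrable lborel {0..} m\<^sub>0 \<and> (LBINT x:{0..}. m\<^sub>0 x) = 1 \<and>
     set_integrable lborel {0..} (\<lambda>x. x * m\<^sub>0 x) \<and>
     smooth_on {0..} u\<^sub>T"

definition mfg_F ::
  "real \<Rightarrow> (real \<Rightarrow> real) \<Rightarrow> (real \<Rightarrow> real \<Rightarrow> real) \<Rightarrow> (real \<Rightarrow> real \<Rightarrow> real) \<Rightarrow> real \<Rightarrow> real \<Rightarrow> real" where
  "mfg_F \<epsilon> \<xi> u m x t = 1/2 * (2 / (2 + \<epsilon> * \<xi> t) +
     \<epsilon> * \<xi> t / (2 + \<epsilon> * \<xi> t) * (LBINT y:{0..}. D_x u y t * m y t) - D_x u x t)"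

text \<open>The integrability clause says that the nonlocal term of \<open>mfg_F\<close> exists; without it the
  integral would silently be \<open>0\<close>.\<close>

definition mfg_solution ::
  "real \<Rightarrow> real \<Rightarrow> real \<Rightarrow> (real \<Rightarrow> real) \<Rightarrow> (real \<Rightarrow> real) \<Rightarrow> (real \<Rightarrow> real) \<Rightarrow> real \<Rightarrow>
   (real \<Rightarrow> real \<Rightarrow> real) \<Rightarrow> (real \<Rightarrow> real \<Rightarrow> real) \<Rightarrow> bool" where
  "mfg_solution \<sigma> r T \<xi> m\<^sub>0 u\<^sub>T \<epsilon> u m \<longleftrightarrow>
     (\<exists>a\<in>{0<..<1}. parabolic_holder a T u \<and> parabolic_holder a T m) \<and>
     (\<forall>t\<in>{0..T}. set_integrable lborel {0..} (\<lambda>x. D_x u x t * m x t)) \<and>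
     (\<forall>x\<ge>0. \<forall>t\<in>{0..T}.
        D_t T u x t + \<sigma>\<^sup>2/2 * D_xx u x t - r * u x t + (mfg_F \<epsilon> \<xi> u m x t)\<^sup>2 = 0 \<and>
        D_t T m x t - \<sigma>\<^sup>2/2 * D_xx m x t - D_x (\<lambda>y s. mfg_F \<epsilon> \<xi> u m y s * m y s) x t = 0) \<and>
     (\<forall>x\<ge>0. m x 0 = m\<^sub>0 x \<and> u x T = u\<^sub>T x) \<and>
     (\<forall>t\<in>{0..T}. u 0 t = 0 \<and> m 0 t = 0)"

definition mfg_unique_solution ::
  "real \<Rightarrow> real \<Rightarrow> real \<Rightarrow> (real \<Rightarrow> real) \<Rightarrow> (real \<Rightarrow> real) \<Rightarrow> (real \<Rightarrow> real) \<Rightarrow> real \<Rightarrow>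
   (real \<Rightarrow> real \<Rightarrow> real) \<Rightarrow> (real \<Rightarrow> real \<Rightarrow> real) \<Rightarrow> bool" where
  "mfg_unique_solution \<sigma> r T \<xi> m\<^sub>0 u\<^sub>T \<epsilon> u m \<longleftrightarrow> mfg_solution \<sigma> r T \<xi> m\<^sub>0 u\<^sub>T \<epsilon> u m \<and>
     (\<forall>v n. mfg_solution \<sigma> r T \<xi> m\<^sub>0 u\<^sub>T \<epsilon> v n \<longrightarrow>
        (\<forall>x\<ge>0. \<forall>t\<in>{0..T}. v x t = u x t \<and> n x t = m x t))"

definition beta :: "real \<Rightarrow> real" where
  "beta s = s / (2 + s)"

definition lin_G ::
  "real \<Rightarrow> (real \<Rightarrow> real) \<Rightarrow> (real \<Rightarrow> real \<Rightarrow> real) \<Rightarrow> (real \<Rightarrow> real \<Rightarrow> real) \<Rightarrow>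
   (real \<Rightarrow> real \<Rightarrow> real) \<Rightarrow> (real \<Rightarrow> real \<Rightarrow> real) \<Rightarrow> real \<Rightarrow> real" where
  "lin_G \<epsilon> \<xi> u m w \<mu> t =
     beta (\<epsilon> * \<xi> t) * (LBINT x:{0..}. D_x u x t * \<mu> x t + m x t * D_x w x t)"

text \<open>Test functions are $C^{2,1}$, have compact support in $[0,\infty)\times[0,T)$ and vanish at
  \<open>x = 0\<close>; their \<open>x\<close>-derivative need not vanish there, and they need not vanish at \<open>t = 0\<close>.\<close>

definition test_function :: "real \<Rightarrow> (real \<Rightarrow> real \<Rightarrow> real) \<Rightarrow> bool" where
  "test_function T \<phi> \<longleftrightarrow> differentiable_21 T \<phi> \<and>
     continuous_on ({0..} \<times> {0..T}) (\<lambda>(x,t). \<phi> x t) \<and>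
     continuous_on ({0..} \<times> {0..T}) (\<lambda>(x,t). D_x \<phi> x t) \<and>
     continuous_on ({0..} \<times> {0..T}) (\<lambda>(x,t). D_xx \<phi> x t) \<and>
     continuous_on ({0..} \<times> {0..T}) (\<lambda>(x,t). D_t T \<phi> x t) \<and>
     (\<forall>t\<in>{0..T}. \<phi> 0 t = 0) \<and>
     (\<exists>R S. S < T \<and> (\<forall>x\<ge>0. \<forall>t\<in>{0..T}. R \<le> x \<or> S \<le> t \<longrightarrow> \<phi> x t = 0))"

text \<open>Weak form of
  $\mu_t-\frac{\sigma^2}{2}\mu_{xx}-(F\mu)_x=q_x$, $\mu(x,0)=0$, $\mu(0,t)=0$, for integrable
  \<open>q\<close>: multiply by a test function and integrate by parts.  Since test functions are free at
  \<open>t = 0\<close> and have a free normal derivative at \<open>x = 0\<close>, the identity contains the initial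
  and the boundary condition.\<close>

definition FP_solution ::
  "real \<Rightarrow> real \<Rightarrow> (real \<Rightarrow> real \<Rightarrow> real) \<Rightarrow> (real \<Rightarrow> real \<Rightarrow> real) \<Rightarrow> (real \<Rightarrow> real \<Rightarrow> real) \<Rightarrow> bool" where
  "FP_solution \<sigma> T F q \<mu> \<longleftrightarrow>
     set_integrable lborel ({0<..} \<times> {0<..<T}) (\<lambda>(x,t). \<mu> x t) \<and>
     set_integrable lborel ({0<..} \<times> {0<..<T}) (\<lambda>(x,t). q x t) \<and>
     (\<forall>\<phi>. test_function T \<phi> \<longrightarrow>
        set_lebesgue_integral lborel ({0<..} \<times> {0<..<T})
          (\<lambda>(x,t). \<mu> x t * (D_t T \<phi> x t + \<sigma>\<^sup>2/2 * D_xx \<phi> x t - F x t * D_x \<phi> x t)) =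
        set_lebesgue_integral lborel ({0<..} \<times> {0<..<T}) (\<lambda>(x,t). q x t * D_x \<phi> x t))"

definition linear_FP_solution ::
  "real \<Rightarrow> real \<Rightarrow> (real \<Rightarrow> real) \<Rightarrow> real \<Rightarrow> (real \<Rightarrow> real \<Rightarrow> real) \<Rightarrow> (real \<Rightarrow> real \<Rightarrow> real) \<Rightarrow>
   (real \<Rightarrow> real \<Rightarrow> real) \<Rightarrow> (real \<Rightarrow> real \<Rightarrow> real) \<Rightarrow> (real \<Rightarrow> real \<Rightarrow> real) \<Rightarrow> bool" where
  "linear_FP_solution \<sigma> T \<xi> \<epsilon> u m \<Phi> w \<mu> \<longleftrightarrow>
     set_borel_measurable lborel ({0<..} \<times> {0<..<T}) (\<lambda>(x,t). w x t) \<and>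
     (\<forall>x>0. \<forall>t\<in>{0<..<T}. (\<lambda>y. w y t) differentiable (at x)) \<and>
     (AE t in lborel. t \<in> {0<..<T} \<longrightarrow>
        set_integrable lborel {0..} (\<lambda>x. D_x u x t * \<mu> x t + m x t * D_x w x t)) \<and>
     FP_solution \<sigma> T (mfg_F \<epsilon> \<xi> u m)
       (\<lambda>x t. \<Phi> x t + 1/2 * (lin_G \<epsilon> \<xi> u m w \<mu> t - D_x w x t) * m x t) \<mu>"

definition LinfL1_norm :: "real \<Rightarrow> (real \<Rightarrow> real \<Rightarrow> real) \<Rightarrow> ennreal" where
  "LinfL1_norm T f =
     esssup (restrict_space lborel {0<..<T}) (\<lambda>t. \<integral>\<^sup>+x\<in>{0..}. ennreal \<bar>f x t\<bar> \<partial>lborel)"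

definition LinfL1 :: "real \<Rightarrow> (real \<Rightarrow> real \<Rightarrow> real) \<Rightarrow> bool" where
  "LinfL1 T f \<longleftrightarrow>
     set_borel_measurable lborel ({0<..} \<times> {0<..<T}) (\<lambda>(x,t). f x t) \<and> LinfL1_norm T f < \<infinity>"

definition heat_const :: "real \<Rightarrow> real" where
  "heat_const \<sigma> = 2 * (2 * pi * \<sigma>\<^sup>2) powr (-1/2)"

definition C\<^sub>0 :: "real \<Rightarrow> real \<Rightarrow> real" where
  "C\<^sub>0 \<sigma> U = 384 * heat_const \<sigma> * ln 2 * (1 + U\<^sup>2) ^ 3"

text \<open>Both sides of the estimate are integrals of nonnegative functions and are taken in
  \<open>[0,\<infinity>]\<close>, so that a finite right-hand side includes finiteness of the left-hand side.\<close>

definition weighted_L1_sq :: "real \<Rightarrow> real \<Rightarrow> (real \<Rightarrow> real \<Rightarrow> real) \<Rightarrow> ennreal" where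
  "weighted_L1_sq l T \<mu> = (\<integral>\<^sup>+t\<in>{0..T}.
     ennreal (exp (- l * t)) * (\<integral>\<^sup>+x\<in>{0..}. ennreal \<bar>\<mu> x t\<bar> \<partial>lborel)\<^sup>2 \<partial>lborel)"

definition weighted_energy ::
  "real \<Rightarrow> real \<Rightarrow> (real \<Rightarrow> real \<Rightarrow> real) \<Rightarrow> (real \<Rightarrow> real \<Rightarrow> real) \<Rightarrow> ennreal" where
  "weighted_energy l T w m = (\<integral>\<^sup>+t\<in>{0..T}.
     ennreal (exp (- l * t)) * (\<integral>\<^sup>+x\<in>{0..}. ennreal ((D_x w x t)\<^sup>2 * m x t) \<partial>lborel) \<partial>lborel)"

end

(* Duality. Fix a bounded continuous test density psi(x,t), odd in x and dominated by omega(t), and solve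
   the backward problem phi_t + (sigma^2/2) phi_xx - F phi_x + zeta(t) u_x = -psi, phi(0,t) = phi(x,T) = 0,
   with the nonlocal coefficient zeta(t) = -(1/2) beta(t) int phi_x m dx. Testing the equation for mu with
   phi makes the nonlocal parts on both sides cancel, so that int int mu psi = - int int q0 phi_x, where q0 is
   q without the contribution of int u_x mu dx; no a priori bound on that integral is needed.

   phi_x is controlled by omega in the L^2 space with weight e^(lt). The heat potential representation and
   the maximum principle bound sup_x |phi_x| by omega and zeta, and zeta is bounded by an energy estimate:
   for c' = r c - zeta, c(T) = 0, the function h = phi - c u_x solves a drift equation in which only c, not
   zeta, appears (u_x is replaced by a difference quotient, since u_xxx need not exist); int h^2 m dx is then
   combined with the total action int int u_xx^2 m dx dt, which the equations for u and m bound in terms of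
   sup |u_x| alone. This is where the constants become independent of the remaining data.

   Letting psi approach sgn(mu) e^(-lt) min(int |mu| dx, N) and then N to infinity gives the estimate.
   The dual problem is only solved up to an error s: coefficients are extended oddly and truncated
   near x = 0 at scale s, and the fixed point is taken among mollified right-hand sides. *)
theory Submission
  imports Defs "HOL-Probability.Probability" "HOL-Real_Asymp.Real_Asymp"
begin

section \<open>Gaussian averages and heat potentials\<close>

text \<open>Two kinds of constants must be kept apart. The final ones may depend on sup |u_x|,
  besides the fixed \<sigma>, whereas the bounds on u_xx and m are only known to be finite. Every
  estimate is therefore arranged so that a constant of the second kind comes with a factor s, the
  error scale, and disappears as s tends to 0.

  The dual equation is solved only up to an error because its drift is merely Lipschitz in x: one
  Picard step does not return a source with two bounded x-derivatives, which the heat potential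
  needs to be a classical solution. Mollification after each step repairs this.

  Two rates have different roles: \<open>Lam\<close> damps the heat potential and is fixed by the
  contraction, while the rate l of the weight exp(l t) comes from the estimate to be proved and is
  only bounded below, by \<open>l0\<close>.

  At the outset m is just a bounded solution. That its mass stays at most 1 has to be proved, and F,
  which contains an integral over m, has to be bounded before that.\<close>

lemma has_real_derivative_integral:
  fixes g g' :: "real \<Rightarrow> 'z \<Rightarrow> real"
  assumes S: "convex S" "a \<in> S"
    and der: "\<And>x z. x \<in> S \<Longrightarrow> ((\<lambda>x. g x z) has_real_derivative g' x z) (at x within S)"
    and int: "\<And>x. x \<in> S \<Longrightarrow> integrable M (g x)"
    and bd: "\<And>x z. x \<in> S \<Longrightarrow> \<bar>g' x z\<bar> \<le> w z"
    and w: "integrable M w" and meas: "g' a \<in> borel_measurable M"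
  shows "((\<lambda>x. \<integral>z. g x z \<partial>M) has_real_derivative (\<integral>z. g' a z \<partial>M)) (at a within S)"
  unfolding has_field_derivative_iff tendsto_at_iff_sequentially
proof (intro allI impI)
  fix X :: "nat \<Rightarrow> real"
  assume X: "\<forall>i. X i \<in> S - {a}" and lim: "X \<longlonglongrightarrow> a"
  have eq: "((\<lambda>y. ((\<integral>z. g y z \<partial>M) - (\<integral>z. g a z \<partial>M)) / (y - a)) \<circ> X) i
      = (\<integral>z. (g (X i) z - g a z) / (X i - a) \<partial>M)" for i
    using int[of "X i"] int[of a] X S by (auto simp: Bochner_Integration.integral_diff)
  have "(\<lambda>i. \<integral>z. (g (X i) z - g a z) / (X i - a) \<partial>M) \<longlonglongrightarrow> (\<integral>z. g' a z \<partial>M)"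
  proof (rule integral_dominated_convergence[where w=w])
    show "g' a \<in> borel_measurable M" by (rule meas)
    show "(\<lambda>z. (g (X i) z - g a z) / (X i - a)) \<in> borel_measurable M" for i
      using int[of "X i"] int[of a] X S by auto
    show "integrable M w" by (rule w)
    show "AE z in M. (\<lambda>i. (g (X i) z - g a z) / (X i - a)) \<longlonglongrightarrow> g' a z"
    proof (rule AE_I2)
      fix z
      have "((\<lambda>y. (g y z - g a z) / (y - a)) \<longlongrightarrow> g' a z) (at a within S)"
        using der[OF S(2)] by (simp add: has_field_derivative_iff)
      then show "(\<lambda>i. (g (X i) z - g a z) / (X i - a)) \<longlonglongrightarrow> g' a z"
        using X lim unfolding tendsto_at_iff_sequentially by (auto simp: o_def)
    qed
    show "AE z in M. norm ((g (X i) z - g a z) / (X i - a)) \<le> w z" for i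
    proof (rule AE_I2)
      fix z
      have "norm (g (X i) z - g a z) \<le> w z * norm (X i - a)"
        by (rule field_differentiable_bound[OF S(1) der]) (use bd X S in auto)
      then show "norm ((g (X i) z - g a z) / (X i - a)) \<le> w z"
        using X[rule_format, of i] by (simp add: divide_simps)
    qed
  qed
  then show "((\<lambda>y. ((\<integral>z. g y z \<partial>M) - (\<integral>z. g a z \<partial>M)) / (y - a)) \<circ> X) \<longlonglongrightarrow> (\<integral>z. g' a z \<partial>M)"
    using eq by presburger
qed

lemma continuous_on_integral_dominated:
  fixes g :: "'p::metric_space \<Rightarrow> 'z \<Rightarrow> real"
  assumes cont: "\<And>z. continuous_on S (\<lambda>p. g p z)"
    and meas: "\<And>p. p \<in> S \<Longrightarrow> g p \<in> borel_measurable M"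
    and bd: "\<And>p z. p \<in> S \<Longrightarrow> \<bar>g p z\<bar> \<le> w z" and w: "integrable M w"
  shows "continuous_on S (\<lambda>p. \<integral>z. g p z \<partial>M)"
  unfolding continuous_on_sequentially comp_def
proof (intro allI ballI impI)
  fix X a assume a: "a \<in> S" and X: "(\<forall>n. X n \<in> S) \<and> X \<longlonglongrightarrow> a"
  show "(\<lambda>n. \<integral>z. g (X n) z \<partial>M) \<longlonglongrightarrow> (\<integral>z. g a z \<partial>M)"
  proof (rule integral_dominated_convergence[where w=w])
    show "AE z in M. (\<lambda>n. g (X n) z) \<longlonglongrightarrow> g a z"
      using cont a X unfolding continuous_on_sequentially comp_def by auto
  qed (use meas bd w X a in auto)
qed

lemma continuous_on_compose_case_prod:
  assumes "continuous_on T (\<lambda>(x, t). h x t)" "continuous_on S f" "continuous_on S g"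
    "\<And>z. z \<in> S \<Longrightarrow> (f z, g z) \<in> T"
  shows "continuous_on S (\<lambda>z. h (f z) (g z))"
  using continuous_on_compose2[OF assms(1), of S "\<lambda>z. (f z, g z)"] assms(2-4)
  by (auto simp: image_subset_iff intro!: continuous_on_Pair)

abbreviation "gauss \<equiv> std_normal_density"

lemma gauss_has_derivative: "(gauss has_real_derivative - z * gauss z) (at z)"
  unfolding std_normal_density_def[abs_def]
  by (rule derivative_eq_intros refl | simp add: field_simps)+

lemma continuous_gauss: "continuous_on S gauss"
  unfolding std_normal_density_def[abs_def] by (intro continuous_intros) auto

lemma integrable_gauss: "integrable lborel gauss"
  and integral_gauss: "(LBINT z. gauss z) = 1"
  using integrable_std_normal_moment[of 0] integral_std_normal_moment_even[of 0] by auto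

lemma integrable_abs_gauss: "integrable lborel (\<lambda>z. \<bar>z\<bar> * gauss z)"
  using integrable_std_normal_moment_abs[of 1] by (simp add: mult.commute)

lemma integral_abs_gauss_le: "(LBINT z. \<bar>z\<bar> * gauss z) \<le> 1"
proof -
  have "sqrt (2 / pi) \<le> 1" using pi_ge_two by (simp add: field_simps)
  then show ?thesis
    using integral_std_normal_moment_abs_odd[of 0] by (simp add: mult.commute)
qed

lemma tendsto_gauss: "(gauss \<longlongrightarrow> 0) at_top" "(gauss \<longlongrightarrow> 0) at_bot"
proof -
  have *: "filterlim (\<lambda>x::real. - x\<^sup>2 / 2) at_bot at_top" "filterlim (\<lambda>x::real. - x\<^sup>2 / 2) at_bot at_bot"
    by real_asymp+
  show "(gauss \<longlongrightarrow> 0) at_top" "(gauss \<longlongrightarrow> 0) at_bot"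
    unfolding std_normal_density_def[abs_def]
    by (rule tendsto_mult_right_zero, rule filterlim_compose[OF exp_at_bot], rule *)+
qed

text \<open>Since gauss' = -z gauss, the integrand \<open>?f\<close> is the derivative of f(x + a z)
  gauss(z), which vanishes at both ends. The identity serves in both directions: to move a
  derivative off a function at the price of 1/a, and to see that the average solves a heat equation
  in a.\<close>

lemma gauss_integration_by_parts:
  fixes f f' :: "real \<Rightarrow> real"
  assumes der: "\<And>x. (f has_real_derivative f' x) (at x)"
    and B: "\<And>x. \<bar>f x\<bar> \<le> B" and B': "\<And>x. \<bar>f' x\<bar> \<le> B'" and cont: "continuous_on UNIV f'"
  shows "(LBINT z. f (x + a * z) * (z * gauss z)) = a * (LBINT z. f' (x + a * z) * gauss z)"
proof -
  have cf: "continuous_on UNIV f"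
    by (meson DERIV_continuous_on der has_field_derivative_at_within)
  have [measurable]: "f \<in> borel_measurable borel" "f' \<in> borel_measurable borel"
    using cf cont by (auto intro: borel_measurable_continuous_onI)
  have i1: "integrable lborel (\<lambda>z. f (x + a * z) * (z * gauss z))"
    by (rule Bochner_Integration.integrable_bound[OF integrable_mult_right[OF integrable_abs_gauss, of B]])
       (use order_trans[OF B abs_ge_self] in \<open>auto simp: abs_mult intro!: mult_right_mono AE_I2\<close>)
  have i2: "integrable lborel (\<lambda>z. f' (x + a * z) * gauss z)"
    by (rule Bochner_Integration.integrable_bound[OF integrable_mult_right[OF integrable_gauss, of B']])
       (use order_trans[OF B' abs_ge_self] in \<open>auto simp: abs_mult intro!: mult_right_mono AE_I2\<close>)
  let ?F = "\<lambda>z. f (x + a * z) * gauss z"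
  let ?f = "\<lambda>z. a * (f' (x + a * z) * gauss z) - f (x + a * z) * (z * gauss z)"
  have lim: "(?F \<longlongrightarrow> 0) at_top" "(?F \<longlongrightarrow> 0) at_bot"
  proof -
    have "((\<lambda>z. B * gauss z) \<longlongrightarrow> 0) at_top" "((\<lambda>z. B * gauss z) \<longlongrightarrow> 0) at_bot"
      by (intro tendsto_mult_right_zero tendsto_gauss)+
    moreover have "eventually (\<lambda>z. norm (?F z) \<le> B * gauss z) F" for F
      using B by (auto simp: abs_mult intro!: always_eventually mult_right_mono)
    ultimately show "(?F \<longlongrightarrow> 0) at_top" "(?F \<longlongrightarrow> 0) at_bot"
      by (metis Lim_null_comparison)+
  qed
  have "(LBINT z=-\<infinity>..\<infinity>. ?f z) = 0 - 0"
  proof (rule interval_integral_FTC_integrable[where F="?F"])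
    fix z :: real
    show "(?F has_vector_derivative ?f z) (at z)"
      unfolding has_real_derivative_iff_has_vector_derivative[symmetric]
      by (rule derivative_eq_intros DERIV_chain2[OF der] gauss_has_derivative refl | simp add: algebra_simps)+
    have "continuous_on UNIV ?f"
      by (intro continuous_intros continuous_gauss continuous_on_compose2[OF cont] continuous_on_compose2[OF cf]) auto
    then show "isCont ?f z" by (simp add: continuous_on_eq_continuous_at)
  next
    show "set_integrable lborel (einterval (- \<infinity>) \<infinity>) ?f"
      unfolding set_integrable_def using i1 i2 by auto
    show "((?F \<circ> real_of_ereal) \<longlongrightarrow> 0) (at_right (- \<infinity>))"
      using lim by (simp add: ereal_tendsto_simps1)
    show "((?F \<circ> real_of_ereal) \<longlongrightarrow> 0) (at_left \<infinity>)"
      using lim by (simp add: ereal_tendsto_simps1)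
  qed simp
  then have "(LBINT z. ?f z) = 0" by (simp add: interval_integral_to_infinity_eq interval_lebesgue_integral_def set_lebesgue_integral_def)
  then show ?thesis using i1 i2 by simp
qed

section \<open>Gaussian averages and heat potentials of bounded continuous functions\<close>

definition bcont :: "(real \<Rightarrow> real \<Rightarrow> real) \<Rightarrow> bool" where
  "bcont h \<longleftrightarrow> continuous_on UNIV (\<lambda>(x, t). h x t) \<and> (\<exists>B. \<forall>x t. \<bar>h x t\<bar> \<le> B)"

text \<open>With a = \<sigma> sqrt \<tau> this is the heat semigroup of \<sigma>^2/2 d_xx at time
  \<tau>. Scaling the variable instead of the density keeps a = 0 harmless: the average is then the
  function itself.\<close>

definition gauss_avg :: "(real \<Rightarrow> real \<Rightarrow> real) \<Rightarrow> real \<Rightarrow> real \<Rightarrow> real \<Rightarrow> real" where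
  "gauss_avg h x a t = (LBINT z. h (x + a * z) t * gauss z)"

text \<open>A solution \<phi> of the backward equation \<phi>_t + \<sigma>^2/2 \<phi>_xx - L \<phi>
  = -h. The damping L makes the integral over all future times converge; an equation without this
  term is reached by adding L \<phi> to the source.\<close>

definition heat_pot :: "real \<Rightarrow> real \<Rightarrow> (real \<Rightarrow> real \<Rightarrow> real) \<Rightarrow> real \<Rightarrow> real \<Rightarrow> real" where
  "heat_pot \<sigma> L h x s = (LBINT \<tau>. indicator {0<..} \<tau> * exp (- L * \<tau>) * gauss_avg h x (\<sigma> * sqrt \<tau>) (s + \<tau>))"

lemma bcontE:
  assumes "bcont h"
  obtains B where "\<And>x t. \<bar>h x t\<bar> \<le> B"
  using assms that unfolding bcont_def by blast

lemma bcont_continuous_on: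
  assumes "bcont h" "continuous_on S f" "continuous_on S g"
  shows "continuous_on S (\<lambda>z. h (f z) (g z))"
  using assms unfolding bcont_def by (auto intro: continuous_on_compose_case_prod)

lemma bcont_measurable:
  assumes "bcont h" "f \<in> borel_measurable M" "g \<in> borel_measurable M"
  shows "(\<lambda>z. h (f z) (g z)) \<in> borel_measurable M"
proof -
  have "(\<lambda>(x, t). h x t) \<in> borel_measurable borel"
    using assms(1) by (auto simp: bcont_def intro: borel_measurable_continuous_onI)
  from measurable_compose[OF _ this, of "\<lambda>z. (f z, g z)" M] show ?thesis
    using assms(2,3) by (simp add: borel_prod[symmetric])
qed

lemma gauss_avg_integrable:
  assumes "bcont h"
  shows "integrable lborel (\<lambda>z. h (x + a * z) t * gauss z)"
proof -
  obtain B where B: "\<And>x t. \<bar>h x t\<bar> \<le> B" using assms by (elim bcontE) (erule that)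
  have [measurable]: "(\<lambda>z. h (x + a * z) t) \<in> borel_measurable lborel"
    by (rule bcont_measurable[OF assms]) auto
  show ?thesis
    by (rule Bochner_Integration.integrable_bound[OF integrable_mult_right[OF integrable_gauss, of B]])
       (use order_trans[OF B abs_ge_self] in \<open>auto simp: abs_mult intro!: mult_right_mono AE_I2\<close>)
qed

lemma gauss_avg_bound:
  assumes "bcont h" "\<And>y. \<bar>h y t\<bar> \<le> B"
  shows "\<bar>gauss_avg h x a t\<bar> \<le> B"
proof -
  have "\<bar>gauss_avg h x a t\<bar> \<le> (LBINT z. \<bar>h (x + a * z) t * gauss z\<bar>)"
    unfolding gauss_avg_def by (rule integral_abs_bound)
  also have "\<dots> \<le> (LBINT z. B * gauss z)"
    by (intro integral_mono integrable_abs gauss_avg_integrable assms integrable_mult_right integrable_gauss)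
       (auto simp: abs_mult intro!: mult_right_mono assms)
  finally show ?thesis by (simp add: integral_gauss)
qed

lemma gauss_avg_continuous:
  assumes "bcont h" "continuous_on S f" "continuous_on S g" "continuous_on S k"
  shows "continuous_on S (\<lambda>p. gauss_avg h (f p) (g p) (k p))"
proof -
  obtain B where B: "\<And>x t. \<bar>h x t\<bar> \<le> B" using assms(1) by (elim bcontE) (erule that)
  have "continuous_on UNIV (\<lambda>p. \<integral>z. h (fst p + fst (snd p) * z) (snd (snd p)) * gauss z \<partial>lborel)"
  proof (rule continuous_on_integral_dominated)
    show "integrable lborel (\<lambda>z. B * gauss z)" by (intro integrable_mult_right integrable_gauss)
    fix z show "continuous_on UNIV (\<lambda>p. h (fst p + fst (snd p) * z) (snd (snd p)) * gauss z)"
      by (intro continuous_intros bcont_continuous_on[OF assms(1)])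
    fix p :: "real \<times> real \<times> real"
    show "\<bar>h (fst p + fst (snd p) * z) (snd (snd p)) * gauss z\<bar> \<le> B * gauss z"
      by (auto simp: abs_mult intro!: mult_right_mono B)
    show "(\<lambda>z. h (fst p + fst (snd p) * z) (snd (snd p)) * gauss z) \<in> borel_measurable lborel"
      by (intro borel_measurable_integrable gauss_avg_integrable assms)
  qed
  from continuous_on_compose2[OF this, of S "\<lambda>p. (f p, g p, k p)"] assms(2-)
  show ?thesis by (simp add: gauss_avg_def continuous_on_Pair)
qed


lemma gauss_avg_measurable:
  assumes "bcont h" and [measurable]: "f \<in> borel_measurable M" "g \<in> borel_measurable M" "k \<in> borel_measurable M"
  shows "(\<lambda>p. gauss_avg h (f p) (g p) (k p)) \<in> borel_measurable M"
proof -
  have "(\<lambda>p. gauss_avg h (fst p) (fst (snd p)) (snd (snd p))) \<in> borel_measurable borel"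
    by (intro borel_measurable_continuous_onI gauss_avg_continuous assms(1) continuous_intros)
  from measurable_compose[OF _ this, of "\<lambda>p. (f p, g p, k p)" M] show ?thesis
    by (simp add: borel_prod[symmetric])
qed

text \<open>The Gamma integral after rescaling by L. The exponents s = 1 and s = 1/2 give the masses
  of the time kernels of the potential and of its gradient.\<close>

lemma exp_powr_tail:
  fixes L s :: real assumes L: "L > 0" and s: "s > 0"
  shows "has_bochner_integral lborel (\<lambda>\<tau>. indicator {0<..} \<tau> * (exp (- L * \<tau>) * \<tau> powr (s - 1))) (Gamma s / L powr s)"
proof -
  let ?f = "\<lambda>t::real. indicator {0<..} t * (exp (- t) * t powr (s - 1))"
  have G: "Gamma s \<ge> 0" using Gamma_real_pos[OF s] by simp
  have "has_bochner_integral lborel ?f (Gamma s)"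
  proof (rule has_bochner_integral_nn_integral)
    show "(\<integral>\<^sup>+t. ennreal (?f t) \<partial>lborel) = ennreal (Gamma s)"
      unfolding Gamma_conv_nn_integral_real[OF s]
      by (rule nn_integral_cong_AE, rule AE_mp[OF AE_lborel_singleton[of 0]], rule AE_I2)
         (auto simp: exp_minus divide_inverse split: split_indicator)
    show "?f \<in> borel_measurable lborel" by measurable
    show "AE t in lborel. 0 \<le> ?f t" by (simp add: indicator_def)
    show "0 \<le> Gamma s" by (rule G)
  qed
  from lborel_has_bochner_integral_real_affine_iff[THEN iffD1, OF _ this, of L 0] L
  have "has_bochner_integral lborel (\<lambda>x. ?f (L * x)) (Gamma s / L)"
    by (simp add: divide_inverse mult.commute[of "inverse L"])
  from has_bochner_integral_divide_zero[OF this, of "L powr (s - 1)"]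
  have *: "has_bochner_integral lborel (\<lambda>x. ?f (L * x) / L powr (s - 1)) (Gamma s / L / L powr (s - 1))" .
  have "(\<lambda>x. ?f (L * x) / L powr (s - 1)) = (\<lambda>\<tau>. indicator {0<..} \<tau> * (exp (- L * \<tau>) * \<tau> powr (s - 1)))"
    using L by (auto simp: fun_eq_iff indicator_def powr_mult zero_less_mult_iff)
  moreover have "Gamma s / L / L powr (s - 1) = Gamma s / L powr s"
    using L by (simp add: powr_diff)
  ultimately show ?thesis using * by (simp only:)
qed

lemma exp_tail:
  fixes L :: real assumes "L > 0"
  shows "has_bochner_integral lborel (\<lambda>\<tau>. indicator {0<..} \<tau> * exp (- L * \<tau>)) (1 / L)"
proof -
  have "(\<lambda>\<tau>. indicator {0<..} \<tau> * (exp (- L * \<tau>) * \<tau> powr (1 - 1))) = (\<lambda>\<tau>::real. indicator {0<..} \<tau> * exp (- L * \<tau>))"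
    by (auto simp: indicator_def fun_eq_iff)
  then show ?thesis using exp_powr_tail[OF assms, of 1] assms by simp
qed

text \<open>The time kernel that dominates x-derivatives of the potential: one derivative of the
  Gaussian average costs 1/(\<sigma> sqrt \<tau>). This is integrable at 0, and together with the
  damping it has a mass that is small for large L.\<close>

definition heat_ker :: "real \<Rightarrow> real \<Rightarrow> real \<Rightarrow> real" where
  "heat_ker \<sigma> L \<tau> = indicator {0<..} \<tau> * (exp (- L * \<tau>) * \<tau> powr (- 1 / 2)) / \<sigma>"

lemma heat_ker_nonneg: "\<sigma> > 0 \<Longrightarrow> heat_ker \<sigma> L \<tau> \<ge> 0"
  by (simp add: heat_ker_def)

lemma heat_ker_integral:
  fixes L :: real assumes "L > 0"
  shows "has_bochner_integral lborel (heat_ker \<sigma> L) (sqrt (pi / L) / \<sigma>)"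
proof -
  have "has_bochner_integral lborel (\<lambda>\<tau>. (indicator {0<..} \<tau> * (exp (- L * \<tau>) * \<tau> powr (1/2 - 1))) / \<sigma>) (Gamma (1/2) / L powr (1/2) / \<sigma>)"
    by (intro has_bochner_integral_divide_zero exp_powr_tail assms) auto
  then show ?thesis using assms
    by (simp add: heat_ker_def[abs_def] Gamma_one_half_real powr_half_sqrt real_sqrt_divide)
qed

lemma integrable_mult_bounded:
  fixes f g :: "'a \<Rightarrow> real"
  assumes "integrable M f" "g \<in> borel_measurable M" "\<And>x. \<bar>g x\<bar> \<le> B"
  shows "integrable M (\<lambda>x. f x * g x)"
proof (rule Bochner_Integration.integrable_bound)
  show "integrable M (\<lambda>x. B * f x)" using assms(1) by simp
  show "AE x in M. norm (f x * g x) \<le> norm (B * f x)"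
    using assms(3) by (intro AE_I2) (auto simp: abs_mult mult.commute[of "\<bar>f _\<bar>"] intro!: mult_right_mono order_trans[OF assms(3) abs_ge_self])
qed (use assms in auto)

lemma heat_pot_integrable:
  assumes h: "bcont h" and L: "L > 0"
  shows "integrable lborel (\<lambda>\<tau>. indicator {0<..} \<tau> * exp (- L * \<tau>) * gauss_avg h x (\<sigma> * sqrt \<tau>) (s + \<tau>))"
proof -
  obtain B where B: "\<And>x t. \<bar>h x t\<bar> \<le> B" using h by (elim bcontE) (erule that)
  show ?thesis
  proof (rule integrable_mult_bounded)
    show "integrable lborel (\<lambda>\<tau>. indicator {0<..} \<tau> * exp (- L * \<tau>))"
      using exp_tail[OF L] by (auto simp: has_bochner_integral_iff)
    show "(\<lambda>\<tau>. gauss_avg h x (\<sigma> * sqrt \<tau>) (s + \<tau>)) \<in> borel_measurable lborel"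
      by (rule gauss_avg_measurable[OF h]) auto
    show "\<bar>gauss_avg h x (\<sigma> * sqrt \<tau>) (s + \<tau>)\<bar> \<le> B" for \<tau>
      by (rule gauss_avg_bound[OF h B])
  qed
qed

lemma bcontI:
  assumes "continuous_on UNIV (\<lambda>p. h (fst p) (snd p))" "\<And>x t. \<bar>h x t\<bar> \<le> B"
  shows "bcont h"
  using assms by (auto simp: bcont_def case_prod_unfold)

lemma bcont_heat_pot:
  assumes h: "bcont h" and L: "L > 0"
  shows "bcont (heat_pot \<sigma> L h)"
proof -
  obtain B where B: "\<And>x t. \<bar>h x t\<bar> \<le> B" using h by (elim bcontE) (erule that)
  let ?e = "\<lambda>\<tau>. indicator {0<..} \<tau> * exp (- L * \<tau>) :: real"
  have bd: "\<bar>?e \<tau> * gauss_avg h x (\<sigma> * sqrt \<tau>) (s + \<tau>)\<bar> \<le> B * ?e \<tau>" for x s \<tau>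
    using gauss_avg_bound[OF h B, of x "\<sigma> * sqrt \<tau>"] by (simp add: abs_mult indicator_def)
  have e: "integrable lborel (\<lambda>\<tau>. B * ?e \<tau>)" "(LBINT \<tau>. B * ?e \<tau>) = B / L"
    using exp_tail[OF L] by (auto simp: has_bochner_integral_iff)
  show ?thesis
  proof (rule bcontI)
    show "continuous_on UNIV (\<lambda>p. heat_pot \<sigma> L h (fst p) (snd p))"
      unfolding heat_pot_def
      by (rule continuous_on_integral_dominated[OF _ _ bd e(1)])
         (intro continuous_intros gauss_avg_continuous h borel_measurable_integrable heat_pot_integrable L)+
    show "\<bar>heat_pot \<sigma> L h x s\<bar> \<le> B / L" for x s
    proof -
      have "\<bar>heat_pot \<sigma> L h x s\<bar> \<le> (LBINT \<tau>. B * ?e \<tau>)"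
        unfolding heat_pot_def
        by (rule order_trans[OF integral_abs_bound integral_mono[OF _ e(1) bd]])
           (intro integrable_abs heat_pot_integrable h L)
      then show ?thesis using e(2) by simp
    qed
  qed
qed

text \<open>The x-derivatives are arguments so that they can be fed to \<open>heat_pot\<close> in
  turn; in time nothing beyond continuity is asked.\<close>

definition C2x :: "(real \<Rightarrow> real \<Rightarrow> real) \<Rightarrow> (real \<Rightarrow> real \<Rightarrow> real) \<Rightarrow> (real \<Rightarrow> real \<Rightarrow> real) \<Rightarrow> bool" where
  "C2x h h1 h2 \<longleftrightarrow> bcont h \<and> bcont h1 \<and> bcont h2 \<and>
     (\<forall>x t. ((\<lambda>y. h y t) has_real_derivative h1 x t) (at x)) \<and>
     (\<forall>x t. ((\<lambda>y. h1 y t) has_real_derivative h2 x t) (at x))"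

text \<open>Integration by parts moves the derivative onto the Gaussian: a times the average of h1
  is the integral of h against z gauss(z), and the first absolute moment of gauss is at most
  1.\<close>

lemma gauss_avg_bound_deriv:
  assumes h: "bcont h" "bcont h1" "\<And>x t. ((\<lambda>y. h y t) has_real_derivative h1 x t) (at x)"
    and B: "\<And>y. \<bar>h y t\<bar> \<le> B" and a: "a > 0"
  shows "\<bar>gauss_avg h1 x a t\<bar> \<le> B / a"
proof -
  obtain B' where B': "\<And>x t. \<bar>h1 x t\<bar> \<le> B'" using h(2) by (elim bcontE) (erule that)
  have "(LBINT z. h (x + a * z) t * (z * gauss z)) = a * gauss_avg h1 x a t"
    unfolding gauss_avg_def
    by (rule gauss_integration_by_parts[where B=B and B'=B'])
       (auto intro!: h B B' bcont_continuous_on[OF h(2)] continuous_intros)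
  moreover have "\<bar>\<integral>z. h (x + a * z) t * (z * gauss z) \<partial>lborel\<bar> \<le> (LBINT z. B * (\<bar>z\<bar> * gauss z))"
  proof (rule order_trans[OF integral_abs_bound integral_mono])
    have [measurable]: "(\<lambda>z. h (x + a * z) t) \<in> borel_measurable lborel"
      by (rule bcont_measurable[OF h(1)]) auto
    show "integrable lborel (\<lambda>z. B * (\<bar>z\<bar> * gauss z))" by (intro integrable_mult_right integrable_abs_gauss)
    show le: "\<bar>h (x + a * z) t * (z * gauss z)\<bar> \<le> B * (\<bar>z\<bar> * gauss z)" for z
      using mult_right_mono[OF B, of "\<bar>z\<bar> * gauss z" "x + a * z"] by (auto simp: abs_mult)
    show "integrable lborel (\<lambda>z. \<bar>h (x + a * z) t * (z * gauss z)\<bar>)"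
      by (rule Bochner_Integration.integrable_bound[OF \<open>integrable lborel (\<lambda>z. B * (\<bar>z\<bar> * gauss z))\<close>])
         (use le in \<open>auto intro!: order_trans[OF le abs_ge_self]\<close>)
  qed
  moreover have "(LBINT z. B * (\<bar>z\<bar> * gauss z)) \<le> B"
    using mult_left_mono[OF integral_abs_gauss_le, of B] B[of 0] by auto
  ultimately have "\<bar>a * gauss_avg h1 x a t\<bar> \<le> B" by simp
  then show ?thesis using a by (simp add: abs_mult field_simps)
qed

lemma integrable_heat_ker_mult:
  assumes "L > 0" "H \<in> borel_measurable borel" "\<And>t. \<bar>H t\<bar> \<le> B"
  shows "integrable lborel (\<lambda>\<tau>. heat_ker \<sigma> L \<tau> * H (s + \<tau>))"
  by (rule integrable_mult_bounded[where B=B])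
     (use heat_ker_integral[OF assms(1), of \<sigma>] assms in \<open>auto simp: has_bochner_integral_iff\<close>)

lemma heat_pot_bound:
  assumes h: "bcont h" and L: "L > 0" and H: "H \<in> borel_measurable borel" "\<And>t. \<bar>H t\<bar> \<le> B"
    and le: "\<And>y t. t \<ge> s \<Longrightarrow> \<bar>h y t\<bar> \<le> H t"
  shows "\<bar>heat_pot \<sigma> L h x s\<bar> \<le> (LBINT \<tau>. indicator {0<..} \<tau> * exp (- L * \<tau>) * H (s + \<tau>))"
  unfolding heat_pot_def
proof (rule order_trans[OF integral_abs_bound integral_mono])
  show "integrable lborel (\<lambda>\<tau>. indicator {0<..} \<tau> * exp (- L * \<tau>) * H (s + \<tau>))"
    by (rule integrable_mult_bounded[where B=B])
       (use exp_tail[OF L] H in \<open>auto simp: has_bochner_integral_iff\<close>)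
  show "\<bar>indicator {0<..} \<tau> * exp (- L * \<tau>) * gauss_avg h x (\<sigma> * sqrt \<tau>) (s + \<tau>)\<bar> \<le>
    indicator {0<..} \<tau> * exp (- L * \<tau>) * H (s + \<tau>)" for \<tau>
    using gauss_avg_bound[OF h, of "s + \<tau>" "H (s + \<tau>)" x "\<sigma> * sqrt \<tau>"] le[of "s + \<tau>"]
    by (auto simp: abs_mult indicator_def)
qed (intro integrable_abs heat_pot_integrable h L)

text \<open>The majorant H depends on time alone and may later contain an unknown sup over x. The
  bound is a convolution in time, to which Young's inequality applies.\<close>

lemma heat_pot_bound_deriv:
  assumes h: "bcont h" "bcont h1" "\<And>x t. ((\<lambda>y. h y t) has_real_derivative h1 x t) (at x)"
    and \<sigma>: "\<sigma> > 0" and L: "L > 0" and H: "H \<in> borel_measurable borel" "\<And>t. \<bar>H t\<bar> \<le> B"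
    and le: "\<And>y t. t \<ge> s \<Longrightarrow> \<bar>h y t\<bar> \<le> H t"
  shows "\<bar>heat_pot \<sigma> L h1 x s\<bar> \<le> (LBINT \<tau>. heat_ker \<sigma> L \<tau> * H (s + \<tau>))"
  unfolding heat_pot_def
proof (rule order_trans[OF integral_abs_bound integral_mono])
  show "integrable lborel (\<lambda>\<tau>. heat_ker \<sigma> L \<tau> * H (s + \<tau>))"
    by (rule integrable_heat_ker_mult[OF L H])
  show "\<bar>indicator {0<..} \<tau> * exp (- L * \<tau>) * gauss_avg h1 x (\<sigma> * sqrt \<tau>) (s + \<tau>)\<bar> \<le>
    heat_ker \<sigma> L \<tau> * H (s + \<tau>)" for \<tau>
  proof (cases "\<tau> > 0")
    case True
    then have "\<bar>gauss_avg h1 x (\<sigma> * sqrt \<tau>) (s + \<tau>)\<bar> \<le> H (s + \<tau>) / (\<sigma> * sqrt \<tau>)"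
      using \<sigma> by (intro gauss_avg_bound_deriv[OF h]) (auto intro!: le)
    then show ?thesis using True \<sigma>
      by (auto simp: heat_ker_def abs_mult powr_minus powr_half_sqrt field_simps)
  qed (simp add: heat_ker_def)
qed (intro integrable_abs heat_pot_integrable h L)

lemma gauss_avg_has_derivative_x:
  assumes h: "bcont h" "bcont h1" "\<And>x t. ((\<lambda>y. h y t) has_real_derivative h1 x t) (at x)"
  shows "((\<lambda>x. gauss_avg h x a t) has_real_derivative gauss_avg h1 x a t) (at x)"
proof -
  obtain B where B: "\<And>x t. \<bar>h1 x t\<bar> \<le> B" using h(2) by (elim bcontE) (erule that)
  show ?thesis unfolding gauss_avg_def
  proof (rule has_real_derivative_integral[where S=UNIV and w="\<lambda>z. B * gauss z"])
    show "((\<lambda>x. h (x + a * z) t * gauss z) has_real_derivative h1 (x + a * z) t * gauss z) (at x)" for x z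
      by (rule derivative_eq_intros DERIV_chain2[OF h(3)] refl | simp)+
    show "\<bar>h1 (x + a * z) t * gauss z\<bar> \<le> B * gauss z" for x z
      by (auto simp: abs_mult intro!: mult_right_mono B)
  qed (intro gauss_avg_integrable h borel_measurable_integrable integrable_mult_right integrable_gauss convex_UNIV UNIV_I)+
qed

lemma heat_pot_has_derivative_x:
  assumes h: "bcont h" "bcont h1" "\<And>x t. ((\<lambda>y. h y t) has_real_derivative h1 x t) (at x)" and L: "L > 0"
  shows "((\<lambda>x. heat_pot \<sigma> L h x s) has_real_derivative heat_pot \<sigma> L h1 x s) (at x)"
proof -
  obtain B where B: "\<And>x t. \<bar>h1 x t\<bar> \<le> B" using h(2) by (elim bcontE) (erule that)
  show ?thesis unfolding heat_pot_def
  proof (rule has_real_derivative_integral[where S=UNIV and w="\<lambda>\<tau>. (indicator {0<..} \<tau> * exp (- L * \<tau>)) * B"])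
    show "((\<lambda>x. indicator {0<..} \<tau> * exp (- L * \<tau>) * gauss_avg h x (\<sigma> * sqrt \<tau>) (s + \<tau>)) has_real_derivative
      indicator {0<..} \<tau> * exp (- L * \<tau>) * gauss_avg h1 x (\<sigma> * sqrt \<tau>) (s + \<tau>)) (at x)" for x \<tau>
      by (intro DERIV_cmult gauss_avg_has_derivative_x h)
    show "\<bar>indicator {0<..} \<tau> * exp (- L * \<tau>) * gauss_avg h1 x (\<sigma> * sqrt \<tau>) (s + \<tau>)\<bar> \<le> (indicator {0<..} \<tau> * exp (- L * \<tau>)) * B" for x \<tau>
      using gauss_avg_bound[OF h(2) B, of x "\<sigma> * sqrt \<tau>"] by (simp add: abs_mult indicator_def)
    show "integrable lborel (\<lambda>\<tau>. indicator {0<..} \<tau> * exp (- L * \<tau>) * B)"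
      using exp_tail[OF L] by (auto simp: has_bochner_integral_iff)
  qed (intro heat_pot_integrable h L borel_measurable_integrable convex_UNIV UNIV_I)+
qed

section \<open>Time derivative of the heat potential\<close>

lemma integral_triangle_swap:
  fixes D :: "real \<Rightarrow> real \<Rightarrow> real"
  assumes D: "continuous_on UNIV (\<lambda>(r, t). D r t)" and ab: "a \<le> b"
  shows "integral {a..b} (\<lambda>t. integral {a..t} (\<lambda>r. D r t)) = integral {a..b} (\<lambda>r. integral {r..b} (\<lambda>t. D r t))"
proof -
  define g where "g = (\<lambda>(r, t). indicator {(r, t). a \<le> r \<and> r \<le> t \<and> t \<le> b} (r, t) * D r t)"
  have cl: "closed {(r, t). a \<le> r \<and> r \<le> t \<and> t \<le> b}"
    unfolding case_prod_unfold by (intro closed_Collect_conj closed_Collect_le continuous_intros)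
  have "{(r, t). a \<le> r \<and> r \<le> t \<and> t \<le> b} \<subseteq> cbox (a, a) (b, b)" by (auto simp: cbox_Pair_eq)
  then have cp: "compact {(r, t). a \<le> r \<and> r \<le> t \<and> t \<le> b}"
    using cl bounded_subset[OF bounded_cbox] by (auto simp: compact_eq_bounded_closed)
  have "integrable lborel (\<lambda>p. indicator {(r, t). a \<le> r \<and> r \<le> t \<and> t \<le> b} p *\<^sub>R (case p of (r, t) \<Rightarrow> D r t))"
    by (rule borel_integrable_compact[OF cp continuous_on_subset[OF D]]) simp
  then have "integrable (lborel \<Otimes>\<^sub>M lborel) (\<lambda>(r, t). g (r, t))"
    by (simp add: lborel_prod g_def case_prod_unfold)
  from lborel_pair.Fubini_integral[OF this]
  have "(LBINT t. (LBINT r. g (r, t))) = (LBINT r. (LBINT t. g (r, t)))" by simp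
  moreover have c1: "continuous_on S (\<lambda>r. D r t)" and c2: "continuous_on S (\<lambda>t. D r t)" for S r t
    by (intro continuous_on_compose_case_prod[OF D] continuous_intros, simp)+
  have int: "set_integrable lborel {c..d} f" if "continuous_on {c..d} f" for c d and f :: "real \<Rightarrow> real"
    using that by (rule borel_integrable_atLeastAtMost')
  have 1: "(LBINT r. g (r, t)) = indicator {a..b} t * integral {a..t} (\<lambda>r. D r t)" for t
  proof (cases "a \<le> t \<and> t \<le> b")
    case True
    then have "(\<lambda>r. g (r, t)) = (\<lambda>r. indicator {a..t} r *\<^sub>R D r t)" by (auto simp: g_def indicator_def)
    then show ?thesis
      using set_borel_integral_eq_integral(2)[OF int[OF c1], of a t t] True by (simp add: set_lebesgue_integral_def)
  next
    case False
    then have "(\<lambda>r. g (r, t)) = (\<lambda>r. 0)" by (auto simp: g_def indicator_def)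
    then show ?thesis using False by simp
  qed
  have 2: "(LBINT t. g (r, t)) = indicator {a..b} r * integral {r..b} (\<lambda>t. D r t)" for r
  proof (cases "a \<le> r \<and> r \<le> b")
    case True
    then have "(\<lambda>t. g (r, t)) = (\<lambda>t. indicator {r..b} t *\<^sub>R D r t)" by (auto simp: g_def indicator_def)
    then show ?thesis
      using set_borel_integral_eq_integral(2)[OF int[OF c2], of r b r] True by (simp add: set_lebesgue_integral_def)
  next
    case False
    then have "(\<lambda>t. g (r, t)) = (\<lambda>t. 0)" by (auto simp: g_def indicator_def)
    then show ?thesis using False by simp
  qed
  have i1: "integrable lborel (\<lambda>t. \<integral>r. g (r, t) \<partial>lborel)" "integrable lborel (\<lambda>r. \<integral>t. g (r, t) \<partial>lborel)"
    using lborel_pair.integrable_fst'[OF \<open>integrable (lborel \<Otimes>\<^sub>M lborel) (\<lambda>(r, t). g (r, t))\<close>]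
      lborel_pair.integrable_snd[of "\<lambda>r t. g (r, t)"] \<open>integrable (lborel \<Otimes>\<^sub>M lborel) (\<lambda>(r, t). g (r, t))\<close>
    by auto
  have 3: "(LBINT t. indicator {a..b} t * f t) = integral {a..b} f"
    if "integrable lborel (\<lambda>t. indicator {a..b} t * f t)" for f :: "real \<Rightarrow> real"
    using set_borel_integral_eq_integral(2)[of "{a..b}" f] that
    by (simp add: set_integrable_def set_lebesgue_integral_def)
  ultimately show ?thesis
    using 3[OF i1(1)[unfolded 1]] 3[OF i1(2)[unfolded 2]] by (simp add: 1 2)
qed

lemma has_derivative_integral_lower:
  fixes \<rho> \<phi> :: "real \<Rightarrow> real"
  assumes \<rho>: "continuous_on UNIV \<rho>" and \<phi>: "\<And>s. s \<le> b \<Longrightarrow> \<phi> s = integral {s..b} \<rho>" and s: "s < b"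
  shows "(\<phi> has_real_derivative - \<rho> s) (at s)"
proof -
  define a where "a = s - 1"
  have i: "\<rho> integrable_on {c..d}" for c d
    by (rule integrable_continuous_real[OF continuous_on_subset[OF \<rho>]]) simp
  have "((\<lambda>u. integral {a..u} \<rho>) has_real_derivative \<rho> s) (at s within {a..b})"
    using integral_has_vector_derivative[OF continuous_on_subset[OF \<rho>, of "{a..b}"], of s] s
    by (simp add: has_real_derivative_iff_has_vector_derivative a_def)
  then have d: "((\<lambda>u. integral {a..u} \<rho>) has_real_derivative \<rho> s) (at s)"
    using s at_within_Icc_at[of a s b] by (simp add: a_def)
  have "((\<lambda>u. integral {a..b} \<rho> - integral {a..u} \<rho>) has_real_derivative 0 - \<rho> s) (at s)"
    by (intro DERIV_diff d DERIV_const)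
  then have "((\<lambda>u. integral {a..b} \<rho> - integral {a..u} \<rho>) has_real_derivative - \<rho> s) (at s)" by simp
  then show ?thesis
  proof (rule DERIV_cong_ev[THEN iffD1, rotated -1, OF _ refl _ refl])
    have "eventually (\<lambda>u. u \<in> {a<..<b}) (nhds s)"
      using s by (intro eventually_nhds_in_open) (auto simp: a_def)
    then show "eventually (\<lambda>u. integral {a..b} \<rho> - integral {a..u} \<rho> = \<phi> u) (nhds s)"
    proof eventually_elim
      case (elim u)
      then have "integral {a..u} \<rho> + integral {u..b} \<rho> = integral {a..b} \<rho>"
        using i by (intro Henstock_Kurzweil_Integration.integral_combine) auto
      then show ?case using \<phi>[of u] elim by simp
    qed
  qed
qed

text \<open>Differentiating in a produces z h1, and integration by parts turns the factor z into one
  more x-derivative: the heat equation with the standard deviation as time variable.\<close>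

lemma gauss_avg_has_derivative_a:
  assumes h: "C2x h h1 h2"
  shows "((\<lambda>a. gauss_avg h x a t) has_real_derivative a * gauss_avg h2 x a t) (at a)"
proof -
  from h have b: "bcont h" "bcont h1" "bcont h2"
    and d: "\<And>x t. ((\<lambda>y. h y t) has_real_derivative h1 x t) (at x)"
           "\<And>x t. ((\<lambda>y. h1 y t) has_real_derivative h2 x t) (at x)" by (auto simp: C2x_def)
  obtain B where B: "\<And>x t. \<bar>h1 x t\<bar> \<le> B" using b(2) by (elim bcontE) (erule that)
  obtain B' where B': "\<And>x t. \<bar>h2 x t\<bar> \<le> B'" using b(3) by (elim bcontE) (erule that)
  have "((\<lambda>a. gauss_avg h x a t) has_real_derivative (LBINT z. h1 (x + a * z) t * (z * gauss z))) (at a)"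
    unfolding gauss_avg_def
  proof (rule has_real_derivative_integral[where S=UNIV and w="\<lambda>z. B * (\<bar>z\<bar> * gauss z)"])
    show "((\<lambda>a. h (x + a * z) t * gauss z) has_real_derivative h1 (x + a * z) t * (z * gauss z)) (at a)" for a z
      by (rule derivative_eq_intros DERIV_chain2[OF d(1)] refl | simp)+
    show "\<bar>h1 (x + a * z) t * (z * gauss z)\<bar> \<le> B * (\<bar>z\<bar> * gauss z)" for a z
      using mult_right_mono[OF B, of "\<bar>z\<bar> * gauss z" "x + a * z"] by (auto simp: abs_mult)
    have [measurable]: "(\<lambda>z. h1 (x + a * z) t) \<in> borel_measurable lborel"
      by (rule bcont_measurable[OF b(2)]) auto
    show "(\<lambda>z. h1 (x + a * z) t * (z * gauss z)) \<in> borel_measurable lborel" by measurable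
  qed (intro gauss_avg_integrable b integrable_mult_right integrable_abs_gauss convex_UNIV UNIV_I)+
  also have "(LBINT z. h1 (x + a * z) t * (z * gauss z)) = a * gauss_avg h2 x a t"
    unfolding gauss_avg_def
    by (rule gauss_integration_by_parts[where B=B and B'=B'])
       (auto intro!: d B B' bcont_continuous_on[OF b(3)] continuous_intros)
  finally show ?thesis .
qed

lemma heat_pot_eq_integral:
  assumes h: "bcont h" and z: "\<And>y t. S \<le> t \<Longrightarrow> h y t = 0" and s: "s \<le> b" "S \<le> b"
  shows "heat_pot \<sigma> L h x s = integral {s..b} (\<lambda>t. exp (- L * (t - s)) * gauss_avg h x (\<sigma> * sqrt (t - s)) t)"
proof -
  let ?g = "\<lambda>t. exp (- L * (t - s)) * gauss_avg h x (\<sigma> * sqrt (t - s)) t"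
  have "heat_pot \<sigma> L h x s = (LBINT t. indicator {0<..} (t - s) * ?g t)"
    unfolding heat_pot_def
    by (subst lborel_integral_real_affine[where c=1 and t="-s"]) (auto simp: mult.assoc intro!: Bochner_Integration.integral_cong)
  also have "\<dots> = (LBINT t. indicator {s..b} t *\<^sub>R ?g t)"
  proof (rule Bochner_Integration.integral_cong_AE)
    show "(\<lambda>t. indicator {0<..} (t - s) * ?g t) \<in> borel_measurable lborel"
      "(\<lambda>t. indicator {s..b} t *\<^sub>R ?g t) \<in> borel_measurable lborel"
      by (intro borel_measurable_times borel_measurable_scaleR gauss_avg_measurable h; measurable)+
    have "gauss_avg h y a t = 0" if "t > b" for y a t
      using that s z by (simp add: gauss_avg_def)
    then show "AE t in lborel. indicator {0<..} (t - s) * ?g t = indicator {s..b} t *\<^sub>R ?g t"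
      by (intro AE_mp[OF AE_lborel_singleton[of s] AE_I2]) (auto simp: indicator_def not_le)
  qed
  also have "\<dots> = integral {s..b} ?g"
  proof -
    have "continuous_on {s..b} ?g" by (intro continuous_intros gauss_avg_continuous h)
    from set_borel_integral_eq_integral(2)[OF borel_integrable_atLeastAtMost'[OF this]]
    show ?thesis by (simp add: set_lebesgue_integral_def)
  qed
  finally show ?thesis .
qed

text \<open>The source need not be differentiable in time, so the integral cannot be differentiated
  in its shifted form. Instead the potential is shown to be the integral from s to \<open>c\<close>
  of a continuous function \<open>\<rho>\<close>; the fundamental theorem then gives
  differentiability and the equation at once.\<close>

lemma heat_pot_has_derivative_t:
  assumes h: "C2x h h1 h2" and L: "L > 0" and \<sigma>: "\<sigma> > 0" and z: "\<And>y t. S \<le> t \<Longrightarrow> h y t = 0"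
  shows "((\<lambda>s. heat_pot \<sigma> L h x s) has_real_derivative
    L * heat_pot \<sigma> L h x s - \<sigma>\<^sup>2 / 2 * heat_pot \<sigma> L h2 x s - h x s) (at s)"
proof -
  from h have b: "bcont h" "bcont h1" "bcont h2"
    and d: "\<And>x t. ((\<lambda>y. h y t) has_real_derivative h1 x t) (at x)"
           "\<And>x t. ((\<lambda>y. h1 y t) has_real_derivative h2 x t) (at x)" by (auto simp: C2x_def)
  have z1: "h1 y t = 0" if "S \<le> t" for y t
    using d(1)[of t y] z[OF that] by (simp add: DERIV_const[THEN DERIV_unique])
  have z2: "h2 y t = 0" if "S \<le> t" for y t
    using d(2)[of t y] z1[OF that] by (simp add: DERIV_const[THEN DERIV_unique])
  \<comment> \<open>Beyond \<open>c\<close> the source vanishes, and s < \<open>c\<close> leaves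
    room for a two-sided derivative at s.\<close>
  define c where "c = max S s + 1"
  define \<Theta> where "\<Theta> = (\<lambda>r t. exp (- L * (t - r)) * gauss_avg h x (\<sigma> * sqrt (t - r)) t)"
  define \<Theta>2 where "\<Theta>2 = (\<lambda>r t. exp (- L * (t - r)) * gauss_avg h2 x (\<sigma> * sqrt (t - r)) t)"
  define D where "D = (\<lambda>r t. L * \<Theta> r t - \<sigma>\<^sup>2 / 2 * \<Theta>2 r t)"
  define \<rho> where "\<rho> = (\<lambda>s. h x s - L * heat_pot \<sigma> L h x s + \<sigma>\<^sup>2 / 2 * heat_pot \<sigma> L h2 x s)"
  have c\<Theta>: "continuous_on A (\<lambda>p. \<Theta> (f p) (g p))" "continuous_on A (\<lambda>p. \<Theta>2 (f p) (g p))"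
    if "continuous_on A f" "continuous_on A g" for A and f g :: "'a::topological_space \<Rightarrow> real"
    unfolding \<Theta>_def \<Theta>2_def by (intro continuous_intros gauss_avg_continuous b that)+
  have cD: "continuous_on UNIV (\<lambda>(r, t). D r t)"
    unfolding D_def case_prod_unfold by (intro continuous_intros c\<Theta>)
  have cD1: "continuous_on A (\<lambda>r. D r t)" "continuous_on A (\<lambda>r. D t r)" for A t
    unfolding D_def by (intro continuous_intros c\<Theta>)+
  \<comment> \<open>The factor \<sigma> sqrt(t - r) that the derivative in a brings cancels the
    singular derivative of the square root; the remaining integrand is continuous up to r =
    t.\<close>
  have deriv: "((\<lambda>r. \<Theta> r t) has_vector_derivative D r t) (at r)" if "r < t" for r t
  proof -
    have "((\<lambda>r. gauss_avg h x (\<sigma> * sqrt (t - r)) t) has_real_derivative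
        (\<sigma> * sqrt (t - r) * gauss_avg h2 x (\<sigma> * sqrt (t - r)) t) * (\<sigma> * (inverse (sqrt (t - r)) / 2 * (-1)))) (at r)"
      by (rule DERIV_chain2[OF gauss_avg_has_derivative_a[OF h]])
         (rule derivative_eq_intros refl | use that in simp)+
    moreover have "(\<sigma> * sqrt (t - r) * gauss_avg h2 x (\<sigma> * sqrt (t - r)) t) * (\<sigma> * (inverse (sqrt (t - r)) / 2 * (-1)))
        = - \<sigma>\<^sup>2 / 2 * gauss_avg h2 x (\<sigma> * sqrt (t - r)) t"
      using that by (simp add: field_simps power2_eq_square)
    ultimately have "((\<lambda>r. gauss_avg h x (\<sigma> * sqrt (t - r)) t) has_real_derivative - \<sigma>\<^sup>2 / 2 * gauss_avg h2 x (\<sigma> * sqrt (t - r)) t) (at r)"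
      by (simp only:)
    note g = this
    have e: "((\<lambda>r. exp (- L * (t - r))) has_real_derivative L * exp (- L * (t - r))) (at r)"
      by (rule derivative_eq_intros refl | simp)+
    show ?thesis
      unfolding has_real_derivative_iff_has_vector_derivative[symmetric] \<Theta>_def D_def \<Theta>2_def
      by (rule DERIV_cong[OF DERIV_mult[OF e g]]) (simp add: algebra_simps)
  qed
  have FTC: "integral {s..t} (\<lambda>r. D r t) = h x t - \<Theta> s t" if "s \<le> t" for s t
  proof -
    have "((\<lambda>r. D r t) has_integral (\<Theta> t t - \<Theta> s t)) {s..t}"
      by (rule fundamental_theorem_of_calculus_interior[OF that])
         (auto intro!: deriv c\<Theta> continuous_intros)
    moreover have "\<Theta> t t = h x t"
      by (simp add: \<Theta>_def gauss_avg_def integral_gauss)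
    ultimately show ?thesis by (simp add: integral_unique)
  qed
  have HP: "heat_pot \<sigma> L h x r = integral {r..c} (\<Theta> r)" "heat_pot \<sigma> L h2 x r = integral {r..c} (\<Theta>2 r)" if "r \<le> c" for r
    using heat_pot_eq_integral[OF b(1) z that] heat_pot_eq_integral[OF b(3) z2 that]
    by (auto simp: c_def \<Theta>_def \<Theta>2_def)
  have eq: "heat_pot \<sigma> L h x r = integral {r..c} \<rho>" if r: "r \<le> c" for r
  proof -
    have "heat_pot \<sigma> L h x r = integral {r..c} (\<lambda>t. h x t - integral {r..t} (\<lambda>r. D r t))"
      unfolding HP[OF r] by (rule Henstock_Kurzweil_Integration.integral_cong) (simp add: FTC)
    also have "\<dots> = integral {r..c} (h x) - integral {r..c} (\<lambda>t. integral {r..t} (\<lambda>r. D r t))"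
    proof (rule Henstock_Kurzweil_Integration.integral_diff)
      show i1: "h x integrable_on {r..c}"
        by (intro integrable_continuous_real bcont_continuous_on[OF b(1)] continuous_intros)
      have "(\<lambda>t. h x t - \<Theta> r t) integrable_on {r..c}"
        by (intro integrable_continuous_real continuous_intros c\<Theta> bcont_continuous_on[OF b(1)])
      then show "(\<lambda>t. integral {r..t} (\<lambda>r. D r t)) integrable_on {r..c}"
        by (rule integrable_eq) (simp add: FTC)
    qed
    \<comment> \<open>After the exchange the inner integral runs over all later times up to
      \<open>c\<close>, and so it is again a heat potential, now started at the inner
      variable.\<close>
    also have "integral {r..c} (\<lambda>t. integral {r..t} (\<lambda>r. D r t)) = integral {r..c} (\<lambda>r. integral {r..c} (\<lambda>t. D r t))"
      by (rule integral_triangle_swap[OF cD r])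
    also have "\<dots> = integral {r..c} (\<lambda>r. L * heat_pot \<sigma> L h x r - \<sigma>\<^sup>2 / 2 * heat_pot \<sigma> L h2 x r)"
    proof (rule Henstock_Kurzweil_Integration.integral_cong)
      fix q assume q: "q \<in> {r..c}"
      have i: "\<Theta> q integrable_on {q..c}" "\<Theta>2 q integrable_on {q..c}"
        using c\<Theta>[of "{q..c}" "\<lambda>_. q" "\<lambda>t. t"] by (auto intro!: integrable_continuous_real continuous_intros)
      have "integral {q..c} (\<lambda>t. L * \<Theta> q t - \<sigma>\<^sup>2 / 2 * \<Theta>2 q t) = integral {q..c} (\<lambda>t. L * \<Theta> q t) - integral {q..c} (\<lambda>t. \<sigma>\<^sup>2 / 2 * \<Theta>2 q t)"
        using i by (intro Henstock_Kurzweil_Integration.integral_diff integrable_on_mult_right)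
      then show "integral {q..c} (\<lambda>t. D q t) = L * heat_pot \<sigma> L h x q - \<sigma>\<^sup>2 / 2 * heat_pot \<sigma> L h2 x q"
        unfolding D_def using HP[of q] q by simp
    qed
    also have "integral {r..c} (h x) - \<dots> = integral {r..c} (\<lambda>r. h x r - (L * heat_pot \<sigma> L h x r - \<sigma>\<^sup>2 / 2 * heat_pot \<sigma> L h2 x r))"
      by (subst Henstock_Kurzweil_Integration.integral_diff)
         (auto intro!: integrable_continuous_real continuous_intros bcont_continuous_on[OF b(1)]
            bcont_continuous_on[OF bcont_heat_pot[OF b(1) L]] bcont_continuous_on[OF bcont_heat_pot[OF b(3) L]])
    finally show ?thesis by (simp add: \<rho>_def algebra_simps)
  qed
  have "continuous_on UNIV \<rho>"
    unfolding \<rho>_def by (intro continuous_intros bcont_continuous_on[OF b(1)]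
            bcont_continuous_on[OF bcont_heat_pot[OF b(1) L]] bcont_continuous_on[OF bcont_heat_pot[OF b(3) L]])
  from has_derivative_integral_lower[OF this eq, of s]
  have "((\<lambda>s. heat_pot \<sigma> L h x s) has_real_derivative - \<rho> s) (at s)"
    by (simp add: c_def)
  then show ?thesis by (simp add: \<rho>_def algebra_simps)
qed

lemma bcont_bound: "bcont h \<Longrightarrow> \<exists>B\<ge>0. \<forall>x t. \<bar>h x t\<bar> \<le> B"
  unfolding bcont_def by (meson abs_ge_zero order_trans)

lemma bcont_const [intro]: "bcont (\<lambda>x t. c)"
  by (rule bcontI[where B="\<bar>c\<bar>"]) auto

lemma bcont_add:
  assumes "bcont f" "bcont g" shows "bcont (\<lambda>x t. f x t + g x t)"
proof -
  obtain B where B: "\<And>x t. \<bar>f x t\<bar> \<le> B" using bcont_bound[OF assms(1)] by blast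
  obtain B' where B': "\<And>x t. \<bar>g x t\<bar> \<le> B'" using bcont_bound[OF assms(2)] by blast
  from B B' show ?thesis
    by (intro bcontI[where B="B + B'"] continuous_intros bcont_continuous_on[OF assms(1)] bcont_continuous_on[OF assms(2)])
       (meson abs_triangle_ineq add_mono order_trans)
qed

lemma bcont_mult:
  assumes "bcont f" "bcont g" shows "bcont (\<lambda>x t. f x t * g x t)"
proof -
  obtain B where B1: "B \<ge> 0" "\<And>x t. \<bar>f x t\<bar> \<le> B" using bcont_bound[OF assms(1)] by blast
  obtain B' where B2: "\<And>x t. \<bar>g x t\<bar> \<le> B'" using bcont_bound[OF assms(2)] by blast
  note B = B1 B2
  then show ?thesis
    by (intro bcontI[where B="B * B'"] continuous_intros bcont_continuous_on[OF assms(1)] bcont_continuous_on[OF assms(2)])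
       (auto simp: abs_mult intro!: mult_mono)
qed

lemma bcont_cmult: "bcont f \<Longrightarrow> bcont (\<lambda>x t. c * f x t)"
  using bcont_mult[OF bcont_const] by simp

lemma bcont_diff: "bcont f \<Longrightarrow> bcont g \<Longrightarrow> bcont (\<lambda>x t. f x t - g x t)"
  using bcont_add[OF _ bcont_cmult[of g "-1"]] by simp

lemma bcont_shift:
  assumes "bcont f" shows "bcont (\<lambda>x t. f (x + c) t)"
proof -
  obtain B where B: "\<And>x t. \<bar>f x t\<bar> \<le> B" using bcont_bound[OF assms] by blast
  show ?thesis
    by (intro bcontI[where B=B] continuous_intros bcont_continuous_on[OF assms] B)
qed

section \<open>Uniform continuity in x and mollification by moving averages\<close>

definition ucont_x :: "(real \<Rightarrow> real \<Rightarrow> real) \<Rightarrow> bool" where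
  "ucont_x g \<longleftrightarrow> (\<forall>e>0. \<exists>d>0. \<forall>x y t. \<bar>x - y\<bar> < d \<longrightarrow> \<bar>g x t - g y t\<bar> < e)"

lemma ucont_xD:
  assumes "ucont_x g" "e > 0"
  obtains d where "d > 0" "\<And>x y t. \<bar>x - y\<bar> < d \<Longrightarrow> \<bar>g x t - g y t\<bar> < e"
  using assms unfolding ucont_x_def by blast

lemma ucont_x_add:
  assumes "ucont_x f" "ucont_x g" shows "ucont_x (\<lambda>x t. f x t + g x t)"
  unfolding ucont_x_def
proof (intro allI impI)
  fix e :: real assume "e > 0"
  then have e2: "e / 2 > 0" by simp
  obtain d where d1: "d > 0" "\<And>x y t. \<bar>x - y\<bar> < d \<Longrightarrow> \<bar>f x t - f y t\<bar> < e / 2"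
    using ucont_xD[OF assms(1) e2] by blast
  obtain d' where d2: "d' > 0" "\<And>x y t. \<bar>x - y\<bar> < d' \<Longrightarrow> \<bar>g x t - g y t\<bar> < e / 2"
    using ucont_xD[OF assms(2) e2] by blast
  note d = d1 d2
  have "\<bar>f x t + g x t - (f y t + g y t)\<bar> < e" if "\<bar>x - y\<bar> < min d d'" for x y t
    using d(2)[of x y t] d(4)[of x y t] that by linarith
  then show "\<exists>d>0. \<forall>x y t. \<bar>x - y\<bar> < d \<longrightarrow> \<bar>f x t + g x t - (f y t + g y t)\<bar> < e"
    using d(1,3) by (intro exI[of _ "min d d'"]) auto
qed

lemma ucont_x_mult:
  assumes "ucont_x f" "ucont_x g" "bcont f" "bcont g" shows "ucont_x (\<lambda>x t. f x t * g x t)"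
  unfolding ucont_x_def
proof (intro allI impI)
  fix e :: real assume e: "e > 0"
  obtain B where B1: "B \<ge> 0" "\<And>x t. \<bar>f x t\<bar> \<le> B" using bcont_bound[OF assms(3)] by blast
  obtain B' where B2: "B' \<ge> 0" "\<And>x t. \<bar>g x t\<bar> \<le> B'" using bcont_bound[OF assms(4)] by blast
  note B = B1 B2
  have "e / (2 * (B' + 1)) > 0" "e / (2 * (B + 1)) > 0" using e B by auto
  note e2 = this
  obtain d where d1: "d > 0" "\<And>x y t. \<bar>x - y\<bar> < d \<Longrightarrow> \<bar>f x t - f y t\<bar> < e / (2 * (B' + 1))"
    using ucont_xD[OF assms(1) e2(1)] by blast
  obtain d' where d2: "d' > 0" "\<And>x y t. \<bar>x - y\<bar> < d' \<Longrightarrow> \<bar>g x t - g y t\<bar> < e / (2 * (B + 1))"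
    using ucont_xD[OF assms(2) e2(2)] by blast
  note d = d1 d2
  have "\<bar>f x t * g x t - f y t * g y t\<bar> < e" if "\<bar>x - y\<bar> < min d d'" for x y t
  proof -
    have "f x t * g x t - f y t * g y t = (f x t - f y t) * g x t + f y t * (g x t - g y t)" by algebra
    also have "\<bar>\<dots>\<bar> \<le> \<bar>f x t - f y t\<bar> * \<bar>g x t\<bar> + \<bar>f y t\<bar> * \<bar>g x t - g y t\<bar>"
      by (metis abs_mult abs_triangle_ineq)
    also have "\<dots> \<le> \<bar>f x t - f y t\<bar> * (B' + 1) + (B + 1) * \<bar>g x t - g y t\<bar>"
      using B(2)[of y t] B(4)[of x t] by (intro add_mono mult_left_mono mult_right_mono) auto
    also have "\<dots> < e / 2 + e / 2"
      using d(2)[of x y t] d(4)[of x y t] that B by (intro add_strict_mono) (auto simp: field_simps)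
    finally show ?thesis by simp
  qed
  then show "\<exists>d>0. \<forall>x y t. \<bar>x - y\<bar> < d \<longrightarrow> \<bar>f x t * g x t - f y t * g y t\<bar> < e"
    using d(1,3) by (intro exI[of _ "min d d'"]) auto
qed

lemma ucont_x_const [intro]: "ucont_x (\<lambda>x t. c t)"
  by (auto simp: ucont_x_def intro: exI[of _ 1])

lemma ucont_x_lipschitz:
  assumes "\<And>x y t. \<bar>f x t - f y t\<bar> \<le> L * \<bar>x - y\<bar>"
  shows "ucont_x f"
  unfolding ucont_x_def
proof (intro allI impI)
  fix e :: real assume e: "e > 0"
  have "\<bar>f x t - f y t\<bar> < e" if "\<bar>x - y\<bar> < e / (\<bar>L\<bar> + 1)" for x y t
  proof -
    have "\<bar>f x t - f y t\<bar> \<le> (\<bar>L\<bar> + 1) * \<bar>x - y\<bar>"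
      by (rule order_trans[OF assms mult_right_mono]) auto
    also have "\<dots> < e" using that pos_less_divide_eq[of "\<bar>L\<bar> + 1" "\<bar>x - y\<bar>" e] by (simp add: mult.commute)
    finally show ?thesis .
  qed
  then show "\<exists>d>0. \<forall>x y t. \<bar>x - y\<bar> < d \<longrightarrow> \<bar>f x t - f y t\<bar> < e"
    using e by (intro exI[of _ "e / (\<bar>L\<bar> + 1)"]) (auto intro!: divide_pos_pos)
qed

lemma ucont_x_deriv:
  assumes d: "\<And>x t. ((\<lambda>y. f y t) has_real_derivative f1 x t) (at x)" and b: "bcont f1"
  shows "ucont_x f"
proof -
  obtain B where B: "\<And>x t. \<bar>f1 x t\<bar> \<le> B" using bcont_bound[OF b] by blast
  show ?thesis
  proof (rule ucont_x_lipschitz)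
    fix x y t
    show "\<bar>f x t - f y t\<bar> \<le> B * \<bar>x - y\<bar>"
      using field_differentiable_bound[of UNIV "\<lambda>y. f y t" "\<lambda>y. f1 y t" B x y] d B by auto
  qed
qed

text \<open>The mean over the interval of radius \<eta> around x. Its x-derivative is a difference
  quotient of g, so one average gains one derivative, and nothing is lost in t.\<close>

definition mavg :: "real \<Rightarrow> (real \<Rightarrow> real \<Rightarrow> real) \<Rightarrow> real \<Rightarrow> real \<Rightarrow> real" where
  "mavg \<eta> g x t = (LBINT z. indicator {-1..1} z * g (x + \<eta> * z) t) / 2"

lemma mavg_integrable:
  assumes g: "bcont g"
  shows "integrable lborel (\<lambda>z. indicator {-1..1} z * g (x + \<eta> * z) t)"
proof -
  obtain B where B: "\<And>x t. \<bar>g x t\<bar> \<le> B" using bcont_bound[OF g] by blast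
  show ?thesis
  proof (rule integrable_mult_bounded[where B=B])
    show "integrable lborel (indicator {-1..1::real} :: real \<Rightarrow> real)" by (rule integrable_real_indicator) auto
    show "(\<lambda>z. g (x + \<eta> * z) t) \<in> borel_measurable lborel" by (rule bcont_measurable[OF g]) auto
  qed (rule B)
qed

lemma mavg_close:
  assumes g: "bcont g" and c: "\<And>y. \<bar>y - x\<bar> \<le> \<bar>\<eta>\<bar> \<Longrightarrow> \<bar>g y t - c\<bar> \<le> e"
  shows "\<bar>mavg \<eta> g x t - c\<bar> \<le> e"
proof -
  have i: "integrable lborel (\<lambda>z::real. indicator {-1..1} z * c :: real)" for c
    by (intro integrable_mult_left integrable_real_indicator) auto
  have "mavg \<eta> g x t - c = (LBINT z. indicator {-1..1} z * g (x + \<eta> * z) t - indicator {-1..1} z * c) / 2"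
    by (subst Bochner_Integration.integral_diff[OF mavg_integrable[OF g] i]) (simp add: mavg_def diff_divide_distrib)
  also have "\<bar>\<dots>\<bar> \<le> (LBINT z. indicator {-1..1::real} z * e) / 2"
  proof -
    have "\<bar>\<integral>z. indicator {-1..1} z * g (x + \<eta> * z) t - indicator {-1..1} z * c \<partial>lborel\<bar> \<le> (LBINT z. indicator {-1..1::real} z * e)"
    proof (rule order_trans[OF integral_abs_bound integral_mono])
      show "\<bar>indicator {-1..1} z * g (x + \<eta> * z) t - indicator {-1..1} z * c\<bar> \<le> indicator {-1..1} z * e" for z
        using c[of "x + \<eta> * z"] mult_left_mono[of "\<bar>z\<bar>" 1 "\<bar>\<eta>\<bar>"] by (auto simp: indicator_def abs_mult)
    qed (intro integrable_abs Bochner_Integration.integrable_diff mavg_integrable g i)+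
    then show ?thesis by simp
  qed
  also have "\<dots> = e" by simp
  finally show ?thesis .
qed

lemma bcont_mavg:
  assumes g: "bcont g" shows "bcont (mavg \<eta> g)"
proof -
  obtain B where B: "\<And>x t. \<bar>g x t\<bar> \<le> B" using bcont_bound[OF g] by blast
  show ?thesis
  proof (rule bcontI)
    show "\<bar>mavg \<eta> g x t\<bar> \<le> B" for x t using mavg_close[OF g, of x \<eta> t 0 B] B by simp
    show "continuous_on UNIV (\<lambda>p. mavg \<eta> g (fst p) (snd p))"
      unfolding mavg_def
    proof (intro continuous_intros continuous_on_integral_dominated[where w="\<lambda>z. indicator {-1..1} z * B"])
      show "\<bar>indicator {-1..1} z * g (fst p + \<eta> * z) (snd p)\<bar> \<le> indicator {-1..1} z * B" for p :: "real \<times> real" and z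
        using B by (auto simp: indicator_def)
      show "integrable lborel (\<lambda>z::real. indicator {-1..1} z * B)"
        by (intro integrable_mult_left integrable_real_indicator) auto
      show "(\<lambda>z. indicator {-1..1} z * g (fst p + \<eta> * z) (snd p)) \<in> borel_measurable lborel" for p
        by (intro borel_measurable_integrable mavg_integrable g)
    qed (intro continuous_intros bcont_continuous_on[OF g], simp)
  qed
qed

text \<open>Near x the average is a difference quotient of an antiderivative \<open>\<Gamma>\<close>
  of g(., t). The antiderivative is taken on a fixed interval that contains all windows with centre
  closer than \<eta> to x.\<close>

lemma mavg_has_derivative:
  assumes g: "bcont g" and \<eta>: "\<eta> > 0"
  shows "((\<lambda>x. mavg \<eta> g x t) has_real_derivative (g (x + \<eta>) t - g (x - \<eta>) t) / (2 * \<eta>)) (at x)"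
proof -
  define a where "a = x - 2 * \<eta>" define b where "b = x + 2 * \<eta>"
  have cg: "continuous_on A (\<lambda>y. g y t)" for A by (intro bcont_continuous_on[OF g] continuous_intros)
  obtain \<Gamma> where \<Gamma>: "\<And>y. y \<in> {a..b} \<Longrightarrow> (\<Gamma> has_vector_derivative g y t) (at y within {a..b})"
    using antiderivative_continuous[OF cg] by blast
  have \<Gamma>': "(\<Gamma> has_real_derivative g y t) (at y)" if "a < y" "y < b" for y
    using \<Gamma>[of y] that by (simp add: has_real_derivative_iff_has_vector_derivative at_within_Icc_at)
  have eq: "mavg \<eta> g y t = (\<Gamma> (y + \<eta>) - \<Gamma> (y - \<eta>)) / (2 * \<eta>)" if y: "\<bar>y - x\<bar> < \<eta>" for y
  proof -
    have "(LBINT z. indicator {-1..1} z *\<^sub>R g (y + \<eta> * z) t) = \<Gamma> (y + \<eta> * 1) / \<eta> - \<Gamma> (y + \<eta> * (-1)) / \<eta>"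
    proof (rule integral_FTC_Icc)
      fix z :: real assume z: "-1 \<le> z" "z \<le> 1"
      have "\<bar>\<eta> * z\<bar> \<le> \<eta>" using z \<eta> mult_left_mono[of "\<bar>z\<bar>" 1 \<eta>] by (simp add: abs_mult)
      then have "(\<Gamma> has_real_derivative g (y + \<eta> * z) t) (at (y + \<eta> * z))"
        using y by (intro \<Gamma>') (auto simp: a_def b_def)
      then have "((\<lambda>z. \<Gamma> (y + \<eta> * z) / \<eta>) has_real_derivative g (y + \<eta> * z) t * \<eta> / \<eta>) (at z)"
        by (intro DERIV_cdivide DERIV_chain2[where f=\<Gamma>]) (auto intro!: derivative_eq_intros)
      then show "((\<lambda>z. \<Gamma> (y + \<eta> * z) / \<eta>) has_vector_derivative g (y + \<eta> * z) t) (at z within {-1..1})"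
        using \<eta> by (auto simp: has_real_derivative_iff_has_vector_derivative intro: has_vector_derivative_at_within)
    qed (auto intro!: continuous_intros bcont_continuous_on[OF g])
    then show ?thesis using \<eta> by (simp add: mavg_def diff_divide_distrib)
  qed
  have "((\<lambda>y. (\<Gamma> (y + \<eta>) - \<Gamma> (y - \<eta>)) / (2 * \<eta>)) has_real_derivative (g (x + \<eta>) t * 1 - g (x - \<eta>) t * 1) / (2 * \<eta>)) (at x)"
    by (intro DERIV_cdivide DERIV_diff DERIV_chain2[where f=\<Gamma>] \<Gamma>')
       (use \<eta> in \<open>auto simp: a_def b_def intro!: derivative_eq_intros\<close>)
  then have *: "((\<lambda>y. (\<Gamma> (y + \<eta>) - \<Gamma> (y - \<eta>)) / (2 * \<eta>)) has_real_derivative (g (x + \<eta>) t - g (x - \<eta>) t) / (2 * \<eta>)) (at x)"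
    by simp
  have "eventually (\<lambda>y. y \<in> {x - \<eta><..<x + \<eta>}) (nhds x)"
    using \<eta> by (intro eventually_nhds_in_open) auto
  then have "eventually (\<lambda>y. mavg \<eta> g y t = (\<Gamma> (y + \<eta>) - \<Gamma> (y - \<eta>)) / (2 * \<eta>)) (nhds x)"
    by eventually_elim (rule eq, auto)
  from DERIV_cong_ev[OF refl this refl] * show ?thesis by simp
qed

lemma mavg_uminus:
  assumes "\<And>x. g (- x) t = - g x t" shows "mavg \<eta> g (- x) t = - mavg \<eta> g x t"
proof -
  have "(LBINT z. indicator {-1..1} z * g (- x + \<eta> * z) t) = (LBINT z. indicator {-1..1} (- z) * g (- (x + \<eta> * z)) t)"
    by (subst lborel_integral_real_affine[where c="-1" and t=0]) auto
  also have "\<dots> = - (LBINT z. indicator {-1..1} z * g (x + \<eta> * z) t)"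
    unfolding assms Bochner_Integration.integral_minus[symmetric]
    by (rule Bochner_Integration.integral_cong) (auto simp: indicator_def)
  finally show ?thesis by (simp add: mavg_def)
qed

text \<open>Each average turns into the bounded continuous difference quotient \<open>D\<close>
  under differentiation, first the outer one and then the inner one; two averages therefore give two
  derivatives.\<close>

lemma C2x_mavg_mavg:
  assumes g: "bcont g" and \<eta>: "\<eta> > 0"
  shows "\<exists>h1 h2. C2x (mavg \<eta> (mavg \<eta> g)) h1 h2"
proof -
  define D where "D = (\<lambda>(f::real \<Rightarrow> real \<Rightarrow> real) x t. (f (x + \<eta>) t - f (x + - \<eta>) t) * (1 / (2 * \<eta>)))"
  have bD: "bcont (D f)" if "bcont f" for f
    unfolding D_def by (rule bcont_mult[OF bcont_diff[OF bcont_shift[OF that] bcont_shift[OF that]] bcont_const])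
  have dD: "((\<lambda>x. D f x t) has_real_derivative D f' x t) (at x)"
    if "\<And>x t. ((\<lambda>x. f x t) has_real_derivative f' x t) (at x)" for f f' x t
    unfolding D_def
    by (intro DERIV_cmult_right DERIV_diff DERIV_shift[THEN iffD1] that)
  have d: "((\<lambda>x. mavg \<eta> f x t) has_real_derivative D f x t) (at x)" if "bcont f" for f x t
    using mavg_has_derivative[OF that \<eta>] by (simp add: D_def)
  have "C2x (mavg \<eta> (mavg \<eta> g)) (D (mavg \<eta> g)) (D (D g))"
    unfolding C2x_def by (intro conjI allI bcont_mavg bD d dD g)
  then show ?thesis by blast
qed

text \<open>Mollifying in x alone keeps the two properties that matter later: oddness, which encodes
  the boundary condition at x = 0, and vanishing from time S on.\<close>

lemma C2x_approx:
  assumes g: "bcont g" "ucont_x g" and odd: "\<And>x t. g (- x) t = - g x t"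
    and z: "\<And>x t. S \<le> t \<Longrightarrow> g x t = 0" and e: "e > 0"
  obtains h h1 h2 where "C2x h h1 h2" "\<And>x t. \<bar>h x t - g x t\<bar> \<le> e" "\<And>x t. h (- x) t = - h x t"
    "\<And>x t. S \<le> t \<Longrightarrow> h x t = 0"
proof -
  obtain d where d: "d > 0" "\<And>x y t. \<bar>x - y\<bar> < d \<Longrightarrow> \<bar>g x t - g y t\<bar> < e"
    using g(2) e unfolding ucont_x_def by blast
  \<comment> \<open>Two averages move a point by at most 2 \<eta> < d.\<close>
  define \<eta> where "\<eta> = d / 3"
  have \<eta>: "\<eta> > 0" using d by (simp add: \<eta>_def)
  have 1: "\<bar>mavg \<eta> g y t - g x t\<bar> \<le> e" if "\<bar>y - x\<bar> \<le> \<eta>" for x y t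
    by (rule mavg_close[OF g(1)]) (rule less_imp_le, rule d(2), use that \<eta> in \<open>unfold \<eta>_def, linarith\<close>)
  have 2: "\<bar>mavg \<eta> (mavg \<eta> g) x t - g x t\<bar> \<le> e" for x t
    by (rule mavg_close[OF bcont_mavg[OF g(1)] 1]) (use \<eta> in auto)
  have 3: "mavg \<eta> g x t = 0" if "S \<le> t" for x t
    using z[OF that] by (simp add: mavg_def)
  from C2x_mavg_mavg[OF g(1) \<eta>] obtain h1 h2 where "C2x (mavg \<eta> (mavg \<eta> g)) h1 h2" by blast
  moreover have "mavg \<eta> (mavg \<eta> g) x t = 0" if "S \<le> t" for x t
    using 3[OF that] by (simp add: mavg_def[of _ "mavg \<eta> g"])
  moreover have "mavg \<eta> (mavg \<eta> g) (- x) t = - mavg \<eta> (mavg \<eta> g) x t" for x t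
    by (intro mavg_uminus odd)
  ultimately show thesis using that 2 by blast
qed

lemma heat_pot_diff:
  assumes "bcont h" "bcont k" "L > 0"
  shows "heat_pot \<sigma> L (\<lambda>x t. h x t - k x t) x s = heat_pot \<sigma> L h x s - heat_pot \<sigma> L k x s"
proof -
  have g: "gauss_avg (\<lambda>x t. h x t - k x t) x a t = gauss_avg h x a t - gauss_avg k x a t" for x a t
    unfolding gauss_avg_def
    unfolding left_diff_distrib by (intro Bochner_Integration.integral_diff gauss_avg_integrable assms)
  show ?thesis
    unfolding heat_pot_def g right_diff_distrib
    by (rule Bochner_Integration.integral_diff) (intro heat_pot_integrable assms)+
qed

lemma heat_pot_uminus:
  assumes "\<And>x t. h (- x) t = c * h x t" shows "heat_pot \<sigma> L h (- x) s = c * heat_pot \<sigma> L h x s"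
proof -
  have "gauss_avg h (- x) a t = c * gauss_avg h x a t" for x a t
  proof -
    have "(LBINT z. h (- x + a * z) t * gauss z) = (LBINT z. h (- (x + a * z)) t * gauss (- z))"
      by (subst lborel_integral_real_affine[where c="-1" and t=0]) auto
    also have "\<dots> = (LBINT z. c * (h (x + a * z) t * gauss z))"
      unfolding assms by (simp add: std_normal_density_def mult.assoc)
    finally show ?thesis by (simp add: gauss_avg_def)
  qed
  then show ?thesis by (simp add: heat_pot_def mult.left_commute)
qed

lemma heat_pot_zero:
  assumes "\<And>x t. S \<le> t \<Longrightarrow> h x t = 0" "S \<le> s" shows "heat_pot \<sigma> L h x s = 0"
proof -
  have "indicator {0<..} \<tau> * exp (- L * \<tau>) * gauss_avg h x (\<sigma> * sqrt \<tau>) (s + \<tau>) = 0" for \<tau>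
    using assms by (cases "\<tau> > 0") (auto simp: gauss_avg_def)
  then show ?thesis unfolding heat_pot_def by (simp only: Bochner_Integration.integral_zero)
qed

lemma C2x_diff: "C2x h h1 h2 \<Longrightarrow> C2x k k1 k2 \<Longrightarrow>
  C2x (\<lambda>x t. h x t - k x t) (\<lambda>x t. h1 x t - k1 x t) (\<lambda>x t. h2 x t - k2 x t)"
  unfolding C2x_def by (auto intro!: bcont_diff DERIV_diff)

section \<open>Approximate solutions of a nonlocal backward problem\<close>

lemma abs_triangle3:
  fixes a u l d b g :: real assumes "l \<ge> 0"
  shows "\<bar>a * u + l * d - b * g\<bar> \<le> \<bar>a\<bar> * \<bar>u\<bar> + l * \<bar>d\<bar> + \<bar>b\<bar> * \<bar>g\<bar>"
proof -
  have "\<bar>a * u + l * d - b * g\<bar> \<le> \<bar>a * u\<bar> + \<bar>l * d\<bar> + \<bar>b * g\<bar>" by linarith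
  then show ?thesis using assms by (simp add: abs_mult)
qed

text \<open>With \<phi> = \<open>heat_pot \<sigma> L h\<close> the equation h =
  \<open>rhs h h1\<close> says \<phi>_t + \<sigma>^2/2 \<phi>_xx - b \<phi>_x + J(\<phi>_x) ut =
  -\<psi> on the whole line. Odd data give an odd \<phi>, hence \<phi>(0, t) = 0. J stands for the
  nonlocal coefficient; \<open>small\<close> says that drift and nonlocal term contribute at most
  1/4 to the contraction.\<close>

locale dual_problem =
  fixes \<sigma> L K U S :: real and b ut \<psi> :: "real \<Rightarrow> real \<Rightarrow> real"
    and J :: "(real \<Rightarrow> real \<Rightarrow> real) \<Rightarrow> real \<Rightarrow> real"
  assumes \<sigma>: "\<sigma> > 0" and L: "L > 0"
    and small: "(K + U / 2) * (sqrt (pi / L) / \<sigma>) \<le> 1 / 4"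
    and b: "bcont b" "ucont_x b" "\<And>x t. \<bar>b x t\<bar> \<le> K" "\<And>x t. b (- x) t = - b x t"
    and ut: "bcont ut" "ucont_x ut" "\<And>x t. \<bar>ut x t\<bar> \<le> U" "\<And>x t. ut (- x) t = - ut x t"
    and \<psi>: "bcont \<psi>" "ucont_x \<psi>" "\<And>x t. \<psi> (- x) t = - \<psi> x t" "\<And>x t. S \<le> t \<Longrightarrow> \<psi> x t = 0"
    and J_cont: "\<And>g. bcont g \<Longrightarrow> continuous_on UNIV (J g)"
    and J_bound: "\<And>g t B. bcont g \<Longrightarrow> (\<And>x. \<bar>g x t\<bar> \<le> B) \<Longrightarrow> \<bar>J g t\<bar> \<le> B / 2"
    and J_diff: "\<And>g g' t. bcont g \<Longrightarrow> bcont g' \<Longrightarrow> J (\<lambda>x t. g x t - g' x t) t = J g t - J g' t"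
begin

definition rhs :: "(real \<Rightarrow> real \<Rightarrow> real) \<Rightarrow> (real \<Rightarrow> real \<Rightarrow> real) \<Rightarrow> real \<Rightarrow> real \<Rightarrow> real" where
  "rhs h h1 x t = \<psi> x t + J (heat_pot \<sigma> L h1) t * ut x t + L * heat_pot \<sigma> L h x t - b x t * heat_pot \<sigma> L h1 x t"

lemma K_nonneg: "K \<ge> 0" and U_nonneg: "U \<ge> 0"
  using b(3)[of 0 0] ut(3)[of 0 0] by linarith+

lemma bcont_J:
  assumes "bcont g" shows "bcont (\<lambda>x t. J g t)"
proof -
  obtain B where B: "\<And>x t. \<bar>g x t\<bar> \<le> B" using bcont_bound[OF assms] by blast
  show ?thesis
    by (rule bcontI[OF _ J_bound[OF assms B]])
       (rule continuous_on_compose2[OF J_cont[OF assms]], auto intro!: continuous_intros)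
qed

lemma bcont_rhs:
  assumes "bcont h" "bcont h1" shows "bcont (rhs h h1)"
  unfolding rhs_def[abs_def]
  by (intro bcont_diff bcont_add bcont_mult[of "\<lambda>x t. J _ t"] bcont_mult[of b] bcont_cmult bcont_J bcont_heat_pot assms L b(1) ut(1) \<psi>(1))

lemma J_zero:
  assumes "bcont g" "\<And>x. g x t = 0" shows "J g t = 0"
  using J_bound[OF assms(1), of t 0] assms(2) by simp

lemma C2x_zero:
  assumes "C2x h h1 h2" "\<And>x t. S \<le> t \<Longrightarrow> h x t = 0" "S \<le> t"
  shows "h1 x t = 0" "h2 x t = 0"
proof -
  have d: "((\<lambda>y. h y t) has_real_derivative h1 x t) (at x)" "((\<lambda>y. h1 y t) has_real_derivative h2 x t) (at x)" for x t
    using assms(1) by (auto simp: C2x_def)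
  show 1: "h1 x t = 0" for x
    using d(1)[of t x] assms(2)[OF assms(3)] by (simp add: DERIV_const[THEN DERIV_unique])
  show "h2 x t = 0"
    using d(2)[of t x] 1 by (simp add: DERIV_const[THEN DERIV_unique])
qed

lemma C2x_even:
  assumes "C2x h h1 h2" "\<And>x t. h (- x) t = - h x t"
  shows "h1 (- x) t = h1 x t"
proof -
  have d: "((\<lambda>y. h y t) has_real_derivative h1 x t) (at x)" for x t
    using assms(1) by (auto simp: C2x_def)
  have "((\<lambda>y. h (- y) t) has_real_derivative h1 (- x) t * (-1)) (at x)"
    by (rule DERIV_chain2[OF d]) (auto intro!: derivative_eq_intros)
  moreover have "((\<lambda>y. h (- y) t) has_real_derivative - h1 x t) (at x)"
    unfolding assms(2) by (intro DERIV_minus d)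
  ultimately show ?thesis using DERIV_unique by fastforce
qed

text \<open>Everything survives the map except the two x-derivatives, because b and ut are only
  uniformly continuous in x. What is listed here is exactly what \<open>C2x_approx\<close> asks
  for.\<close>

lemma rhs_props:
  assumes h: "C2x h h1 h2" and odd: "\<And>x t. h (- x) t = - h x t" and z: "\<And>x t. S \<le> t \<Longrightarrow> h x t = 0"
  shows "bcont (rhs h h1)" "ucont_x (rhs h h1)" "rhs h h1 (- x) t = - rhs h h1 x t"
    "S \<le> t \<Longrightarrow> rhs h h1 x t = 0"
proof -
  have bc: "bcont h" "bcont h1" "bcont h2"
    and d: "\<And>x t. ((\<lambda>y. h y t) has_real_derivative h1 x t) (at x)"
           "\<And>x t. ((\<lambda>y. h1 y t) has_real_derivative h2 x t) (at x)" using h by (auto simp: C2x_def)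
  note hb = bcont_heat_pot[OF bc(1) L] bcont_heat_pot[OF bc(2) L] bcont_heat_pot[OF bc(3) L]
  show "bcont (rhs h h1)" by (rule bcont_rhs[OF bc(1,2)])
  have u: "ucont_x (heat_pot \<sigma> L h)" "ucont_x (heat_pot \<sigma> L h1)"
    using ucont_x_deriv[OF heat_pot_has_derivative_x[OF bc(1,2) d(1) L] hb(2)]
      ucont_x_deriv[OF heat_pot_has_derivative_x[OF bc(2,3) d(2) L] hb(3)] by blast+
  have "ucont_x (\<lambda>x t. (\<psi> x t + J (heat_pot \<sigma> L h1) t * ut x t + L * heat_pot \<sigma> L h x t) + (- 1) * (b x t * heat_pot \<sigma> L h1 x t))"
    by (intro ucont_x_add \<psi>(2) ucont_x_mult[OF ucont_x_const ut(2) bcont_J[OF hb(2)] ut(1)]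
      ucont_x_mult[OF ucont_x_const u(1) bcont_const hb(1)] ucont_x_mult[OF ucont_x_const _ bcont_const]
      ucont_x_mult[OF b(2) u(2) b(1) hb(2)] bcont_mult b(1) hb(2))
  then show "ucont_x (rhs h h1)" by (simp add: rhs_def[abs_def])
  show "rhs h h1 (- x) t = - rhs h h1 x t"
    using heat_pot_uminus[of h "-1" \<sigma> L x t] heat_pot_uminus[of h1 1 \<sigma> L x t] odd C2x_even[OF h odd]
    by (simp add: rhs_def \<psi>(3) b(4) ut(4))
  show "rhs h h1 x t = 0" if "S \<le> t"
    using heat_pot_zero[OF z that] heat_pot_zero[OF C2x_zero(1)[OF h z] that] \<psi>(4)[OF that] J_zero[OF hb(2)]
    by (simp add: rhs_def)
qed

text \<open>In the weight exp(-L t) the decay of h doubles the damping, so L times the potential is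
  at most half of the bound. Hence the term L \<phi> that was added to the source is contractive for
  every L.\<close>

lemma heat_pot_weighted:
  assumes h: "C2x h h1 h2" and N: "N \<ge> 0" and le: "\<And>x t. \<bar>h x t\<bar> \<le> N * exp (- L * t)"
  shows "L * \<bar>heat_pot \<sigma> L h x s\<bar> \<le> 1 / 2 * N * exp (- L * s)"
    and "\<bar>heat_pot \<sigma> L h1 x s\<bar> \<le> sqrt (pi / L) / \<sigma> * (N * exp (- L * s))"
proof -
  have bc: "bcont h" "bcont h1" and d: "\<And>x t. ((\<lambda>y. h y t) has_real_derivative h1 x t) (at x)"
    using h by (auto simp: C2x_def)
  \<comment> \<open>Freezing the weight before time s makes the majorant bounded on the whole line;
    only times after s enter.\<close>
  define H where "H = (\<lambda>t. N * exp (- L * max s t))"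
  have Hm: "H \<in> borel_measurable borel" unfolding H_def by measurable
  have Hb: "\<bar>H t\<bar> \<le> N * exp (- L * s)" for t
    using N L by (auto simp: H_def abs_mult intro!: mult_left_mono)
  have Hle: "\<bar>h y t\<bar> \<le> H t" if "t \<ge> s" for y t using le[of y t] that by (simp add: H_def max_def)
  have "\<bar>heat_pot \<sigma> L h x s\<bar> \<le> (LBINT \<tau>. indicator {0<..} \<tau> * exp (- L * \<tau>) * H (s + \<tau>))"
    by (rule heat_pot_bound[OF bc(1) L Hm Hb Hle])
  also have "\<dots> = (LBINT \<tau>. (indicator {0<..} \<tau> * exp (- (2 * L) * \<tau>)) * (N * exp (- L * s)))"
    by (rule Bochner_Integration.integral_cong)
       (auto simp: H_def indicator_def exp_add[symmetric] algebra_simps)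
  also have "\<dots> = 1 / (2 * L) * (N * exp (- L * s))"
    using exp_tail[of "2 * L"] L by (simp add: has_bochner_integral_iff)
  finally show "L * \<bar>heat_pot \<sigma> L h x s\<bar> \<le> 1 / 2 * N * exp (- L * s)"
    using L by (simp add: field_simps)
  have "\<bar>heat_pot \<sigma> L h1 x s\<bar> \<le> (LBINT \<tau>. heat_ker \<sigma> L \<tau> * H (s + \<tau>))"
    by (rule heat_pot_bound_deriv[OF bc d \<sigma> L Hm Hb Hle])
  also have "\<dots> \<le> (LBINT \<tau>. heat_ker \<sigma> L \<tau> * (N * exp (- L * s)))"
    by (intro integral_mono integrable_heat_ker_mult[OF L Hm Hb] integrable_heat_ker_mult[OF L, of "\<lambda>_. N * exp (- L * s)" "N * exp (- L * s)"] mult_left_mono heat_ker_nonneg \<sigma>)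
       (use order_trans[OF abs_ge_self Hb] N in auto)
  also have "\<dots> = sqrt (pi / L) / \<sigma> * (N * exp (- L * s))"
    using heat_ker_integral[OF L, of \<sigma>] by (simp add: has_bochner_integral_iff)
  finally show "\<bar>heat_pot \<sigma> L h1 x s\<bar> \<le> sqrt (pi / L) / \<sigma> * (N * exp (- L * s))" .
qed

text \<open>The factor 3/4 is 1/2 from L \<phi> plus 1/4 from the drift and the nonlocal term, by
  \<open>small\<close>.\<close>

lemma rhs_contraction:
  assumes h: "C2x h h1 h2" and k: "C2x k k1 k2" and N: "N \<ge> 0"
    and le: "\<And>x t. \<bar>h x t - k x t\<bar> \<le> N * exp (- L * t)"
  shows "\<bar>rhs h h1 x s - rhs k k1 x s\<bar> \<le> 3 / 4 * N * exp (- L * s)"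
proof -
  have bc: "bcont h" "bcont h1" "bcont k" "bcont k1" using h k by (auto simp: C2x_def)
  define E where "E = N * exp (- L * s)"
  have E: "E \<ge> 0" using N by (simp add: E_def)
  let ?g = "\<lambda>x s. heat_pot \<sigma> L h1 x s - heat_pot \<sigma> L k1 x s"
  let ?c = "sqrt (pi / L) / \<sigma>"
  have 1: "L * \<bar>heat_pot \<sigma> L h x s - heat_pot \<sigma> L k x s\<bar> \<le> 1 / 2 * E" for x
    using heat_pot_weighted(1)[OF C2x_diff[OF h k] N le, of x s] bc L by (simp add: heat_pot_diff E_def mult.assoc)
  have 2: "\<bar>?g x s\<bar> \<le> ?c * E" for x
    using heat_pot_weighted(2)[OF C2x_diff[OF h k] N le, of x s] bc L by (simp add: heat_pot_diff E_def)
  have 3: "\<bar>J (heat_pot \<sigma> L h1) s - J (heat_pot \<sigma> L k1) s\<bar> \<le> ?c * E / 2"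
    using J_bound[of ?g s "?c * E"] 2 J_diff[of "heat_pot \<sigma> L h1" "heat_pot \<sigma> L k1" s] bc L
    by (simp add: bcont_heat_pot bcont_diff)
  have eq: "rhs h h1 x s - rhs k k1 x s = (J (heat_pot \<sigma> L h1) s - J (heat_pot \<sigma> L k1) s) * ut x s
      + L * (heat_pot \<sigma> L h x s - heat_pot \<sigma> L k x s) - b x s * ?g x s"
    unfolding rhs_def by algebra
  have "\<bar>rhs h h1 x s - rhs k k1 x s\<bar> \<le> \<bar>J (heat_pot \<sigma> L h1) s - J (heat_pot \<sigma> L k1) s\<bar> * \<bar>ut x s\<bar>
      + L * \<bar>heat_pot \<sigma> L h x s - heat_pot \<sigma> L k x s\<bar> + \<bar>b x s\<bar> * \<bar>?g x s\<bar>"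
    unfolding eq by (rule abs_triangle3) (use L in simp)
  also have "\<dots> \<le> ?c * E / 2 * U + 1 / 2 * E + K * (?c * E)"
  proof (intro add_mono 1)
    show "\<bar>J (heat_pot \<sigma> L h1) s - J (heat_pot \<sigma> L k1) s\<bar> * \<bar>ut x s\<bar> \<le> ?c * E / 2 * U"
      by (rule mult_mono[OF 3 ut(3)]) (use E \<sigma> L in auto)
    show "\<bar>b x s\<bar> * \<bar>?g x s\<bar> \<le> K * (?c * E)"
      by (rule mult_mono[OF b(3) 2]) (use K_nonneg in auto)
  qed
  also have "\<dots> = ((K + U / 2) * ?c) * E + 1 / 2 * E" by (simp add: algebra_simps)
  also have "\<dots> \<le> 1 / 4 * E + 1 / 2 * E"
    using small E by (intro add_mono mult_right_mono) auto
  finally show ?thesis by (simp add: E_def)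
qed

lemma ex_approx_solution:
  assumes \<epsilon>: "\<epsilon> > 0"
  obtains h h1 h2 where "C2x h h1 h2" "\<And>x t. h (- x) t = - h x t" "\<And>x t. S \<le> t \<Longrightarrow> h x t = 0"
    "\<And>x t. \<bar>h x t - rhs h h1 x t\<bar> \<le> \<epsilon> * exp (- L * t)"
proof -
  obtain P where P: "P \<ge> 0" "\<And>x t. \<bar>\<psi> x t\<bar> \<le> P" using bcont_bound[OF \<psi>(1)] by blast
  define e0 where "e0 = P * exp (L * S)"
  \<comment> \<open>The iteration error settles at 8 \<open>e\<close> = \<epsilon>/2; the
    contribution of the initial error has to drop below the same amount.\<close>
  define e where "e = \<epsilon> / 16"
  have e: "e > 0" "e0 \<ge> 0" using \<epsilon> P by (auto simp: e_def e0_def)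
  \<comment> \<open>This form is stable: one mollified step turns an error E into at most e + 3/4 (E
    + e), so 8 e becomes 31/4 e.\<close>
  have step: "\<exists>h h1 h2. C2x h h1 h2 \<and> (\<forall>x t. h (- x) t = - h x t) \<and> (\<forall>x t. S \<le> t \<longrightarrow> h x t = 0) \<and>
      (\<forall>x t. \<bar>h x t - rhs h h1 x t\<bar> \<le> ((3/4)^n * e0 + 8 * e) * exp (- L * t))" for n
  proof (induction n)
    case 0
    have hz: "heat_pot \<sigma> L (\<lambda>x t. 0) x t = 0" for x t by (simp add: heat_pot_def gauss_avg_def)
    have psi: "\<bar>\<psi> x t\<bar> \<le> e0 * exp (- L * t)" for x t
    proof (cases "S \<le> t")
      case False
      then have "L * t \<le> L * S" using L by simp
      then have "P * exp 0 \<le> P * exp (L * S - L * t)" using P(1) by (intro mult_left_mono) auto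
      then show ?thesis using P(2)[of x t] by (simp add: e0_def exp_add[symmetric] mult.assoc)
    qed (simp add: \<psi>(4) e)
    have "\<bar>0 - rhs (\<lambda>x t. 0) (\<lambda>x t. 0) x t\<bar> \<le> ((3/4)^0 * e0 + 8 * e) * exp (- L * t)" for x t
    proof -
      have "e0 * exp (- L * t) \<le> (e0 + 8 * e) * exp (- L * t)" using e by (intro mult_right_mono) auto
      from order_trans[OF psi[of x t] this] show ?thesis
        using J_zero[OF bcont_const, of 0 t] by (simp add: rhs_def hz[abs_def])
    qed
    then show ?case
      by (intro exI[of _ "\<lambda>x t. 0"]) (auto simp: C2x_def)
  next
    case (Suc n)
    then obtain h h1 h2 where h: "C2x h h1 h2" "\<And>x t. h (- x) t = - h x t" "\<And>x t. S \<le> t \<Longrightarrow> h x t = 0"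
      and err: "\<And>x t. \<bar>h x t - rhs h h1 x t\<bar> \<le> ((3/4)^n * e0 + 8 * e) * exp (- L * t)" by blast
    \<comment> \<open>The mollification is as accurate as the weight at time S demands; before S the
      weight is larger, and from S on both functions vanish.\<close>
    have "e * exp (- L * S) > 0" using e by simp
    from C2x_approx[OF rhs_props[OF h] this]
    obtain k k1 k2 where k: "C2x k k1 k2" "\<And>x t. \<bar>k x t - rhs h h1 x t\<bar> \<le> e * exp (- L * S)"
      "\<And>x t. k (- x) t = - k x t" "\<And>x t. S \<le> t \<Longrightarrow> k x t = 0" by blast
    have c: "\<bar>k x t - rhs h h1 x t\<bar> \<le> e * exp (- L * t)" for x t
    proof (cases "S \<le> t")
      case False
      then have "e * exp (- L * S) \<le> e * exp (- L * t)" using L e by simp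
      then show ?thesis using k(2) order_trans by blast
    qed (use k(4) rhs_props(4)[OF h] e in simp)
    define N where "N = (3/4)^n * e0 + 9 * e"
    have "\<bar>h x t - k x t\<bar> \<le> N * exp (- L * t)" for x t
      using c[of x t] err[of x t] unfolding N_def by (simp add: algebra_simps)
    then have "\<bar>rhs h h1 x t - rhs k k1 x t\<bar> \<le> 3 / 4 * N * exp (- L * t)" for x t
      using e by (intro rhs_contraction[OF h(1) k(1)]) (auto simp: N_def)
    note d = this
    have "\<bar>k x t - rhs k k1 x t\<bar> \<le> (e + 3 / 4 * N) * exp (- L * t)" for x t
      using c[of x t] d[of x t] unfolding distrib_right[of e] by linarith
    moreover have "(e + 3 / 4 * N) * exp (- L * t) \<le> ((3/4)^Suc n * e0 + 8 * e) * exp (- L * t)" for t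
      using e by (intro mult_right_mono) (auto simp: N_def)
    ultimately have "\<bar>k x t - rhs k k1 x t\<bar> \<le> ((3/4)^Suc n * e0 + 8 * e) * exp (- L * t)" for x t
      using order_trans by blast
    then show ?case using k(1,3,4) by blast
  qed
  have "(\<lambda>n. (3/4)^n * e0) \<longlonglongrightarrow> 0"
    by (intro tendsto_mult_left_zero LIMSEQ_realpow_zero) auto
  then have "eventually (\<lambda>n. (3/4)^n * e0 < 8 * e) sequentially"
    by (rule order_tendstoD(2)) (use e in simp)
  then obtain n where n: "(3/4)^n * e0 < 8 * e" by (auto simp: eventually_sequentially)
  from step[of n] obtain h h1 h2 where h: "C2x h h1 h2" "\<And>x t. h (- x) t = - h x t" "\<And>x t. S \<le> t \<Longrightarrow> h x t = 0"
    and err: "\<And>x t. \<bar>h x t - rhs h h1 x t\<bar> \<le> ((3/4)^n * e0 + 8 * e) * exp (- L * t)" by blast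
  have "((3/4)^n * e0 + 8 * e) * exp (- L * t) \<le> \<epsilon> * exp (- L * t)" for t
    using n by (intro mult_right_mono) (auto simp: e_def)
  then show thesis using that[OF h] err order_trans by blast
qed

text \<open>Comparison with the zero function, on which the map takes the value \<psi>: a bound N
  improves to 3/4 N + P + \<epsilon>, with fixed point 4 (P + \<epsilon>). For \<epsilon> at most 1
  the result is uniform over all approximate solutions.\<close>

lemma approx_solution_bound:
  assumes h: "C2x h h1 h2" and z: "\<And>x t. S \<le> t \<Longrightarrow> h x t = 0"
    and err: "\<And>x t. \<bar>h x t - rhs h h1 x t\<bar> \<le> \<epsilon> * exp (- L * t)"
    and P: "\<And>x t. \<bar>\<psi> x t\<bar> \<le> P * exp (- L * t)"
  shows "\<bar>h x t\<bar> \<le> 4 * (P + \<epsilon>) * exp (- L * t)"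
proof -
  have hz: "heat_pot \<sigma> L (\<lambda>x t. 0) x t = 0" for x t by (simp add: heat_pot_def gauss_avg_def)
  have r0: "rhs (\<lambda>x t. 0) (\<lambda>x t. 0) x t = \<psi> x t" for x t
    using J_zero[OF bcont_const, of 0 t] by (simp add: rhs_def hz[abs_def])
  have C0: "C2x (\<lambda>x t. 0) (\<lambda>x t. 0) (\<lambda>x t. 0)" by (auto simp: C2x_def)
  obtain B where B: "B \<ge> 0" "\<And>x t. \<bar>h x t\<bar> \<le> B" using h bcont_bound[of h] unfolding C2x_def by blast
  \<comment> \<open>A first bound in the weight exp(-L t) exists because h is bounded and vanishes
    from S on; its size is lost in the iteration.\<close>
  define N where "N = B * exp (L * S)"
  have N: "N \<ge> 0" using B by (simp add: N_def)
  have P0: "P \<ge> 0" using order_trans[OF abs_ge_zero P[of 0 0]] by simp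
  have \<epsilon>0: "\<epsilon> \<ge> 0" using order_trans[OF abs_ge_zero err[of 0 0]] by simp
  have *: "\<bar>h x t\<bar> \<le> ((3/4)^n * N + 4 * (P + \<epsilon>)) * exp (- L * t)" for n x t
  proof (induction n arbitrary: x t)
    case 0
    have "\<bar>h x t\<bar> \<le> N * exp (- L * t)"
    proof (cases "S \<le> t")
      case False
      then have "L * t \<le> L * S" using L by simp
      then have "B * exp 0 \<le> B * exp (L * S - L * t)" using B(1) by (intro mult_left_mono) auto
      then show ?thesis using B(2)[of x t] by (simp add: N_def exp_add[symmetric] mult.assoc)
    qed (simp add: z N)
    also have "\<dots> \<le> (N + 4 * (P + \<epsilon>)) * exp (- L * t)" using P0 \<epsilon>0 by (intro mult_right_mono) auto
    finally show ?case by simp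
  next
    case (Suc n)
    let ?M = "(3/4)^n * N + 4 * (P + \<epsilon>)"
    have "\<bar>rhs h h1 x t - rhs (\<lambda>x t. 0) (\<lambda>x t. 0) x t\<bar> \<le> 3 / 4 * ?M * exp (- L * t)"
      using Suc N P0 \<epsilon>0 by (intro rhs_contraction[OF h C0]) auto
    then have "\<bar>h x t\<bar> \<le> 3 / 4 * ?M * exp (- L * t) + P * exp (- L * t) + \<epsilon> * exp (- L * t)"
      using err[of x t] P[of x t] unfolding r0 by linarith
    also have "\<dots> = ((3/4)^Suc n * N + 4 * (P + \<epsilon>)) * exp (- L * t)" by (simp add: algebra_simps)
    finally show ?case .
  qed
  have "(\<lambda>n. ((3/4)^n * N + 4 * (P + \<epsilon>)) * exp (- L * t)) \<longlonglongrightarrow> (0 * N + 4 * (P + \<epsilon>)) * exp (- L * t)"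
    by (intro tendsto_intros LIMSEQ_realpow_zero) auto
  then show ?thesis
    using LIMSEQ_le_const[of _ _ "\<bar>h x t\<bar>"] * by fastforce
qed

end

section \<open>Maximum principle\<close>

text \<open>With a negative second derivative f' would be negative just to the right of x, and by
  the mean value theorem f would take a smaller value there.\<close>

lemma DERIV_min_second_nonneg:
  fixes f f' :: "real \<Rightarrow> real"
  assumes d: "d > 0" and f: "\<And>y. \<bar>y - x\<bar> < d \<Longrightarrow> (f has_real_derivative f' y) (at y)"
    and f': "(f' has_real_derivative l) (at x)" and min: "\<And>y. \<bar>y - x\<bar> < d \<Longrightarrow> f x \<le> f y"
  shows "f' x = 0" "l \<ge> 0"
proof -
  show 0: "f' x = 0"
    by (rule DERIV_local_min[OF f, of x d]) (use d min in \<open>auto simp: abs_minus_commute\<close>)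
  show "l \<ge> 0"
  proof (rule ccontr)
    assume "\<not> l \<ge> 0"
    then obtain e where e: "e > 0" "\<And>h. h > 0 \<Longrightarrow> h < e \<Longrightarrow> f' (x + h) < 0"
      using DERIV_neg_dec_right[OF f'] 0 by auto
    define h where "h = min d e / 2"
    have h: "h > 0" "h < d" "h < e" using d e by (auto simp: h_def)
    have "\<exists>z>x. z < x + h \<and> f (x + h) - f x = (x + h - x) * f' z"
      by (rule MVT2) (use h f in auto)
    then obtain z where z: "z > x" "z < x + h" "f (x + h) - f x = h * f' z" by auto
    have "f' z < 0" using e(2)[of "z - x"] z h by auto
    then have "f (x + h) < f x" using z h by (simp add: mult_pos_neg algebra_simps)
    then show False using min[of "x + h"] h by auto
  qed
qed

text \<open>Difference quotients from the left are nonpositive; a one-sided derivative suffices, so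
  the final time t = T is covered.\<close>

lemma DERIV_left_min_nonpos:
  fixes f :: "real \<Rightarrow> real"
  assumes f: "(f has_real_derivative l) (at t within {0..T})" and t: "0 < t" "t \<le> T"
    and min: "\<And>s. 0 \<le> s \<Longrightarrow> s < t \<Longrightarrow> f t \<le> f s"
  shows "l \<le> 0"
proof -
  have "((\<lambda>s. (f s - f t) / (s - t)) \<longlongrightarrow> l) (at t within {0..<t})"
    using DERIV_subset[OF f, of "{0..<t}"] t by (simp add: has_field_derivative_iff subset_iff)
  moreover have "eventually (\<lambda>s. (f s - f t) / (s - t) \<le> 0) (at t within {0..<t})"
    using min by (auto simp: eventually_at_filter divide_le_0_iff intro!: always_eventually)
  moreover have "at t within {0..<t} \<noteq> bot"
    using t by (simp add: at_within_eq_bot_iff)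
  ultimately show ?thesis by (rule tendsto_upperbound)
qed

text \<open>A negative value is excluded after two changes. The factor exp(-M t) makes the zero
  order coefficient negative, and a small multiple of g = (1 + x^2) exp(C t) is added, a strict
  supersolution whose growth forces the minimum to be attained although the domain is
  unbounded.\<close>

lemma max_principle:
  fixes z zx zxx zt B c :: "real \<Rightarrow> real \<Rightarrow> real"
  assumes cont: "continuous_on ({0..} \<times> {0..T}) (\<lambda>(x, t). z x t)"
    and bd: "\<And>x t. 0 \<le> x \<Longrightarrow> 0 \<le> t \<Longrightarrow> t \<le> T \<Longrightarrow> - Z \<le> z x t"
    and bc: "\<And>t. 0 \<le> t \<Longrightarrow> t \<le> T \<Longrightarrow> 0 \<le> z 0 t" and ic: "\<And>x. 0 \<le> x \<Longrightarrow> 0 \<le> z x 0"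
    and dx: "\<And>x t. 0 < x \<Longrightarrow> 0 < t \<Longrightarrow> t \<le> T \<Longrightarrow> ((\<lambda>y. z y t) has_real_derivative zx x t) (at x)"
    and dxx: "\<And>x t. 0 < x \<Longrightarrow> 0 < t \<Longrightarrow> t \<le> T \<Longrightarrow> ((\<lambda>y. zx y t) has_real_derivative zxx x t) (at x)"
    and dt: "\<And>x t. 0 < x \<Longrightarrow> 0 < t \<Longrightarrow> t \<le> T \<Longrightarrow> ((\<lambda>s. z x s) has_real_derivative zt x t) (at t within {0..T})"
    and ineq: "\<And>x t. 0 < x \<Longrightarrow> 0 < t \<Longrightarrow> t \<le> T \<Longrightarrow> a * zxx x t + B x t * zx x t + c x t * z x t \<le> zt x t"
    and a: "a \<ge> 0" and K: "\<And>x t. 0 < x \<Longrightarrow> 0 < t \<Longrightarrow> t \<le> T \<Longrightarrow> \<bar>B x t\<bar> \<le> K"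
    and K': "\<And>x t. 0 < x \<Longrightarrow> 0 < t \<Longrightarrow> t \<le> T \<Longrightarrow> c x t \<le> K'"
    and x0: "0 \<le> x0" and t0: "0 \<le> t0" "t0 \<le> T"
  shows "0 \<le> z x0 t0"
proof (rule ccontr)
  assume neg: "\<not> 0 \<le> z x0 t0"
  have x0': "x0 > 0" using neg bc[of t0] t0 x0 by (cases "x0 = 0") auto
  have t0': "t0 > 0" using neg ic[OF x0] t0 by (cases "t0 = 0") auto
  define M where "M = K' + 1"
  define C where "C = 2 * a + K + 1"
  have K0: "K \<ge> 0" using K[OF x0' t0' t0(2)] by linarith
  have C: "C > 0" using a K0 by (simp add: C_def)
  define g where "g = (\<lambda>x t. (1 + x\<^sup>2) * exp (C * t) :: real)"
  \<comment> \<open>Half of the factor at which \<open>Y\<close> would vanish at (x0, t0).\<close>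
  define e where "e = exp (- M * t0) * (- z x0 t0) / (2 * g x0 t0)"
  have g0: "g x t > 0" for x t unfolding g_def by (intro mult_pos_pos) (auto simp: add_pos_nonneg)
  have e: "e > 0" unfolding e_def using neg g0[of x0 t0] by (intro divide_pos_pos mult_pos_pos) auto
  define Y where "Y = (\<lambda>x t. exp (- M * t) * z x t + e * g x t)"
  have Y0: "Y x0 t0 < 0"
  proof -
    have "e * g x0 t0 = exp (- M * t0) * (- z x0 t0) / 2"
      using g0[of x0 t0] by (simp add: e_def)
    then have "Y x0 t0 = exp (- M * t0) * z x0 t0 / 2" by (simp add: Y_def)
    moreover have "exp (- M * t0) * z x0 t0 < 0" using neg by (simp add: mult_pos_neg)
    ultimately show ?thesis by linarith
  qed
  \<comment> \<open>M may have either sign, so the weight is bounded by the larger of its end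
    values.\<close>
  define E where "E = max 1 (exp (- M * T))"
  have E: "exp (- M * t) \<le> E" if "0 \<le> t" "t \<le> T" for t
  proof (cases "M \<ge> 0")
    case True then have "exp (- M * t) \<le> exp 0" using that by (subst exp_le_cancel_iff) (simp add: mult_nonneg_nonneg)
    then show ?thesis by (simp add: E_def le_max_iff_disj)
  next
    case False then have "- M * t \<le> - M * T" using that by (intro mult_left_mono) auto
    then show ?thesis by (simp add: E_def le_max_iff_disj)
  qed
  \<comment> \<open>From R on the quadratic term outweighs the lower bound of z, so a negative
    minimum over the compact rectangle lies to the left of R.\<close>
  define R where "R = max (x0 + 1) (1 + \<bar>Z\<bar> * E / e)"
  have Rpos: "Y x t \<ge> 0" if "x \<ge> R" "0 \<le> t" "t \<le> T" for x t
  proof -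
    have E1: "E \<ge> 1" by (simp add: E_def)
    have x: "x \<ge> 1 + \<bar>Z\<bar> * E / e" "x \<ge> 0" using that e E1 x0 by (auto simp: R_def)
    have q: "\<bar>Z\<bar> * E / e \<ge> 0" using e E1 by simp
    then have "x * 1 \<le> x * x" using x by (intro mult_left_mono) linarith+
    then have "\<bar>Z\<bar> * E / e \<le> 1 + x\<^sup>2" using x by (simp add: power2_eq_square)
    then have "\<bar>Z\<bar> * E \<le> e * (1 + x\<^sup>2)" using e by (simp add: field_simps)
    also have "\<dots> \<le> e * g x t"
    proof -
      have "(1 + x\<^sup>2) * 1 \<le> (1 + x\<^sup>2) * exp (C * t)"
        using C that by (intro mult_left_mono) auto
      then show ?thesis using e unfolding g_def by (intro mult_left_mono) auto
    qed
    finally have 1: "\<bar>Z\<bar> * E \<le> e * g x t" .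
    have "exp (- M * t) * z x t \<ge> exp (- M * t) * (- \<bar>Z\<bar>)"
      using bd[of x t] x that by (intro mult_left_mono) auto
    moreover have "exp (- M * t) * \<bar>Z\<bar> \<le> E * \<bar>Z\<bar>" using E that by (intro mult_right_mono) auto
    ultimately show ?thesis using 1 by (simp add: Y_def mult.commute)
  qed
  have R: "R \<ge> x0 + 1" by (simp add: R_def)
  have "continuous_on ({0..R} \<times> {0..T}) (\<lambda>p. Y (fst p) (snd p))"
  proof -
    have "continuous_on ({0..R} \<times> {0..T}) (\<lambda>p. z (fst p) (snd p))"
      by (rule continuous_on_compose_case_prod[OF cont]) (auto intro: continuous_intros)
    then show ?thesis unfolding Y_def g_def by (intro continuous_intros)
  qed
  from continuous_attains_inf[OF _ _ this] obtain p where
    p: "p \<in> {0..R} \<times> {0..T}" "\<And>q. q \<in> {0..R} \<times> {0..T} \<Longrightarrow> Y (fst p) (snd p) \<le> Y (fst q) (snd q)"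
    using x0 t0 R by (auto simp: compact_Times)
  obtain x t where xt: "p = (x, t)" by fastforce
  have xt': "0 \<le> x" "x \<le> R" "0 \<le> t" "t \<le> T" using p(1) xt by auto
  have min: "Y x t \<le> Y y s" if "0 \<le> y" "y \<le> R" "0 \<le> s" "s \<le> T" for y s
    using p(2)[of "(y, s)"] xt that by auto
  have Yn: "Y x t < 0" using min[of x0 t0] x0 t0 R Y0 by auto
  have x: "x > 0"
  proof (rule ccontr)
    assume "\<not> x > 0" then have "Y x t \<ge> 0" using xt' bc[of t] e g0[of 0 t] by (auto simp: Y_def)
    then show False using Yn by simp
  qed
  have t: "t > 0"
  proof (rule ccontr)
    assume "\<not> t > 0" then have "Y x t \<ge> 0" using xt' ic[of x] e g0[of x 0] by (auto simp: Y_def)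
    then show False using Yn by simp
  qed
  have xR: "x < R" using Rpos[of x t] Yn xt' by force
  define Yx where "Yx = (\<lambda>y. exp (- M * t) * zx y t + e * (2 * y * exp (C * t)))"
  have dY: "((\<lambda>y. Y y t) has_real_derivative Yx y) (at y)" if "y > 0" for y
    unfolding Y_def Yx_def g_def
    by (rule derivative_eq_intros dx[OF that t xt'(4)] refl | simp)+
  have dYx: "(Yx has_real_derivative exp (- M * t) * zxx x t + e * (2 * exp (C * t))) (at x)"
    unfolding Yx_def
    by (rule derivative_eq_intros dxx[OF x t xt'(4)] refl | simp)+
  define d where "d = min x (R - x)"
  have d: "d > 0" using x xR by (simp add: d_def)
  have m2: "Yx x = 0" "exp (- M * t) * zxx x t + e * (2 * exp (C * t)) \<ge> 0"
    by (rule DERIV_min_second_nonneg[OF d dY dYx], (auto simp: d_def intro!: min xt')[2])+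
  have "((\<lambda>s. Y x s) has_real_derivative exp (- M * t) * zt x t - M * exp (- M * t) * z x t + e * (C * g x t)) (at t within {0..T})"
    unfolding Y_def g_def
    by (rule derivative_eq_intros dt[OF x t xt'(4)] refl | simp add: algebra_simps)+
  then have m1: "exp (- M * t) * zt x t - M * exp (- M * t) * z x t + e * (C * g x t) \<le> 0"
    by (rule DERIV_left_min_nonpos) (use t xt' min in auto)
  \<comment> \<open>At the minimum the x-derivative of \<open>Y\<close> vanishes, the second one is
    nonnegative and the time derivative nonpositive. These three facts are now added up against the
    differential inequality; 2 x \<le> 1 + x^2 explains the summand K in C.\<close>
  let ?E = "exp (- M * t)" let ?G = "exp (C * t)"
  have "?E * (a * zxx x t + B x t * zx x t + c x t * z x t) \<le> ?E * zt x t"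
    using ineq[OF x t xt'(4)] by (intro mult_left_mono) auto
  moreover have "a * (?E * zxx x t) \<ge> a * (- (e * (2 * ?G)))"
    using m2(2) a by (intro mult_left_mono) auto
  moreover have "B x t * (?E * zx x t) \<ge> - (K * (e * (2 * x * ?G)))"
  proof -
    have "?E * zx x t = - (e * (2 * x * ?G))" using m2(1) by (simp add: Yx_def)
    moreover have "B x t * (e * (2 * x * ?G)) \<le> K * (e * (2 * x * ?G))"
      using K[OF x t xt'(4)] e x by (intro mult_right_mono) auto
    ultimately show ?thesis by simp
  qed
  moreover have "(c x t - M) * (?E * z x t) > 0"
  proof -
    have "?E * z x t < 0" using Yn e g0[of x t] unfolding Y_def by (smt (verit) mult_pos_pos)
    moreover have "c x t - M < 0" using K'[OF x t xt'(4)] by (simp add: M_def)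
    ultimately show ?thesis by (rule mult_neg_neg[rotated])
  qed
  moreover have "e * (C * g x t) \<ge> a * (e * (2 * ?G)) + K * (e * (2 * x * ?G))"
  proof -
    have "0 \<le> (1 - x)\<^sup>2" by simp
    then have "2 * x \<le> 1 + x\<^sup>2" by (simp add: power2_eq_square algebra_simps)
    then have "K * (2 * x) \<le> K * (1 + x\<^sup>2)" using K0 by (rule mult_left_mono)
    moreover have "a * 2 * 1 \<le> a * 2 * (1 + x\<^sup>2)" using a by (intro mult_left_mono) auto
    moreover have "C * (1 + x\<^sup>2) = a * 2 * (1 + x\<^sup>2) + K * (1 + x\<^sup>2) + (1 + x\<^sup>2)" unfolding C_def by algebra
    moreover have "0 \<le> x\<^sup>2" by simp
    ultimately have "a * 2 + K * (2 * x) \<le> C * (1 + x\<^sup>2)" by linarith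
    then have "(e * ?G) * (a * 2 + K * (2 * x)) \<le> (e * ?G) * (C * (1 + x\<^sup>2))"
      using e by (intro mult_left_mono) auto
    moreover have "e * (C * g x t) = (e * ?G) * (C * (1 + x\<^sup>2))" unfolding g_def by algebra
    moreover have "a * (e * (2 * ?G)) + K * (e * (2 * x * ?G)) = (e * ?G) * (a * 2 + K * (2 * x))" by algebra
    ultimately show ?thesis by linarith
  qed
  moreover have "?E * (a * zxx x t + B x t * zx x t + c x t * z x t)
      = a * (?E * zxx x t) + B x t * (?E * zx x t) + c x t * (?E * z x t)" by algebra
  moreover have "(c x t - M) * (?E * z x t) = c x t * (?E * z x t) - M * ?E * z x t" by algebra
  moreover have "a * (- (e * (2 * ?G))) = - (a * (e * (2 * ?G)))" by simp
  ultimately show False using m1 by linarith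
qed

section \<open>Regularity on the strip and calculus on the half-line\<close>

lemma continuous_on_strip_holder:
  fixes g :: "real \<Rightarrow> real \<Rightarrow> real"
  assumes x: "\<And>x y t. 0 \<le> x \<Longrightarrow> 0 \<le> y \<Longrightarrow> t \<in> {0..T} \<Longrightarrow> \<bar>g x t - g y t\<bar> \<le> C * \<bar>x - y\<bar> powr a"
    and t: "\<And>x s t. 0 \<le> x \<Longrightarrow> s \<in> {0..T} \<Longrightarrow> t \<in> {0..T} \<Longrightarrow> \<bar>g x s - g x t\<bar> \<le> C' * \<bar>s - t\<bar> powr b"
    and ab: "a > 0" "b > 0"
  shows "continuous_on ({0..} \<times> {0..T}) (\<lambda>(x, t). g x t)"
  unfolding continuous_on_def
proof
  fix p :: "real \<times> real" assume "p \<in> {0..} \<times> {0..T}"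
  then obtain x t where p: "p = (x, t)" "0 \<le> x" "t \<in> {0..T}" by auto
  let ?F = "at p within {0..} \<times> {0..T}"
  have c: "(fst \<longlongrightarrow> x) ?F" "(snd \<longlongrightarrow> t) ?F"
    using tendsto_fst[OF tendsto_ident_at, of p] tendsto_snd[OF tendsto_ident_at, of p] p by auto
  have c': "((\<lambda>q. \<bar>fst q - x\<bar>) \<longlongrightarrow> 0) ?F" "((\<lambda>q. \<bar>snd q - t\<bar>) \<longlongrightarrow> 0) ?F"
    using c by (auto intro!: tendsto_rabs_zero LIM_zero)
  have "((\<lambda>q. \<bar>fst q - x\<bar> powr a) \<longlongrightarrow> 0) ?F"
    by (rule tendsto_zero_powrI[OF c'(1) tendsto_const]) (use ab in auto)
  moreover have "((\<lambda>q. \<bar>snd q - t\<bar> powr b) \<longlongrightarrow> 0) ?F"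
    by (rule tendsto_zero_powrI[OF c'(2) tendsto_const]) (use ab in auto)
  ultimately have "((\<lambda>q. C * \<bar>fst q - x\<bar> powr a + C' * \<bar>snd q - t\<bar> powr b) \<longlongrightarrow> C * 0 + C' * 0) ?F"
    by (intro tendsto_add tendsto_mult_left)
  then have lim: "((\<lambda>q. C * \<bar>fst q - x\<bar> powr a + C' * \<bar>snd q - t\<bar> powr b) \<longlongrightarrow> 0) ?F" by simp
  have ev: "eventually (\<lambda>q. norm ((\<lambda>(x, t). g x t) q - (\<lambda>(x, t). g x t) p) \<le> C * \<bar>fst q - x\<bar> powr a + C' * \<bar>snd q - t\<bar> powr b) ?F"
    unfolding eventually_at_filter
  proof (rule always_eventually, intro allI impI)
    fix q :: "real \<times> real" assume q: "q \<in> {0..} \<times> {0..T}"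
    obtain y s where ys: "q = (y, s)" by fastforce
    have "\<bar>g y s - g x s\<bar> \<le> C * \<bar>y - x\<bar> powr a" "\<bar>g x s - g x t\<bar> \<le> C' * \<bar>s - t\<bar> powr b"
      using x[of y x s] t[of x s t] p q ys by auto
    then have "\<bar>g y s - g x t\<bar> \<le> C * \<bar>y - x\<bar> powr a + C' * \<bar>s - t\<bar> powr b" by linarith
    then show "norm ((\<lambda>(x, t). g x t) q - (\<lambda>(x, t). g x t) p) \<le> C * \<bar>fst q - x\<bar> powr a + C' * \<bar>snd q - t\<bar> powr b"
      by (simp add: ys p(1))
  qed
  show "((\<lambda>(x, t). g x t) \<longlongrightarrow> (case p of (x, t) \<Rightarrow> g x t)) ?F"
    by (rule LIM_zero_cancel, rule Lim_null_comparison[OF ev lim])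
qed

lemma D_x_eqI:
  assumes "((\<lambda>y. f y t) has_real_derivative d) (at x within {0..})" "x \<ge> 0"
  shows "D_x f x t = d"
  unfolding D_x_def
proof (rule vector_derivative_within)
  have "x islimpt {0..}"
    using islimpt_subset[of x "{x..x + 1}" "{0..}"] assms(2) by (simp add: islimpt_Icc)
  then show "at x within {0..} \<noteq> bot" by (simp add: trivial_limit_within)
qed (use assms in \<open>simp add: has_real_derivative_iff_has_vector_derivative\<close>)

lemma D_t_eqI:
  assumes "((\<lambda>s. f x s) has_real_derivative d) (at t within {0..T})" "t \<in> {0..T}" "T > 0"
  shows "D_t T f x t = d"
  unfolding D_t_def
proof (rule vector_derivative_within)
  show "at t within {0..T} \<noteq> bot" using assms by (simp add: trivial_limit_within islimpt_Icc)
qed (use assms in \<open>simp add: has_real_derivative_iff_has_vector_derivative\<close>)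

lemma differentiable_21D:
  assumes "differentiable_21 T f" "x \<ge> 0" "t \<in> {0..T}"
  shows "((\<lambda>y. f y t) has_real_derivative D_x f x t) (at x within {0..})"
    and "((\<lambda>y. D_x f y t) has_real_derivative D_xx f x t) (at x within {0..})"
    and "((\<lambda>s. f x s) has_real_derivative D_t T f x t) (at t within {0..T})"
  using assms unfolding differentiable_21_def has_real_derivative_iff_has_vector_derivative D_x_def[of f x] D_x_def[of "D_x f" x] D_t_def
  by (auto simp: vector_derivative_works[symmetric])

lemma exp_tail_Ici:
  fixes \<delta> :: real assumes \<delta>: "\<delta> > 0"
  shows "set_integrable lborel {0..} (\<lambda>x. C * exp (- \<delta> * x))"
proof -
  have i: "integrable lborel (\<lambda>x. indicator {0<..} x * exp (- \<delta> * x))"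
    using exp_tail[OF \<delta>] by (auto simp: has_bochner_integral_iff)
  have "integrable lborel (\<lambda>x. indicator {0..} x * exp (- \<delta> * x))"
  proof (rule integrable_cong_AE_imp[OF i])
    show "AE x in lborel. indicator {0<..} x * exp (- \<delta> * x) = indicator {0..} x * exp (- \<delta> * x)"
      by (intro AE_mp[OF AE_lborel_singleton[of 0] AE_I2]) (auto simp: indicator_def)
  qed auto
  from integrable_mult_right[OF this, of C] show ?thesis
    by (simp add: set_integrable_def mult.left_commute)
qed

lemma set_integrable_continuous_bound:
  fixes f w :: "real \<Rightarrow> real"
  assumes f: "continuous_on {0..} f" and w: "set_integrable lborel {0..} w" and le: "\<And>x. x \<ge> 0 \<Longrightarrow> \<bar>f x\<bar> \<le> w x"
  shows "set_integrable lborel {0..} f"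
  unfolding set_integrable_def
proof (rule Bochner_Integration.integrable_bound[OF w[unfolded set_integrable_def]])
  show "(\<lambda>x. indicator {0..} x *\<^sub>R f x) \<in> borel_measurable lborel"
    using borel_measurable_continuous_on_indicator[OF _ f] by simp
  show "AE x in lborel. norm (indicator {0..} x *\<^sub>R f x) \<le> norm (indicator {0..} x *\<^sub>R w x)"
    using order_trans[OF le abs_ge_self] by (intro AE_I2) (auto simp: indicator_def)
qed

lemma exp_decay_tendsto:
  fixes \<delta> :: real assumes "\<delta> > 0" shows "((\<lambda>x. C * exp (- \<delta> * x)) \<longlongrightarrow> 0) at_top"
proof -
  have "filterlim (\<lambda>x. \<delta> * x) at_top at_top"
    using assms by (intro filterlim_tendsto_pos_mult_at_top[OF tendsto_const]) (auto simp: filterlim_ident)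
  then have "filterlim (\<lambda>x. - \<delta> * x) at_bot at_top"
    by (simp add: filterlim_uminus_at_bot)
  then show ?thesis
    by (intro tendsto_mult_right_zero filterlim_compose[OF exp_at_bot])
qed

text \<open>The exponential bounds make H' integrable and send H to 0 at infinity, so only the
  boundary value at 0 survives.\<close>

lemma integral_half_line_FTC:
  fixes H H' :: "real \<Rightarrow> real"
  assumes d: "\<And>x. x \<ge> 0 \<Longrightarrow> (H has_real_derivative H' x) (at x within {0..})" and c: "continuous_on {0..} H'"
    and b: "\<And>x. x \<ge> 0 \<Longrightarrow> \<bar>H x\<bar> \<le> C * exp (- \<delta> * x)" "\<And>x. x \<ge> 0 \<Longrightarrow> \<bar>H' x\<bar> \<le> C' * exp (- \<delta> * x)" and \<delta>: "\<delta> > 0"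
  shows "(LBINT x:{0..}. H' x) = - H 0"
proof -
  have i: "set_integrable lborel {0..} H'"
    by (rule set_integrable_continuous_bound[OF c exp_tail_Ici[OF \<delta>] b(2)])
  have ein: "einterval 0 \<infinity> = {0<..}" by (auto simp: einterval_def)
  have "(LBINT x=0..\<infinity>. H' x) = 0 - H 0"
  proof (rule interval_integral_FTC_integrable[where F=H])
    fix x :: real assume "0 < ereal x"
    then have x: "x > 0" by simp
    then have at: "at x within {0..} = at x"
      by (intro at_within_interior) (simp add: interior_real_atLeast)
    show "(H has_vector_derivative H' x) (at x)"
      using d[of x] x at by (simp add: has_real_derivative_iff_has_vector_derivative)
    show "isCont H' x"
      using bspec[OF c[unfolded continuous_on_eq_continuous_within], of x] x by (simp add: at)
  next
    show "set_integrable lborel (einterval 0 \<infinity>) H'"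
      unfolding ein using set_integrable_subset[OF i, of "{0<..}"] by (simp add: greaterThan_subset_iff subset_iff)
    have "((\<lambda>x. H x) \<longlongrightarrow> H 0) (at 0 within {0..})"
      using DERIV_continuous[OF d[OF order_refl]] unfolding continuous_within .
    then have "(H \<longlongrightarrow> H 0) (at_right 0)" by (rule tendsto_within_subset) auto
    then show "((H \<circ> real_of_ereal) \<longlongrightarrow> H 0) (at_right 0)"
      by (simp add: zero_ereal_def ereal_tendsto_simps1)
    have "(H \<longlongrightarrow> 0) at_top"
      by (rule Lim_null_comparison[OF _ exp_decay_tendsto[OF \<delta>, of C]])
         (use b(1) in \<open>auto intro!: eventually_mono[OF eventually_ge_at_top[of 0]]\<close>)
    then show "((H \<circ> real_of_ereal) \<longlongrightarrow> 0) (at_left \<infinity>)"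
      unfolding ereal_tendsto_simps1 .
  qed simp
  also have "(LBINT x=0..\<infinity>. H' x) = (LBINT x:{0<..}. H' x)"
    by (simp add: interval_lebesgue_integral_def ein)
  also have "\<dots> = (LBINT x:{0..}. H' x)"
    unfolding set_lebesgue_integral_def
  proof (rule integral_cong_AE)
    show "(\<lambda>x. indicat_real {0<..} x *\<^sub>R H' x) \<in> borel_measurable lborel" "(\<lambda>x. indicat_real {0..} x *\<^sub>R H' x) \<in> borel_measurable lborel"
      using borel_measurable_continuous_on_indicator[OF _ c]
        borel_measurable_continuous_on_indicator[OF _ continuous_on_subset[OF c Ioi_le_Ico]] by auto
    show "AE x in lborel. indicat_real {0<..} x *\<^sub>R H' x = indicat_real {0..} x *\<^sub>R H' x"
      by (intro AE_mp[OF AE_lborel_singleton[of 0] AE_I2]) (auto simp: indicator_def)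
  qed
  finally show ?thesis by simp
qed

abbreviation "strip T \<equiv> {0::real..} \<times> {0..T::real}"

lemma bounded_stripD:
  assumes "bounded_strip T g"
  obtains C where "C \<ge> 0" "\<And>x t. 0 \<le> x \<Longrightarrow> t \<in> {0..T} \<Longrightarrow> \<bar>g x t\<bar> \<le> C"
proof -
  obtain C where C: "\<forall>x\<ge>0. \<forall>t\<in>{0..T}. \<bar>g x t\<bar> \<le> C" using assms unfolding bounded_strip_def by blast
  show thesis by (rule that[of "\<bar>C\<bar>"]) (use C in \<open>auto intro: order_trans[OF _ abs_ge_self]\<close>)
qed

text \<open>For f itself both derivatives are bounded, which gives Lipschitz bounds. For f_x this
  works in x only; its modulus in time is the seminorm of order (1+a)/2, as no mixed derivative is
  available.\<close>

lemma parabolic_holderD: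
  assumes f: "parabolic_holder a T f" and a: "a > 0"
  shows "differentiable_21 T f"
    "continuous_on (strip T) (\<lambda>(x, t). f x t)" "continuous_on (strip T) (\<lambda>(x, t). D_x f x t)"
    "continuous_on (strip T) (\<lambda>(x, t). D_xx f x t)" "continuous_on (strip T) (\<lambda>(x, t). D_t T f x t)"
    "bounded_strip T f" "bounded_strip T (D_x f)" "bounded_strip T (D_xx f)" "bounded_strip T (D_t T f)"
proof -
  show d: "differentiable_21 T f" and b: "bounded_strip T f" "bounded_strip T (D_x f)" "bounded_strip T (D_xx f)" "bounded_strip T (D_t T f)"
    using f by (auto simp: parabolic_holder_def)
  obtain C1 where C1: "\<And>x t. 0 \<le> x \<Longrightarrow> t \<in> {0..T} \<Longrightarrow> \<bar>D_x f x t\<bar> \<le> C1" using b(2) by (elim bounded_stripD) (rule that)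
  obtain C2 where C2: "\<And>x t. 0 \<le> x \<Longrightarrow> t \<in> {0..T} \<Longrightarrow> \<bar>D_xx f x t\<bar> \<le> C2" using b(3) by (elim bounded_stripD) (rule that)
  obtain C3 where C3: "\<And>x t. 0 \<le> x \<Longrightarrow> t \<in> {0..T} \<Longrightarrow> \<bar>D_t T f x t\<bar> \<le> C3" using b(4) by (elim bounded_stripD) (rule that)
  note C = C1 C2 C3
  have powr1: "\<bar>x\<bar> powr 1 = \<bar>x\<bar>" for x :: real by simp
  show "continuous_on (strip T) (\<lambda>(x, t). f x t)"
  proof (rule continuous_on_strip_holder[where a=1 and b=1, unfolded powr1])
    show "\<bar>f x t - f y t\<bar> \<le> C1 * \<bar>x - y\<bar>" if "0 \<le> x" "0 \<le> y" "t \<in> {0..T}" for x y t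
      using field_differentiable_bound[of "{0..}" "\<lambda>y. f y t" "\<lambda>y. D_x f y t" C1 x y] differentiable_21D(1)[OF d] C(1) that by auto
    show "\<bar>f x s - f x t\<bar> \<le> C3 * \<bar>s - t\<bar>" if "0 \<le> x" "s \<in> {0..T}" "t \<in> {0..T}" for x s t
      using field_differentiable_bound[of "{0..T}" "\<lambda>s. f x s" "\<lambda>s. D_t T f x s" C3 s t] differentiable_21D(3)[OF d] C(3) that by auto
  qed auto
  from f obtain H where H: "\<And>x s t. 0 \<le> x \<Longrightarrow> s \<in> {0..T} \<Longrightarrow> t \<in> {0..T} \<Longrightarrow> \<bar>D_x f x s - D_x f x t\<bar> \<le> H * \<bar>s - t\<bar> powr ((1 + a) / 2)"
    unfolding parabolic_holder_def holder_t_def by blast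
  show "continuous_on (strip T) (\<lambda>(x, t). D_x f x t)"
  proof (rule continuous_on_strip_holder[where a=1 and b="(1 + a) / 2" and C=C2 and C'=H, unfolded powr1])
    show "\<bar>D_x f x t - D_x f y t\<bar> \<le> C2 * \<bar>x - y\<bar>" if "0 \<le> x" "0 \<le> y" "t \<in> {0..T}" for x y t
      using field_differentiable_bound[of "{0..}" "\<lambda>y. D_x f y t" "\<lambda>y. D_xx f y t" C2 x y] differentiable_21D(2)[OF d] C(2) that by auto
  qed (use H a in auto)
  have g: "continuous_on (strip T) (\<lambda>(x, t). g x t)" if hx: "holder_x a T g" and ht: "holder_t (a / 2) T g" for g
  proof -
    obtain A where A: "\<forall>x\<ge>0. \<forall>y\<ge>0. \<forall>t\<in>{0..T}. \<bar>g x t - g y t\<bar> \<le> A * \<bar>x - y\<bar> powr a"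
      using hx unfolding holder_x_def by blast
    obtain B where B: "\<forall>x\<ge>0. \<forall>s\<in>{0..T}. \<forall>t\<in>{0..T}. \<bar>g x s - g x t\<bar> \<le> B * \<bar>s - t\<bar> powr (a / 2)"
      using ht unfolding holder_t_def by blast
    show ?thesis
      by (rule continuous_on_strip_holder[where C=A and C'=B and a=a and b="a / 2"]) (use A B a in auto)
  qed
  show "continuous_on (strip T) (\<lambda>(x, t). D_xx f x t)" "continuous_on (strip T) (\<lambda>(x, t). D_t T f x t)"
    using f by (auto simp: parabolic_holder_def intro!: g)
qed

section \<open>Mass and boundary flux\<close>

locale mfg =
  fixes \<sigma> r T :: real and \<xi> m\<^sub>0 u\<^sub>T :: "real \<Rightarrow> real" and \<epsilon> :: real and u m :: "real \<Rightarrow> real \<Rightarrow> real"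
  assumes \<sigma>: "\<sigma> > 0" and data: "mfg_data r T \<xi> m\<^sub>0 u\<^sub>T \<epsilon>" and sol: "mfg_solution \<sigma> r T \<xi> m\<^sub>0 u\<^sub>T \<epsilon> u m"
begin

abbreviation "F \<equiv> mfg_F \<epsilon> \<xi> u m"

definition "U = sup_norm T (D_x u)"
definition "\<beta> t = beta (\<epsilon> * \<xi> t)"

lemma T: "T > 0" and r: "r > 0"
  using data by (auto simp: mfg_data_def)

lemma \<beta>: "t \<in> {0..T} \<Longrightarrow> 0 \<le> \<beta> t" "t \<in> {0..T} \<Longrightarrow> \<beta> t \<le> 1"
  "t \<in> {0..T} \<Longrightarrow> 0 \<le> 2 / (2 + \<epsilon> * \<xi> t)" "t \<in> {0..T} \<Longrightarrow> 2 / (2 + \<epsilon> * \<xi> t) \<le> 1"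
proof -
  have "0 \<le> \<epsilon> * \<xi> t" if "t \<in> {0..T}" for t
  proof -
    have "\<xi> t \<in> {0..1}" using that data unfolding mfg_data_def by blast
    then show ?thesis using data unfolding mfg_data_def by (intro mult_nonneg_nonneg) auto
  qed
  note eps = this
  show "t \<in> {0..T} \<Longrightarrow> 0 \<le> \<beta> t" "t \<in> {0..T} \<Longrightarrow> \<beta> t \<le> 1"
  "t \<in> {0..T} \<Longrightarrow> 0 \<le> 2 / (2 + \<epsilon> * \<xi> t)" "t \<in> {0..T} \<Longrightarrow> 2 / (2 + \<epsilon> * \<xi> t) \<le> 1"
    using eps[of t] by (auto simp: \<beta>_def beta_def)
qed

lemma continuous_\<xi>: "continuous_on {0..T} \<xi>"
proof -
  have "smooth_on {0..T} \<xi>" using data by (simp add: mfg_data_def)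
  then obtain D where D: "\<forall>x\<in>{0..T}. D 0 x = \<xi> x"
    "\<forall>k. \<forall>x\<in>{0..T}. (D k has_real_derivative D (Suc k) x) (at x within {0..T})"
    unfolding smooth_on_def by blast
  have "continuous_on {0..T} (D 0)"
    by (rule DERIV_continuous_on) (use D(2) in blast)
  then show ?thesis
    using continuous_on_cong[OF refl, of "{0..T}" "D 0" \<xi>] D(1) by simp
qed

lemma continuous_\<beta>: "continuous_on {0..T} \<beta>" "continuous_on {0..T} (\<lambda>t. 2 / (2 + \<epsilon> * \<xi> t))"
proof -
  have "2 + \<epsilon> * \<xi> t \<noteq> 0" if "t \<in> {0..T}" for t
  proof -
    have "\<xi> t \<in> {0..1}" using that data unfolding mfg_data_def by blast
    then have "0 \<le> \<epsilon> * \<xi> t" using data unfolding mfg_data_def by (intro mult_nonneg_nonneg) auto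
    then show ?thesis by linarith
  qed
  then show "continuous_on {0..T} \<beta>" "continuous_on {0..T} (\<lambda>t. 2 / (2 + \<epsilon> * \<xi> t))"
    unfolding \<beta>_def[abs_def] beta_def by (auto intro!: continuous_intros continuous_\<xi>)
qed

lemma u_holder: "\<exists>a>0. parabolic_holder a T u" and m_holder: "\<exists>a>0. parabolic_holder a T m"
  using sol unfolding mfg_solution_def by auto

lemma u_cont: "continuous_on (strip T) (\<lambda>(x, t). u x t)" "continuous_on (strip T) (\<lambda>(x, t). D_x u x t)"
    "continuous_on (strip T) (\<lambda>(x, t). D_xx u x t)" "continuous_on (strip T) (\<lambda>(x, t). D_t T u x t)"
  and u_diff: "differentiable_21 T u"
  and u_bdd: "bounded_strip T u" "bounded_strip T (D_x u)" "bounded_strip T (D_xx u)" "bounded_strip T (D_t T u)"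
  using u_holder parabolic_holderD[of _ T u] by blast+

lemma m_cont: "continuous_on (strip T) (\<lambda>(x, t). m x t)" "continuous_on (strip T) (\<lambda>(x, t). D_x m x t)"
    "continuous_on (strip T) (\<lambda>(x, t). D_xx m x t)" "continuous_on (strip T) (\<lambda>(x, t). D_t T m x t)"
  and m_diff: "differentiable_21 T m"
  and m_bdd: "bounded_strip T m" "bounded_strip T (D_x m)" "bounded_strip T (D_xx m)" "bounded_strip T (D_t T m)"
  using m_holder parabolic_holderD[of _ T m] by blast+

lemmas u_deriv = differentiable_21D[OF u_diff] and m_deriv = differentiable_21D[OF m_diff]

lemma D_x_u_le: "x \<ge> 0 \<Longrightarrow> t \<in> {0..T} \<Longrightarrow> \<bar>D_x u x t\<bar> \<le> U"
proof -
  assume "x \<ge> 0" "t \<in> {0..T}"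
  obtain C where C: "\<And>x t. 0 \<le> x \<Longrightarrow> t \<in> {0..T} \<Longrightarrow> \<bar>D_x u x t\<bar> \<le> C"
    using u_bdd(2) by (elim bounded_stripD) (rule that)
  have "(case (x, t) of (x, t) \<Rightarrow> \<bar>D_x u x t\<bar>) \<le> U"
    unfolding U_def sup_norm_def
    by (rule cSUP_upper) (use C \<open>x \<ge> 0\<close> \<open>t \<in> {0..T}\<close> in \<open>auto intro!: bdd_aboveI[of _ C]\<close>)
  then show ?thesis by simp
qed

lemma U_nonneg: "U \<ge> 0"
  using D_x_u_le[of 0 0] T by auto

text \<open>The nonlocal part of F does not depend on x. Differences and derivatives in x are
  therefore those of -u_x/2 and can be taken without any knowledge of the integral.\<close>

lemma F_eq: "F x t = F y t + D_x u y t / 2 - D_x u x t / 2"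
  by (simp add: mfg_F_def field_simps)

lemma F_deriv:
  assumes "x \<ge> 0" "t \<in> {0..T}"
  shows "((\<lambda>y. F y t) has_real_derivative - D_xx u x t / 2) (at x within {0..})"
proof -
  have eq: "(\<lambda>y. F y t) = (\<lambda>y. F x t + D_x u x t / 2 - D_x u y t / 2)"
    by (rule ext) (rule F_eq)
  show ?thesis
    unfolding eq using u_deriv(2)[OF assms] by (auto intro!: derivative_eq_intros)
qed

lemma u_eq: "x \<ge> 0 \<Longrightarrow> t \<in> {0..T} \<Longrightarrow> D_t T u x t + \<sigma>\<^sup>2/2 * D_xx u x t - r * u x t + (F x t)\<^sup>2 = 0"
  using sol by (simp add: mfg_solution_def)

lemma m_eq:
  assumes "x \<ge> 0" "t \<in> {0..T}"
  shows "D_t T m x t = \<sigma>\<^sup>2/2 * D_xx m x t + F x t * D_x m x t - D_xx u x t / 2 * m x t"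
proof -
  have "((\<lambda>y. F y t * m y t) has_real_derivative - D_xx u x t / 2 * m x t + D_x m x t * F x t) (at x within {0..})"
    by (rule DERIV_mult[OF F_deriv[OF assms] m_deriv(1)[OF assms]])
  from D_x_eqI[where f="\<lambda>y s. F y s * m y s", OF this assms(1)]
  have "D_x (\<lambda>y s. F y s * m y s) x t = - D_xx u x t / 2 * m x t + D_x m x t * F x t" .
  then show ?thesis using sol assms unfolding mfg_solution_def by (simp add: algebra_simps)
qed

lemma m_0: "t \<in> {0..T} \<Longrightarrow> m 0 t = 0" and m_init: "x \<ge> 0 \<Longrightarrow> m x 0 = m\<^sub>0 x"
  using sol by (auto simp: mfg_solution_def)

text \<open>The integral inside F cannot be estimated before the mass of m is known. But the
  equation for u says that F^2 equals r u - u_t - \<sigma>^2/2 u_xx, and all these terms are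
  bounded.\<close>

lemma F_bdd: "\<exists>C\<ge>0. \<forall>x\<ge>0. \<forall>t\<in>{0..T}. \<bar>F x t\<bar> \<le> C"
proof -
  obtain A where A: "\<And>x t. 0 \<le> x \<Longrightarrow> t \<in> {0..T} \<Longrightarrow> \<bar>u x t\<bar> \<le> A" using u_bdd(1) by (elim bounded_stripD) (rule that)
  obtain B where B: "\<And>x t. 0 \<le> x \<Longrightarrow> t \<in> {0..T} \<Longrightarrow> \<bar>D_xx u x t\<bar> \<le> B" using u_bdd(3) by (elim bounded_stripD) (rule that)
  obtain C where C': "\<And>x t. 0 \<le> x \<Longrightarrow> t \<in> {0..T} \<Longrightarrow> \<bar>D_t T u x t\<bar> \<le> C" using u_bdd(4) by (elim bounded_stripD) (rule that)
  note C = A B C'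
  have "\<bar>F x t\<bar> \<le> 1 + (r * A + C + \<sigma>\<^sup>2/2 * B)" if x: "x \<ge> 0" "t \<in> {0..T}" for x t
  proof -
    have "(F x t)\<^sup>2 = r * u x t - D_t T u x t - \<sigma>\<^sup>2/2 * D_xx u x t" using u_eq[OF x] by simp
    also have "\<dots> \<le> r * A + C + \<sigma>\<^sup>2/2 * B"
    proof -
      have "r * u x t \<le> r * A" using C(1)[OF x] r by (intro mult_left_mono) auto
      moreover have "\<sigma>\<^sup>2/2 * (- D_xx u x t) \<le> \<sigma>\<^sup>2/2 * B" using C(2)[OF x] by (intro mult_left_mono) auto
      ultimately show ?thesis using C(3)[OF x] by (simp add: abs_le_iff)
    qed
    finally have *: "(F x t)\<^sup>2 \<le> r * A + C + \<sigma>\<^sup>2/2 * B" .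
    have "0 \<le> (1 - \<bar>F x t\<bar>)\<^sup>2" by simp
    then have "2 * \<bar>F x t\<bar> \<le> 1 + (F x t)\<^sup>2" by (simp add: power2_eq_square algebra_simps)
    with * show ?thesis using abs_ge_zero[of "F x t"] by linarith
  qed
  then show ?thesis
    by (intro exI[of _ "\<bar>1 + (r * A + C + \<sigma>\<^sup>2/2 * B)\<bar>"]) (auto intro: order_trans[OF _ abs_ge_self])
qed

lemma at_within_pos: "x > 0 \<Longrightarrow> at x within {0..} = at (x::real)"
  by (intro at_within_interior) (simp add: interior_real_atLeast)

text \<open>Expanding the divergence gives the zero order coefficient F_x = -u_xx/2, which is
  bounded, so the maximum principle carries the sign of the initial density forward.\<close>

lemma m_nonneg:
  assumes "x \<ge> 0" "t \<in> {0..T}" shows "m x t \<ge> 0"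
proof -
  obtain C where C: "\<And>x t. 0 \<le> x \<Longrightarrow> t \<in> {0..T} \<Longrightarrow> \<bar>D_xx u x t\<bar> \<le> C" using u_bdd(3) by (elim bounded_stripD) (rule that)
  obtain K where K: "\<And>x t. 0 \<le> x \<Longrightarrow> t \<in> {0..T} \<Longrightarrow> \<bar>F x t\<bar> \<le> K" using F_bdd by blast
  obtain Z where Z: "\<And>x t. 0 \<le> x \<Longrightarrow> t \<in> {0..T} \<Longrightarrow> \<bar>m x t\<bar> \<le> Z" using m_bdd(1) by (elim bounded_stripD) (rule that)
  show ?thesis
  proof (rule max_principle[where z=m and zx="D_x m" and zxx="D_xx m" and zt="D_t T m" and B=F and a="\<sigma>\<^sup>2/2" and c="\<lambda>x t. - D_xx u x t / 2" and T=T and K=K and K'="C / 2" and Z=Z])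
    show "continuous_on (strip T) (\<lambda>(x, t). m x t)" by (rule m_cont)
    fix x t :: real
    show "- Z \<le> m x t" if "0 \<le> x" "0 \<le> t" "t \<le> T" using Z[of x t] that by (simp add: abs_le_iff)
    show "0 \<le> m 0 t" if "0 \<le> t" "t \<le> T" using m_0[of t] that by simp
    show "0 \<le> m x 0" if "0 \<le> x" using m_init[OF that] data that by (simp add: mfg_data_def)
    assume x: "0 < x" "0 < t" "t \<le> T"
    then have x': "x \<ge> 0" "t \<in> {0..T}" by auto
    show "((\<lambda>y. m y t) has_real_derivative D_x m x t) (at x)" "((\<lambda>y. D_x m y t) has_real_derivative D_xx m x t) (at x)"
      using m_deriv(1,2)[OF x'] at_within_pos[OF x(1)] by simp_all
    show "((\<lambda>s. m x s) has_real_derivative D_t T m x t) (at t within {0..T})" by (rule m_deriv(3)[OF x'])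
    show "\<sigma>\<^sup>2/2 * D_xx m x t + F x t * D_x m x t + - D_xx u x t / 2 * m x t \<le> D_t T m x t"
      using m_eq[OF x'] by simp
    show "\<bar>F x t\<bar> \<le> K" using K[OF x'] .
    show "- D_xx u x t / 2 \<le> C / 2" using C[OF x'] by (simp add: abs_le_iff)
  qed (use assms in auto)
qed

text \<open>The rate at which mass leaves through x = 0.\<close>

definition "flux t = \<sigma>\<^sup>2/2 * D_x m 0 t"

lemma flux_nonneg:
  assumes "t \<in> {0..T}" shows "flux t \<ge> 0"
proof -
  have "((\<lambda>y. (m y t - m 0 t) / (y - 0)) \<longlongrightarrow> D_x m 0 t) (at 0 within {0..})"
    using m_deriv(1)[of 0 t] assms by (simp add: has_field_derivative_iff)
  moreover have "eventually (\<lambda>y. 0 \<le> (m y t - m 0 t) / (y - 0)) (at 0 within {0..})"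
    using m_nonneg assms m_0[OF assms] by (auto simp: eventually_at_filter intro!: always_eventually)
  moreover have "at (0::real) within {0..} \<noteq> bot" by (simp add: trivial_limit_within islimpt_subset[of _ "{0..1}"] islimpt_Icc)
  ultimately have "0 \<le> D_x m 0 t" by (rule tendsto_lowerbound)
  then show ?thesis by (simp add: flux_def)
qed

end

section \<open>Functions with bounded continuous derivatives on the strip\<close>

definition bstrip :: "real \<Rightarrow> (real \<Rightarrow> real \<Rightarrow> real) \<Rightarrow> bool" where
  "bstrip T g \<longleftrightarrow> continuous_on (strip T) (\<lambda>(x, t). g x t) \<and> bounded_strip T g"

text \<open>The derivatives are named arguments, so that products and differences are differentiated
  by rule instead of under \<open>D_x\<close> and \<open>D_t\<close>.\<close>

definition C21 :: "real \<Rightarrow> (real \<Rightarrow> real \<Rightarrow> real) \<Rightarrow> (real \<Rightarrow> real \<Rightarrow> real) \<Rightarrow> (real \<Rightarrow> real \<Rightarrow> real) \<Rightarrow> (real \<Rightarrow> real \<Rightarrow> real) \<Rightarrow> bool" where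
  "C21 T f fx fxx ft \<longleftrightarrow> bstrip T f \<and> bstrip T fx \<and> bstrip T fxx \<and> bstrip T ft \<and>
    (\<forall>x\<ge>0. \<forall>t\<in>{0..T}. ((\<lambda>y. f y t) has_real_derivative fx x t) (at x within {0..}) \<and>
      ((\<lambda>y. fx y t) has_real_derivative fxx x t) (at x within {0..}) \<and>
      ((\<lambda>s. f x s) has_real_derivative ft x t) (at t within {0..T}))"

lemma bstripI:
  assumes "continuous_on (strip T) (\<lambda>p. g (fst p) (snd p))" "\<And>x t. 0 \<le> x \<Longrightarrow> t \<in> {0..T} \<Longrightarrow> \<bar>g x t\<bar> \<le> C"
  shows "bstrip T g"
  using assms unfolding bstrip_def bounded_strip_def case_prod_unfold by blast

lemma bstripD:
  assumes "bstrip T g"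
  obtains C where "C \<ge> 0" "\<And>x t. 0 \<le> x \<Longrightarrow> t \<in> {0..T} \<Longrightarrow> \<bar>g x t\<bar> \<le> C"
  using assms unfolding bstrip_def by (elim conjE bounded_stripD) (rule that)

lemma bstrip_compose:
  assumes "bstrip T g" "continuous_on S f" "continuous_on S k" "\<And>z. z \<in> S \<Longrightarrow> 0 \<le> f z \<and> k z \<in> {0..T}"
  shows "continuous_on S (\<lambda>z. g (f z) (k z))"
  using assms unfolding bstrip_def by (intro continuous_on_compose_case_prod[of "strip T" g]) auto

lemma bstrip_cont: "bstrip T g \<Longrightarrow> continuous_on (strip T) (\<lambda>p. g (fst p) (snd p))"
  by (rule bstrip_compose) (auto intro: continuous_intros)

lemma bstrip_add:
  assumes "bstrip T f" "bstrip T g" shows "bstrip T (\<lambda>x t. f x t + g x t)"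
proof -
  obtain B where B: "\<And>x t. 0 \<le> x \<Longrightarrow> t \<in> {0..T} \<Longrightarrow> \<bar>f x t\<bar> \<le> B" using assms(1) by (elim bstripD) (rule that)
  obtain B' where B': "\<And>x t. 0 \<le> x \<Longrightarrow> t \<in> {0..T} \<Longrightarrow> \<bar>g x t\<bar> \<le> B'" using assms(2) by (elim bstripD) (rule that)
  show ?thesis
  proof (rule bstripI)
    fix x t :: real assume "0 \<le> x" "t \<in> {0..T}"
    then show "\<bar>f x t + g x t\<bar> \<le> B + B'" using B[of x t] B'[of x t] by linarith
  qed (intro continuous_intros bstrip_cont assms)
qed

lemma bstrip_mult:
  assumes "bstrip T f" "bstrip T g" shows "bstrip T (\<lambda>x t. f x t * g x t)"
proof -
  obtain B where B: "B \<ge> 0" "\<And>x t. 0 \<le> x \<Longrightarrow> t \<in> {0..T} \<Longrightarrow> \<bar>f x t\<bar> \<le> B" using assms(1) by (elim bstripD) (rule that)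
  obtain B' where B': "\<And>x t. 0 \<le> x \<Longrightarrow> t \<in> {0..T} \<Longrightarrow> \<bar>g x t\<bar> \<le> B'" using assms(2) by (elim bstripD) (rule that)
  show ?thesis
  proof (rule bstripI)
    fix x t :: real assume "0 \<le> x" "t \<in> {0..T}"
    then show "\<bar>f x t * g x t\<bar> \<le> B * B'" using B B' by (auto simp: abs_mult intro!: mult_mono)
  qed (intro continuous_intros bstrip_cont assms)
qed

lemma bstrip_time:
  assumes "continuous_on {0..T} c" shows "bstrip T (\<lambda>x t. c t)"
proof -
  have "compact (c ` {0..T})" by (rule compact_continuous_image[OF assms]) simp
  then have "\<exists>B. \<forall>t\<in>{0..T}. \<bar>c t\<bar> \<le> B" using compact_imp_bounded[of "c ` {0..T}"] by (auto simp: bounded_iff)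
  then obtain B where B: "\<forall>t\<in>{0..T}. \<bar>c t\<bar> \<le> B" by blast
  show ?thesis
    by (rule bstripI[where C=B]) (auto intro!: continuous_on_compose2[OF assms] continuous_intros B[rule_format])
qed

lemma bstrip_const: "bstrip T (\<lambda>x t. c)"
  by (rule bstrip_time) auto

lemma bstrip_cmult: "bstrip T f \<Longrightarrow> bstrip T (\<lambda>x t. c * f x t)"
  by (rule bstrip_mult[OF bstrip_const])

lemma bstrip_uminus: "bstrip T f \<Longrightarrow> bstrip T (\<lambda>x t. - f x t)"
  using bstrip_cmult[of T f "-1"] by simp

lemma bstrip_diff: "bstrip T f \<Longrightarrow> bstrip T g \<Longrightarrow> bstrip T (\<lambda>x t. f x t - g x t)"
  using bstrip_add[OF _ bstrip_uminus[of T g]] by simp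

lemma C21_mult:
  assumes f: "C21 T f fx fxx ft" and g: "C21 T g gx gxx gt"
  shows "C21 T (\<lambda>x t. f x t * g x t) (\<lambda>x t. fx x t * g x t + gx x t * f x t)
    (\<lambda>x t. (fxx x t * g x t + gx x t * fx x t) + (gxx x t * f x t + fx x t * gx x t)) (\<lambda>x t. ft x t * g x t + gt x t * f x t)"
  unfolding C21_def
  by (intro conjI allI impI ballI bstrip_mult bstrip_add DERIV_mult DERIV_add)
     (use assms in \<open>auto simp: C21_def\<close>)

lemma C21_diff:
  assumes f: "C21 T f fx fxx ft" and g: "C21 T g gx gxx gt"
  shows "C21 T (\<lambda>x t. f x t - g x t) (\<lambda>x t. fx x t - gx x t) (\<lambda>x t. fxx x t - gxx x t) (\<lambda>x t. ft x t - gt x t)"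
  using assms unfolding C21_def by (auto intro!: bstrip_diff DERIV_diff)

lemma C21_time:
  assumes "continuous_on {0..T} c'" "\<And>t. t \<in> {0..T} \<Longrightarrow> (c has_real_derivative c' t) (at t within {0..T})"
  shows "C21 T (\<lambda>x t. c t) (\<lambda>x t. 0) (\<lambda>x t. 0) (\<lambda>x t. c' t)"
  unfolding C21_def
  by (intro conjI allI impI ballI bstrip_time bstrip_const assms DERIV_const DERIV_continuous_on[OF assms(2)])

definition expw :: "real \<Rightarrow> real \<Rightarrow> real \<Rightarrow> real" where "expw \<delta> x t = exp (- \<delta> * x)"

lemma C21_expw:
  assumes "\<delta> \<ge> 0"
  shows "C21 T (expw \<delta>) (\<lambda>x t. - \<delta> * expw \<delta> x t) (\<lambda>x t. \<delta>\<^sup>2 * expw \<delta> x t) (\<lambda>x t. 0)"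
proof -
  have "bstrip T (expw \<delta>)"
    by (rule bstripI[where C=1]) (use assms in \<open>auto simp: expw_def intro!: continuous_intros\<close>)
  moreover have "((\<lambda>y. expw \<delta> y t) has_real_derivative - \<delta> * expw \<delta> x t) (at x within A)" for x t A
    unfolding expw_def by (auto intro!: derivative_eq_intros)
  moreover have "((\<lambda>y. - \<delta> * expw \<delta> y t) has_real_derivative \<delta>\<^sup>2 * expw \<delta> x t) (at x within A)" for x t A
    unfolding expw_def by (auto intro!: derivative_eq_intros simp: power2_eq_square)
  moreover have "((\<lambda>s. expw \<delta> x s) has_real_derivative 0) (at t within A)" for x t A
    unfolding expw_def by auto
  ultimately show ?thesis
    unfolding C21_def by (intro conjI allI impI ballI bstrip_cmult bstrip_const)
qed

section \<open>Moments of m: the duality identity, the mass bound and continuity in time\<close>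

context mfg begin

lemma m_C21: "C21 T m (D_x m) (D_xx m) (D_t T m)" and u_C21: "C21 T u (D_x u) (D_xx u) (D_t T u)"
  unfolding C21_def bstrip_def using m_cont m_bdd m_deriv u_cont u_bdd u_deriv by auto


definition E :: "real \<Rightarrow> (real \<Rightarrow> real) \<Rightarrow> real" where
  "E t g = (LBINT x. indicator {0..} x * (g x * m x t))"

lemma bm: "bstrip T m" "bstrip T (D_x m)" "bstrip T (D_xx m)" "bstrip T (D_t T m)"
  and bu: "bstrip T u" "bstrip T (D_x u)" "bstrip T (D_xx u)" "bstrip T (D_t T u)"
  using m_C21 u_C21 by (auto simp: C21_def)

lemma continuous_F_x: "t \<in> {0..T} \<Longrightarrow> continuous_on {0..} (\<lambda>x. F x t)"
  by (rule DERIV_continuous_on[OF F_deriv]) auto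

lemma continuous_bstrip_x: "bstrip T g \<Longrightarrow> t \<in> {0..T} \<Longrightarrow> continuous_on {0..} (\<lambda>x. g x t)"
  by (rule bstrip_compose) (auto intro: continuous_intros)

lemma measurable_half_line:
  assumes "continuous_on {0..} (f :: real \<Rightarrow> real)"
  shows "(\<lambda>x. indicator {0..} x * f x) \<in> borel_measurable lborel"
  using borel_measurable_continuous_on_indicator[OF _ assms] by simp

text \<open>The operator f_t + \<sigma>^2/2 f_xx - F f_x is dual to the Fokker-Planck operator: once
  it is split off, the time derivative of f m is an exact x-derivative \<open>H'\<close>, and as
  m(0, t) = 0 its only boundary term is f(0, t) times the flux. The exponential decay of f stands in
  for the integrability of m, which is not yet known.\<close>

lemma identity_decay:
  assumes f: "C21 T f fx fxx ft" and \<delta>: "\<delta> > 0"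
    and dec: "\<And>x t. 0 \<le> x \<Longrightarrow> t \<in> {0..T} \<Longrightarrow> \<bar>f x t\<bar> \<le> C * exp (- \<delta> * x)"
      "\<And>x t. 0 \<le> x \<Longrightarrow> t \<in> {0..T} \<Longrightarrow> \<bar>fx x t\<bar> \<le> C * exp (- \<delta> * x)"
      "\<And>x t. 0 \<le> x \<Longrightarrow> t \<in> {0..T} \<Longrightarrow> \<bar>fxx x t\<bar> \<le> C * exp (- \<delta> * x)"
      "\<And>x t. 0 \<le> x \<Longrightarrow> t \<in> {0..T} \<Longrightarrow> \<bar>ft x t\<bar> \<le> C * exp (- \<delta> * x)"
    and t: "t \<in> {0..T}"
  shows "((\<lambda>t. E t (\<lambda>x. f x t)) has_real_derivative
     E t (\<lambda>x. ft x t + \<sigma>\<^sup>2/2 * fxx x t - F x t * fx x t) - f 0 t * flux t) (at t within {0..T})"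
proof -
  have fd: "bstrip T f" "bstrip T fx" "bstrip T fxx" "bstrip T ft"
    and fder: "\<And>x t. x \<ge> 0 \<Longrightarrow> t \<in> {0..T} \<Longrightarrow> ((\<lambda>y. f y t) has_real_derivative fx x t) (at x within {0..})"
      "\<And>x t. x \<ge> 0 \<Longrightarrow> t \<in> {0..T} \<Longrightarrow> ((\<lambda>y. fx y t) has_real_derivative fxx x t) (at x within {0..})"
      "\<And>x t. x \<ge> 0 \<Longrightarrow> t \<in> {0..T} \<Longrightarrow> ((\<lambda>s. f x s) has_real_derivative ft x t) (at t within {0..T})"
    using f unfolding C21_def by auto
  have C: "C \<ge> 0" using order_trans[OF abs_ge_zero dec(1)[of 0 0]] T by auto
  obtain B0 where B0: "B0 \<ge> 0" "\<And>x t. 0 \<le> x \<Longrightarrow> t \<in> {0..T} \<Longrightarrow> \<bar>m x t\<bar> \<le> B0" using bm(1) by (elim bstripD) (rule that)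
  obtain B1 where B1: "B1 \<ge> 0" "\<And>x t. 0 \<le> x \<Longrightarrow> t \<in> {0..T} \<Longrightarrow> \<bar>D_x m x t\<bar> \<le> B1" using bm(2) by (elim bstripD) (rule that)
  obtain B2 where B2: "B2 \<ge> 0" "\<And>x t. 0 \<le> x \<Longrightarrow> t \<in> {0..T} \<Longrightarrow> \<bar>D_xx m x t\<bar> \<le> B2" using bm(3) by (elim bstripD) (rule that)
  obtain B3 where B3: "B3 \<ge> 0" "\<And>x t. 0 \<le> x \<Longrightarrow> t \<in> {0..T} \<Longrightarrow> \<bar>D_t T m x t\<bar> \<le> B3" using bm(4) by (elim bstripD) (rule that)
  obtain K where K: "K \<ge> 0" "\<And>x t. 0 \<le> x \<Longrightarrow> t \<in> {0..T} \<Longrightarrow> \<bar>F x t\<bar> \<le> K" using F_bdd by blast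
  obtain V where V: "V \<ge> 0" "\<And>x t. 0 \<le> x \<Longrightarrow> t \<in> {0..T} \<Longrightarrow> \<bar>D_xx u x t\<bar> \<le> V" using bu(3) by (elim bstripD) (rule that)
  define e where "e = (\<lambda>x. exp (- \<delta> * x))"
  have e: "e x \<ge> 0" for x by (simp add: e_def)
  have e': "exp (- \<delta> * x) = e x" for x by (simp add: e_def)
  note dece = dec[unfolded e']
  have mle: "\<bar>a * b\<bar> \<le> (A * e x) * B" if "\<bar>a\<bar> \<le> A * e x" "\<bar>b\<bar> \<le> B" for a b A B x :: real
    unfolding abs_mult using that by (intro mult_mono) (auto intro: order_trans[OF abs_ge_zero])
  have ie: "integrable lborel (\<lambda>x. indicator {0..} x * (c * e x))" for c
    using exp_tail_Ici[OF \<delta>, of c] by (simp add: set_integrable_def e_def)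
  have cont: "continuous_on {0..} (\<lambda>x. f x s)" "continuous_on {0..} (\<lambda>x. fx x s)" "continuous_on {0..} (\<lambda>x. fxx x s)"
    "continuous_on {0..} (\<lambda>x. ft x s)" "continuous_on {0..} (\<lambda>x. m x s)" "continuous_on {0..} (\<lambda>x. D_x m x s)"
    "continuous_on {0..} (\<lambda>x. D_xx m x s)" "continuous_on {0..} (\<lambda>x. D_t T m x s)" "continuous_on {0..} (\<lambda>x. D_xx u x s)"
    "continuous_on {0..} (\<lambda>x. F x s)" if "s \<in> {0..T}" for s
    using fd bm bu that by (auto intro!: continuous_bstrip_x continuous_F_x)
  have intg: "integrable lborel (\<lambda>x. indicator {0..} x * g x)"
    if "continuous_on {0..} g" "\<And>x. x \<ge> 0 \<Longrightarrow> \<bar>g x\<bar> \<le> c * e x" for g c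
    using set_integrable_continuous_bound[OF that(1) exp_tail_Ici[OF \<delta>, of c]] that(2)
    by (simp add: set_integrable_def e_def)
  have 1: "((\<lambda>t. E t (\<lambda>x. f x t)) has_real_derivative
      (LBINT x. indicator {0..} x * (ft x t * m x t + D_t T m x t * f x t))) (at t within {0..T})"
    unfolding E_def
  proof (rule has_real_derivative_integral[where S="{0..T}" and w="\<lambda>x. indicator {0..} x * ((C * B0 + C * B3) * e x)"])
    fix s x :: real assume s: "s \<in> {0..T}"
    show "((\<lambda>s. indicator {0..} x * (f x s * m x s)) has_real_derivative indicator {0..} x * (ft x s * m x s + D_t T m x s * f x s)) (at s within {0..T})"
    proof (cases "x \<ge> 0")
      case True
      show ?thesis by (intro DERIV_cmult DERIV_mult fder m_deriv True s)
    qed simp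
    show "\<bar>indicator {0..} x * (ft x s * m x s + D_t T m x s * f x s)\<bar> \<le> indicator {0..} x * ((C * B0 + C * B3) * e x)"
    proof (cases "x \<ge> 0")
      case True
      have "\<bar>ft x s * m x s\<bar> \<le> (C * e x) * B0" "\<bar>f x s * D_t T m x s\<bar> \<le> (C * e x) * B3"
        using mle[OF dece(4)[OF True s] B0(2)[OF True s]] mle[OF dece(1)[OF True s] B3(2)[OF True s]] by auto
      then show ?thesis using True by (simp add: algebra_simps)
    qed simp
  next
    show "integrable lborel (\<lambda>x. indicator {0..} x * (f x s * m x s))" if "s \<in> {0..T}" for s
      by (rule intg[where c="C * B0"])
         (use mle[OF dece(1)[OF _ that] B0(2)[OF _ that]] that in \<open>auto intro!: continuous_intros cont simp: mult_ac\<close>)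
    show "integrable lborel (\<lambda>x. indicator {0..} x * ((C * B0 + C * B3) * e x))" by (rule ie)
    show "(\<lambda>x. indicator {0..} x * (ft x t * m x t + D_t T m x t * f x t)) \<in> borel_measurable lborel"
      by (intro measurable_half_line continuous_intros cont t)
  qed (use t in auto)
  define H where "H = (\<lambda>x. \<sigma>\<^sup>2/2 * (f x t * D_x m x t - fx x t * m x t) + F x t * f x t * m x t)"
  define H' where "H' = (\<lambda>x. \<sigma>\<^sup>2/2 * (f x t * D_xx m x t - fxx x t * m x t) + (- D_xx u x t / 2) * f x t * m x t + F x t * (fx x t * m x t + f x t * D_x m x t))"
  define G where "G = (\<lambda>x. (ft x t + \<sigma>\<^sup>2/2 * fxx x t - F x t * fx x t) * m x t)"
  note d = dece[OF _ t] and b = B0(2)[OF _ t] B1(2)[OF _ t] B2(2)[OF _ t] K(2)[OF _ t] V(2)[OF _ t]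
  have bH: "\<bar>H x\<bar> \<le> (\<sigma>\<^sup>2/2 * (C * B1 + C * B0) + C * K * B0) * e x" if x: "x \<ge> 0" for x
  proof -
    have "\<bar>f x t * D_x m x t\<bar> \<le> C * B1 * e x" "\<bar>fx x t * m x t\<bar> \<le> C * B0 * e x"
      "\<bar>f x t * F x t * m x t\<bar> \<le> C * K * B0 * e x"
      using mle[OF d(1)[OF x] b(2)[OF x]] mle[OF d(2)[OF x] b(1)[OF x]]
        mle[OF mle[OF d(1)[OF x] b(4)[OF x], unfolded mult.assoc mult.commute[of "e x"], folded mult.assoc] b(1)[OF x]]
      by (simp_all add: mult_ac)
    then have "\<bar>f x t * D_x m x t - fx x t * m x t\<bar> \<le> C * B1 * e x + C * B0 * e x" by linarith
    then have "\<bar>\<sigma>\<^sup>2/2 * (f x t * D_x m x t - fx x t * m x t)\<bar> \<le> \<sigma>\<^sup>2/2 * (C * B1 * e x + C * B0 * e x)"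
      unfolding abs_mult[of "\<sigma>\<^sup>2/2"] by (intro mult_mono) auto
    then show ?thesis
      using \<open>\<bar>f x t * F x t * m x t\<bar> \<le> C * K * B0 * e x\<close>
      unfolding H_def mult.commute[of "F x t" "f x t"] by (simp add: distrib_right distrib_left mult.assoc)
  qed
  have bH': "\<bar>H' x\<bar> \<le> (\<sigma>\<^sup>2/2 * (C * B2 + C * B0) + C * V * B0 + (C * K * B0 + C * K * B1)) * e x" if x: "x \<ge> 0" for x
  proof -
    have v: "\<bar>- D_xx u x t / 2\<bar> \<le> V" using b(5)[OF x] V by simp
    have 1: "\<bar>f x t * D_xx m x t\<bar> \<le> C * B2 * e x" "\<bar>fxx x t * m x t\<bar> \<le> C * B0 * e x"
      using mle[OF d(1)[OF x] b(3)[OF x]] mle[OF d(3)[OF x] b(1)[OF x]] by (simp_all add: mult_ac)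
    have 2: "\<bar>f x t * (- D_xx u x t / 2) * m x t\<bar> \<le> C * V * B0 * e x"
      "\<bar>fx x t * F x t * m x t\<bar> \<le> C * K * B0 * e x" "\<bar>f x t * F x t * D_x m x t\<bar> \<le> C * K * B1 * e x"
      using mle[OF mle[OF d(1)[OF x] v, unfolded mult.assoc mult.commute[of "e x"], folded mult.assoc] b(1)[OF x]]
        mle[OF mle[OF d(2)[OF x] b(4)[OF x], unfolded mult.assoc mult.commute[of "e x"], folded mult.assoc] b(1)[OF x]]
        mle[OF mle[OF d(1)[OF x] b(4)[OF x], unfolded mult.assoc mult.commute[of "e x"], folded mult.assoc] b(2)[OF x]]
      by (simp_all add: mult_ac)
    have 3: "\<bar>\<sigma>\<^sup>2/2 * (f x t * D_xx m x t - fxx x t * m x t)\<bar> \<le> \<sigma>\<^sup>2/2 * (C * B2 * e x + C * B0 * e x)"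
      unfolding abs_mult using 1 by (intro mult_mono) auto
    have "H' x = \<sigma>\<^sup>2/2 * (f x t * D_xx m x t - fxx x t * m x t) + f x t * (- D_xx u x t / 2) * m x t + (fx x t * F x t * m x t + f x t * F x t * D_x m x t)"
      by (simp add: H'_def algebra_simps)
    then have "\<bar>H' x\<bar> \<le> \<sigma>\<^sup>2/2 * (C * B2 * e x + C * B0 * e x) + C * V * B0 * e x + (C * K * B0 * e x + C * K * B1 * e x)"
      using 2 3 by linarith
    also have "\<dots> = (\<sigma>\<^sup>2/2 * (C * B2 + C * B0) + C * V * B0 + (C * K * B0 + C * K * B1)) * e x" by algebra
    finally show ?thesis .
  qed
  have cH': "continuous_on {0..} H'" and cG: "continuous_on {0..} G"
    unfolding H'_def G_def by (auto intro!: continuous_intros cont[OF t])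
  have "(LBINT x:{0..}. H' x) = - H 0"
  proof (rule integral_half_line_FTC[OF _ cH' bH[unfolded e_def] bH'[unfolded e_def] \<delta>])
    fix x :: real assume x: "x \<ge> 0"
    have "(H has_real_derivative (\<sigma>\<^sup>2/2 * ((fx x t * D_x m x t + D_xx m x t * f x t) - (fxx x t * m x t + D_x m x t * fx x t))
       + ((- D_xx u x t / 2 * f x t + fx x t * F x t) * m x t + D_x m x t * (F x t * f x t)))) (at x within {0..})"
      unfolding H_def
      by (intro DERIV_cmult DERIV_mult DERIV_add DERIV_diff fder m_deriv F_deriv x t)
    then show "(H has_real_derivative H' x) (at x within {0..})"
      by (rule back_subst) (simp add: H'_def algebra_simps)
  qed
  also have "H 0 = f 0 t * flux t"
    using m_0[OF t] by (simp add: H_def flux_def)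
  finally have iH: "(LBINT x. indicator {0..} x * H' x) = - (f 0 t * flux t)"
    by (simp add: set_lebesgue_integral_def)
  have eq: "ft x t * m x t + D_t T m x t * f x t = G x + H' x" if "x \<ge> 0" for x
    unfolding G_def H'_def m_eq[OF that t] by (simp add: algebra_simps)
  have bG: "\<bar>G x\<bar> \<le> ((C * B0 + C * B3) + (\<sigma>\<^sup>2/2 * (C * B2 + C * B0) + C * V * B0 + (C * K * B0 + C * K * B1))) * e x" if x: "x \<ge> 0" for x
  proof -
    have "\<bar>ft x t * m x t\<bar> \<le> (C * e x) * B0" "\<bar>f x t * D_t T m x t\<bar> \<le> (C * e x) * B3"
      using mle[OF d(4)[OF x] b(1)[OF x]] mle[OF d(1)[OF x] B3(2)[OF x t]] by auto
    moreover have "G x = ft x t * m x t + f x t * D_t T m x t - H' x" using eq[OF x] by (simp add: mult.commute)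
    ultimately have "\<bar>G x\<bar> \<le> (C * e x) * B0 + (C * e x) * B3 + (\<sigma>\<^sup>2/2 * (C * B2 + C * B0) + C * V * B0 + (C * K * B0 + C * K * B1)) * e x"
      using bH'[OF x] by linarith
    then show ?thesis by (simp add: algebra_simps)
  qed
  have "(LBINT x. indicator {0..} x * (ft x t * m x t + D_t T m x t * f x t)) = (LBINT x. indicator {0..} x * G x + indicator {0..} x * H' x)"
    by (rule Bochner_Integration.integral_cong) (auto simp: indicator_def eq)
  also have "\<dots> = (LBINT x. indicator {0..} x * G x) + (LBINT x. indicator {0..} x * H' x)"
    by (rule Bochner_Integration.integral_add[OF intg[OF cG bG] intg[OF cH' bH']])
  also have "\<dots> = E t (\<lambda>x. ft x t + \<sigma>\<^sup>2/2 * fxx x t - F x t * fx x t) - f 0 t * flux t"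
    by (simp add: iH E_def G_def)
  finally show ?thesis using 1 by (simp only:)
qed


text \<open>On exp(-\<delta> x) the dual operator costs at most the factor \<sigma>^2/2 \<delta>^2 +
  K \<delta>, and the flux has the good sign, so Gronwall's argument applies. The rate vanishes as
  \<delta> tends to 0, which is how the mass bound 1 will come out.\<close>

lemma E_expw_le:
  assumes \<delta>: "\<delta> > 0" and K: "K \<ge> 0" "\<And>x t. 0 \<le> x \<Longrightarrow> t \<in> {0..T} \<Longrightarrow> \<bar>F x t\<bar> \<le> K" and t: "t \<in> {0..T}"
  shows "E t (\<lambda>x. expw \<delta> x t) \<le> exp ((\<sigma>\<^sup>2/2 * \<delta>\<^sup>2 + K * \<delta>) * t)"
proof -
  let ?c = "\<sigma>\<^sup>2/2 * \<delta>\<^sup>2 + K * \<delta>"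
  let ?Y = "\<lambda>t. E t (\<lambda>x. expw \<delta> x t)"
  define Y' where "Y' = (\<lambda>t. E t (\<lambda>x. 0 + \<sigma>\<^sup>2/2 * (\<delta>\<^sup>2 * expw \<delta> x t) - F x t * (- \<delta> * expw \<delta> x t)) - expw \<delta> 0 t * flux t)"
  have dec: "\<bar>c * expw \<delta> x t\<bar> \<le> (1 + \<delta> + \<delta>\<^sup>2) * exp (- \<delta> * x)" if "\<bar>c\<bar> \<le> 1 + \<delta> + \<delta>\<^sup>2" for c x t
    unfolding abs_mult expw_def using that by (intro mult_mono) auto
  have D: "(?Y has_real_derivative Y' s) (at s within {0..T})" if "s \<in> {0..T}" for s
    unfolding Y'_def
  proof (rule identity_decay[OF C21_expw \<delta> _ _ _ _ that, where C="1 + \<delta> + \<delta>\<^sup>2"])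
    show "\<bar>expw \<delta> x t\<bar> \<le> (1 + \<delta> + \<delta>\<^sup>2) * exp (- \<delta> * x)" for x t using dec[of 1 x t] \<delta> by simp
    show "\<bar>- \<delta> * expw \<delta> x t\<bar> \<le> (1 + \<delta> + \<delta>\<^sup>2) * exp (- \<delta> * x)" for x t by (rule dec) (use \<delta> in simp)
    show "\<bar>\<delta>\<^sup>2 * expw \<delta> x t\<bar> \<le> (1 + \<delta> + \<delta>\<^sup>2) * exp (- \<delta> * x)" for x t by (rule dec) (use \<delta> in simp)
    show "\<bar>0\<bar> \<le> (1 + \<delta> + \<delta>\<^sup>2) * exp (- \<delta> * x)" for x using \<delta> by simp
  qed (use \<delta> in auto)
  obtain B where B: "B \<ge> 0" "\<And>x t. 0 \<le> x \<Longrightarrow> t \<in> {0..T} \<Longrightarrow> \<bar>m x t\<bar> \<le> B" using bm(1) by (elim bstripD) (rule that)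
  have i: "integrable lborel (\<lambda>x. indicator {0..} x * (g x * m x s))"
    if "continuous_on {0..} g" "\<And>x. x \<ge> 0 \<Longrightarrow> \<bar>g x\<bar> \<le> c * exp (- \<delta> * x)" "s \<in> {0..T}" for g c s
  proof -
    have "set_integrable lborel {0..} (\<lambda>x. g x * m x s)"
    proof (rule set_integrable_continuous_bound[OF _ exp_tail_Ici[OF \<delta>, of "c * B"]])
      show "continuous_on {0..} (\<lambda>x. g x * m x s)" by (intro continuous_intros that continuous_bstrip_x bm)
      fix x :: real assume x: "x \<ge> 0"
      have "\<bar>g x\<bar> * \<bar>m x s\<bar> \<le> (c * exp (- \<delta> * x)) * B"
        by (rule mult_mono[OF that(2)[OF x] B(2)[OF x that(3)]]) (use order_trans[OF abs_ge_zero that(2)[OF x]] in auto)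
      then show "\<bar>g x * m x s\<bar> \<le> c * B * exp (- \<delta> * x)" by (simp add: abs_mult mult_ac)
    qed
    then show ?thesis by (simp add: set_integrable_def)
  qed
  have le: "Y' s \<le> ?c * ?Y s" if s: "s \<in> {0..T}" for s
  proof -
    have "E s (\<lambda>x. 0 + \<sigma>\<^sup>2/2 * (\<delta>\<^sup>2 * expw \<delta> x s) - F x s * (- \<delta> * expw \<delta> x s)) \<le> E s (\<lambda>x. ?c * expw \<delta> x s)"
      unfolding E_def
    proof (rule integral_mono)
      fix x :: real
      show "indicator {0..} x * ((0 + \<sigma>\<^sup>2/2 * (\<delta>\<^sup>2 * expw \<delta> x s) - F x s * (- \<delta> * expw \<delta> x s)) * m x s)
        \<le> indicator {0..} x * (?c * expw \<delta> x s * m x s)"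
      proof (cases "x \<ge> 0")
        case True
        have "F x s * \<delta> \<le> K * \<delta>" using K(2)[OF True s] \<delta> by (intro mult_right_mono) auto
        then have "(\<sigma>\<^sup>2/2 * \<delta>\<^sup>2 + F x s * \<delta>) * (expw \<delta> x s * m x s) \<le> ?c * (expw \<delta> x s * m x s)"
          using m_nonneg[OF True s] by (intro mult_right_mono) (auto simp: expw_def)
        then show ?thesis using True by (simp add: algebra_simps)
      qed simp
    next
      show "integrable lborel (\<lambda>x. indicator {0..} x * ((0 + \<sigma>\<^sup>2/2 * (\<delta>\<^sup>2 * expw \<delta> x s) - F x s * (- \<delta> * expw \<delta> x s)) * m x s))"
      proof (rule i[OF _ _ s, where c="?c"])
        show "continuous_on {0..} (\<lambda>x. 0 + \<sigma>\<^sup>2/2 * (\<delta>\<^sup>2 * expw \<delta> x s) - F x s * (- \<delta> * expw \<delta> x s))"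
          unfolding expw_def by (intro continuous_intros continuous_F_x s) auto
        fix x :: real assume x: "x \<ge> 0"
        have eq: "0 + \<sigma>\<^sup>2/2 * (\<delta>\<^sup>2 * expw \<delta> x s) - F x s * (- \<delta> * expw \<delta> x s) = (\<sigma>\<^sup>2/2 * \<delta>\<^sup>2 + F x s * \<delta>) * expw \<delta> x s"
          by (simp add: algebra_simps)
        have "\<bar>F x s * \<delta>\<bar> \<le> K * \<delta>" unfolding abs_mult using K(2)[OF x s] \<delta> by (intro mult_mono) auto
        then have "\<bar>\<sigma>\<^sup>2/2 * \<delta>\<^sup>2 + F x s * \<delta>\<bar> \<le> ?c" by (intro order_trans[OF abs_triangle_ineq]) simp
        then show "\<bar>0 + \<sigma>\<^sup>2/2 * (\<delta>\<^sup>2 * expw \<delta> x s) - F x s * (- \<delta> * expw \<delta> x s)\<bar> \<le> ?c * exp (- \<delta> * x)"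
          unfolding eq by (subst abs_mult, intro mult_mono) (auto simp: expw_def)
      qed
      show "integrable lborel (\<lambda>x. indicator {0..} x * (?c * expw \<delta> x s * m x s))"
      proof (rule i[OF _ _ s, where c="?c"])
        show "continuous_on {0..} (\<lambda>x. ?c * expw \<delta> x s)" unfolding expw_def by (intro continuous_intros)
        have "\<bar>?c\<bar> = ?c" using K \<delta> by simp
        then show "\<bar>?c * expw \<delta> x s\<bar> \<le> ?c * exp (- \<delta> * x)" for x
          by (subst abs_mult) (simp add: expw_def)
      qed
    qed
    also have "\<dots> = ?c * ?Y s"
      unfolding E_def Bochner_Integration.integral_mult_right_zero[symmetric]
      by (rule Bochner_Integration.integral_cong) (auto simp: mult_ac)
    finally show ?thesis using flux_nonneg[OF s] by (simp add: Y'_def expw_def)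
  qed
  \<comment> \<open>Gronwall in the form that exp(-c t) \<open>?Y t\<close> is decreasing; initially
    it is at most the mass of m_0, which is 1.\<close>
  have "exp (- ?c * t) * ?Y t \<le> exp (- ?c * 0) * ?Y 0"
  proof (rule DERIV_nonpos_imp_decreasing_open[where f="\<lambda>t. exp (- ?c * t) * ?Y t"])
    show "0 \<le> t" using t by auto
    have "continuous_on {0..T} ?Y" by (rule DERIV_continuous_on[OF D])
    then show "continuous_on {0..t} (\<lambda>t. exp (- ?c * t) * ?Y t)"
      using t by (intro continuous_intros) (auto intro: continuous_on_subset)
    fix s assume s: "0 < s" "s < t"
    then have s': "s \<in> {0..T}" and at: "at s within {0..T} = at s" using t by (auto simp: at_within_Icc_at)
    have "((\<lambda>t. exp (- ?c * t) * ?Y t) has_real_derivative (exp (- ?c * s) * (- ?c)) * ?Y s + Y' s * exp (- ?c * s)) (at s)"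
      by (rule DERIV_mult) (use D[OF s'] at in \<open>auto intro!: derivative_eq_intros\<close>)
    note d1 = this
    have e1: "(exp (- ?c * s) * (- ?c)) * ?Y s + Y' s * exp (- ?c * s) = exp (- ?c * s) * (Y' s - ?c * ?Y s)"
      by (simp add: algebra_simps)
    have "exp (- ?c * s) * (Y' s - ?c * ?Y s) \<le> 0" using le[OF s'] by (intro mult_nonneg_nonpos) auto
    then show "\<exists>y. ((\<lambda>t. exp (- ?c * t) * ?Y t) has_real_derivative y) (at s) \<and> y \<le> 0"
      using d1 unfolding e1 by (intro exI conjI)
  qed
  also have "\<dots> \<le> 1"
  proof -
    have m0: "set_integrable lborel {0..} m\<^sub>0" "(LBINT x:{0..}. m\<^sub>0 x) = 1" using data by (auto simp: mfg_data_def)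
    have "?Y 0 \<le> (LBINT x. indicator {0..} x * m\<^sub>0 x)"
      unfolding E_def
    proof (rule integral_mono)
      show "integrable lborel (\<lambda>x. indicator {0..} x * (expw \<delta> x 0 * m x 0))"
        by (rule i[where c=1]) (use T in \<open>auto simp: expw_def intro!: continuous_intros\<close>)
      show "integrable lborel (\<lambda>x. indicator {0..} x * m\<^sub>0 x)" using m0(1) by (simp add: set_integrable_def)
      fix x show "indicator {0..} x * (expw \<delta> x 0 * m x 0) \<le> indicator {0..} x * m\<^sub>0 x"
      proof (cases "x \<ge> 0")
        case True
        have "expw \<delta> x 0 * m x 0 \<le> 1 * m x 0" using m_nonneg[OF True, of 0] T True \<delta>
          by (intro mult_right_mono) (auto simp: expw_def)
        then show ?thesis using m_init[OF True] True by simp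
      qed simp
    qed
    moreover have "(LBINT x. indicator {0..} x * m\<^sub>0 x) = 1"
      using m0(2) unfolding set_lebesgue_integral_def real_scaleR_def .
    ultimately show ?thesis by simp
  qed
  finally have "exp (- ?c * t) * ?Y t \<le> 1" .
  then have "exp (?c * t) * (exp (- ?c * t) * ?Y t) \<le> exp (?c * t) * 1" by (rule mult_left_mono) simp
  moreover have "exp (?c * t) * (exp (- ?c * t) * ?Y t) = ?Y t"
    unfolding mult.assoc[symmetric] exp_add[symmetric] by (simp add: algebra_simps)
  ultimately show ?thesis by (simp only: mult_1_right)
qed

text \<open>Fatou's lemma along \<delta> = 1/(n+1): both the weights exp(-\<delta> x) and the bounds
  from \<open>E_expw_le\<close> tend to 1.\<close>

lemma m_integrable: "t \<in> {0..T} \<Longrightarrow> integrable lborel (\<lambda>x. indicator {0..} x * m x t)"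
  and mass_le: "t \<in> {0..T} \<Longrightarrow> E t (\<lambda>x. 1) \<le> 1"
proof -
  assume t: "t \<in> {0..T}"
  obtain K where K: "K \<ge> 0" "\<And>x t. 0 \<le> x \<Longrightarrow> t \<in> {0..T} \<Longrightarrow> \<bar>F x t\<bar> \<le> K" using F_bdd by blast
  obtain B where B: "B \<ge> 0" "\<And>x t. 0 \<le> x \<Longrightarrow> t \<in> {0..T} \<Longrightarrow> \<bar>m x t\<bar> \<le> B" using bm(1) by (elim bstripD) (rule that)
  define d where "d = (\<lambda>n. 1 / real (Suc n))"
  define g where "g = (\<lambda>n x. indicator {0..} x * (expw (d n) x t * m x t))"
  have dpos: "d n > 0" for n by (simp add: d_def)
  have dlim: "d \<longlonglongrightarrow> 0" unfolding d_def by (rule lim_1_over_n[THEN filterlim_sequentially_Suc[THEN iffD2]])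
  have meas: "(\<lambda>x. indicator {0..} x * m x t) \<in> borel_measurable lborel"
    by (intro measurable_half_line continuous_bstrip_x bm t)
  have ig: "integrable lborel (g n)" for n
  proof -
    have "set_integrable lborel {0..} (\<lambda>x. expw (d n) x t * m x t)"
    proof (rule set_integrable_continuous_bound[OF _ exp_tail_Ici[OF dpos[of n], of B]])
      show "continuous_on {0..} (\<lambda>x. expw (d n) x t * m x t)"
        unfolding expw_def by (intro continuous_intros continuous_bstrip_x bm t)
      show "\<bar>expw (d n) x t * m x t\<bar> \<le> B * exp (- d n * x)" if "x \<ge> 0" for x
        using B(2)[OF that t] by (simp add: expw_def abs_mult mult.commute)
    qed
    then show ?thesis by (simp add: set_integrable_def g_def)
  qed
  have gpos: "g n x \<ge> 0" for n x using m_nonneg[OF _ t, of x] by (auto simp: g_def expw_def indicator_def)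
  have gi: "(LBINT x. g n x) \<le> exp ((\<sigma>\<^sup>2/2 * (d n)\<^sup>2 + K * d n) * t)" for n
    using E_expw_le[OF dpos K t, of n] by (simp add: E_def g_def)
  have "(\<integral>\<^sup>+x. ennreal (indicator {0..} x * m x t) \<partial>lborel) = (\<integral>\<^sup>+x. liminf (\<lambda>n. ennreal (g n x)) \<partial>lborel)"
  proof (rule nn_integral_cong)
    fix x
    have "(\<lambda>n. g n x) \<longlonglongrightarrow> indicator {0..} x * (exp (- 0 * x) * m x t)"
      unfolding g_def expw_def by (intro tendsto_intros dlim)
    then have "(\<lambda>n. ennreal (g n x)) \<longlonglongrightarrow> ennreal (indicator {0..} x * m x t)"
      by (intro tendsto_ennrealI) simp
    then show "ennreal (indicator {0..} x * m x t) = liminf (\<lambda>n. ennreal (g n x))"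
      by (simp add: lim_imp_Liminf)
  qed
  also have "\<dots> \<le> liminf (\<lambda>n. \<integral>\<^sup>+x. ennreal (g n x) \<partial>lborel)"
    by (rule nn_integral_liminf) (use ig in auto)
  also have "\<dots> \<le> liminf (\<lambda>n. ennreal (exp ((\<sigma>\<^sup>2/2 * (d n)\<^sup>2 + K * d n) * t)))"
    by (intro Liminf_mono always_eventually allI)
       (use gi gpos in \<open>auto simp: nn_integral_eq_integral[OF ig] intro!: ennreal_leI\<close>)
  also have "\<dots> = ennreal 1"
  proof -
    have "(\<lambda>n. exp ((\<sigma>\<^sup>2/2 * (d n)\<^sup>2 + K * d n) * t)) \<longlonglongrightarrow> exp ((\<sigma>\<^sup>2/2 * 0\<^sup>2 + K * 0) * t)"
      by (intro tendsto_intros dlim)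
    then have "(\<lambda>n. ennreal (exp ((\<sigma>\<^sup>2/2 * (d n)\<^sup>2 + K * d n) * t))) \<longlonglongrightarrow> ennreal 1"
      by (intro tendsto_ennrealI) simp
    then show ?thesis by (simp add: lim_imp_Liminf)
  qed
  finally have le: "(\<integral>\<^sup>+x. ennreal (indicator {0..} x * m x t) \<partial>lborel) \<le> ennreal 1" .
  have pos: "0 \<le> indicator {0..} x * m x t" for x using m_nonneg[OF _ t, of x] by (auto simp: indicator_def)
  show int: "integrable lborel (\<lambda>x. indicator {0..} x * m x t)"
    using le pos meas by (intro integrableI_bounded) (auto simp: abs_of_nonneg le_less_trans)
  have "ennreal (LBINT x. indicator {0..} x * m x t) \<le> ennreal 1"
    using le nn_integral_eq_integral[OF int] pos by simp
  then show "E t (\<lambda>x. 1) \<le> 1" by (simp add: E_def)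
qed

definition adm :: "(real \<Rightarrow> real) \<Rightarrow> bool" where
  "adm g \<longleftrightarrow> continuous_on {0..} g \<and> (\<exists>B. \<forall>x\<ge>0. \<bar>g x\<bar> \<le> B)"

lemma adm_bstrip:
  assumes "bstrip T g" "t \<in> {0..T}" shows "adm (\<lambda>x. g x t)"
proof -
  obtain C where "\<And>x t. 0 \<le> x \<Longrightarrow> t \<in> {0..T} \<Longrightarrow> \<bar>g x t\<bar> \<le> C" using assms(1) by (elim bstripD) (rule that)
  then show ?thesis using continuous_bstrip_x[OF assms] assms(2) unfolding adm_def by blast
qed

lemma E_integrable:
  assumes "adm g" "t \<in> {0..T}"
  shows "integrable lborel (\<lambda>x. indicator {0..} x * (g x * m x t))"
proof -
  obtain B where B: "\<forall>x\<ge>0. \<bar>g x\<bar> \<le> B" using assms(1) unfolding adm_def by blast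
  show ?thesis
  proof (rule Bochner_Integration.integrable_bound[OF integrable_mult_right[OF m_integrable[OF assms(2)], of B]])
    show "(\<lambda>x. indicator {0..} x * (g x * m x t)) \<in> borel_measurable lborel"
      by (rule measurable_half_line[OF continuous_on_mult[OF conjunct1[OF assms(1)[unfolded adm_def]] continuous_bstrip_x[OF bm(1) assms(2)]]])
    show "AE x in lborel. norm (indicator {0..} x * (g x * m x t)) \<le> norm (B * (indicator {0..} x * m x t))"
      using B by (intro AE_I2) (auto simp: indicator_def abs_mult intro!: mult_right_mono order_trans[OF _ abs_ge_self] m_nonneg[OF _ assms(2)])
  qed
qed

lemma E_mono:
  assumes "adm f" "adm g" "t \<in> {0..T}" "\<And>x. x \<ge> 0 \<Longrightarrow> f x \<le> g x"
  shows "E t f \<le> E t g"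
  unfolding E_def
proof (rule integral_mono[OF E_integrable[OF assms(1,3)] E_integrable[OF assms(2,3)]])
  fix x :: real
  show "indicator {0..} x * (f x * m x t) \<le> indicator {0..} x * (g x * m x t)"
    using mult_right_mono[OF assms(4) m_nonneg[OF _ assms(3)], of x x] by (cases "x \<ge> 0") auto
qed

lemma E_add: "adm f \<Longrightarrow> adm g \<Longrightarrow> t \<in> {0..T} \<Longrightarrow> E t (\<lambda>x. f x + g x) = E t f + E t g"
  unfolding E_def distrib_right distrib_left
  by (rule Bochner_Integration.integral_add[OF E_integrable E_integrable])

lemma E_diff: "adm f \<Longrightarrow> adm g \<Longrightarrow> t \<in> {0..T} \<Longrightarrow> E t (\<lambda>x. f x - g x) = E t f - E t g"
  unfolding E_def left_diff_distrib right_diff_distrib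
  by (rule Bochner_Integration.integral_diff[OF E_integrable E_integrable])

lemma E_cmult: "E t (\<lambda>x. c * f x) = c * E t f"
  unfolding E_def Bochner_Integration.integral_mult_right_zero[symmetric]
  by (rule Bochner_Integration.integral_cong) (auto simp: mult_ac)

lemma adm_add:
  assumes "adm f" "adm g" shows "adm (\<lambda>x. f x + g x)"
proof -
  obtain A where A: "\<forall>x\<ge>0. \<bar>f x\<bar> \<le> A" using assms(1) unfolding adm_def by blast
  obtain B where B: "\<forall>x\<ge>0. \<bar>g x\<bar> \<le> B" using assms(2) unfolding adm_def by blast
  have "\<bar>f x + g x\<bar> \<le> A + B" if "x \<ge> 0" for x
    using A[rule_format, OF that] B[rule_format, OF that] by linarith
  then show ?thesis using assms unfolding adm_def by (intro conjI continuous_on_add exI[of _ "A + B"]) auto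
qed

lemma adm_mult:
  assumes "adm f" "adm g" shows "adm (\<lambda>x. f x * g x)"
proof -
  obtain A where A: "\<forall>x\<ge>0. \<bar>f x\<bar> \<le> A" using assms(1) unfolding adm_def by blast
  obtain B where B: "\<forall>x\<ge>0. \<bar>g x\<bar> \<le> B" using assms(2) unfolding adm_def by blast
  note AB = A B
  have "\<bar>f x * g x\<bar> \<le> A * B" if "x \<ge> 0" for x
    unfolding abs_mult using AB that by (intro mult_mono) (auto intro: order_trans[OF abs_ge_zero])
  then show ?thesis using assms unfolding adm_def by (intro conjI continuous_on_mult exI[of _ "A * B"]) auto
qed

lemma adm_const: "adm (\<lambda>x. c)" unfolding adm_def by auto

lemma adm_cmult: "adm f \<Longrightarrow> adm (\<lambda>x. c * f x)" by (rule adm_mult[OF adm_const])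

lemma adm_diff: "adm f \<Longrightarrow> adm g \<Longrightarrow> adm (\<lambda>x. f x - g x)"
  using adm_add[OF _ adm_cmult[of g "-1"]] by simp

lemma adm_abs: "adm f \<Longrightarrow> adm (\<lambda>x. \<bar>f x\<bar>)"
  unfolding adm_def by (auto intro!: continuous_intros)

lemma E_nonneg: "t \<in> {0..T} \<Longrightarrow> (\<And>x. x \<ge> 0 \<Longrightarrow> 0 \<le> g x) \<Longrightarrow> 0 \<le> E t g"
  unfolding E_def using m_nonneg by (intro Bochner_Integration.integral_nonneg) (auto simp: indicator_def)

lemma E_abs_le:
  assumes "adm g" "t \<in> {0..T}" "\<And>x. x \<ge> 0 \<Longrightarrow> \<bar>g x\<bar> \<le> B" "B \<ge> 0"
  shows "\<bar>E t g\<bar> \<le> B"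
proof -
  have "E t g \<le> E t (\<lambda>x. B * 1)" "E t (\<lambda>x. - B * 1) \<le> E t g"
    using assms(3) by (intro E_mono assms adm_const; force simp: abs_le_iff)+
  moreover have "B * E t (\<lambda>x. 1) \<le> B * 1" by (rule mult_left_mono[OF mass_le[OF assms(2)] assms(4)])
  ultimately show ?thesis using E_cmult[of t B "\<lambda>x. 1"] E_cmult[of t "- B" "\<lambda>x. 1"] by simp
qed

lemma E_Cauchy_Schwarz:
  assumes "adm f" "adm g" and t: "t \<in> {0..T}"
  shows "(E t (\<lambda>x. f x * g x))\<^sup>2 \<le> E t (\<lambda>x. f x * f x) * E t (\<lambda>x. g x * g x)"
proof -
  let ?a = "E t (\<lambda>x. f x * f x)" let ?b = "E t (\<lambda>x. f x * g x)" let ?c = "E t (\<lambda>x. g x * g x)"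
  have q: "0 \<le> ?a - 2 * s * ?b + s * s * ?c" for s
  proof -
    have eq: "(\<lambda>x. (f x - s * g x) * (f x - s * g x)) = (\<lambda>x. f x * f x - (2 * s) * (f x * g x) + (s * s) * (g x * g x))"
      by (simp add: fun_eq_iff algebra_simps)
    note a = adm_mult[OF assms(1,1)] adm_cmult[OF adm_mult[OF assms(1,2)], of "2 * s"] adm_cmult[OF adm_mult[OF assms(2,2)], of "s * s"]
    have "0 \<le> E t (\<lambda>x. (f x - s * g x) * (f x - s * g x))" by (rule E_nonneg[OF t]) simp
    then show ?thesis
      unfolding eq E_add[OF adm_diff[OF a(1,2)] a(3) t] E_diff[OF a(1,2) t] E_cmult .
  qed
  have c0: "?c \<ge> 0" by (rule E_nonneg[OF t]) simp
  show ?thesis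
  proof (cases "?c = 0")
    case True
    have "?b = 0"
    proof (rule ccontr)
      assume "?b \<noteq> 0"
      \<comment> \<open>Without the quadratic coefficient the polynomial in s is affine, and this
        choice of s gives it the value -1.\<close>
      then show False using q[of "(?a + 1) / (2 * ?b)"] True by simp
    qed
    then show ?thesis using True by simp
  next
    case False
    then have c: "?c > 0" using c0 by simp
    have "0 \<le> ?a - ?b\<^sup>2 / ?c"
      using q[of "?b / ?c"] c by (simp add: power2_eq_square field_simps)
    then show ?thesis using c by (simp add: field_simps)
  qed
qed

lemma E_square_le:
  assumes "adm g" "t \<in> {0..T}" shows "(E t g)\<^sup>2 \<le> E t (\<lambda>x. g x * g x)"
proof -
  have "(E t g)\<^sup>2 \<le> E t (\<lambda>x. 1) * E t (\<lambda>x. g x * g x)"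
    using E_Cauchy_Schwarz[OF adm_const[of 1] assms(1,2)] by simp
  also have "\<dots> \<le> 1 * E t (\<lambda>x. g x * g x)"
    by (intro mult_right_mono mass_le assms E_nonneg) auto
  finally show ?thesis by simp
qed


lemma E_tendsto:
  assumes g: "\<And>n. adm (g n)" and l: "adm l" and t: "t \<in> {0..T}"
    and lim: "\<And>x. x \<ge> 0 \<Longrightarrow> (\<lambda>n. g n x) \<longlonglongrightarrow> l x" and B: "\<And>n x. x \<ge> 0 \<Longrightarrow> \<bar>g n x\<bar> \<le> B"
  shows "(\<lambda>n. E t (g n)) \<longlonglongrightarrow> E t l"
  unfolding E_def
proof (rule integral_dominated_convergence[where w="\<lambda>x. B * (indicator {0..} x * m x t)"])
  show "integrable lborel (\<lambda>x. B * (indicator {0..} x * m x t))" by (intro integrable_mult_right m_integrable t)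
  show "AE x in lborel. (\<lambda>n. indicator {0..} x * (g n x * m x t)) \<longlonglongrightarrow> indicator {0..} x * (l x * m x t)"
    by (rule AE_I2) (auto simp: indicator_def intro!: tendsto_mult_right lim)
  show "AE x in lborel. norm (indicator {0..} x * (g n x * m x t)) \<le> B * (indicator {0..} x * m x t)" for n
    using B m_nonneg[OF _ t] by (intro AE_I2) (auto simp: indicator_def abs_mult intro!: mult_right_mono)
qed (intro borel_measurable_integrable E_integrable g l t)+

lemma F_le: obtains K where "K \<ge> 0" "\<And>x t. 0 \<le> x \<Longrightarrow> t \<in> {0..T} \<Longrightarrow> \<bar>F x t\<bar> \<le> K"
  using F_bdd by blast

lemma adm_F: "t \<in> {0..T} \<Longrightarrow> adm (\<lambda>x. F x t)"
  using F_bdd continuous_F_x unfolding adm_def by blast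

lemma flux_continuous: "continuous_on {0..T} flux"
  unfolding flux_def[abs_def] by (intro continuous_intros bstrip_compose[OF bm(2)]) auto

text \<open>The weight exp(-\<delta> x) reduces bounded f to decaying f, and its derivatives carry
  factors \<delta> that vanish in the limit. The limit is taken in the time-integrated form, where
  dominated convergence suffices; the differential form has to wait until the integrand is known to
  be continuous.\<close>

lemma identity_int:
  assumes f: "C21 T f fx fxx ft" and ab: "0 \<le> a" "a \<le> b" "b \<le> T"
  shows "((\<lambda>t. E t (\<lambda>x. ft x t + \<sigma>\<^sup>2/2 * fxx x t - F x t * fx x t) - f 0 t * flux t)
    has_integral (E b (\<lambda>x. f x b) - E a (\<lambda>x. f x a))) {a..b}"
proof -
  have fd: "bstrip T f" "bstrip T fx" "bstrip T fxx" "bstrip T ft" using f by (auto simp: C21_def)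
  obtain B0 where B0: "B0 \<ge> 0" "\<And>x t. 0 \<le> x \<Longrightarrow> t \<in> {0..T} \<Longrightarrow> \<bar>f x t\<bar> \<le> B0" using fd(1) by (elim bstripD) (rule that)
  obtain B1 where B1: "B1 \<ge> 0" "\<And>x t. 0 \<le> x \<Longrightarrow> t \<in> {0..T} \<Longrightarrow> \<bar>fx x t\<bar> \<le> B1" using fd(2) by (elim bstripD) (rule that)
  obtain B2 where B2: "B2 \<ge> 0" "\<And>x t. 0 \<le> x \<Longrightarrow> t \<in> {0..T} \<Longrightarrow> \<bar>fxx x t\<bar> \<le> B2" using fd(3) by (elim bstripD) (rule that)
  obtain B3 where B3: "B3 \<ge> 0" "\<And>x t. 0 \<le> x \<Longrightarrow> t \<in> {0..T} \<Longrightarrow> \<bar>ft x t\<bar> \<le> B3" using fd(4) by (elim bstripD) (rule that)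
  obtain K where K: "K \<ge> 0" "\<And>x t. 0 \<le> x \<Longrightarrow> t \<in> {0..T} \<Longrightarrow> \<bar>F x t\<bar> \<le> K" by (rule F_le) (rule that)
  have "bstrip T (\<lambda>x t. f 0 t * flux t)"
    by (intro bstrip_time continuous_on_mult flux_continuous bstrip_compose[OF fd(1)]) (auto intro: continuous_intros)
  then obtain B4 where B4: "\<And>x t. 0 \<le> (x::real) \<Longrightarrow> t \<in> {0..T} \<Longrightarrow> \<bar>f 0 t * flux t\<bar> \<le> B4"
    by (elim bstripD) (rule that)
  define d where "d = (\<lambda>n. 1 / real (Suc n))"
  have d: "d n > 0" "d n \<le> 1" for n by (auto simp: d_def)
  have dlim: "d \<longlonglongrightarrow> 0" unfolding d_def by (rule lim_1_over_n[THEN filterlim_sequentially_Suc[THEN iffD2]])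
  let ?f = "\<lambda>n x t. f x t * expw (d n) x t"
  let ?fx = "\<lambda>n x t. fx x t * expw (d n) x t + - d n * expw (d n) x t * f x t"
  let ?fxx = "\<lambda>n x t. (fxx x t * expw (d n) x t + - d n * expw (d n) x t * fx x t) + ((d n)\<^sup>2 * expw (d n) x t * f x t + fx x t * (- d n * expw (d n) x t))"
  let ?ft = "\<lambda>n x t. ft x t * expw (d n) x t + 0 * f x t"
  let ?G = "\<lambda>n x t. ?ft n x t + \<sigma>\<^sup>2/2 * ?fxx n x t - F x t * ?fx n x t"
  let ?L = "\<lambda>n t. E t (\<lambda>x. ?G n x t) - ?f n 0 t * flux t"
  have c: "C21 T (?f n) (?fx n) (?fxx n) (?ft n)" for n
    by (rule C21_mult[OF f C21_expw]) (use d[of n] in simp)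
  have e: "0 \<le> expw (d n) x t" "expw (d n) x t \<le> 1" if "x \<ge> 0" for n x t
    using d[of n] that by (auto simp: expw_def)
  have bw: "\<bar>w * expw (d n) x t\<bar> \<le> B * exp (- d n * x)" if "\<bar>w\<bar> \<le> B" for w B n x t
    using that by (auto simp: abs_mult expw_def intro!: mult_right_mono)
  define C where "C = B0 + B1 + B0 + B2 + B1 + B0 + B1 + B3"
  have D: "((\<lambda>t. E t (\<lambda>x. ?f n x t)) has_real_derivative ?L n t) (at t within {0..T})" if t: "t \<in> {0..T}" for t n
  proof (rule identity_decay[OF c d(1)[of n] _ _ _ _ t, where C=C])
    fix x s :: real assume x: "0 \<le> x" "s \<in> {0..T}"
    note b = B0(2)[OF x] B1(2)[OF x] B2(2)[OF x] B3(2)[OF x]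
    have dn: "\<bar>d n\<bar> \<le> 1" "(d n)\<^sup>2 \<le> 1" using d[of n] by (auto simp: power_le_one)
    have m: "\<bar>- d n * f x s\<bar> \<le> B0" "\<bar>(d n)\<^sup>2 * f x s\<bar> \<le> B0" "\<bar>- d n * fx x s\<bar> \<le> B1"
      using mult_mono[OF dn(1) b(1)] mult_mono[OF dn(2) b(1)] mult_mono[OF dn(1) b(2)] by (auto simp: abs_mult)
    show "\<bar>?f n x s\<bar> \<le> C * exp (- d n * x)" by (rule bw) (use b B0 B1 B2 B3 in \<open>auto simp: C_def\<close>)
    have eq: "?fx n x s = (fx x s + - d n * f x s) * expw (d n) x s"
      "?fxx n x s = (fxx x s + - d n * fx x s + (d n)\<^sup>2 * f x s + - d n * fx x s) * expw (d n) x s"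
      "?ft n x s = ft x s * expw (d n) x s" by algebra+
    have "\<bar>fx x s + - d n * f x s\<bar> \<le> C" "\<bar>fxx x s + - d n * fx x s + (d n)\<^sup>2 * f x s + - d n * fx x s\<bar> \<le> C" "\<bar>ft x s\<bar> \<le> C"
      using m b B0(1) B1(1) B2(1) B3(1) unfolding C_def by linarith+
    note q = this
    show "\<bar>?fx n x s\<bar> \<le> C * exp (- d n * x)" unfolding eq(1) by (rule bw[OF q(1)])
    show "\<bar>?fxx n x s\<bar> \<le> C * exp (- d n * x)" unfolding eq(2) by (rule bw[OF q(2)])
    show "\<bar>?ft n x s\<bar> \<le> C * exp (- d n * x)" unfolding eq(3) by (rule bw[OF q(3)])
  qed
  define B where "B = C + \<sigma>\<^sup>2/2 * C + K * C"
  have C0: "C \<ge> 0" using B0(1) B1(1) B2(1) B3(1) unfolding C_def by linarith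
  have GB: "\<bar>?G n x t\<bar> \<le> B" if x: "x \<ge> 0" "t \<in> {0..T}" for n x t
  proof -
    note b = B0(2)[OF x] B1(2)[OF x] B2(2)[OF x] B3(2)[OF x]
    have dn: "\<bar>d n\<bar> \<le> 1" "(d n)\<^sup>2 \<le> 1" using d[of n] by (auto simp: power_le_one)
    have m: "\<bar>- d n * f x t\<bar> \<le> B0" "\<bar>(d n)\<^sup>2 * f x t\<bar> \<le> B0" "\<bar>- d n * fx x t\<bar> \<le> B1"
      using mult_mono[OF dn(1) b(1)] mult_mono[OF dn(2) b(1)] mult_mono[OF dn(1) b(2)] by (auto simp: abs_mult)
    have eq: "?fx n x t = (fx x t + - d n * f x t) * expw (d n) x t"
      "?fxx n x t = (fxx x t + - d n * fx x t + (d n)\<^sup>2 * f x t + - d n * fx x t) * expw (d n) x t"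
      "?ft n x t = ft x t * expw (d n) x t" by algebra+
    have le1: "\<bar>w * expw (d n) x t\<bar> \<le> C" if "\<bar>w\<bar> \<le> C" for w
      using mult_mono[OF that, of "\<bar>expw (d n) x t\<bar>" 1] e[OF x(1), of n t] C0 by (simp add: abs_mult)
    have "\<bar>fx x t + - d n * f x t\<bar> \<le> C" "\<bar>fxx x t + - d n * fx x t + (d n)\<^sup>2 * f x t + - d n * fx x t\<bar> \<le> C" "\<bar>ft x t\<bar> \<le> C"
      using m b B0(1) B1(1) B2(1) B3(1) unfolding C_def by linarith+
    note q' = this
    have q: "\<bar>?fx n x t\<bar> \<le> C" "\<bar>?fxx n x t\<bar> \<le> C" "\<bar>?ft n x t\<bar> \<le> C"
      unfolding eq by (rule le1[OF q'(1)], rule le1[OF q'(2)], rule le1[OF q'(3)])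
    have "\<bar>\<sigma>\<^sup>2/2 * ?fxx n x t\<bar> \<le> \<sigma>\<^sup>2/2 * C" unfolding abs_mult[of "\<sigma>\<^sup>2/2"] using q(2) by (intro mult_mono) auto
    moreover have "\<bar>F x t * ?fx n x t\<bar> \<le> K * C" unfolding abs_mult[of "F x t"] using q(1) K(1) K(2)[OF x] by (intro mult_mono) auto
    ultimately show ?thesis using q(3) unfolding B_def by linarith
  qed
  have be: "bstrip T (expw (d n))" for n using C21_expw[of "d n" T] d[of n] by (auto simp: C21_def)
  have admG: "adm (\<lambda>x. ?G n x t)" if t: "t \<in> {0..T}" for n t
    using c[of n] unfolding C21_def
    by (intro adm_diff[OF adm_add[OF _ adm_cmult] adm_mult] adm_F t) (auto intro!: adm_bstrip[of _ t] t)
  have admg: "adm (\<lambda>x. ft x t + \<sigma>\<^sup>2/2 * fxx x t - F x t * fx x t)" if t: "t \<in> {0..T}" for t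
    by (intro adm_diff[OF adm_add[OF _ adm_cmult] adm_mult] adm_F t adm_bstrip fd)
  have elim: "(\<lambda>n. expw (d n) x t) \<longlonglongrightarrow> 1" for x t
  proof -
    have "(\<lambda>n. expw (d n) x t) \<longlonglongrightarrow> exp (- 0 * x)" unfolding expw_def by (intro tendsto_intros dlim)
    then show ?thesis by simp
  qed
  have limG: "(\<lambda>n. E t (\<lambda>x. ?G n x t)) \<longlonglongrightarrow> E t (\<lambda>x. ft x t + \<sigma>\<^sup>2/2 * fxx x t - F x t * fx x t)" if t: "t \<in> {0..T}" for t
  proof (rule E_tendsto[OF admG[OF t] admg[OF t] t _ GB[OF _ t]])
    fix x :: real assume "x \<ge> 0"
    have "(\<lambda>n. ?G n x t) \<longlonglongrightarrow> (ft x t * 1 + 0 * f x t) + \<sigma>\<^sup>2/2 * ((fxx x t * 1 + - 0 * 1 * fx x t) + (0\<^sup>2 * 1 * f x t + fx x t * (- 0 * 1))) - F x t * (fx x t * 1 + - 0 * 1 * f x t)"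
      by (intro tendsto_intros dlim elim)
    then show "(\<lambda>n. ?G n x t) \<longlonglongrightarrow> ft x t + \<sigma>\<^sup>2/2 * fxx x t - F x t * fx x t" by simp
  qed
  have limf: "(\<lambda>n. E t (\<lambda>x. ?f n x t)) \<longlonglongrightarrow> E t (\<lambda>x. f x t)" if t: "t \<in> {0..T}" for t
  proof (rule E_tendsto[where B=B0])
    show "adm (\<lambda>x. ?f n x t)" for n by (intro adm_mult adm_bstrip[OF _ t] fd be)
    show "(\<lambda>n. ?f n x t) \<longlonglongrightarrow> f x t" for x using tendsto_mult_left[OF elim, of "f x t"] by simp
    show "\<bar>?f n x t\<bar> \<le> B0" if "x \<ge> 0" for n x
      using mult_mono[OF B0(2)[OF that t], of "\<bar>expw (d n) x t\<bar>" 1] e[OF that, of n t] B0(1) by (simp add: abs_mult)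
  qed (use fd t in \<open>auto intro: adm_bstrip\<close>)
  have hi: "(?L n has_integral (E b (\<lambda>x. ?f n x b) - E a (\<lambda>x. ?f n x a))) {a..b}" for n
  proof (rule fundamental_theorem_of_calculus[OF ab(2)])
    fix t assume t: "t \<in> {a..b}"
    then have "t \<in> {0..T}" using ab by auto
    from D[OF this, of n] show "((\<lambda>t. E t (\<lambda>x. ?f n x t)) has_vector_derivative ?L n t) (at t within {a..b})"
      unfolding has_real_derivative_iff_has_vector_derivative[symmetric] by (rule DERIV_subset) (use ab in auto)
  qed
  let ?l = "\<lambda>t. E t (\<lambda>x. ft x t + \<sigma>\<^sup>2/2 * fxx x t - F x t * fx x t) - f 0 t * flux t"
  have t': "t \<in> {0..T}" if "t \<in> {a..b}" for t using that ab by auto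
  have B0': "B \<ge> 0" using C0 K(1) by (simp add: B_def)
  have A1: "?L n integrable_on {a..b}" for n using hi[of n] by (rule has_integral_integrable)
  have A2: "(\<lambda>_. B + B4) integrable_on {a..b}" by (rule integrable_const_ivl)
  have A3: "norm (?L n t) \<le> B + B4" if t: "t \<in> {a..b}" for n t
  proof -
    have "\<bar>E t (\<lambda>x. ?G n x t)\<bar> \<le> B" by (rule E_abs_le[OF admG[OF t'[OF t]] t'[OF t] GB[OF _ t'[OF t]] B0'])
    moreover have "\<bar>?f n 0 t * flux t\<bar> \<le> B4" using B4[of 0 t] t'[OF t] by (simp add: expw_def)
    ultimately show ?thesis unfolding real_norm_def by linarith
  qed
  have A4: "(\<lambda>n. ?L n t) \<longlonglongrightarrow> ?l t" if t: "t \<in> {a..b}" for t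
  proof -
    have "(\<lambda>n. ?f n 0 t * flux t) \<longlonglongrightarrow> f 0 t * flux t" by (simp add: expw_def)
    then show ?thesis by (rule tendsto_diff[OF limG[OF t'[OF t]]])
  qed
  note dc = dominated_convergence[where f="?L" and g="?l", OF A1 A2 A3 A4]
  have "(\<lambda>n. integral {a..b} (?L n)) \<longlonglongrightarrow> E b (\<lambda>x. f x b) - E a (\<lambda>x. f x a)"
  proof -
    have eq: "(\<lambda>n. integral {a..b} (?L n)) = (\<lambda>n. E b (\<lambda>x. ?f n x b) - E a (\<lambda>x. ?f n x a))"
      by (rule ext, rule integral_unique[OF hi])
    show ?thesis unfolding eq by (rule tendsto_diff[OF limf limf]) (use ab in auto)
  qed
  from LIMSEQ_unique[OF dc(2) this] show ?thesis using dc(1) by (simp add: has_integral_integrable_integral)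
qed

lemma mass_eq:
  assumes "t \<in> {0..T}" shows "E t (\<lambda>x. 1) = E 0 (\<lambda>x. 1) - integral {0..t} flux"
proof -
  have "C21 T (\<lambda>x t. 1) (\<lambda>x t. 0) (\<lambda>x t. 0) (\<lambda>x t. 0)"
    by (rule C21_time[where c="\<lambda>t. 1"]) auto
  from identity_int[OF this order_refl, of t] assms
  have "((\<lambda>t. - flux t) has_integral (E t (\<lambda>x. 1) - E 0 (\<lambda>x. 1))) {0..t}"
    by (simp add: E_def)
  from has_integral_neg[OF this] have "(flux has_integral - (E t (\<lambda>x. 1) - E 0 (\<lambda>x. 1))) {0..t}" by simp
  then show ?thesis by (simp add: integral_unique)
qed

text \<open>What leaves through x = 0 during [0, T] cannot exceed the initial mass. This controls
  the flux without any bound on m_x.\<close>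

lemma flux_integral_le: "integral {0..T} flux \<le> 1"
  using mass_eq[of T] E_nonneg[of T "\<lambda>x. 1"] mass_le[of 0] T by auto

lemma mass_continuous: "continuous_on {0..T} (\<lambda>t. E t (\<lambda>x. 1))"
proof -
  have "continuous_on {0..T} (\<lambda>t. E 0 (\<lambda>x. 1) - integral {0..t} flux)"
    by (intro continuous_intros indefinite_integral_continuous_1 integrable_continuous_real flux_continuous)
  then show ?thesis by (rule continuous_on_eq) (rule mass_eq[symmetric])
qed

text \<open>Pointwise convergence of m along a sequence of times does not prevent mass from escaping
  to infinity. Continuity of the total mass, known from \<open>mass_eq\<close>, excludes this:
  Scheffe's lemma upgrades the convergence to L^1.\<close>

lemma E_continuous:
  assumes g: "bstrip T g" shows "continuous_on {0..T} (\<lambda>t. E t (\<lambda>x. g x t))"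
  unfolding continuous_on_sequentially comp_def
proof (intro allI ballI impI)
  fix X t assume t: "t \<in> {0..T}" and X: "(\<forall>n. X n \<in> {0..T}) \<and> X \<longlonglongrightarrow> t"
  then have Xn: "X n \<in> {0..T}" for n by blast
  obtain B where B: "B \<ge> 0" "\<And>x t. 0 \<le> x \<Longrightarrow> t \<in> {0..T} \<Longrightarrow> \<bar>g x t\<bar> \<le> B" using g by (elim bstripD) (rule that)
  define f where "f = (\<lambda>t x. indicator {0..} x * m x t)"
  have fpos: "f s x \<ge> 0" if "s \<in> {0..T}" for s x using m_nonneg[OF _ that, of x] by (auto simp: f_def indicator_def)
  have fint: "integrable lborel (f s)" if "s \<in> {0..T}" for s using m_integrable[OF that] by (simp add: f_def)
  have fE: "(\<integral>\<^sup>+x. ennreal (norm (f s x)) \<partial>lborel) = ennreal (E s (\<lambda>x. 1))" if "s \<in> {0..T}" for s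
    using nn_integral_eq_integral[OF fint[OF that]] fpos[OF that] by (simp add: E_def f_def)
  have seq: "(\<lambda>n. h x (X n)) \<longlonglongrightarrow> h x t" if "bstrip T h" "x \<ge> 0" for h x
    using bstrip_compose[OF that(1), of "{0..T}" "\<lambda>_. x" "\<lambda>t. t"] that(2) X t
    by (auto simp: continuous_on_sequentially comp_def)
  have "(\<lambda>n. \<integral>\<^sup>+x. ennreal (norm (f (X n) x - f t x)) \<partial>lborel) \<longlonglongrightarrow> 0"
  proof (rule Scheffe_lemma1)
    show "AE x in lborel. (\<lambda>n. f (X n) x) \<longlonglongrightarrow> f t x"
      by (rule AE_I2) (auto simp: f_def indicator_def intro!: seq bm)
    have "(\<lambda>n. ennreal (E (X n) (\<lambda>x. 1))) \<longlonglongrightarrow> ennreal (E t (\<lambda>x. 1))"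
      using mass_continuous t X by (intro tendsto_ennrealI) (auto simp: continuous_on_sequentially comp_def)
    then show "limsup (\<lambda>n. \<integral>\<^sup>+x. ennreal (norm (f (X n) x)) \<partial>lborel) \<le> (\<integral>\<^sup>+x. ennreal (norm (f t x)) \<partial>lborel)"
      unfolding fE[OF t] fE[OF Xn] by (simp add: lim_imp_Limsup)
  qed (intro fint Xn t)+
  then have "(\<lambda>n. ennreal (LBINT x. \<bar>f (X n) x - f t x\<bar>)) \<longlonglongrightarrow> ennreal 0"
    by (subst (asm) nn_integral_eq_integral) (auto intro!: integrable_norm Bochner_Integration.integrable_diff fint Xn t)
  then have l1: "(\<lambda>n. \<integral>x. \<bar>f (X n) x - f t x\<bar> \<partial>lborel) \<longlonglongrightarrow> 0"
    by (subst (asm) tendsto_ennreal_iff) auto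
  have l2: "(\<lambda>n. E t (\<lambda>x. g x (X n))) \<longlonglongrightarrow> E t (\<lambda>x. g x t)"
    by (rule E_tendsto[OF adm_bstrip[OF g Xn] adm_bstrip[OF g t] t seq[OF g] B(2)[OF _ Xn]])
  have "\<bar>E (X n) (\<lambda>x. g x (X n)) - E t (\<lambda>x. g x (X n))\<bar> \<le> B * (LBINT x. \<bar>f (X n) x - f t x\<bar>)" for n
  proof -
    have eq: "E (X n) (\<lambda>x. g x (X n)) - E t (\<lambda>x. g x (X n)) = (LBINT x. indicator {0..} x * (g x (X n) * m x (X n)) - indicator {0..} x * (g x (X n) * m x t))"
      unfolding E_def by (rule Bochner_Integration.integral_diff[symmetric]) (intro E_integrable adm_bstrip g Xn t)+
    have "\<bar>\<integral>x. indicator {0..} x * (g x (X n) * m x (X n)) - indicator {0..} x * (g x (X n) * m x t) \<partial>lborel\<bar> \<le> (LBINT x. B * \<bar>f (X n) x - f t x\<bar>)"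
    proof (rule order_trans[OF integral_abs_bound integral_mono])
      show "integrable lborel (\<lambda>x. \<bar>indicator {0..} x * (g x (X n) * m x (X n)) - indicator {0..} x * (g x (X n) * m x t)\<bar>)"
        by (intro integrable_abs Bochner_Integration.integrable_diff E_integrable adm_bstrip g Xn t)
      show "integrable lborel (\<lambda>x. B * \<bar>f (X n) x - f t x\<bar>)"
        by (intro integrable_mult_right integrable_abs Bochner_Integration.integrable_diff fint Xn t)
      fix x :: real
      show "\<bar>indicator {0..} x * (g x (X n) * m x (X n)) - indicator {0..} x * (g x (X n) * m x t)\<bar> \<le> B * \<bar>f (X n) x - f t x\<bar>"
      proof (cases "x \<ge> 0")
        case True
        have "\<bar>g x (X n) * (m x (X n) - m x t)\<bar> \<le> B * \<bar>m x (X n) - m x t\<bar>"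
          unfolding abs_mult using B(2)[OF True Xn] by (intro mult_right_mono) auto
        then show ?thesis using True by (simp add: f_def right_diff_distrib)
      qed (simp add: f_def)
    qed
    then show ?thesis unfolding eq by (simp only: Bochner_Integration.integral_mult_right_zero)
  qed
  note le = this
  have "(\<lambda>n. E (X n) (\<lambda>x. g x (X n)) - E t (\<lambda>x. g x (X n))) \<longlonglongrightarrow> 0"
    by (rule Lim_null_comparison[OF always_eventually tendsto_mult_right_zero[OF l1, of B]]) (intro allI, unfold real_norm_def, rule le)
  from tendsto_add[OF this l2] show "(\<lambda>n. E (X n) (\<lambda>x. g x (X n))) \<longlonglongrightarrow> E t (\<lambda>x. g x t)" by simp
qed

lemma F_eq_E: "F x t = 1/2 * (2 / (2 + \<epsilon> * \<xi> t) + \<beta> t * E t (\<lambda>y. D_x u y t) - D_x u x t)"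
  by (simp add: mfg_F_def \<beta>_def beta_def E_def set_lebesgue_integral_def)

text \<open>Now that the mass is at most 1, F is bounded by (1 + U + U)/2, a bound in U alone that
  replaces the qualitative \<open>F_bdd\<close>.\<close>

lemma F_bstrip: "bstrip T F" and F_bound: "x \<ge> 0 \<Longrightarrow> t \<in> {0..T} \<Longrightarrow> \<bar>F x t\<bar> \<le> 1/2 + U"
proof -
  have "bstrip T (\<lambda>x t. 1/2 * ((2 / (2 + \<epsilon> * \<xi> t) + \<beta> t * E t (\<lambda>y. D_x u y t)) - D_x u x t))"
    by (intro bstrip_cmult bstrip_diff bstrip_time bu continuous_on_add continuous_on_mult continuous_\<beta> E_continuous)
  then show "bstrip T F" by (simp add: F_eq_E[abs_def])
  assume x: "x \<ge> 0" "t \<in> {0..T}"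
  have "\<bar>E t (\<lambda>y. D_x u y t)\<bar> \<le> U"
    by (rule E_abs_le[OF adm_bstrip[OF bu(2) x(2)] x(2) D_x_u_le[OF _ x(2)] U_nonneg])
  then have "\<bar>\<beta> t * E t (\<lambda>y. D_x u y t)\<bar> \<le> 1 * U" unfolding abs_mult using \<beta>[OF x(2)] by (intro mult_mono) auto
  then show "\<bar>F x t\<bar> \<le> 1/2 + U" 
  proof -
    have "\<bar>1/2 * (p + q - d)\<bar> \<le> 1/2 + U" if "\<bar>q\<bar> \<le> 1 * U" "\<bar>d\<bar> \<le> U" "0 \<le> p" "p \<le> 1" for p q d :: real
      using that by (auto simp: abs_le_iff)
    from this[OF _ D_x_u_le[OF x] \<beta>(3,4)[OF x(2)]] show ?thesis unfolding F_eq_E using \<open>\<bar>\<beta> t * E t (\<lambda>y. D_x u y t)\<bar> \<le> 1 * U\<close> .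
  qed
qed

lemma identity:
  assumes f: "C21 T f fx fxx ft" and t: "t \<in> {0..T}"
  shows "((\<lambda>t. E t (\<lambda>x. f x t)) has_real_derivative
     E t (\<lambda>x. ft x t + \<sigma>\<^sup>2/2 * fxx x t - F x t * fx x t) - f 0 t * flux t) (at t within {0..T})"
    and "continuous_on {0..T} (\<lambda>t. E t (\<lambda>x. ft x t + \<sigma>\<^sup>2/2 * fxx x t - F x t * fx x t) - f 0 t * flux t)"
proof -
  let ?l = "\<lambda>t. E t (\<lambda>x. ft x t + \<sigma>\<^sup>2/2 * fxx x t - F x t * fx x t) - f 0 t * flux t"
  have fd: "bstrip T f" "bstrip T fx" "bstrip T fxx" "bstrip T ft" using f by (auto simp: C21_def)
  show c: "continuous_on {0..T} ?l"
    by (intro continuous_on_diff continuous_on_mult E_continuous bstrip_diff bstrip_add bstrip_cmult bstrip_mult F_bstrip fd flux_continuous bstrip_compose[OF fd(1)]) (auto intro: continuous_intros)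
  have d: "((\<lambda>t. E 0 (\<lambda>x. f x 0) + integral {0..t} ?l) has_real_derivative ?l t) (at t within {0..T})"
    using DERIV_add[OF DERIV_const integral_has_real_derivative[OF c t]] by simp
  have e: "E s (\<lambda>x. f x s) = E 0 (\<lambda>x. f x 0) + integral {0..s} ?l" if "s \<in> {0..T}" for s
    using integral_unique[OF identity_int[OF f order_refl, of s]] that by simp
  show "((\<lambda>t. E t (\<lambda>x. f x t)) has_real_derivative ?l t) (at t within {0..T})"
    unfolding has_field_derivative_def
    by (rule has_derivative_transform[OF t e d[unfolded has_field_derivative_def]])
qed

end

section \<open>Energy estimate\<close>

lemma integral_of_derivative:
  fixes G g :: "real \<Rightarrow> real"
  assumes "a \<le> b" "\<And>t. t \<in> {a..b} \<Longrightarrow> (G has_real_derivative g t) (at t within {a..b})"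
  shows "(g has_integral (G b - G a)) {a..b}"
  by (rule fundamental_theorem_of_calculus[OF assms(1)])
     (rule assms(2)[unfolded has_real_derivative_iff_has_vector_derivative])

definition diff_quot :: "real \<Rightarrow> (real \<Rightarrow> real \<Rightarrow> real) \<Rightarrow> real \<Rightarrow> real \<Rightarrow> real" where
  "diff_quot \<eta> f x t = (f (x + \<eta>) t - f x t) / \<eta>"

lemma C21_diff_quot:
  assumes f: "C21 T f fx fxx ft" and \<eta>: "\<eta> > 0"
  shows "C21 T (diff_quot \<eta> f) (diff_quot \<eta> fx) (diff_quot \<eta> fxx) (diff_quot \<eta> ft)"
proof -
  have fd: "bstrip T f" "bstrip T fx" "bstrip T fxx" "bstrip T ft"
    and d: "\<And>x t. x \<ge> 0 \<Longrightarrow> t \<in> {0..T} \<Longrightarrow> ((\<lambda>y. f y t) has_real_derivative fx x t) (at x within {0..})"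
     "\<And>x t. x \<ge> 0 \<Longrightarrow> t \<in> {0..T} \<Longrightarrow> ((\<lambda>y. fx y t) has_real_derivative fxx x t) (at x within {0..})"
     "\<And>x t. x \<ge> 0 \<Longrightarrow> t \<in> {0..T} \<Longrightarrow> ((\<lambda>s. f x s) has_real_derivative ft x t) (at t within {0..T})"
    using f by (auto simp: C21_def)
  have b: "bstrip T (diff_quot \<eta> g)" if g: "bstrip T g" for g
  proof -
    obtain B where B: "\<And>x t. 0 \<le> x \<Longrightarrow> t \<in> {0..T} \<Longrightarrow> \<bar>g x t\<bar> \<le> B" using g by (elim bstripD) (rule that)
    have s: "bstrip T (\<lambda>x t. g (x + \<eta>) t)"
    proof (rule bstripI)
      show "continuous_on (strip T) (\<lambda>p. g (fst p + \<eta>) (snd p))"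
        by (rule bstrip_compose[OF g]) (use \<eta> in \<open>auto intro!: continuous_intros\<close>)
      show "\<bar>g (x + \<eta>) t\<bar> \<le> B" if "0 \<le> x" "t \<in> {0..T}" for x t using B[of "x + \<eta>" t] that \<eta> by simp
    qed
    have "bstrip T (\<lambda>x t. (1 / \<eta>) * (g (x + \<eta>) t - g x t))" by (intro bstrip_cmult bstrip_diff s g)
    then show ?thesis by (simp add: diff_quot_def[abs_def])
  qed
  have x: "((\<lambda>y. diff_quot \<eta> g y t) has_real_derivative diff_quot \<eta> g' x t) (at x within {0..})"
    if g: "\<And>x. x \<ge> 0 \<Longrightarrow> ((\<lambda>y. g y t) has_real_derivative g' x t) (at x within {0..})" and x: "x \<ge> 0" for g g' x t
  proof -
    have at: "at (x + \<eta>) within {0..} = at (x + \<eta>)"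
      by (rule at_within_interior) (use x \<eta> in \<open>simp add: interior_real_atLeast\<close>)
    have 1: "((\<lambda>y. g y t) has_real_derivative g' (x + \<eta>) t) (at (x + \<eta>))"
      by (rule g[of "x + \<eta>", unfolded at]) (use x \<eta> in simp)
    have 2: "((\<lambda>y. y + \<eta>) has_real_derivative 1) (at x within {0..})" by (auto intro!: derivative_eq_intros)
    have 3: "((\<lambda>y. g (y + \<eta>) t) has_real_derivative g' (x + \<eta>) t) (at x within {0..})"
      using DERIV_chain'[of "\<lambda>y. y + \<eta>" 1 x "{0..}" "\<lambda>y. g y t" "g' (x + \<eta>) t", OF 2 1] by simp
    show ?thesis unfolding diff_quot_def by (rule DERIV_cdivide[OF DERIV_diff[OF 3 g[OF x]]])
  qed
  have t: "((\<lambda>s. diff_quot \<eta> f x s) has_real_derivative diff_quot \<eta> ft x t) (at t within {0..T})"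
    if "x \<ge> 0" "t \<in> {0..T}" for x t
    unfolding diff_quot_def by (rule DERIV_cdivide[OF DERIV_diff[OF d(3) d(3)]]) (use that \<eta> in simp_all)
  show ?thesis unfolding C21_def
    by (intro conjI allI impI ballI b fd x d(1) d(2) t)
qed

context mfg begin

context
  fixes \<eta> V :: real
  assumes \<eta>: "\<eta> > 0" and V: "\<And>x t. 0 \<le> x \<Longrightarrow> t \<in> {0..T} \<Longrightarrow> \<bar>D_xx u x t\<bar> \<le> V"
begin

abbreviation "d \<equiv> diff_quot \<eta> u"
abbreviation "dx \<equiv> diff_quot \<eta> (D_x u)"
abbreviation "dxx \<equiv> diff_quot \<eta> (D_xx u)"
abbreviation "dt \<equiv> diff_quot \<eta> (D_t T u)"

lemma d_C21: "C21 T d dx dxx dt" by (rule C21_diff_quot[OF u_C21 \<eta>])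

lemma bd: "bstrip T d" "bstrip T dx" "bstrip T dxx" "bstrip T dt"
  using d_C21 by (auto simp: C21_def)

lemma d_le: "x \<ge> 0 \<Longrightarrow> t \<in> {0..T} \<Longrightarrow> \<bar>d x t\<bar> \<le> U"
  and dx_le: "x \<ge> 0 \<Longrightarrow> t \<in> {0..T} \<Longrightarrow> \<bar>dx x t\<bar> \<le> V"
  and d_close: "x \<ge> 0 \<Longrightarrow> t \<in> {0..T} \<Longrightarrow> \<bar>d x t - D_x u x t\<bar> \<le> V * \<eta>"
proof -
  assume x: "x \<ge> 0" "t \<in> {0..T}"
  have "\<bar>u (x + \<eta>) t - u x t\<bar> \<le> U * \<bar>x + \<eta> - x\<bar>"
    by (rule field_differentiable_bound[of "{0..}" "\<lambda>y. u y t" "\<lambda>y. D_x u y t" U "x + \<eta>" x, unfolded real_norm_def])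
       (use u_deriv(1)[OF _ x(2)] D_x_u_le[OF _ x(2)] x \<eta> in \<open>simp_all\<close>)
  then show "\<bar>d x t\<bar> \<le> U" using \<eta> by (simp add: diff_quot_def divide_simps)
  have "\<bar>D_x u (x + \<eta>) t - D_x u x t\<bar> \<le> V * \<bar>x + \<eta> - x\<bar>"
    by (rule field_differentiable_bound[of "{0..}" "\<lambda>y. D_x u y t" "\<lambda>y. D_xx u y t" V "x + \<eta>" x, unfolded real_norm_def])
       (use u_deriv(2)[OF _ x(2)] V[OF _ x(2)] x \<eta> in \<open>simp_all\<close>)
  then show "\<bar>dx x t\<bar> \<le> V" using \<eta> by (simp add: diff_quot_def divide_simps)
  obtain z where z: "x < z" "z < x + \<eta>" "u (x + \<eta>) t - u x t = D_x u z t * (x + \<eta> - x)"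
  proof (rule mvt[of x "x + \<eta>" "\<lambda>y. u y t" "\<lambda>y. (*) (D_x u y t)"])
    show "continuous_on {x..x + \<eta>} (\<lambda>y. u y t)"
      by (rule continuous_on_subset[OF continuous_bstrip_x[OF bu(1) x(2)]]) (use x in auto)
    show "((\<lambda>y. u y t) has_derivative (*) (D_x u y t)) (at y)" if "x < y" "y < x + \<eta>" for y
    proof -
      have "0 < y" using x that by simp
      then show ?thesis using u_deriv(1)[of y t] x at_within_pos[of y] by (simp add: has_field_derivative_def)
    qed
  qed (use \<eta> in auto)
  have dz: "d x t = D_x u z t" using \<eta> z(3) by (simp add: diff_quot_def)
  have "\<bar>D_x u z t - D_x u x t\<bar> \<le> V * \<bar>z - x\<bar>"
    by (rule field_differentiable_bound[of "{0..}" "\<lambda>y. D_x u y t" "\<lambda>y. D_xx u y t" V z x, unfolded real_norm_def])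
       (use u_deriv(2)[OF _ x(2)] V[OF _ x(2)] x z in \<open>simp_all\<close>)
  also have "\<dots> \<le> V * \<eta>" using V[OF x] z by (intro mult_left_mono) auto
  finally show "\<bar>d x t - D_x u x t\<bar> \<le> V * \<eta>" by (simp add: dz)
qed

definition "e2 x t = dt x t + \<sigma>\<^sup>2/2 * dxx x t - F x t * dx x t - r * d x t"

text \<open>Subtract the equation for u at x from the one at x + \<eta>. When u_x changes by q, F
  changes by -q/2 and F^2 by -F q + q^2/4; the linear part is the drift term of the quotient, and
  only the quadratic part, of order \<eta> V^2, is left as an error.\<close>

lemma e2_le: "x \<ge> 0 \<Longrightarrow> t \<in> {0..T} \<Longrightarrow> \<bar>e2 x t\<bar> \<le> \<eta> * V\<^sup>2 / 4"
proof -
  assume x: "x \<ge> 0" "t \<in> {0..T}"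
  define a where "a = F x t"
  define q where "q = D_x u (x + \<eta>) t - D_x u x t"
  have Fp: "F (x + \<eta>) t = a - q / 2" using F_eq[of "x + \<eta>" t x] by (simp add: a_def q_def field_simps)
  have u1: "D_t T u (x + \<eta>) t + \<sigma>\<^sup>2/2 * D_xx u (x + \<eta>) t - r * u (x + \<eta>) t + (a - q / 2)\<^sup>2 = 0"
    using u_eq[of "x + \<eta>" t] x \<eta> Fp by simp
  have u2: "D_t T u x t + \<sigma>\<^sup>2/2 * D_xx u x t - r * u x t + a\<^sup>2 = 0" using u_eq[OF x] by (simp add: a_def)
  have "\<eta> * e2 x t = (D_t T u (x + \<eta>) t - D_t T u x t) + \<sigma>\<^sup>2/2 * (D_xx u (x + \<eta>) t - D_xx u x t) - a * q - r * (u (x + \<eta>) t - u x t)"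
    using \<eta> by (simp add: e2_def diff_quot_def a_def q_def field_simps)
  also have "\<dots> = a\<^sup>2 - (a - q / 2)\<^sup>2 - a * q" using u1 u2 by (simp add: algebra_simps)
  also have "\<dots> = - (q\<^sup>2 / 4)" by (simp add: power2_eq_square algebra_simps)
  finally have "\<eta> * e2 x t = - (q\<^sup>2 / 4)" .
  moreover have "q = \<eta> * dx x t" using \<eta> by (simp add: diff_quot_def q_def)
  ultimately have "\<eta> * e2 x t = \<eta> * - (\<eta> * (dx x t)\<^sup>2 / 4)"
    by (simp add: power2_eq_square)
  then have "e2 x t = - (\<eta> * (dx x t)\<^sup>2 / 4)" using \<eta> by (simp only: mult_cancel_left) simp
  moreover have "(dx x t)\<^sup>2 \<le> V\<^sup>2" using dx_le[OF x] by (rule power2_le_iff_abs_le[THEN iffD2, rotated]) (use V[OF x] in auto)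
  ultimately show ?thesis using \<eta> by (simp add: mult_left_mono abs_mult)
qed

text \<open>The first two terms are what the square of the difference quotient produces in the
  moment identity. The flux term is added to absorb the boundary term in the energy
  estimate.\<close>

definition "act t = 2 * r * E t (\<lambda>x. d x t * d x t) + \<sigma>\<^sup>2 * E t (\<lambda>x. dx x t * dx x t) + U\<^sup>2 * flux t"

lemma act_continuous: "continuous_on {0..T} act"
  unfolding act_def[abs_def]
  by (intro continuous_on_add continuous_on_mult continuous_on_const E_continuous bstrip_mult bd flux_continuous)

lemma act_nonneg: "t \<in> {0..T} \<Longrightarrow> act t \<ge> 0"
  unfolding act_def using r by (intro add_nonneg_nonneg mult_nonneg_nonneg[OF _ E_nonneg] mult_nonneg_nonneg[OF _ flux_nonneg]) auto

text \<open>The moment identity for the square of the difference quotient: the final time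
  contributes U^2 and the boundary 2 U^2, as the total flux is at most 1. The bound V on u_xx
  survives only in the term with \<eta>.\<close>

lemma act_integral: "integral {0..T} act \<le> 3 * U\<^sup>2 + U * \<eta> * V\<^sup>2 * T / 2"
proof -
  let ?p = "\<lambda>t. E t (\<lambda>x. d x t * d x t)"
  let ?p' = "\<lambda>t. E t (\<lambda>x. (dt x t * d x t + dt x t * d x t) + \<sigma>\<^sup>2/2 * ((dxx x t * d x t + dx x t * dx x t) + (dxx x t * d x t + dx x t * dx x t))
     - F x t * (dx x t * d x t + dx x t * d x t)) - (d 0 t * d 0 t) * flux t"
  note C = C21_mult[OF d_C21 d_C21]
  have hi: "(?p' has_integral (?p T - ?p 0)) {0..T}"
    by (rule integral_of_derivative) (use T identity(1)[OF C] in auto)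
  have b2: "bstrip T (\<lambda>x t. e2 x t)" unfolding e2_def[abs_def]
    by (intro bstrip_diff bstrip_add bstrip_cmult bstrip_mult bd F_bstrip)
  have le: "act t \<le> ?p' t + (2 * U\<^sup>2) * flux t + U * \<eta> * V\<^sup>2 / 2" if t: "t \<in> {0..T}" for t
  proof -
    have eq: "(\<lambda>x. (dt x t * d x t + dt x t * d x t) + \<sigma>\<^sup>2/2 * ((dxx x t * d x t + dx x t * dx x t) + (dxx x t * d x t + dx x t * dx x t))
     - F x t * (dx x t * d x t + dx x t * d x t)) = (\<lambda>x. 2 * r * (d x t * d x t) + \<sigma>\<^sup>2 * (dx x t * dx x t) + 2 * (d x t * e2 x t))"
      by (rule ext) (simp add: e2_def field_simps)
    note a = adm_mult[OF adm_bstrip[OF bd(1) t] adm_bstrip[OF bd(1) t]] adm_mult[OF adm_bstrip[OF bd(2) t] adm_bstrip[OF bd(2) t]]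
      adm_mult[OF adm_bstrip[OF bd(1) t] adm_bstrip[OF b2 t]]
    have "?p' t = 2 * r * ?p t + \<sigma>\<^sup>2 * E t (\<lambda>x. dx x t * dx x t) + 2 * E t (\<lambda>x. d x t * e2 x t) - (d 0 t * d 0 t) * flux t"
      unfolding eq E_add[OF adm_add[OF adm_cmult[OF a(1)] adm_cmult[OF a(2)]] adm_cmult[OF a(3)] t]
        E_add[OF adm_cmult[OF a(1)] adm_cmult[OF a(2)] t] E_cmult ..
    moreover have "\<bar>E t (\<lambda>x. d x t * e2 x t)\<bar> \<le> U * (\<eta> * V\<^sup>2 / 4)"
    proof (rule E_abs_le[OF a(3) t])
      show "\<bar>d x t * e2 x t\<bar> \<le> U * (\<eta> * V\<^sup>2 / 4)" if "x \<ge> 0" for x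
        unfolding abs_mult using d_le[OF that t] e2_le[OF that t] U_nonneg by (intro mult_mono) auto
    qed (use U_nonneg \<eta> in auto)
    moreover have "(d 0 t * d 0 t) * flux t \<le> U\<^sup>2 * flux t"
    proof -
      have "(d 0 t)\<^sup>2 \<le> U\<^sup>2" using d_le[of 0 t] t U_nonneg by (auto simp: power2_le_iff_abs_le)
      then show ?thesis using flux_nonneg[OF t] by (intro mult_right_mono) (auto simp: power2_eq_square)
    qed
    ultimately show ?thesis unfolding act_def by (simp add: algebra_simps)
  qed
  have "(\<lambda>t. ?p' t + (2 * U\<^sup>2) * flux t + U * \<eta> * V\<^sup>2 / 2) integrable_on {0..T}"
    by (intro integrable_add has_integral_integrable[OF hi] integrable_on_mult_right integrable_continuous_real flux_continuous integrable_const_ivl)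
  then have "integral {0..T} act \<le> integral {0..T} (\<lambda>t. ?p' t + (2 * U\<^sup>2) * flux t + U * \<eta> * V\<^sup>2 / 2)"
    by (rule integral_le[OF integrable_continuous_real[OF act_continuous] _ le])
  also have "\<dots> = (?p T - ?p 0) + 2 * U\<^sup>2 * integral {0..T} flux + U * \<eta> * V\<^sup>2 / 2 * T"
  proof (rule integral_unique)
    have "((\<lambda>t. ?p' t + (2 * U\<^sup>2) * flux t + U * \<eta> * V\<^sup>2 / 2) has_integral ((?p T - ?p 0) + 2 * U\<^sup>2 * integral {0..T} flux + (T - 0) *\<^sub>R (U * \<eta> * V\<^sup>2 / 2))) {0..T}"
      by (intro has_integral_add hi has_integral_mult_right integrable_integral integrable_continuous_real flux_continuous)
         (use has_integral_const_real[of "U * \<eta> * V\<^sup>2 / 2" 0 T] T in simp)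
    then show "((\<lambda>t. ?p' t + (2 * U\<^sup>2) * flux t + U * \<eta> * V\<^sup>2 / 2) has_integral ((?p T - ?p 0) + 2 * U\<^sup>2 * integral {0..T} flux + U * \<eta> * V\<^sup>2 / 2 * T)) {0..T}"
      by (simp add: mult.commute)
  qed
  also have "\<dots> \<le> (U\<^sup>2 - 0) + 2 * U\<^sup>2 * 1 + U * \<eta> * V\<^sup>2 / 2 * T"
  proof (intro add_mono diff_mono mult_left_mono flux_integral_le order_refl)
    have TT: "T \<in> {0..T}" using T by auto
    have "\<bar>?p T\<bar> \<le> U\<^sup>2"
    proof (rule E_abs_le[OF adm_mult[OF adm_bstrip[OF bd(1) TT] adm_bstrip[OF bd(1) TT]] TT])
      show "\<bar>d x T * d x T\<bar> \<le> U\<^sup>2" if "x \<ge> 0" for x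
        unfolding abs_mult power2_eq_square using d_le[OF that TT] U_nonneg by (intro mult_mono) auto
    qed simp
    then show "?p T \<le> U\<^sup>2" by simp
    show "0 \<le> ?p 0" by (rule E_nonneg) (use T in auto)
  qed (use T U_nonneg \<eta> in simp_all)
  finally show ?thesis by (simp add: algebra_simps)
qed

text \<open>The diffusion of h produces the good term E(h_x^2), which by \<open>\<zeta>_le\<close>
  dominates a multiple of \<zeta>^2 up to c^2 E(d_x^2). That remainder has no small factor; it is
  absorbed because the weight \<open>\<theta>\<close> grows at the rate of the action, whose total
  is bounded. As \<open>\<Psi> T\<close> = 0 and \<open>\<Psi> 0\<close> is nonnegative, integrating
  \<open>\<Psi>'\<close> gives the estimate.\<close>

lemma energy_estimate:
  fixes \<omega> \<zeta> :: "real \<Rightarrow> real"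
  assumes l: "l > 0" and M: "M > 0" and Ml: "1 \<le> \<sigma>\<^sup>2 * (M * l)"
    and \<phi>: "C21 T \<phi> \<phi>x \<phi>xx \<phi>t" and \<phi>0: "\<And>t. t \<in> {0..T} \<Longrightarrow> \<phi> 0 t = 0" and \<phi>T: "\<And>x. x \<ge> 0 \<Longrightarrow> \<phi> x T = 0"
    and \<psi>: "bstrip T \<psi>" and \<psi>\<omega>: "\<And>x t. x \<ge> 0 \<Longrightarrow> t \<in> {0..T} \<Longrightarrow> \<bar>\<psi> x t\<bar> \<le> \<omega> t"
    and \<omega>: "continuous_on {0..T} \<omega>" and \<zeta>: "continuous_on {0..T} \<zeta>"
    and B\<phi>: "\<And>x t. x \<ge> 0 \<Longrightarrow> t \<in> {0..T} \<Longrightarrow> \<bar>\<phi> x t\<bar> \<le> B\<phi>" and B\<zeta>: "\<And>t. t \<in> {0..T} \<Longrightarrow> \<bar>\<zeta> t\<bar> \<le> B\<zeta>"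
    and err: "\<And>t. t \<in> {0..T} \<Longrightarrow> E t (\<lambda>x. \<bar>\<phi>t x t + \<sigma>\<^sup>2/2 * \<phi>xx x t - F x t * \<phi>x x t + \<psi> x t + \<zeta> t * d x t\<bar>) \<le> \<epsilon>2"
    and \<zeta>_le: "\<And>t. t \<in> {0..T} \<Longrightarrow> 4 * (\<zeta> t)\<^sup>2 \<le> E t (\<lambda>x. \<phi>x x t * \<phi>x x t)"
    and \<epsilon>3: "\<epsilon>3 = 2 * (B\<phi> + T * B\<zeta> * U) * (\<epsilon>2 + T * B\<zeta> * (\<eta> * V\<^sup>2 / 4))"
  shows "integral {0..T} (\<lambda>t. exp (l * t) * (\<zeta> t)\<^sup>2) \<le>
    exp (2 * M * (3 * U\<^sup>2 + U * \<eta> * V\<^sup>2 * T / 2)) / \<sigma>\<^sup>2 * integral {0..T} (\<lambda>t. exp (l * t) * ((\<omega> t)\<^sup>2 / l + \<epsilon>3))"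
proof -
  have B\<phi>0: "B\<phi> \<ge> 0" and B\<zeta>0: "B\<zeta> \<ge> 0" using B\<phi>[of 0 0] B\<zeta>[of 0] T by auto
  have \<epsilon>20: "\<epsilon>2 \<ge> 0" using order_trans[OF E_nonneg err[of 0]] T by auto
  \<comment> \<open>The solution of c' = r c - \<zeta> with c(T) = 0, so that h inherits the final
    value 0 of \<phi>.\<close>
  define c where "c = (\<lambda>t. exp (r * t) * integral {t..T} (\<lambda>s. exp (- r * s) * \<zeta> s))"
  define c' where "c' = (\<lambda>t. r * c t - \<zeta> t)"
  have c_der: "(c has_real_derivative c' t) (at t within {0..T})" if t: "t \<in> {0..T}" for t
  proof -
    have "continuous_on {0..T} (\<lambda>s. exp (- r * s) * \<zeta> s)" by (intro continuous_intros \<zeta>)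
    from integral_has_real_derivative'[OF this t]
    have i: "((\<lambda>t. integral {t..T} (\<lambda>s. exp (- r * s) * \<zeta> s)) has_real_derivative - (exp (- r * t) * \<zeta> t)) (at t within {0..T})" .
    have e: "((\<lambda>t. exp (r * t)) has_real_derivative r * exp (r * t)) (at t within {0..T})"
      by (auto intro!: derivative_eq_intros)
    have "exp (r * t) * exp (- r * t) = 1" by (simp add: exp_add[symmetric])
    then have "r * exp (r * t) * integral {t..T} (\<lambda>s. exp (- r * s) * \<zeta> s) + - (exp (- r * t) * \<zeta> t) * exp (r * t) = c' t"
      unfolding c'_def c_def by algebra
    with DERIV_mult[OF e i] show ?thesis unfolding c_def by simp
  qed
  have c_cont: "continuous_on {0..T} c" by (rule DERIV_continuous_on[OF c_der])
  have c'_cont: "continuous_on {0..T} c'" unfolding c'_def by (intro continuous_intros c_cont \<zeta>)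
  have cT: "c T = 0" by (simp add: c_def)
  have c_le: "\<bar>c t\<bar> \<le> T * B\<zeta>" if t: "t \<in> {0..T}" for t
  proof -
    have "norm (integral {t..T} (\<lambda>s. exp (- r * s) * \<zeta> s)) \<le> (exp (- r * t) * B\<zeta>) * (T - t)"
    proof (rule integral_bound)
      show "continuous_on {t..T} (\<lambda>s. exp (- r * s) * \<zeta> s)"
        by (intro continuous_intros continuous_on_subset[OF \<zeta>]) (use t in auto)
      show "norm (exp (- r * s) * \<zeta> s) \<le> exp (- r * t) * B\<zeta>" if "s \<in> {t..T}" for s
        unfolding norm_mult using that t r B\<zeta>[of s] by (intro mult_mono) auto
    qed (use t in auto)
    then have "exp (r * t) * norm (integral {t..T} (\<lambda>s. exp (- r * s) * \<zeta> s)) \<le> exp (r * t) * ((exp (- r * t) * B\<zeta>) * (T - t))"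
      by (intro mult_left_mono) auto
    also have "\<dots> = (exp (r * t) * exp (- r * t)) * B\<zeta> * (T - t)" by simp
    also have "\<dots> = B\<zeta> * (T - t)" by (simp add: exp_add[symmetric])
    also have "\<dots> \<le> B\<zeta> * T" using t B\<zeta>0 by (intro mult_left_mono) auto
    finally show ?thesis by (simp add: c_def abs_mult mult.commute)
  qed
  have CC: "C21 T (\<lambda>x t. c t) (\<lambda>x t. 0) (\<lambda>x t. 0) (\<lambda>x t. c' t)" by (rule C21_time[OF c'_cont c_der])
  define h where "h = (\<lambda>x t. \<phi> x t - c t * d x t)"
  define hx where "hx = (\<lambda>x t. \<phi>x x t - (0 * d x t + dx x t * c t))"
  define hxx where "hxx = (\<lambda>x t. \<phi>xx x t - ((0 * d x t + dx x t * 0) + (dxx x t * c t + 0 * dx x t)))"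
  define ht where "ht = (\<lambda>x t. \<phi>t x t - (c' t * d x t + dt x t * c t))"
  have H: "C21 T h hx hxx ht" unfolding h_def hx_def hxx_def ht_def by (rule C21_diff[OF \<phi> C21_mult[OF CC d_C21]])
  have bh: "bstrip T h" "bstrip T hx" "bstrip T hxx" "bstrip T ht" using H by (auto simp: C21_def)
  have b\<phi>: "bstrip T \<phi>" "bstrip T \<phi>x" "bstrip T \<phi>xx" "bstrip T \<phi>t" using \<phi> by (auto simp: C21_def)
  have b2: "bstrip T e2" unfolding e2_def[abs_def] by (intro bstrip_diff bstrip_add bstrip_cmult bstrip_mult bd F_bstrip)
  define e1 where "e1 = (\<lambda>x t. \<phi>t x t + \<sigma>\<^sup>2/2 * \<phi>xx x t - F x t * \<phi>x x t + \<psi> x t + \<zeta> t * d x t)"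
  have b1: "bstrip T e1" unfolding e1_def by (intro bstrip_diff bstrip_add bstrip_cmult bstrip_mult bd F_bstrip b\<phi> \<psi> bstrip_time \<zeta>)
  define e where "e = (\<lambda>x t. e1 x t - c t * e2 x t)"
  have be: "bstrip T e" unfolding e_def by (intro bstrip_diff bstrip_mult b1 b2 bstrip_time c_cont)
  define Y where "Y = (\<lambda>t. E t (\<lambda>x. h x t * h x t))"
  define Y' where "Y' = (\<lambda>t. E t (\<lambda>x. (ht x t * h x t + ht x t * h x t) + \<sigma>\<^sup>2/2 * ((hxx x t * h x t + hx x t * hx x t) + (hxx x t * h x t + hx x t * hx x t))
     - F x t * (hx x t * h x t + hx x t * h x t)) - (h 0 t * h 0 t) * flux t)"
  have Y_der: "(Y has_real_derivative Y' t) (at t within {0..T})" if "t \<in> {0..T}" for t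
    unfolding Y_def Y'_def by (rule identity(1)[OF C21_mult[OF H H] that])
  define A where "A = (\<lambda>t. l * t + 2 * M * integral {0..t} act)"
  define \<theta> where "\<theta> = (\<lambda>t. exp (A t))"
  have \<theta>_der: "(\<theta> has_real_derivative (l + 2 * M * act t) * \<theta> t) (at t within {0..T})" if t: "t \<in> {0..T}" for t
    unfolding \<theta>_def A_def
    by (rule derivative_eq_intros integral_has_real_derivative[OF act_continuous t] refl | simp)+
  have \<theta>_pos: "\<theta> t > 0" for t by (simp add: \<theta>_def)
  \<comment> \<open>The growth rate \<open>l + 2 M act\<close> of the weight \<open>\<theta>\<close> absorbs the terms with \<open>c\<^sup>2\<close> that the equation of \<open>h\<close> produces.\<close>
  define \<Psi> where "\<Psi> = (\<lambda>t. 2 * (\<theta> t * Y t) + (\<theta> t * (c t * c t)) / M)"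
  define \<Psi>' where "\<Psi>' = (\<lambda>t. 2 * ((l + 2 * M * act t) * \<theta> t * Y t + Y' t * \<theta> t)
      + ((l + 2 * M * act t) * \<theta> t * (c t * c t) + (c' t * c t + c' t * c t) * \<theta> t) / M)"
  have \<Psi>_der: "(\<Psi> has_real_derivative \<Psi>' t) (at t within {0..T})" if t: "t \<in> {0..T}" for t
    unfolding \<Psi>_def \<Psi>'_def
    by (intro DERIV_add DERIV_cmult DERIV_cdivide DERIV_mult \<theta>_der Y_der c_der t)
  \<comment> \<open>The gain is 4 \<sigma>^2 \<zeta>^2. One \<sigma>^2 \<zeta>^2 is spent on the
    product c \<zeta> that comes from differentiating c^2, which is why \<open>Ml\<close> asks for 1
    \<le> \<sigma>^2 M l.\<close>
  have main: "\<theta> t * (3 * \<sigma>\<^sup>2 * (\<zeta> t)\<^sup>2 - 2 * ((\<omega> t)\<^sup>2 / l + \<epsilon>3)) \<le> \<Psi>' t" if t: "t \<in> {0..T}" for t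
  proof -
    define p where "p = E t (\<lambda>x. d x t * d x t)"
    define q where "q = E t (\<lambda>x. h x t * d x t)"
    define s where "s = E t (\<lambda>x. h x t * \<psi> x t)"
    define v where "v = E t (\<lambda>x. h x t * e x t)"
    define X where "X = E t (\<lambda>x. hx x t * hx x t)"
    define D where "D = E t (\<lambda>x. dx x t * dx x t)"
    note ad = adm_bstrip[OF bd(1) t] adm_bstrip[OF bd(2) t] and ah = adm_bstrip[OF bh(1) t] adm_bstrip[OF bh(2) t]
      and a\<psi> = adm_bstrip[OF \<psi> t] and ae = adm_bstrip[OF be t]
    have eq: "(\<lambda>x. (ht x t * h x t + ht x t * h x t) + \<sigma>\<^sup>2/2 * ((hxx x t * h x t + hx x t * hx x t) + (hxx x t * h x t + hx x t * hx x t))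
     - F x t * (hx x t * h x t + hx x t * h x t)) =
     (\<lambda>x. \<sigma>\<^sup>2 * (hx x t * hx x t) - 2 * (h x t * \<psi> x t) - (4 * r * c t) * (h x t * d x t) + 2 * (h x t * e x t))"
    proof (rule ext)
      fix x
      have "ht x t + \<sigma>\<^sup>2/2 * hxx x t - F x t * hx x t = - \<psi> x t - 2 * r * c t * d x t + e x t"
        unfolding ht_def hxx_def hx_def e_def e1_def e2_def c'_def by (simp add: algebra_simps)
      then show "(ht x t * h x t + ht x t * h x t) + \<sigma>\<^sup>2/2 * ((hxx x t * h x t + hx x t * hx x t) + (hxx x t * h x t + hx x t * hx x t))
     - F x t * (hx x t * h x t + hx x t * h x t) = \<sigma>\<^sup>2 * (hx x t * hx x t) - 2 * (h x t * \<psi> x t) - (4 * r * c t) * (h x t * d x t) + 2 * (h x t * e x t)"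
        by algebra
    qed
    note m = adm_cmult[OF adm_mult[OF ah(2) ah(2)], of "\<sigma>\<^sup>2"] adm_cmult[OF adm_mult[OF ah(1) a\<psi>], of 2]
      adm_cmult[OF adm_mult[OF ah(1) ad(1)], of "4 * r * c t"] adm_cmult[OF adm_mult[OF ah(1) ae], of 2]
    have Y': "Y' t = \<sigma>\<^sup>2 * X - 2 * s - 4 * r * c t * q + 2 * v - (h 0 t * h 0 t) * flux t"
      unfolding Y'_def eq X_def s_def q_def v_def
      E_add[OF adm_diff[OF adm_diff[OF m(1) m(2)] m(3)] m(4) t] E_diff[OF adm_diff[OF m(1) m(2)] m(3) t] E_diff[OF m(1) m(2) t] E_cmult ..
    have Y0: "Y t \<ge> 0" unfolding Y_def by (rule E_nonneg[OF t]) simp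
    have f0: "flux t \<ge> 0" by (rule flux_nonneg[OF t])
    have s: "2 * s \<le> l * Y t + (\<omega> t)\<^sup>2 / l"
    proof -
      have "E t (\<lambda>x. 2 * (h x t * \<psi> x t)) \<le> E t (\<lambda>x. l * (h x t * h x t) + (\<omega> t)\<^sup>2 / l * 1)"
      proof (rule E_mono[OF _ _ t])
        fix x :: real assume x: "x \<ge> 0"
        have "h x t * \<psi> x t \<le> \<bar>h x t\<bar> * \<omega> t"
          using mult_left_mono[OF \<psi>\<omega>[OF x t], of "\<bar>h x t\<bar>"] abs_ge_self[of "h x t * \<psi> x t"] by (simp add: abs_mult)
        moreover have "0 \<le> (l * \<bar>h x t\<bar> - \<omega> t)\<^sup>2 / l" using l by simp
        moreover have "(l * \<bar>h x t\<bar> - \<omega> t)\<^sup>2 / l = l * (h x t * h x t) + (\<omega> t)\<^sup>2 / l - 2 * (\<bar>h x t\<bar> * \<omega> t)"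
        proof -
          have "\<bar>h x t\<bar> * \<bar>h x t\<bar> = h x t * h x t" by simp
          then show ?thesis using l by (simp add: power2_eq_square field_simps)
        qed
        ultimately show "2 * (h x t * \<psi> x t) \<le> l * (h x t * h x t) + (\<omega> t)\<^sup>2 / l * 1" by simp
      qed (intro adm_cmult adm_mult adm_add adm_const ah a\<psi>)+
      also have "\<dots> = l * Y t + (\<omega> t)\<^sup>2 / l * E t (\<lambda>x. 1)"
        unfolding Y_def by (simp only: E_add[OF adm_cmult[OF adm_mult[OF ah(1) ah(1)]] adm_const t] E_cmult E_add[OF adm_cmult[OF adm_mult[OF ah(1) ah(1)]] adm_cmult[OF adm_const] t])
      also have "\<dots> \<le> l * Y t + (\<omega> t)\<^sup>2 / l * 1" using l mass_le[OF t] by (intro add_left_mono mult_left_mono) auto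
      finally show ?thesis unfolding s_def E_cmult by simp
    qed
    \<comment> \<open>The coupling is split in two: the part with E(h^2) goes into the growth of the
      weight, since 2 r E(d^2) belongs to \<open>act\<close>, and the part with c^2 is matched by
      the term 2 r c^2 / M that c' contributes.\<close>
    have q: "4 * r * c t * q \<le> r * (c t)\<^sup>2 / M + 2 * M * act t * Y t"
    proof -
      have "q\<^sup>2 \<le> Y t * p" unfolding q_def Y_def p_def by (rule E_Cauchy_Schwarz[OF ah(1) ad(1) t])
      then have "4 * r * M * q\<^sup>2 \<le> 4 * r * M * (Y t * p)" using r M by (intro mult_left_mono) auto
      also have "\<dots> = 2 * M * (2 * r * p) * Y t" by simp
      also have "\<dots> \<le> 2 * M * act t * Y t"
      proof (intro mult_right_mono mult_left_mono Y0)
        show "2 * r * p \<le> act t" unfolding act_def p_def using f0 E_nonneg[OF t, of "\<lambda>x. dx x t * dx x t"] by simp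
      qed (use M in simp)
      finally have 1: "4 * r * M * q\<^sup>2 \<le> 2 * M * act t * Y t" .
      have "0 \<le> r * (c t - 2 * M * q)\<^sup>2 / M" using r M by simp
      moreover have "r * (c t - 2 * M * q)\<^sup>2 / M = r * (c t)\<^sup>2 / M + 4 * r * M * q\<^sup>2 - 4 * r * c t * q"
        using M by (simp add: power2_eq_square field_simps)
      ultimately show ?thesis using 1 by linarith
    qed
    have v: "- \<epsilon>3 \<le> 2 * v"
    proof -
      define Bh where "Bh = B\<phi> + T * B\<zeta> * U"
      have Bh0: "Bh \<ge> 0" using B\<phi>0 B\<zeta>0 T U_nonneg by (simp add: Bh_def)
      have hB: "\<bar>h x t\<bar> \<le> Bh" if x: "x \<ge> 0" for x
      proof -
        have "\<bar>c t * d x t\<bar> \<le> T * B\<zeta> * U" unfolding abs_mult using c_le[OF t] d_le[OF x t] T B\<zeta>0 by (intro mult_mono) auto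
        then show ?thesis using B\<phi>[OF x t] unfolding h_def Bh_def by linarith
      qed
      note a1 = adm_abs[OF adm_bstrip[OF b1 t]]
      have "- v \<le> E t (\<lambda>x. Bh * (\<bar>e1 x t\<bar> + T * B\<zeta> * (\<eta> * V\<^sup>2 / 4)))"
      proof -
        have "E t (\<lambda>x. (-1) * (h x t * e x t)) \<le> E t (\<lambda>x. Bh * (\<bar>e1 x t\<bar> + T * B\<zeta> * (\<eta> * V\<^sup>2 / 4)))"
        proof (rule E_mono[OF _ _ t])
          fix x :: real assume x: "x \<ge> 0"
          have "\<bar>c t * e2 x t\<bar> \<le> T * B\<zeta> * (\<eta> * V\<^sup>2 / 4)"
            unfolding abs_mult using c_le[OF t] e2_le[OF x t] T B\<zeta>0 by (intro mult_mono) auto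
          then have "\<bar>e x t\<bar> \<le> \<bar>e1 x t\<bar> + T * B\<zeta> * (\<eta> * V\<^sup>2 / 4)" unfolding e_def by linarith
          then have "\<bar>h x t * e x t\<bar> \<le> Bh * (\<bar>e1 x t\<bar> + T * B\<zeta> * (\<eta> * V\<^sup>2 / 4))"
            unfolding abs_mult using hB[OF x] Bh0 by (intro mult_mono) auto
          then show "(-1) * (h x t * e x t) \<le> Bh * (\<bar>e1 x t\<bar> + T * B\<zeta> * (\<eta> * V\<^sup>2 / 4))" by linarith
        qed (intro adm_cmult adm_mult adm_add adm_const ah ae a1)+
        then show ?thesis unfolding v_def E_cmult by simp
      qed
      also have "\<dots> = Bh * (E t (\<lambda>x. \<bar>e1 x t\<bar>) + E t (\<lambda>x. T * B\<zeta> * (\<eta> * V\<^sup>2 / 4)))"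
        by (simp only: E_cmult[of t Bh] E_add[OF a1 adm_const t])
      also have "\<dots> \<le> Bh * (\<epsilon>2 + T * B\<zeta> * (\<eta> * V\<^sup>2 / 4))"
      proof (intro mult_left_mono add_mono Bh0)
        show "E t (\<lambda>x. \<bar>e1 x t\<bar>) \<le> \<epsilon>2" unfolding e1_def by (rule err[OF t])
        have "0 \<le> T * B\<zeta> * (\<eta> * V\<^sup>2 / 4)" using T B\<zeta>0 \<eta> by simp
        then show "E t (\<lambda>x. T * B\<zeta> * (\<eta> * V\<^sup>2 / 4)) \<le> T * B\<zeta> * (\<eta> * V\<^sup>2 / 4)"
          using E_abs_le[OF adm_const t, of "T * B\<zeta> * (\<eta> * V\<^sup>2 / 4)" "T * B\<zeta> * (\<eta> * V\<^sup>2 / 4)"] by auto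
      qed
      finally have "- v \<le> Bh * (\<epsilon>2 + T * B\<zeta> * (\<eta> * V\<^sup>2 / 4))" .
      moreover have "\<epsilon>3 = 2 * (Bh * (\<epsilon>2 + T * B\<zeta> * (\<eta> * V\<^sup>2 / 4)))" unfolding \<epsilon>3 Bh_def by simp
      ultimately show ?thesis by linarith
    qed
    \<comment> \<open>As \<phi> vanishes at x = 0, h(0, t) is -c d(0, t); this is what the flux term
      of \<open>act\<close> is for.\<close>
    have b: "(h 0 t * h 0 t) * flux t \<le> U\<^sup>2 * flux t * (c t)\<^sup>2"
    proof -
      have "(d 0 t)\<^sup>2 \<le> U\<^sup>2" using d_le[of 0 t] t U_nonneg by (auto simp: power2_le_iff_abs_le)
      then have "(d 0 t)\<^sup>2 * (flux t * (c t)\<^sup>2) \<le> U\<^sup>2 * (flux t * (c t)\<^sup>2)" using f0 by (intro mult_right_mono) auto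
      then show ?thesis unfolding h_def \<phi>0[OF t] by (simp add: power2_eq_square algebra_simps)
    qed
    have X: "4 * (\<zeta> t)\<^sup>2 \<le> 2 * X + 2 * (c t)\<^sup>2 * D"
    proof -
      have "E t (\<lambda>x. \<phi>x x t * \<phi>x x t) \<le> E t (\<lambda>x. 2 * (hx x t * hx x t) + (2 * (c t)\<^sup>2) * (dx x t * dx x t))"
      proof (rule E_mono[OF adm_mult[OF adm_bstrip[OF b\<phi>(2) t] adm_bstrip[OF b\<phi>(2) t]] _ t])
        fix x :: real
        have "0 \<le> (hx x t - c t * dx x t)\<^sup>2" by simp
        moreover have "\<phi>x x t = hx x t + c t * dx x t" by (simp add: hx_def)
        ultimately show "\<phi>x x t * \<phi>x x t \<le> 2 * (hx x t * hx x t) + (2 * (c t)\<^sup>2) * (dx x t * dx x t)"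
          by (simp add: power2_eq_square algebra_simps)
      qed (intro adm_cmult adm_mult adm_add ah ad)
      also have "\<dots> = 2 * X + 2 * (c t)\<^sup>2 * D"
        unfolding X_def D_def by (simp only: E_add[OF adm_cmult[OF adm_mult[OF ah(2,2)]] adm_cmult[OF adm_mult[OF ad(2,2)]] t] E_cmult)
      finally show ?thesis using \<zeta>_le[OF t] by linarith
    qed
    have act: "\<sigma>\<^sup>2 * D + U\<^sup>2 * flux t \<le> act t"
      unfolding act_def D_def using r E_nonneg[OF t, of "\<lambda>x. d x t * d x t"] by simp
    have cz: "- (2 * c t * \<zeta> t) \<ge> - (l * (c t)\<^sup>2) - (\<zeta> t)\<^sup>2 / l"
    proof -
      have "0 \<le> (l * c t - \<zeta> t)\<^sup>2 / l" using l by simp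
      moreover have "(l * c t - \<zeta> t)\<^sup>2 / l = l * (c t)\<^sup>2 + (\<zeta> t)\<^sup>2 / l - 2 * c t * \<zeta> t"
        using l by (simp add: power2_eq_square field_simps)
      ultimately show ?thesis by linarith
    qed
    have zz: "(\<zeta> t)\<^sup>2 / l / M \<le> \<sigma>\<^sup>2 * (\<zeta> t)\<^sup>2"
    proof -
      have "(\<zeta> t)\<^sup>2 * 1 \<le> (\<zeta> t)\<^sup>2 * (\<sigma>\<^sup>2 * (M * l))" using Ml by (intro mult_left_mono) auto
      then show ?thesis using l M by (simp add: field_simps)
    qed
    let ?a = "act t" let ?k = "(c t)\<^sup>2"
    have P1: "2 * ((l + 2 * M * ?a) * Y t + Y' t) \<ge> 2 * \<sigma>\<^sup>2 * X - 2 * (\<omega> t)\<^sup>2 / l - 2 * (r * ?k / M) - 2 * \<epsilon>3 - 2 * (U\<^sup>2 * flux t * ?k)"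
      using s q v b unfolding Y' by (simp add: distrib_right)
    have P2: "((l + 2 * M * ?a) * ?k + 2 * c' t * c t) / M \<ge> 2 * ?a * ?k + 2 * (r * ?k / M) - (\<zeta> t)\<^sup>2 / l / M"
    proof -
      have "(l + 2 * M * ?a) * ?k + 2 * c' t * c t \<ge> 2 * M * ?a * ?k + 2 * r * ?k - (\<zeta> t)\<^sup>2 / l"
        using cz unfolding c'_def by (simp add: power2_eq_square algebra_simps)
      then have "((l + 2 * M * ?a) * ?k + 2 * c' t * c t) / M \<ge> (2 * M * ?a * ?k + 2 * r * ?k - (\<zeta> t)\<^sup>2 / l) / M"
        using M by (intro divide_right_mono) auto
      moreover have "(2 * M * ?a * ?k + 2 * r * ?k - (\<zeta> t)\<^sup>2 / l) / M = 2 * ?a * ?k + 2 * (r * ?k / M) - (\<zeta> t)\<^sup>2 / l / M"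
        using M by (simp add: field_simps)
      ultimately show ?thesis by linarith
    qed
    have P3: "(\<sigma>\<^sup>2 * D + U\<^sup>2 * flux t) * ?k \<le> ?a * ?k" using act by (rule mult_right_mono) simp
    have P4: "\<sigma>\<^sup>2 * (4 * (\<zeta> t)\<^sup>2) \<le> \<sigma>\<^sup>2 * (2 * X + 2 * ?k * D)" using X by (rule mult_left_mono) simp
    have "3 * \<sigma>\<^sup>2 * (\<zeta> t)\<^sup>2 - 2 * ((\<omega> t)\<^sup>2 / l + \<epsilon>3)
        \<le> 2 * ((l + 2 * M * ?a) * Y t + Y' t) + ((l + 2 * M * ?a) * ?k + 2 * c' t * c t) / M"
      using P1 P2 P3 P4 zz by (simp add: distrib_right distrib_left mult_ac)
    then have "\<theta> t * (3 * \<sigma>\<^sup>2 * (\<zeta> t)\<^sup>2 - 2 * ((\<omega> t)\<^sup>2 / l + \<epsilon>3))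
        \<le> \<theta> t * (2 * ((l + 2 * M * ?a) * Y t + Y' t) + ((l + 2 * M * ?a) * ?k + 2 * c' t * c t) / M)"
      using \<theta>_pos[of t] by (intro mult_left_mono) auto
    also have "\<dots> = \<Psi>' t" unfolding \<Psi>'_def using M by (simp add: power2_eq_square field_simps)
    finally show ?thesis .
  qed
  have hi: "(\<Psi>' has_integral (\<Psi> T - \<Psi> 0)) {0..T}" by (rule integral_of_derivative[OF _ \<Psi>_der]) (use T in auto)
  have \<theta>_cont: "continuous_on {0..T} \<theta>" by (rule DERIV_continuous_on[OF \<theta>_der])
  have YT: "Y T = 0"
  proof -
    have "Y T = E T (\<lambda>x. 0)" unfolding Y_def E_def
      by (rule Bochner_Integration.integral_cong) (auto simp: indicator_def h_def cT \<phi>T)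
    then show ?thesis by (simp add: E_def)
  qed
  have \<Psi>0: "\<Psi> T - \<Psi> 0 \<le> 0"
  proof -
    have "Y 0 \<ge> 0" unfolding Y_def by (rule E_nonneg) (use T in auto)
    then have "\<Psi> 0 \<ge> 0" using \<theta>_pos[of 0] M unfolding \<Psi>_def by simp
    then show ?thesis by (simp add: \<Psi>_def YT cT)
  qed
  let ?w = "\<lambda>t. (\<omega> t)\<^sup>2 / l + \<epsilon>3"
  have cont: "continuous_on {0..T} (\<lambda>t. \<theta> t * (\<zeta> t)\<^sup>2)" "continuous_on {0..T} (\<lambda>t. \<theta> t * ?w t)"
    "continuous_on {0..T} (\<lambda>t. exp (l * t) * (\<zeta> t)\<^sup>2)" "continuous_on {0..T} (\<lambda>t. exp (l * t) * ?w t)"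
    using l by (intro continuous_intros \<theta>_cont \<zeta> \<omega>; simp)+
  note int = cont[THEN integrable_continuous_real]
  have "integral {0..T} (\<lambda>t. (3 * \<sigma>\<^sup>2) * (\<theta> t * (\<zeta> t)\<^sup>2) - 2 * (\<theta> t * ?w t)) \<le> integral {0..T} \<Psi>'"
    by (intro integral_le integrable_diff integrable_on_mult_right int has_integral_integrable[OF hi])
       (use main in \<open>simp add: algebra_simps\<close>)
  also have "\<dots> \<le> 0" using \<Psi>0 integral_unique[OF hi] by simp
  also have "integral {0..T} (\<lambda>t. (3 * \<sigma>\<^sup>2) * (\<theta> t * (\<zeta> t)\<^sup>2) - 2 * (\<theta> t * ?w t))
      = (3 * \<sigma>\<^sup>2) * integral {0..T} (\<lambda>t. \<theta> t * (\<zeta> t)\<^sup>2) - 2 * integral {0..T} (\<lambda>t. \<theta> t * ?w t)"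
    by (subst Henstock_Kurzweil_Integration.integral_diff) (auto intro!: integrable_on_mult_right int)
  finally have 1: "(3 * \<sigma>\<^sup>2) * integral {0..T} (\<lambda>t. \<theta> t * (\<zeta> t)\<^sup>2) \<le> 2 * integral {0..T} (\<lambda>t. \<theta> t * ?w t)" by simp
  define N where "N = 3 * U\<^sup>2 + U * \<eta> * V\<^sup>2 * T / 2"
  have act_int: "0 \<le> integral {0..t} act" "integral {0..t} act \<le> N" if t: "t \<in> {0..T}" for t
  proof -
    have i: "act integrable_on {a..b}" if "0 \<le> a" "b \<le> T" for a b
      by (rule integrable_continuous_real[OF continuous_on_subset[OF act_continuous]]) (use that in auto)
    show "0 \<le> integral {0..t} act" by (rule integral_nonneg[OF i]) (use t act_nonneg in auto)
    have "integral {0..t} act \<le> integral {0..T} act"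
      by (rule integral_subset_le) (use t act_nonneg i in auto)
    then show "integral {0..t} act \<le> N" using act_integral unfolding N_def by linarith
  qed
  \<comment> \<open>The weight is comparable to exp(l t), up to a factor that depends only on M and
    the total action.\<close>
  have \<theta>_ge: "exp (l * t) \<le> \<theta> t" and \<theta>_le: "\<theta> t \<le> exp (2 * M * N) * exp (l * t)" if t: "t \<in> {0..T}" for t
    using act_int[OF t] M by (auto simp: \<theta>_def A_def exp_add[symmetric])
  have \<epsilon>30: "\<epsilon>3 \<ge> 0" unfolding \<epsilon>3 using B\<phi>0 B\<zeta>0 T U_nonneg \<epsilon>20 \<eta> by (intro mult_nonneg_nonneg add_nonneg_nonneg) auto
  have "integral {0..T} (\<lambda>t. exp (l * t) * (\<zeta> t)\<^sup>2) \<le> integral {0..T} (\<lambda>t. \<theta> t * (\<zeta> t)\<^sup>2)"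
    by (intro integral_le int mult_right_mono \<theta>_ge) auto
  moreover have "integral {0..T} (\<lambda>t. \<theta> t * ?w t) \<le> integral {0..T} (\<lambda>t. exp (2 * M * N) * (exp (l * t) * ?w t))"
  proof (intro integral_le int integrable_on_mult_right)
    fix t assume t: "t \<in> {0..T}"
    have "?w t \<ge> 0" using l \<epsilon>30 by simp
    then show "\<theta> t * ?w t \<le> exp (2 * M * N) * (exp (l * t) * ?w t)"
      unfolding mult.assoc[symmetric] by (rule mult_right_mono[OF \<theta>_le[OF t]])
  qed
  moreover have "integral {0..T} (\<lambda>t. exp (l * t) * ?w t) \<ge> 0"
    by (rule integral_nonneg[OF int(4)]) (use l \<epsilon>30 in auto)
  ultimately have 2: "3 * \<sigma>\<^sup>2 * integral {0..T} (\<lambda>t. exp (l * t) * (\<zeta> t)\<^sup>2) \<le> 2 * (exp (2 * M * N) * integral {0..T} (\<lambda>t. exp (l * t) * ?w t))"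
    and 3: "exp (2 * M * N) * integral {0..T} (\<lambda>t. exp (l * t) * ?w t) \<ge> 0"
    using 1 mult_left_mono[of "integral {0..T} (\<lambda>t. exp (l * t) * (\<zeta> t)\<^sup>2)" "integral {0..T} (\<lambda>t. \<theta> t * (\<zeta> t)\<^sup>2)" "3 * \<sigma>\<^sup>2"] by auto
  then have "\<sigma>\<^sup>2 * integral {0..T} (\<lambda>t. exp (l * t) * (\<zeta> t)\<^sup>2) \<le> exp (2 * M * N) * integral {0..T} (\<lambda>t. exp (l * t) * ?w t)"
    by linarith
  then show ?thesis using \<sigma> by (simp add: N_def field_simps)
qed

end

end

section \<open>Weighted time norms\<close>

text \<open>The variance of g under the probability density k / c is nonnegative.\<close>

lemma weighted_Jensen:
  fixes k g :: "real \<Rightarrow> real"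
  assumes k: "\<And>x. 0 \<le> k x" "integrable lborel k" "(LBINT x. k x) = c" "c > 0"
    and g: "g \<in> borel_measurable borel" "\<And>x. \<bar>g x\<bar> \<le> B"
  shows "(LBINT x. k x * g x)\<^sup>2 \<le> c * (LBINT x. k x * (g x)\<^sup>2)"
proof -
  define a where "a = (LBINT x. k x * g x)"
  have 1: "integrable lborel (\<lambda>x. k x * g x)" by (rule integrable_mult_bounded[OF k(2) _ g(2)]) (use g in simp)
  have 2: "integrable lborel (\<lambda>x. k x * (g x)\<^sup>2)"
  proof (rule integrable_mult_bounded[OF k(2)])
    show "\<bar>(g x)\<^sup>2\<bar> \<le> B\<^sup>2" for x using power_mono[OF g(2), of x 2] by simp
  qed (use g in simp)
  have "0 \<le> (LBINT x. k x * (g x - a / c)\<^sup>2)" using k(1) by (intro Bochner_Integration.integral_nonneg) simp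
  also have "(\<lambda>x. k x * (g x - a / c)\<^sup>2) = (\<lambda>x. k x * (g x)\<^sup>2 - (2 * (a / c)) * (k x * g x) + (a / c)\<^sup>2 * k x)"
    by (rule ext) (simp add: power2_eq_square algebra_simps)
  also have "(LBINT x. k x * (g x)\<^sup>2 - (2 * (a / c)) * (k x * g x) + (a / c)\<^sup>2 * k x)
      = (LBINT x. k x * (g x)\<^sup>2) - (2 * (a / c)) * a + (a / c)\<^sup>2 * c"
    using 1 2 k(2,3) by (simp add: a_def)
  also have "\<dots> = (LBINT x. k x * (g x)\<^sup>2) - a\<^sup>2 / c" using k(4) by (simp add: power2_eq_square field_simps)
  finally have "a\<^sup>2 / c \<le> (LBINT x. k x * (g x)\<^sup>2)" by simp
  then show ?thesis using k(4) by (simp add: a_def field_simps)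
qed

lemma integrable_indicator_Icc: "integrable lborel (indicator {a..b :: real} :: real \<Rightarrow> real)"
  by (rule integrable_real_indicator) (auto simp: emeasure_lborel_Icc_eq)

text \<open>The mass c enters twice: once through Jensen's inequality in \<tau>, and once when the
  order of integration is exchanged and the shifted square of H is integrated first.\<close>

lemma Young_square:
  fixes k H N :: "real \<Rightarrow> real"
  assumes k: "\<And>x. 0 \<le> k x" "integrable lborel k" "(LBINT x. k x) = c" "c > 0"
    and H: "H \<in> borel_measurable borel" "\<And>t. \<bar>H t\<bar> \<le> B" "\<And>t. t \<notin> {0..T} \<Longrightarrow> H t = 0"
    and N: "N \<in> borel_measurable borel"
      "\<And>s. s \<in> {0..T} \<Longrightarrow> 0 \<le> N s" "\<And>s. s \<in> {0..T} \<Longrightarrow> N s \<le> (LBINT \<tau>. k \<tau> * H (s + \<tau>))"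
  shows "(LBINT s. indicator {0..T} s * (N s)\<^sup>2) \<le> c\<^sup>2 * (LBINT t. indicator {0..T} t * (H t)\<^sup>2)"
proof -
  have [measurable]: "k \<in> borel_measurable borel" using k(2) by auto
  have [measurable]: "H \<in> borel_measurable borel" "N \<in> borel_measurable borel" by (fact H N)+
  have H2: "(H t)\<^sup>2 \<le> B\<^sup>2" for t using power_mono[OF H(2), of t 2] by simp
  have iH: "integrable lborel (\<lambda>t. indicator {0..T} t * (H t)\<^sup>2)"
    by (rule integrable_mult_bounded[OF integrable_indicator_Icc _, of _ "B\<^sup>2"]) (use H2 in simp_all)
  have ik: "integrable lborel (\<lambda>\<tau>. k \<tau> * (H (s + \<tau>))\<^sup>2)" for s
    by (rule integrable_mult_bounded[OF k(2) _, of _ "B\<^sup>2"]) (use H2 in simp_all)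
  have pt: "(N s)\<^sup>2 \<le> c * (LBINT \<tau>. k \<tau> * (H (s + \<tau>))\<^sup>2)" if s: "s \<in> {0..T}" for s
  proof -
    have "(N s)\<^sup>2 \<le> (LBINT \<tau>. k \<tau> * H (s + \<tau>))\<^sup>2" by (rule power_mono[OF N(3)[OF s] N(2)[OF s]])
    also have "\<dots> \<le> c * (LBINT \<tau>. k \<tau> * (H (s + \<tau>))\<^sup>2)" by (rule weighted_Jensen[OF k _ H(2)]) simp
    finally show ?thesis .
  qed
  have "(\<integral>\<^sup>+s. ennreal (indicator {0..T} s * (N s)\<^sup>2) \<partial>lborel)
      \<le> (\<integral>\<^sup>+s. (\<integral>\<^sup>+\<tau>. ennreal (c * k \<tau>) * ennreal ((H (s + \<tau>))\<^sup>2) \<partial>lborel) \<partial>lborel)"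
  proof (rule nn_integral_mono)
    fix s :: real
    have "ennreal (indicator {0..T} s * (N s)\<^sup>2) \<le> ennreal (LBINT \<tau>. c * (k \<tau> * (H (s + \<tau>))\<^sup>2))"
    proof (rule ennreal_leI)
      have "0 \<le> c * (LBINT \<tau>. k \<tau> * (H (s + \<tau>))\<^sup>2)"
        using k(1,4) by (intro mult_nonneg_nonneg Bochner_Integration.integral_nonneg) auto
      then show "indicator {0..T} s * (N s)\<^sup>2 \<le> (LBINT \<tau>. c * (k \<tau> * (H (s + \<tau>))\<^sup>2))"
        using pt[of s] by (cases "s \<in> {0..T}") simp_all
    qed
    also have "\<dots> = (\<integral>\<^sup>+\<tau>. ennreal (c * (k \<tau> * (H (s + \<tau>))\<^sup>2)) \<partial>lborel)"
      by (rule nn_integral_eq_integral[symmetric]) (use ik k in auto)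
    also have "\<dots> = (\<integral>\<^sup>+\<tau>. ennreal (c * k \<tau>) * ennreal ((H (s + \<tau>))\<^sup>2) \<partial>lborel)"
      using k by (intro nn_integral_cong) (simp add: ennreal_mult[symmetric] mult.assoc)
    finally show "ennreal (indicator {0..T} s * (N s)\<^sup>2) \<le> (\<integral>\<^sup>+\<tau>. ennreal (c * k \<tau>) * ennreal ((H (s + \<tau>))\<^sup>2) \<partial>lborel)" .
  qed
  also have "\<dots> = (\<integral>\<^sup>+\<tau>. (\<integral>\<^sup>+s. ennreal (c * k \<tau>) * ennreal ((H (s + \<tau>))\<^sup>2) \<partial>lborel) \<partial>lborel)"
    by (rule lborel_pair.Fubini') simp
  also have "\<dots> = (\<integral>\<^sup>+\<tau>. ennreal (c * k \<tau>) * (\<integral>\<^sup>+s. ennreal ((H s)\<^sup>2) \<partial>lborel) \<partial>lborel)"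
  proof (rule nn_integral_cong)
    fix \<tau> :: real
    have "(\<integral>\<^sup>+s. ennreal ((H s)\<^sup>2) \<partial>lborel) = (\<integral>\<^sup>+s. ennreal ((H (s + \<tau>))\<^sup>2) \<partial>lborel)"
      using nn_integral_real_affine[of "\<lambda>s. ennreal ((H s)\<^sup>2)" 1 \<tau>] by (simp add: add.commute)
    then show "(\<integral>\<^sup>+s. ennreal (c * k \<tau>) * ennreal ((H (s + \<tau>))\<^sup>2) \<partial>lborel) = ennreal (c * k \<tau>) * (\<integral>\<^sup>+s. ennreal ((H s)\<^sup>2) \<partial>lborel)"
      by (simp add: nn_integral_cmult)
  qed
  also have "\<dots> = (\<integral>\<^sup>+\<tau>. ennreal (c * k \<tau>) \<partial>lborel) * (\<integral>\<^sup>+s. ennreal ((H s)\<^sup>2) \<partial>lborel)"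
    by (rule nn_integral_multc) simp
  also have "(\<integral>\<^sup>+\<tau>. ennreal (c * k \<tau>) \<partial>lborel) = ennreal (c\<^sup>2)"
    using nn_integral_eq_integral[of lborel "\<lambda>\<tau>. c * k \<tau>"] k by (simp add: power2_eq_square)
  also have "(\<integral>\<^sup>+s. ennreal ((H s)\<^sup>2) \<partial>lborel) = (\<integral>\<^sup>+s. ennreal (indicator {0..T} s * (H s)\<^sup>2) \<partial>lborel)"
    by (rule nn_integral_cong) (use H(3) in \<open>auto simp: indicator_def\<close>)
  also have "\<dots> = ennreal (LBINT t. indicator {0..T} t * (H t)\<^sup>2)"
    by (rule nn_integral_eq_integral[OF iH]) simp
  finally have le: "(\<integral>\<^sup>+s. ennreal (indicator {0..T} s * (N s)\<^sup>2) \<partial>lborel) \<le> ennreal (c\<^sup>2 * (LBINT t. indicator {0..T} t * (H t)\<^sup>2))"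
    by (simp add: ennreal_mult)
  show ?thesis
    by (rule integral_real_bounded[OF _ le]) (intro mult_nonneg_nonneg Bochner_Integration.integral_nonneg; simp)
qed

lemma exp_arg_le:
  fixes l t T :: real assumes "t \<in> {0..T}" shows "exp (l * t) \<le> exp (\<bar>l\<bar> * \<bar>T\<bar>)"
proof -
  have "l * t \<le> \<bar>l\<bar> * \<bar>t\<bar>" using abs_ge_self[of "l * t"] by (simp add: abs_mult)
  also have "\<dots> \<le> \<bar>l\<bar> * \<bar>T\<bar>" using assms by (intro mult_left_mono) auto
  finally show ?thesis by simp
qed

text \<open>The square of the norm of L^2(0, T) with weight exp(l t). The estimate to be proved has
  the reciprocal weight, and the two are paired in \<open>weak_bound\<close>.\<close>

definition wnorm :: "real \<Rightarrow> real \<Rightarrow> (real \<Rightarrow> real) \<Rightarrow> real" where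
  "wnorm T l g = (LBINT t. indicator {0..T} t * (exp (l * t) * (g t)\<^sup>2))"

lemma wnorm_integrable:
  fixes g :: "real \<Rightarrow> real" and l T :: real
  assumes g: "g \<in> borel_measurable borel" "\<And>t. t \<in> {0..T} \<Longrightarrow> \<bar>g t\<bar> \<le> B"
  shows "integrable lborel (\<lambda>t. indicator {0..T} t * (exp (l * t) * (g t)\<^sup>2))"
proof -
  have "integrable lborel (\<lambda>t. indicator {0..T} t * (indicator {0..T} t * (exp (l * t) * (g t)\<^sup>2)))"
  proof (rule integrable_mult_bounded[OF integrable_indicator_Icc])
    show "\<bar>indicator {0..T} t * (exp (l * t) * (g t)\<^sup>2)\<bar> \<le> exp (\<bar>l\<bar> * \<bar>T\<bar>) * B\<^sup>2" for t
    proof (cases "t \<in> {0..T}")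
      case True
      have "(g t)\<^sup>2 \<le> B\<^sup>2" using power_mono[OF g(2)[OF True], of 2] by simp
      then have "exp (l * t) * (g t)\<^sup>2 \<le> exp (\<bar>l\<bar> * \<bar>T\<bar>) * B\<^sup>2" using exp_arg_le[OF True, of l] by (intro mult_mono) auto
      then show ?thesis using True by simp
    qed simp
  qed (use g in simp)
  moreover have "(\<lambda>t. indicator {0..T} t * (indicator {0..T} t * (exp (l * t) * (g t)\<^sup>2))) = (\<lambda>t. indicator {0..T} t * (exp (l * t) * (g t)\<^sup>2))"
    by (rule ext) (simp add: indicator_def)
  ultimately show ?thesis by simp
qed

lemma wnorm_nonneg: "0 \<le> wnorm T l g"
  unfolding wnorm_def by (intro Bochner_Integration.integral_nonneg) simp

lemma wnorm_le_add:
  assumes f: "f \<in> borel_measurable borel" "\<And>t. t \<in> {0..T} \<Longrightarrow> \<bar>f t\<bar> \<le> A" and g: "g \<in> borel_measurable borel" "\<And>t. t \<in> {0..T} \<Longrightarrow> \<bar>g t\<bar> \<le> B"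
  shows "wnorm T l (\<lambda>t. f t + g t) \<le> 2 * wnorm T l f + 2 * wnorm T l g"
proof -
  have "wnorm T l (\<lambda>t. f t + g t) \<le> (LBINT t. 2 * (indicator {0..T} t * (exp (l * t) * (f t)\<^sup>2)) + 2 * (indicator {0..T} t * (exp (l * t) * (g t)\<^sup>2)))"
    unfolding wnorm_def
  proof (rule integral_mono)
    show "integrable lborel (\<lambda>t. indicator {0..T} t * (exp (l * t) * (f t + g t)\<^sup>2))"
    proof (rule wnorm_integrable)
      show "\<bar>f t + g t\<bar> \<le> A + B" if "t \<in> {0..T}" for t using f(2)[OF that] g(2)[OF that] by linarith
    qed (use f g in simp)
    have "(f t + g t)\<^sup>2 \<le> 2 * (f t)\<^sup>2 + 2 * (g t)\<^sup>2" for t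
      using zero_le_power2[of "f t - g t"] by (simp add: power2_eq_square algebra_simps)
    then have le: "exp (l * t) * (f t + g t)\<^sup>2 \<le> exp (l * t) * (2 * (f t)\<^sup>2 + 2 * (g t)\<^sup>2)" for t
      by (intro mult_left_mono) auto
    show "indicator {0..T} t * (exp (l * t) * (f t + g t)\<^sup>2) \<le> 2 * (indicator {0..T} t * (exp (l * t) * (f t)\<^sup>2)) + 2 * (indicator {0..T} t * (exp (l * t) * (g t)\<^sup>2))" for t
      using le[of t] by (cases "t \<in> {0..T}") (simp_all add: algebra_simps)
  qed (intro Bochner_Integration.integrable_add Bochner_Integration.integrable_mult_right wnorm_integrable[OF f] wnorm_integrable[OF g])
  also have "\<dots> = 2 * wnorm T l f + 2 * wnorm T l g"
    unfolding wnorm_def using wnorm_integrable[OF f, where l=l] wnorm_integrable[OF g, where l=l] by simp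
  finally show ?thesis .
qed

lemma wnorm_cmult: "wnorm T l (\<lambda>t. c * g t) = c\<^sup>2 * wnorm T l g"
proof -
  have "(\<lambda>t. indicator {0..T} t * (exp (l * t) * (c * g t)\<^sup>2)) = (\<lambda>t. c\<^sup>2 * (indicator {0..T} t * (exp (l * t) * (g t)\<^sup>2)))"
    by (rule ext) (simp add: power_mult_distrib mult_ac)
  then show ?thesis unfolding wnorm_def by simp
qed

lemma wnorm_integral:
  assumes "continuous_on {0..T} g"
  shows "integral {0..T} (\<lambda>t. exp (l * t) * (g t)\<^sup>2) = wnorm T l g"
proof -
  have "set_integrable lborel {0..T} (\<lambda>t. exp (l * t) * (g t)\<^sup>2)"
    by (rule borel_integrable_atLeastAtMost') (intro continuous_intros assms)
  from set_borel_integral_eq_integral(2)[OF this] show ?thesis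
    by (simp add: wnorm_def set_lebesgue_integral_def)
qed

lemma wnorm_Young:
  fixes k H N :: "real \<Rightarrow> real"
  assumes k: "\<And>x. 0 \<le> k x" "integrable lborel (\<lambda>\<tau>. k \<tau>)" "(LBINT x. k x) = c" "c > 0"
    and H: "H \<in> borel_measurable borel" "\<And>t. t \<in> {0..T} \<Longrightarrow> 0 \<le> H t" "\<And>t. t \<in> {0..T} \<Longrightarrow> H t \<le> B"
    and N: "N \<in> borel_measurable borel"
      "\<And>s. s \<in> {0..T} \<Longrightarrow> 0 \<le> N s" "\<And>s. s \<in> {0..T} \<Longrightarrow> exp (l / 2 * s) * N s \<le> (LBINT \<tau>. k \<tau> * (indicator {0..T} (s + \<tau>) * (exp (l / 2 * (s + \<tau>)) * H (s + \<tau>))))"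
  shows "wnorm T l N \<le> c\<^sup>2 * wnorm T l H"
proof -
  have e: "indicator {0..T} t * (exp (l * t) * (g t)\<^sup>2) = indicator {0..T} t * (exp (l / 2 * t) * g t)\<^sup>2"
    "indicator {0..T} t * (exp (l * t) * (g t)\<^sup>2) = indicator {0..T} t * (indicator {0..T} t * (exp (l / 2 * t) * g t))\<^sup>2" for g :: "real \<Rightarrow> real" and t
    by (auto simp: power_mult_distrib indicator_def exp_double[symmetric])
  show ?thesis unfolding wnorm_def e(1)[of _ N] e(2)[of _ H]
  proof (rule Young_square[OF k])
    show "\<bar>indicator {0..T} t * (exp (l / 2 * t) * H t)\<bar> \<le> exp (\<bar>l / 2\<bar> * \<bar>T\<bar>) * \<bar>B\<bar>" for t
    proof (cases "t \<in> {0..T}")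
      case True
      have "exp (l / 2 * t) * H t \<le> exp (\<bar>l / 2\<bar> * \<bar>T\<bar>) * \<bar>B\<bar>"
        by (rule mult_mono[OF exp_arg_le[OF True]]) (use H(2,3)[OF True] in auto)
      then show ?thesis using True H(2)[OF True] by simp
    qed simp
  qed (use H(1) N in simp_all)
qed

section \<open>The dual problem\<close>

definition tclamp :: "real \<Rightarrow> real \<Rightarrow> real" where "tclamp T t = max 0 (min T t)"
definition ramp :: "real \<Rightarrow> real \<Rightarrow> real" where "ramp \<kappa> x = max (-1) (min 1 (\<kappa> * x))"

lemma tclamp: "T \<ge> 0 \<Longrightarrow> tclamp T t \<in> {0..T}" "t \<in> {0..T} \<Longrightarrow> tclamp T t = t"
  by (auto simp: tclamp_def)

lemma continuous_tclamp: "continuous_on S f \<Longrightarrow> continuous_on S (\<lambda>p. tclamp T (f p))"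
  unfolding tclamp_def by (intro continuous_intros)

lemma ramp: "\<bar>ramp \<kappa> x\<bar> \<le> 1" "ramp \<kappa> (- x) = - ramp \<kappa> x" "ramp \<kappa> x \<le> 1"
  unfolding ramp_def by (auto simp: min_def max_def)

lemma continuous_ramp: "continuous_on S f \<Longrightarrow> continuous_on S (\<lambda>p. ramp \<kappa> (f p))"
  unfolding ramp_def by (intro continuous_intros)

lemma ramp_nonneg: "\<kappa> > 0 \<Longrightarrow> x \<ge> 0 \<Longrightarrow> 0 \<le> ramp \<kappa> x" and ramp_eq_1: "\<kappa> > 0 \<Longrightarrow> 1 / \<kappa> \<le> x \<Longrightarrow> ramp \<kappa> x = 1"
proof -
  show "0 \<le> ramp \<kappa> x" if "\<kappa> > 0" "x \<ge> 0" using that by (simp add: ramp_def le_max_iff_disj)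
  show "ramp \<kappa> x = 1" if "\<kappa> > 0" "1 / \<kappa> \<le> x" using that by (auto simp: ramp_def field_simps)
qed

lemma ramp_lipschitz: "\<kappa> > 0 \<Longrightarrow> \<bar>ramp \<kappa> x - ramp \<kappa> y\<bar> \<le> \<kappa> * \<bar>x - y\<bar>"
proof -
  assume "\<kappa> > 0"
  then have "\<kappa> * \<bar>x - y\<bar> = \<bar>\<kappa> * x - \<kappa> * y\<bar>" by (simp add: abs_mult flip: right_diff_distrib)
  then show ?thesis unfolding ramp_def by linarith
qed

text \<open>An odd extension jumps at x = 0 unless the function vanishes there. The factor
  \<open>ramp \<kappa>\<close> removes the jump and alters the function only for |x| < 1/\<kappa>.
  Times outside [0, T] are frozen, because the abstract problem lives on the whole plane.\<close>

definition odd_ext :: "real \<Rightarrow> real \<Rightarrow> (real \<Rightarrow> real \<Rightarrow> real) \<Rightarrow> real \<Rightarrow> real \<Rightarrow> real" where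
  "odd_ext T \<kappa> g x t = g \<bar>x\<bar> (tclamp T t) * ramp \<kappa> x"

lemma odd_ext:
  assumes g: "bstrip T g" and B: "\<And>x t. 0 \<le> x \<Longrightarrow> t \<in> {0..T} \<Longrightarrow> \<bar>g x t\<bar> \<le> B"
    and L: "\<And>x y t. 0 \<le> x \<Longrightarrow> 0 \<le> y \<Longrightarrow> t \<in> {0..T} \<Longrightarrow> \<bar>g x t - g y t\<bar> \<le> L * \<bar>x - y\<bar>" and T: "T \<ge> 0" and \<kappa>: "\<kappa> > 0"
  shows "bcont (odd_ext T \<kappa> g)" "ucont_x (odd_ext T \<kappa> g)" "\<bar>odd_ext T \<kappa> g x t\<bar> \<le> B" "odd_ext T \<kappa> g (- x) t = - odd_ext T \<kappa> g x t"
proof -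
  have B0: "B \<ge> 0" using B[of 0 0] T by auto
  have L0: "L \<ge> 0" using L[of 1 0 0] T by auto
  show le: "\<bar>odd_ext T \<kappa> g x t\<bar> \<le> B" for x t
    using mult_mono[OF B[OF abs_ge_zero tclamp(1)[OF T]] ramp(1)[of \<kappa> x], of x t] B0 by (simp add: odd_ext_def abs_mult)
  show "odd_ext T \<kappa> g (- x) t = - odd_ext T \<kappa> g x t" by (simp add: odd_ext_def ramp(2))
  show "bcont (odd_ext T \<kappa> g)"
  proof (rule bcontI[OF _ le])
    have "continuous_on UNIV (\<lambda>p. g \<bar>fst p\<bar> (tclamp T (snd p)))"
      by (rule bstrip_compose[OF g]) (use tclamp(1)[OF T] in \<open>auto intro!: continuous_intros continuous_tclamp\<close>)
    then show "continuous_on UNIV (\<lambda>p. odd_ext T \<kappa> g (fst p) (snd p))"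
      unfolding odd_ext_def by (intro continuous_on_mult continuous_ramp continuous_on_fst continuous_on_id)
  qed
  show "ucont_x (odd_ext T \<kappa> g)"
  proof (rule ucont_x_lipschitz)
    fix x y t
    let ?t = "tclamp T t"
    have "odd_ext T \<kappa> g x t - odd_ext T \<kappa> g y t = (g \<bar>x\<bar> ?t - g \<bar>y\<bar> ?t) * ramp \<kappa> x + g \<bar>y\<bar> ?t * (ramp \<kappa> x - ramp \<kappa> y)"
      by (simp add: odd_ext_def algebra_simps)
    then have "\<bar>odd_ext T \<kappa> g x t - odd_ext T \<kappa> g y t\<bar> \<le> \<bar>g \<bar>x\<bar> ?t - g \<bar>y\<bar> ?t\<bar> * \<bar>ramp \<kappa> x\<bar> + \<bar>g \<bar>y\<bar> ?t\<bar> * \<bar>ramp \<kappa> x - ramp \<kappa> y\<bar>"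
      unfolding abs_mult[symmetric] by (simp only: abs_triangle_ineq)
    moreover have "\<bar>g \<bar>x\<bar> ?t - g \<bar>y\<bar> ?t\<bar> * \<bar>ramp \<kappa> x\<bar> \<le> (L * \<bar>x - y\<bar>) * 1"
    proof (rule mult_mono[OF _ ramp(1)])
      have "\<bar>g \<bar>x\<bar> ?t - g \<bar>y\<bar> ?t\<bar> \<le> L * \<bar>\<bar>x\<bar> - \<bar>y\<bar>\<bar>" by (rule L[OF _ _ tclamp(1)[OF T]]) auto
      also have "\<dots> \<le> L * \<bar>x - y\<bar>" using L0 by (intro mult_left_mono) auto
      finally show "\<bar>g \<bar>x\<bar> ?t - g \<bar>y\<bar> ?t\<bar> \<le> L * \<bar>x - y\<bar>" .
    qed (use L0 in auto)
    moreover have "\<bar>g \<bar>y\<bar> ?t\<bar> * \<bar>ramp \<kappa> x - ramp \<kappa> y\<bar> \<le> B * (\<kappa> * \<bar>x - y\<bar>)"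
      by (rule mult_mono[OF B[OF abs_ge_zero tclamp(1)[OF T]] ramp_lipschitz[OF \<kappa>]]) (use B0 in auto)
    ultimately show "\<bar>odd_ext T \<kappa> g x t - odd_ext T \<kappa> g y t\<bar> \<le> (L + B * \<kappa>) * \<bar>x - y\<bar>" by (simp add: algebra_simps)
  qed
qed

lemma bcont_bstrip:
  assumes "bcont g" shows "bstrip T g"
proof -
  obtain B where B: "\<And>x t. \<bar>g x t\<bar> \<le> B" using assms by (elim bcontE) (rule that)
  show ?thesis
    by (rule bstripI[OF _ B]) (intro bcont_continuous_on[OF assms] continuous_intros)
qed

lemma heat_pot_C21:
  assumes h: "C2x h h1 h2" and \<sigma>: "\<sigma> > 0" and L: "L > 0" and z: "\<And>y t. S \<le> t \<Longrightarrow> h y t = 0"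
  shows "C21 T (heat_pot \<sigma> L h) (heat_pot \<sigma> L h1) (heat_pot \<sigma> L h2) (\<lambda>x t. L * heat_pot \<sigma> L h x t - \<sigma>\<^sup>2 / 2 * heat_pot \<sigma> L h2 x t - h x t)"
proof -
  have hb: "bcont h" "bcont h1" "bcont h2"
    and d: "\<And>x t. ((\<lambda>y. h y t) has_real_derivative h1 x t) (at x)" "\<And>x t. ((\<lambda>y. h1 y t) has_real_derivative h2 x t) (at x)"
    using h by (auto simp: C2x_def)
  show ?thesis unfolding C21_def
    by (intro conjI allI impI ballI bstrip_diff bstrip_cmult bcont_bstrip bcont_heat_pot hb L
      has_field_derivative_at_within[OF heat_pot_has_derivative_x[OF hb(1,2) d(1) L]]
      has_field_derivative_at_within[OF heat_pot_has_derivative_x[OF hb(2,3) d(2) L]]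
      has_field_derivative_at_within[OF heat_pot_has_derivative_t[OF h L \<sigma> z]])
qed

context mfg begin

lemma adm_bcont:
  assumes "bcont g" shows "adm (\<lambda>x. g x t)"
proof -
  obtain B where B: "\<And>x t. \<bar>g x t\<bar> \<le> B" using assms by (elim bcontE) (rule that)
  have "continuous_on {0..} (\<lambda>x. g x t)" by (intro bcont_continuous_on[OF assms] continuous_intros)
  then show ?thesis unfolding adm_def using B by blast
qed

text \<open>The nonlocal coefficient \<zeta> as a functional of \<phi>_x. The clamp freezes \<beta>
  and m outside [0, T], while g keeps its own time.\<close>

definition Jop :: "(real \<Rightarrow> real \<Rightarrow> real) \<Rightarrow> real \<Rightarrow> real" where
  "Jop g t = - (1/2) * (\<beta> (tclamp T t) * E (tclamp T t) (\<lambda>x. g x t))"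

lemma T0: "T \<ge> 0" using T by simp

text \<open>Inside [0, T] this is \<open>E_continuous\<close>. Outside, m is frozen and only g
  varies, so dominated convergence against that fixed density applies; the three closed pieces are
  glued.\<close>

lemma Jop_cont: assumes g: "bcont g" shows "continuous_on UNIV (Jop g)"
proof -
  obtain B where B: "\<And>x t. \<bar>g x t\<bar> \<le> B" using g by (elim bcontE) (rule that)
  have fix_time: "continuous_on UNIV (\<lambda>t. E s (\<lambda>x. g x t))" if s: "s \<in> {0..T}" for s
    unfolding E_def
  proof (rule continuous_on_integral_dominated)
    show "continuous_on UNIV (\<lambda>t. indicator {0..} x * (g x t * m x s))" for x
      by (intro continuous_intros bcont_continuous_on[OF g])
    show "\<bar>indicator {0..} x * (g x t * m x s)\<bar> \<le> B * (indicator {0..} x * m x s)" for x t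
      using B[of x t] m_nonneg[OF _ s, of x] by (auto simp: indicator_def abs_mult intro: mult_right_mono)
    show "integrable lborel (\<lambda>x. B * (indicator {0..} x * m x s))" using m_integrable[OF s] by simp
    show "(\<lambda>x. indicator {0..} x * (g x t * m x s)) \<in> borel_measurable lborel" for t
      by (rule borel_measurable_integrable[OF E_integrable[OF adm_bcont[OF g] s]])
  qed
  have e: "E (tclamp T t) (\<lambda>x. g x t) = (if t \<le> 0 then E 0 (\<lambda>x. g x t) else if t \<le> T then E t (\<lambda>x. g x t) else E T (\<lambda>x. g x t))" for t
    using T by (auto simp: tclamp_def)
  have "continuous_on ({..0} \<union> ({0..T} \<union> {T..})) (\<lambda>t. E (tclamp T t) (\<lambda>x. g x t))"
  proof (intro continuous_on_closed_Un closed_atMost closed_atLeastAtMost closed_atLeast closed_Un)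
    show "continuous_on {..0} (\<lambda>t. E (tclamp T t) (\<lambda>x. g x t))"
      by (rule continuous_on_eq[OF continuous_on_subset[OF fix_time[of 0]]]) (use T in \<open>auto simp: tclamp_def\<close>)
    show "continuous_on {0..T} (\<lambda>t. E (tclamp T t) (\<lambda>x. g x t))"
      by (rule continuous_on_eq[OF E_continuous[OF bcont_bstrip[OF g]]]) (auto simp: tclamp_def)
    show "continuous_on {T..} (\<lambda>t. E (tclamp T t) (\<lambda>x. g x t))"
      by (rule continuous_on_eq[OF continuous_on_subset[OF fix_time[of T]]]) (use T in \<open>auto simp: tclamp_def\<close>)
  qed
  moreover have "{..0} \<union> ({0..T} \<union> {T..}) = UNIV" using T by auto
  ultimately have 1: "continuous_on UNIV (\<lambda>t. E (tclamp T t) (\<lambda>x. g x t))" by simp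
  have "continuous_on UNIV (\<lambda>t. \<beta> (tclamp T t))"
    by (rule continuous_on_compose2[OF continuous_\<beta>(1)]) (use tclamp(1)[OF T0] in \<open>auto intro!: continuous_tclamp continuous_intros\<close>)
  then show ?thesis unfolding Jop_def[abs_def] by (rule continuous_on_mult[OF continuous_on_const continuous_on_mult[OF _ 1]])
qed

lemma Jop_bound:
  assumes g: "bcont g" and B: "\<And>x. \<bar>g x t\<bar> \<le> B" shows "\<bar>Jop g t\<bar> \<le> B / 2"
proof -
  have B0: "B \<ge> 0" using B[of 0] by simp
  have "\<bar>\<beta> (tclamp T t) * E (tclamp T t) (\<lambda>x. g x t)\<bar> \<le> 1 * B"
    unfolding abs_mult using \<beta>[OF tclamp(1)[OF T0]] E_abs_le[OF adm_bcont[OF g] tclamp(1)[OF T0] B B0] B0 by (intro mult_mono) auto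
  then show ?thesis by (simp add: Jop_def)
qed

lemma Jop_diff:
  assumes "bcont g" "bcont g'" shows "Jop (\<lambda>x t. g x t - g' x t) t = Jop g t - Jop g' t"
  unfolding Jop_def E_diff[OF adm_bcont[OF assms(1)] adm_bcont[OF assms(2)] tclamp(1)[OF T0]] by (simp add: algebra_simps)

lemma F_lipschitz:
  assumes V: "\<And>x t. 0 \<le> x \<Longrightarrow> t \<in> {0..T} \<Longrightarrow> \<bar>D_xx u x t\<bar> \<le> V" and xy: "0 \<le> x" "0 \<le> y" "t \<in> {0..T}"
  shows "\<bar>D_x u x t - D_x u y t\<bar> \<le> V * \<bar>x - y\<bar>" "\<bar>F x t - F y t\<bar> \<le> V * \<bar>x - y\<bar>"
proof -
  show 1: "\<bar>D_x u x t - D_x u y t\<bar> \<le> V * \<bar>x - y\<bar>"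
    by (rule field_differentiable_bound[of "{0..}" "\<lambda>y. D_x u y t" "\<lambda>y. D_xx u y t" V x y, unfolded real_norm_def])
       (use u_deriv(2)[OF _ xy(3)] V[OF _ xy(3)] xy in simp_all)
  have "F x t - F y t = - (D_x u x t - D_x u y t) / 2" using F_eq[of x t y] by simp
  then show "\<bar>F x t - F y t\<bar> \<le> V * \<bar>x - y\<bar>" using 1 by simp
qed

text \<open>The damping for which the condition \<open>small\<close> holds with equality at K = 1/2
  + U, where K + U/2 = 1/2 + 3U/2. It involves \<sigma> and U only.\<close>

definition "Lam = pi * (4 * (1/2 + 3 / 2 * U) / \<sigma>)\<^sup>2"

lemma Lam: "Lam > 0" "sqrt (pi / Lam) / \<sigma> = 1 / (4 * (1/2 + 3 / 2 * U))"
proof -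
  have a: "1/2 + 3 / 2 * U > 0" using U_nonneg by simp
  then show "Lam > 0" unfolding Lam_def using \<sigma> by simp
  have "pi / Lam = (\<sigma> / (4 * (1/2 + 3 / 2 * U)))\<^sup>2" unfolding Lam_def using \<sigma> a by (simp add: power_divide power_mult_distrib)
  then have "sqrt (pi / Lam) = \<sigma> / (4 * (1/2 + 3 / 2 * U))" using \<sigma> a by (simp add: real_sqrt_abs)
  then show "sqrt (pi / Lam) / \<sigma> = 1 / (4 * (1/2 + 3 / 2 * U))" using \<sigma> by simp
qed

lemma dual_problem_odd_ext:
  assumes \<psi>: "bcont \<psi>" "ucont_x \<psi>" "\<And>x t. \<psi> (- x) t = - \<psi> x t" "\<And>x t. S \<le> t \<Longrightarrow> \<psi> x t = 0" and \<kappa>: "\<kappa> > 0"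
  shows "dual_problem \<sigma> Lam (1/2 + U) U S (odd_ext T \<kappa> F) (odd_ext T \<kappa> (D_x u)) \<psi> Jop"
proof -
  obtain V where V: "\<And>x t. 0 \<le> x \<Longrightarrow> t \<in> {0..T} \<Longrightarrow> \<bar>D_xx u x t\<bar> \<le> V" using bounded_stripD[OF u_bdd(3)] by metis
  have f: "bcont (odd_ext T \<kappa> F)" "ucont_x (odd_ext T \<kappa> F)" "\<And>x t. \<bar>odd_ext T \<kappa> F x t\<bar> \<le> 1/2 + U" "\<And>x t. odd_ext T \<kappa> F (- x) t = - odd_ext T \<kappa> F x t"
    by (rule odd_ext[OF F_bstrip F_bound F_lipschitz(2)[OF V] T0 \<kappa>], assumption+)+
  have u': "bcont (odd_ext T \<kappa> (D_x u))" "ucont_x (odd_ext T \<kappa> (D_x u))" "\<And>x t. \<bar>odd_ext T \<kappa> (D_x u) x t\<bar> \<le> U" "\<And>x t. odd_ext T \<kappa> (D_x u) (- x) t = - odd_ext T \<kappa> (D_x u) x t"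
    by (rule odd_ext[OF bu(2) D_x_u_le F_lipschitz(1)[OF V] T0 \<kappa>]; assumption)+
  have a: "1/2 + U + U / 2 = 1/2 + 3 / 2 * U" "1/2 + 3 / 2 * U > 0" using U_nonneg by simp_all
  then have sm: "(1/2 + U + U / 2) * (sqrt (pi / Lam) / \<sigma>) \<le> 1 / 4" unfolding Lam(2) by simp
  show ?thesis
    by (rule dual_problem.intro) (rule \<sigma> Lam(1) sm f u' \<psi> Jop_cont Jop_bound Jop_diff; assumption)+
qed

text \<open>A single parameter s is both the tolerance in the equation and the width of the layer 0
  \<le> x < s in which the coefficients are cut off. The bound B is kept separate because it must
  not depend on s.\<close>

definition "approx_dual S \<psi> s B h h1 h2 \<longleftrightarrow> C2x h h1 h2 \<and> (\<forall>x t. h (- x) t = - h x t) \<and> (\<forall>x t. S \<le> t \<longrightarrow> h x t = 0) \<and>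
    (\<forall>x. \<forall>t\<ge>0. \<bar>h x t - (\<psi> x t + Jop (heat_pot \<sigma> Lam h1) t * odd_ext T (1 / s) (D_x u) x t + Lam * heat_pot \<sigma> Lam h x t
       - odd_ext T (1 / s) F x t * heat_pot \<sigma> Lam h1 x t)\<bar> \<le> s) \<and>
    (\<forall>x. \<forall>t\<ge>0. \<bar>heat_pot \<sigma> Lam h x t\<bar> \<le> B \<and> \<bar>heat_pot \<sigma> Lam h1 x t\<bar> \<le> B)"

text \<open>The bound of \<open>approx_solution_bound\<close> is taken at tolerance 1 and thereby
  serves all s \<le> 1.\<close>

lemma ex_dual:
  assumes \<psi>: "bcont \<psi>" "ucont_x \<psi>" "\<And>x t. \<psi> (- x) t = - \<psi> x t" "\<And>x t. S \<le> t \<Longrightarrow> \<psi> x t = 0"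
  obtains B where "B \<ge> 0" "\<And>s. 0 < s \<Longrightarrow> s \<le> 1 \<Longrightarrow> \<exists>h h1 h2. approx_dual S \<psi> s B h h1 h2"
proof -
  obtain P0 where P0: "\<And>x t. \<bar>\<psi> x t\<bar> \<le> P0" using \<psi>(1) by (elim bcontE) (rule that)
  have P00: "P0 \<ge> 0" using P0[of 0 0] by simp
  \<comment> \<open>As \<psi> vanishes from S on, its sup bound can be traded for one in the weight
    exp(-Lam t).\<close>
  define P where "P = P0 * exp (Lam * S)"
  have P: "\<bar>\<psi> x t\<bar> \<le> P * exp (- Lam * t)" for x t
  proof (cases "S \<le> t")
    case True then show ?thesis using \<psi>(4) P00 by (simp add: P_def)
  next
    case False
    have "P0 * 1 \<le> P0 * exp (Lam * S - Lam * t)" using P00 False Lam(1) by (intro mult_left_mono) auto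
    also have "\<dots> = P * exp (- Lam * t)" by (simp add: P_def exp_diff exp_minus field_simps)
    finally show ?thesis using P0[of x t] by simp
  qed
  define N where "N = 4 * (P + 1)"
  have N0: "N \<ge> 0" using P00 by (simp add: N_def P_def)
  define B where "B = max (N / Lam) (sqrt (pi / Lam) / \<sigma> * N)"
  have "B \<ge> 0" using N0 Lam(1) by (simp add: B_def le_max_iff_disj)
  moreover have "\<exists>h h1 h2. approx_dual S \<psi> s B h h1 h2" if s: "0 < s" "s \<le> 1" for s
  proof -
    have "1 / s > 0" using s by simp
    interpret dual: dual_problem \<sigma> Lam "1/2 + U" U S "odd_ext T (1 / s) F" "odd_ext T (1 / s) (D_x u)" \<psi> Jop
      by (rule dual_problem_odd_ext[OF \<psi> \<open>1 / s > 0\<close>])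
    obtain h h1 h2 where h: "C2x h h1 h2" "\<And>x t. h (- x) t = - h x t" "\<And>x t. S \<le> t \<Longrightarrow> h x t = 0"
      and err: "\<And>x t. \<bar>h x t - dual.rhs h h1 x t\<bar> \<le> s * exp (- Lam * t)"
      using s(1) by (elim dual.ex_approx_solution) (rule that)
    have b: "\<bar>h x t\<bar> \<le> N * exp (- Lam * t)" for x t
    proof -
      have "\<bar>h x t\<bar> \<le> 4 * (P + s) * exp (- Lam * t)" by (rule dual.approx_solution_bound[OF h(1,3) err P])
      also have "\<dots> \<le> N * exp (- Lam * t)" unfolding N_def using s by (intro mult_right_mono) auto
      finally show ?thesis .
    qed
    have e1: "exp (- Lam * t) \<le> 1" if "t \<ge> 0" for t using that Lam(1) by simp
    have "\<bar>h x t - dual.rhs h h1 x t\<bar> \<le> s" if "t \<ge> 0" for x t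
      using order_trans[OF err mult_left_mono[OF e1[OF that], of s]] s by simp
    moreover have "\<bar>heat_pot \<sigma> Lam h x t\<bar> \<le> B" if "t \<ge> 0" for x t
    proof -
      have "Lam * \<bar>heat_pot \<sigma> Lam h x t\<bar> \<le> 1 / 2 * N * exp (- Lam * t)" by (rule dual.heat_pot_weighted(1)[OF h(1) N0 b])
      also have "\<dots> \<le> N * 1" using e1[OF that] N0 by (intro mult_mono) auto
      finally have "\<bar>heat_pot \<sigma> Lam h x t\<bar> \<le> N / Lam" using Lam(1) by (simp add: field_simps)
      then show ?thesis by (simp add: B_def)
    qed
    moreover have "\<bar>heat_pot \<sigma> Lam h1 x t\<bar> \<le> B" if "t \<ge> 0" for x t
    proof -
      have "\<bar>heat_pot \<sigma> Lam h1 x t\<bar> \<le> sqrt (pi / Lam) / \<sigma> * (N * exp (- Lam * t))" by (rule dual.heat_pot_weighted(2)[OF h(1) N0 b])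
      also have "\<dots> \<le> sqrt (pi / Lam) / \<sigma> * (N * 1)" using e1[OF that] N0 Lam(1) \<sigma> by (intro mult_left_mono) auto
      finally show ?thesis by (simp add: B_def)
    qed
    ultimately show ?thesis using h unfolding approx_dual_def dual.rhs_def
      by (intro exI[of _ h] exI[of _ h1] exI[of _ h2] conjI allI impI) auto
  qed
  ultimately show ?thesis by (rule that)
qed

end

section \<open>Weighted bounds for approximate dual solutions\<close>

lemma bcont_measurable_x: "bcont g \<Longrightarrow> (\<lambda>t. g x t) \<in> borel_measurable borel"
  by (rule bcont_measurable) auto

text \<open>By density of the rationals and continuity. The point of the countable sup is that it
  stays measurable in t.\<close>

lemma abs_le_SUP_Rats:
  fixes f :: "real \<Rightarrow> real"
  assumes c: "continuous_on UNIV f" and B: "\<And>x. \<bar>f x\<bar> \<le> B"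
  shows "\<bar>f x\<bar> \<le> (SUP q\<in>\<rat>. \<bar>f q\<bar>)"
proof -
  have "closed {x. \<bar>f x\<bar> \<le> (SUP q\<in>\<rat>. \<bar>f q\<bar>)}" by (intro closed_Collect_le continuous_intros c)
  moreover have "\<rat> \<subseteq> {x. \<bar>f x\<bar> \<le> (SUP q\<in>\<rat>. \<bar>f q\<bar>)}"
    using B by (auto intro!: cSUP_upper bdd_aboveI2)
  ultimately have "closure \<rat> \<subseteq> {x. \<bar>f x\<bar> \<le> (SUP q\<in>\<rat>. \<bar>f q\<bar>)}" by (rule closure_minimal[rotated])
  then show ?thesis using Rats_closure_real by auto
qed

lemma SUP_Rats_measurable:
  assumes g: "bcont g" shows "(\<lambda>t. SUP q\<in>\<rat>. \<bar>g q t\<bar>) \<in> borel_measurable borel"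
proof (rule borel_measurable_cSUP[OF countable_rat])
  obtain B where B: "\<And>x t. \<bar>g x t\<bar> \<le> B" using g by (elim bcontE) (rule that)
  show "bdd_above ((\<lambda>q. \<bar>g q t\<bar>) ` \<rat>)" for t using B by (intro bdd_aboveI2)
qed (use bcont_measurable_x[OF g] in simp)

text \<open>Brings a backward integral into the convolution form of \<open>wnorm_Young\<close>, with
  a kernel exp(-l \<tau> / 2) of mass 2 / l.\<close>

lemma real_integral_tail_affine:
  fixes A :: "real \<Rightarrow> real"
  assumes A: "continuous_on UNIV A" and l: "l > 0" and s: "s \<in> {0..T}"
  shows "exp (l / 2 * s) * integral {s..T} A = (LBINT \<tau>. indicator {0<..} \<tau> * exp (- (l / 2) * \<tau>) * (indicator {0..T} (s + \<tau>) * (exp (l / 2 * (s + \<tau>)) * A (s + \<tau>))))"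
proof -
  have "set_integrable lborel {s..T} A" by (rule borel_integrable_atLeastAtMost') (rule continuous_on_subset[OF A subset_UNIV])
  from set_borel_integral_eq_integral(2)[OF this]
  have "integral {s..T} A = (LBINT \<tau>. indicator {s..T} \<tau> * A \<tau>)" by (simp add: set_lebesgue_integral_def)
  also have "\<dots> = (LBINT \<tau>. indicator {s..T} (s + \<tau>) * A (s + \<tau>))"
    using lborel_integral_real_affine[of 1 "\<lambda>\<tau>. indicator {s..T} \<tau> * A \<tau>" s] by simp
  finally have "exp (l / 2 * s) * integral {s..T} A = (LBINT \<tau>. exp (l / 2 * s) * (indicator {s..T} (s + \<tau>) * A (s + \<tau>)))" by simp
  also have "\<dots> = (LBINT \<tau>. indicator {0<..} \<tau> * exp (- (l / 2) * \<tau>) * (indicator {0..T} (s + \<tau>) * (exp (l / 2 * (s + \<tau>)) * A (s + \<tau>))))"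
  proof (rule Bochner_Integration.integral_cong_AE)
    have [measurable]: "A \<in> borel_measurable borel" by (rule borel_measurable_continuous_onI[OF A])
    show "(\<lambda>\<tau>. exp (l / 2 * s) * (indicator {s..T} (s + \<tau>) * A (s + \<tau>))) \<in> borel_measurable lborel" by measurable
    show "(\<lambda>\<tau>. indicator {0<..} \<tau> * exp (- (l / 2) * \<tau>) * (indicator {0..T} (s + \<tau>) * (exp (l / 2 * (s + \<tau>)) * A (s + \<tau>)))) \<in> borel_measurable lborel" by measurable
    have "AE \<tau> in lborel. \<tau> \<noteq> (0::real)" by (rule AE_lborel_singleton)
    then show "AE \<tau> in lborel. exp (l / 2 * s) * (indicator {s..T} (s + \<tau>) * A (s + \<tau>)) = indicator {0<..} \<tau> * exp (- (l / 2) * \<tau>) * (indicator {0..T} (s + \<tau>) * (exp (l / 2 * (s + \<tau>)) * A (s + \<tau>)))"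
    proof (rule AE_mp[OF _ AE_I2], intro impI)
      fix \<tau> :: real assume "\<tau> \<noteq> 0"
      have "exp (- (l / 2) * \<tau>) * exp (l / 2 * (s + \<tau>)) = exp (l / 2 * s)" by (simp add: exp_add[symmetric] algebra_simps)
      moreover have "indicator {s..T} (s + \<tau>) = indicator {0<..} \<tau> * (indicator {0..T} (s + \<tau>) :: real)"
        using s \<open>\<tau> \<noteq> 0\<close> by (auto simp: indicator_def)
      ultimately show "exp (l / 2 * s) * (indicator {s..T} (s + \<tau>) * A (s + \<tau>)) = indicator {0<..} \<tau> * exp (- (l / 2) * \<tau>) * (indicator {0..T} (s + \<tau>) * (exp (l / 2 * (s + \<tau>)) * A (s + \<tau>)))"
        by (simp add: mult_ac)
    qed
  qed
  finally show ?thesis .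
qed

context mfg begin

text \<open>The factor from \<open>energy_estimate\<close> for M = 1/(\<sigma>^2 l0), the smallest M
  that is allowed for all l \<ge> l0; the 1 next to 3 U^2 covers the error of the difference
  quotient in the action.\<close>

definition "CE l0 = exp (2 * (1 / (\<sigma>\<^sup>2 * l0)) * (3 * U\<^sup>2 + 1)) / \<sigma>\<^sup>2"
text \<open>Product of the two losses in \<open>gradient_estimate\<close>: from the source bound
  \<open>A0\<close> to the gradient, and from \<omega> to \<open>A0\<close>.\<close>

definition "dual_const l0 = (2 + 8 * Lam\<^sup>2 / l0\<^sup>2) * (2 + 4 * U\<^sup>2 * CE l0 / l0)"

end

text \<open>The step of the difference quotient will be the same s as the tolerance;
  \<open>small\<close> keeps its contribution to the action at most 1.\<close>

locale dual_approx = mfg +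
  fixes s S V B Mm :: real and \<psi> h h1 h2 :: "real \<Rightarrow> real \<Rightarrow> real" and \<omega> :: "real \<Rightarrow> real"
  assumes s: "0 < s" "s \<le> 1" and small: "U * s * V\<^sup>2 * T \<le> 2"
    and V: "\<And>x t. 0 \<le> x \<Longrightarrow> t \<in> {0..T} \<Longrightarrow> \<bar>D_xx u x t\<bar> \<le> V"
    and Mm: "\<And>x t. 0 \<le> x \<Longrightarrow> t \<in> {0..T} \<Longrightarrow> \<bar>m x t\<bar> \<le> Mm"
    and \<psi>: "bcont \<psi>" "\<And>x t. 0 \<le> x \<Longrightarrow> t \<in> {0..T} \<Longrightarrow> \<bar>\<psi> x t\<bar> \<le> \<omega> t" and \<omega>: "continuous_on UNIV \<omega>"
    and S: "S \<le> T"
    and h: "C2x h h1 h2" "\<And>x t. h (- x) t = - h x t" "\<And>x t. S \<le> t \<Longrightarrow> h x t = 0"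
    and h_err: "\<And>x t. t \<ge> 0 \<Longrightarrow> \<bar>h x t - (\<psi> x t + Jop (heat_pot \<sigma> Lam h1) t * odd_ext T (1 / s) (D_x u) x t + Lam * heat_pot \<sigma> Lam h x t
       - odd_ext T (1 / s) F x t * heat_pot \<sigma> Lam h1 x t)\<bar> \<le> s"
    and \<phi>_le: "\<And>x t. t \<ge> 0 \<Longrightarrow> \<bar>heat_pot \<sigma> Lam h x t\<bar> \<le> B" and \<phi>x_le: "\<And>x t. t \<ge> 0 \<Longrightarrow> \<bar>heat_pot \<sigma> Lam h1 x t\<bar> \<le> B"
begin

abbreviation "\<phi> \<equiv> heat_pot \<sigma> Lam h"
abbreviation "\<phi>x \<equiv> heat_pot \<sigma> Lam h1"
abbreviation "\<phi>xx \<equiv> heat_pot \<sigma> Lam h2"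
abbreviation "\<phi>t \<equiv> (\<lambda>x t. Lam * heat_pot \<sigma> Lam h x t - \<sigma>\<^sup>2 / 2 * heat_pot \<sigma> Lam h2 x t - h x t)"
abbreviation "\<zeta> \<equiv> Jop (heat_pot \<sigma> Lam h1)"

lemma B_nonneg: "B \<ge> 0" using \<phi>_le[of 0 0] by simp
lemma V_nonneg: "V \<ge> 0" using V[of 0 0] T by simp
lemma Mm_nonneg: "Mm \<ge> 0" using Mm[of 0 0] T by simp

lemma hb: "bcont h" "bcont h1" "bcont h2"
  and hd: "\<And>x t. ((\<lambda>y. h y t) has_real_derivative h1 x t) (at x)"
  using h(1) by (auto simp: C2x_def)

lemma \<phi>_C21: "C21 T \<phi> \<phi>x \<phi>xx \<phi>t" by (rule heat_pot_C21[OF h(1) \<sigma> Lam(1) h(3)])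

lemma \<phi>x_bcont: "bcont \<phi>x" by (rule bcont_heat_pot[OF hb(2) Lam(1)])

lemma \<phi>_odd: "\<phi> (- x) t = - \<phi> x t"
  using heat_pot_uminus[of h "-1" \<sigma> Lam x t] h(2) by simp

lemma \<phi>_0: "\<phi> 0 t = 0" using \<phi>_odd[of 0 t] by simp

lemma \<phi>_S: "S \<le> t \<Longrightarrow> \<phi> x t = 0" by (rule heat_pot_zero[OF h(3)])

lemma \<zeta>_cont: "continuous_on UNIV \<zeta>" by (rule Jop_cont[OF \<phi>x_bcont])

lemma \<zeta>_le: "t \<ge> 0 \<Longrightarrow> \<bar>\<zeta> t\<bar> \<le> B / 2" by (rule Jop_bound[OF \<phi>x_bcont \<phi>x_le])

text \<open>The cut-off coefficients differ from F and u_x by the factor 1 - ramp, which vanishes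
  for x \<ge> s. The true equation is thus violated only in a layer at the boundary, though there by
  an amount that need not be small.\<close>

lemma residual:
  assumes x: "x \<ge> 0" "t \<in> {0..T}"
  shows "\<bar>\<phi>t x t + \<sigma>\<^sup>2/2 * \<phi>xx x t - F x t * \<phi>x x t + \<psi> x t + \<zeta> t * D_x u x t\<bar> \<le> s + (1/2 + 3/2 * U) * B * (1 - ramp (1 / s) x)"
proof -
  define e where "e = h x t - (\<psi> x t + \<zeta> t * odd_ext T (1 / s) (D_x u) x t + Lam * \<phi> x t - odd_ext T (1 / s) F x t * \<phi>x x t)"
  define k where "k = 1 - ramp (1 / s) x"
  have k: "k \<ge> 0" using ramp(3)[of "1 / s" x] by (simp add: k_def)
  have "\<phi>t x t + \<sigma>\<^sup>2/2 * \<phi>xx x t - F x t * \<phi>x x t + \<psi> x t + \<zeta> t * D_x u x t = - e - (F x t * k) * \<phi>x x t + \<zeta> t * (D_x u x t * k)"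
    using x by (simp add: e_def k_def odd_ext_def tclamp(2) algebra_simps)
  moreover have "\<bar>e\<bar> \<le> s" unfolding e_def using h_err x by simp
  moreover have "\<bar>(F x t * k) * \<phi>x x t\<bar> \<le> ((1/2 + U) * k) * B"
    unfolding abs_mult using F_bound[OF x] \<phi>x_le[of t x] x k U_nonneg by (intro mult_mono) auto
  moreover have "\<bar>\<zeta> t * (D_x u x t * k)\<bar> \<le> B / 2 * (U * k)"
    unfolding abs_mult using D_x_u_le[OF x] \<zeta>_le[of t] x k U_nonneg B_nonneg by (intro mult_mono) auto
  ultimately have "\<bar>\<phi>t x t + \<sigma>\<^sup>2/2 * \<phi>xx x t - F x t * \<phi>x x t + \<psi> x t + \<zeta> t * D_x u x t\<bar> \<le> s + ((1/2 + U) * k) * B + B / 2 * (U * k)"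
    by linarith
  then show ?thesis unfolding k_def[symmetric] by (simp add: algebra_simps)
qed

text \<open>The layer has width s and the density is bounded, so its error is small in the mean with
  respect to m. This is why \<open>energy_estimate\<close> measures its error by E and not by a
  sup.\<close>

lemma E_ramp_le:
  assumes t: "t \<in> {0..T}" shows "E t (\<lambda>x. 1 - ramp (1 / s) x) \<le> s * Mm"
proof -
  have a: "adm (\<lambda>x. 1 - ramp (1 / s) x)"
  proof -
    have "continuous_on {0..} (\<lambda>x. 1 - ramp (1 / s) x)" by (intro continuous_intros continuous_ramp)
    moreover have "\<forall>x\<ge>0. \<bar>1 - ramp (1 / s) x\<bar> \<le> 2"
    proof (intro allI impI)
      fix x :: real show "\<bar>1 - ramp (1 / s) x\<bar> \<le> 2" using ramp(1)[of "1 / s" x] by linarith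
    qed
    ultimately show ?thesis unfolding adm_def by blast
  qed
  have "E t (\<lambda>x. 1 - ramp (1 / s) x) \<le> (LBINT x. Mm * indicator {0..s} x)"
    unfolding E_def
  proof (rule integral_mono[OF E_integrable[OF a t]])
    show "integrable lborel (\<lambda>x. Mm * indicator {0..s} x)" using integrable_indicator_Icc by simp
    fix x :: real
    show "indicator {0..} x * ((1 - ramp (1 / s) x) * m x t) \<le> Mm * indicator {0..s} x"
    proof (cases "x \<in> {0..s}")
      case True
      then have "(1 - ramp (1 / s) x) * m x t \<le> 1 * Mm"
        using ramp(3)[of "1 / s" x] ramp_nonneg[of "1 / s" x] s Mm[OF _ t, of x] m_nonneg[OF _ t, of x] by (intro mult_mono) auto
      then show ?thesis using True by simp
    next
      case False
      then show ?thesis using ramp_eq_1[of "1 / s" x] s by (auto simp: indicator_def)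
    qed
  qed
  also have "\<dots> = s * Mm" using s by simp
  finally show ?thesis .
qed

definition "C2 = 1 + (1/2 + 3/2 * U) * B * Mm + B / 2 * V"
definition "C3 = 2 * (B + T * (B / 2) * U) * (C2 + T * (B / 2) * (V\<^sup>2 / 4))"

lemma C3_nonneg: "C3 \<ge> 0"
  unfolding C3_def C2_def using B_nonneg V_nonneg U_nonneg Mm_nonneg T by simp

lemma residual_d:
  assumes t: "t \<in> {0..T}"
  shows "E t (\<lambda>x. \<bar>\<phi>t x t + \<sigma>\<^sup>2/2 * \<phi>xx x t - F x t * \<phi>x x t + \<psi> x t + \<zeta> t * diff_quot s u x t\<bar>) \<le> s * C2"
proof -
  let ?k = "\<lambda>x. 1 - ramp (1 / s) x"
  have ak: "adm ?k"
  proof -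
    have "continuous_on {0..} ?k" by (intro continuous_intros continuous_ramp)
    moreover have "\<forall>x\<ge>0. \<bar>?k x\<bar> \<le> 2"
    proof (intro allI impI)
      fix x :: real show "\<bar>?k x\<bar> \<le> 2" using ramp(1)[of "1 / s" x] by linarith
    qed
    ultimately show ?thesis unfolding adm_def by blast
  qed
  have bs: "bstrip T \<phi>t" "bstrip T \<phi>xx" "bstrip T \<phi>x" using \<phi>_C21 by (auto simp: C21_def)
  have "bstrip T (\<lambda>x t. \<phi>t x t + \<sigma>\<^sup>2/2 * \<phi>xx x t - F x t * \<phi>x x t + \<psi> x t + \<zeta> t * diff_quot s u x t)"
    by (intro bstrip_add bstrip_diff[OF bstrip_add] bstrip_cmult bstrip_mult bs F_bstrip bcont_bstrip[OF \<psi>(1)] bstrip_time continuous_on_subset[OF \<zeta>_cont] subset_UNIV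
      bd(1)[OF s(1) V])
  from adm_abs[OF adm_bstrip[OF this t]]
  have "E t (\<lambda>x. \<bar>\<phi>t x t + \<sigma>\<^sup>2/2 * \<phi>xx x t - F x t * \<phi>x x t + \<psi> x t + \<zeta> t * diff_quot s u x t\<bar>) \<le> E t (\<lambda>x. (s + B / 2 * (V * s)) + ((1/2 + 3/2 * U) * B) * ?k x)"
  proof (rule E_mono[OF _ adm_add[OF adm_const adm_cmult[OF ak]] t])
    fix x :: real assume x: "x \<ge> 0"
    have "\<bar>\<zeta> t * (diff_quot s u x t - D_x u x t)\<bar> \<le> B / 2 * (V * s)"
      unfolding abs_mult using \<zeta>_le[of t] d_close[OF s(1) V x t] t B_nonneg by (intro mult_mono) auto
    moreover have "\<zeta> t * (diff_quot s u x t - D_x u x t) = \<zeta> t * diff_quot s u x t - \<zeta> t * D_x u x t" by (simp add: algebra_simps)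
    ultimately show "\<bar>\<phi>t x t + \<sigma>\<^sup>2/2 * \<phi>xx x t - F x t * \<phi>x x t + \<psi> x t + \<zeta> t * diff_quot s u x t\<bar> \<le> (s + B / 2 * (V * s)) + ((1/2 + 3/2 * U) * B) * ?k x"
      using residual[OF x t] by linarith
  qed
  also have "\<dots> = E t (\<lambda>x. s + B / 2 * (V * s)) + ((1/2 + 3/2 * U) * B) * E t ?k"
    unfolding E_add[OF adm_const adm_cmult[OF ak] t] E_cmult ..
  also have "\<dots> \<le> (s + B / 2 * (V * s)) + ((1/2 + 3/2 * U) * B) * (s * Mm)"
  proof (intro add_mono mult_left_mono E_ramp_le t)
    have "0 \<le> s + B / 2 * (V * s)" using s B_nonneg V_nonneg by simp
    then show "E t (\<lambda>x. s + B / 2 * (V * s)) \<le> s + B / 2 * (V * s)"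
      using E_abs_le[OF adm_const t, of "s + B / 2 * (V * s)" "s + B / 2 * (V * s)"] by auto
  qed (use B_nonneg U_nonneg in simp)
  also have "\<dots> = s * C2" by (simp add: C2_def algebra_simps)
  finally show ?thesis .
qed

lemma \<omega>_nonneg: "t \<in> {0..T} \<Longrightarrow> \<omega> t \<ge> 0" using \<psi>(2)[of 0 t] by simp

text \<open>Jensen's inequality for m, whose mass is at most 1, together with \<beta> \<le> 1. The 4
  is the square of the factor 1/2 in \<open>Jop\<close>, moved to the other side.\<close>

lemma \<zeta>_sq_le: assumes t: "t \<in> {0..T}" shows "4 * (\<zeta> t)\<^sup>2 \<le> E t (\<lambda>x. \<phi>x x t * \<phi>x x t)"
proof -
  have "4 * (\<zeta> t)\<^sup>2 = (\<beta> t)\<^sup>2 * (E t (\<lambda>x. \<phi>x x t))\<^sup>2"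
    using t by (simp add: Jop_def tclamp(2) power2_eq_square)
  also have "\<dots> \<le> 1 * (E t (\<lambda>x. \<phi>x x t))\<^sup>2"
    using \<beta>[OF t] by (intro mult_right_mono) (auto intro: power_le_one)
  also have "\<dots> \<le> E t (\<lambda>x. \<phi>x x t * \<phi>x x t)" using E_square_le[OF adm_bcont[OF \<phi>x_bcont] t] by simp
  finally show ?thesis .
qed

lemma \<zeta>_wnorm:
  assumes l: "0 < l0" "l0 \<le> l"
  shows "wnorm T l \<zeta> \<le> CE l0 * (wnorm T l \<omega> / l + s * C3 * wnorm T l (\<lambda>t. 1))"
proof -
  define M where "M = 1 / (\<sigma>\<^sup>2 * l0)"
  have M: "M > 0" using \<sigma> l by (simp add: M_def)
  have Ml: "1 \<le> \<sigma>\<^sup>2 * (M * l)" using \<sigma> l by (simp add: M_def)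
  have lp: "l > 0" using l by simp
  have \<epsilon>3: "s * C3 = 2 * (B + T * (B / 2) * U) * (s * C2 + T * (B / 2) * (s * V\<^sup>2 / 4))"
    by (simp add: C3_def algebra_simps)
  have c: "continuous_on {0..T} \<zeta>" "continuous_on {0..T} \<omega>" using \<zeta>_cont \<omega> continuous_on_subset by blast+
  have "integral {0..T} (\<lambda>t. exp (l * t) * (\<zeta> t)\<^sup>2) \<le>
    exp (2 * M * (3 * U\<^sup>2 + U * s * V\<^sup>2 * T / 2)) / \<sigma>\<^sup>2 * integral {0..T} (\<lambda>t. exp (l * t) * ((\<omega> t)\<^sup>2 / l + s * C3))"
    by (rule energy_estimate[OF s(1) V lp M Ml \<phi>_C21 \<phi>_0 \<phi>_S[OF S] bcont_bstrip[OF \<psi>(1)] \<psi>(2) c(2,1) \<phi>_le \<zeta>_le residual_d \<zeta>_sq_le \<epsilon>3]) auto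
  also have "integral {0..T} (\<lambda>t. exp (l * t) * ((\<omega> t)\<^sup>2 / l + s * C3)) = wnorm T l \<omega> / l + s * C3 * wnorm T l (\<lambda>t. 1)"
  proof -
    have i: "(\<lambda>t. exp (l * t) * (\<omega> t)\<^sup>2) integrable_on {0..T}" "(\<lambda>t. exp (l * t) * 1\<^sup>2) integrable_on {0..T}"
      by (intro integrable_continuous_real continuous_intros c)+
    have "(\<lambda>t. exp (l * t) * ((\<omega> t)\<^sup>2 / l + s * C3)) = (\<lambda>t. (1 / l) * (exp (l * t) * (\<omega> t)\<^sup>2) + (s * C3) * (exp (l * t) * 1\<^sup>2))"
      by (rule ext) (simp add: field_simps)
    then have "integral {0..T} (\<lambda>t. exp (l * t) * ((\<omega> t)\<^sup>2 / l + s * C3))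
        = integral {0..T} (\<lambda>t. (1 / l) * (exp (l * t) * (\<omega> t)\<^sup>2)) + integral {0..T} (\<lambda>t. (s * C3) * (exp (l * t) * 1\<^sup>2))"
      by (simp only: Henstock_Kurzweil_Integration.integral_add[OF integrable_on_mult_right[OF i(1)] integrable_on_mult_right[OF i(2)]])
    then show ?thesis
      using wnorm_integral[OF c(2), of l] wnorm_integral[of T "\<lambda>t. 1" l] by simp
  qed
  also have "exp (2 * M * (3 * U\<^sup>2 + U * s * V\<^sup>2 * T / 2)) / \<sigma>\<^sup>2 * (wnorm T l \<omega> / l + s * C3 * wnorm T l (\<lambda>t. 1))
      \<le> CE l0 * (wnorm T l \<omega> / l + s * C3 * wnorm T l (\<lambda>t. 1))"
  proof (rule mult_right_mono)
    have "2 * M * (3 * U\<^sup>2 + U * s * V\<^sup>2 * T / 2) \<le> 2 * M * (3 * U\<^sup>2 + 1)" using small M by (intro mult_left_mono) auto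
    then show "exp (2 * M * (3 * U\<^sup>2 + U * s * V\<^sup>2 * T / 2)) / \<sigma>\<^sup>2 \<le> CE l0" unfolding CE_def M_def[symmetric] by (intro divide_right_mono) auto
    show "0 \<le> wnorm T l \<omega> / l + s * C3 * wnorm T l (\<lambda>t. 1)" using lp s C3_nonneg wnorm_nonneg by simp
  qed
  finally show ?thesis using wnorm_integral[OF c(1), of l] by simp
qed

end

lemma integral_reflect_derivative:
  fixes A :: "real \<Rightarrow> real"
  assumes A: "continuous_on {0..T} A" and t: "t \<in> {0..T}"
  shows "((\<lambda>\<tau>. integral {T - \<tau>..T} A) has_real_derivative A (T - t)) (at t within {0..T})"
proof -
  have im: "(\<lambda>\<tau>. T - \<tau>) ` {0..T} = {0..T}" by (simp add: image_diff_atLeastAtMost)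
  have "((\<lambda>\<tau>. integral {\<tau>..T} A) has_real_derivative - A (T - t)) (at (T - t) within (\<lambda>\<tau>. T - \<tau>) ` {0..T})"
    unfolding im by (rule integral_has_real_derivative'[OF A]) (use t in auto)
  moreover have "((\<lambda>\<tau>. T - \<tau>) has_real_derivative - 1) (at t within {0..T})"
    by (auto intro!: derivative_eq_intros)
  ultimately have "((\<lambda>\<tau>. integral {\<tau>..T} A) \<circ> (\<lambda>\<tau>. T - \<tau>) has_real_derivative - A (T - t) * - 1) (at t within {0..T})"
    by (rule DERIV_image_chain)
  then show ?thesis by (simp add: o_def)
qed

context dual_approx begin

text \<open>A bound, uniform in x, for the source of the drift equation once the nonlocal term is
  counted as source. Its backward integral \<open>P1\<close> is the supersolution that dominates
  \<phi>.\<close>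

definition "A0 t = \<omega> t + U * \<bar>\<zeta> t\<bar> + s"
definition "P1 t = integral {tclamp T t..T} A0"
definition "n t = (SUP q\<in>\<rat>. \<bar>\<phi>x q t\<bar>)"

lemma A0_cont: "continuous_on X A0"
  unfolding A0_def[abs_def]
  by (intro continuous_on_add continuous_on_mult continuous_on_const continuous_on_rabs continuous_on_subset[OF \<omega>] continuous_on_subset[OF \<zeta>_cont] subset_UNIV)

lemma A0_nonneg: "t \<in> {0..T} \<Longrightarrow> A0 t \<ge> 0"
  unfolding A0_def using \<omega>_nonneg[of t] U_nonneg s by simp

lemma P1_cont: "continuous_on UNIV P1"
proof -
  have "continuous_on {0..T} (\<lambda>t. integral {t..T} A0)"
    by (rule DERIV_continuous_on[OF integral_has_real_derivative'[OF A0_cont]])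
  then show ?thesis unfolding P1_def[abs_def]
    by (rule continuous_on_compose2) (use tclamp(1)[OF T0] in \<open>auto intro!: continuous_tclamp continuous_intros\<close>)
qed

lemma P1_nonneg: "0 \<le> P1 t"
  unfolding P1_def
proof (rule integral_nonneg[OF integrable_continuous_real[OF A0_cont]])
  show "0 \<le> A0 \<tau>" if "\<tau> \<in> {tclamp T t..T}" for \<tau>
    by (rule A0_nonneg) (use that tclamp(1)[OF T0, of t] in auto)
qed

lemma drift:
  assumes x: "t \<in> {0..T}" "0 \<le> x"
  shows "\<bar>\<phi>t x t + \<sigma>\<^sup>2/2 * \<phi>xx x t - odd_ext T (1 / s) F x t * \<phi>x x t\<bar> \<le> A0 t"
proof -
  define e where "e = h x t - (\<psi> x t + \<zeta> t * odd_ext T (1 / s) (D_x u) x t + Lam * \<phi> x t - odd_ext T (1 / s) F x t * \<phi>x x t)"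
  have e: "\<bar>e\<bar> \<le> s" unfolding e_def using h_err x by simp
  have "\<bar>D_x u x t * ramp (1 / s) x\<bar> \<le> U * 1"
    unfolding abs_mult by (rule mult_mono[OF D_x_u_le[OF x(2,1)] ramp(1)]) (use U_nonneg in auto)
  then have "\<bar>odd_ext T (1 / s) (D_x u) x t\<bar> \<le> U" using x by (simp add: odd_ext_def tclamp(2))
  then have "\<bar>\<zeta> t * odd_ext T (1 / s) (D_x u) x t\<bar> \<le> \<bar>\<zeta> t\<bar> * U"
    unfolding abs_mult by (rule mult_left_mono) simp
  then have z: "\<bar>\<zeta> t * odd_ext T (1 / s) (D_x u) x t\<bar> \<le> U * \<bar>\<zeta> t\<bar>" by (simp add: mult.commute)
  have "\<phi>t x t + \<sigma>\<^sup>2/2 * \<phi>xx x t - odd_ext T (1 / s) F x t * \<phi>x x t = - e - \<psi> x t - \<zeta> t * odd_ext T (1 / s) (D_x u) x t"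
    by (simp add: e_def)
  then show ?thesis unfolding A0_def using e z \<psi>(2)[OF x(2,1)] by linarith
qed

text \<open>Maximum principle for \<open>P1\<close> minus and plus \<phi>, the cases k = 1 and k =
  -1, after reversing time. The term with \<open>Lam\<close> in the source cancels the damping, so
  there is no zero order term and no exponential factor in the bound.\<close>

lemma \<phi>_le_P1:
  assumes x: "x \<ge> 0" and t: "t \<in> {0..T}" shows "\<bar>\<phi> x t\<bar> \<le> P1 t"
proof -
  have pd: "((\<lambda>y. \<phi> y t) has_real_derivative \<phi>x y t) (at y)" "((\<lambda>y. \<phi>x y t) has_real_derivative \<phi>xx y t) (at y)" for y t
    using heat_pot_has_derivative_x[OF hb(1,2) hd Lam(1)] heat_pot_has_derivative_x[OF hb(2,3) _ Lam(1)] h(1) by (auto simp: C2x_def)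
  have pt: "((\<lambda>\<tau>. \<phi> y (T - \<tau>)) has_real_derivative - \<phi>t y (T - t)) (at t within {0..T})" for y t
  proof -
    have 1: "((\<lambda>\<tau>. T - \<tau>) has_real_derivative - 1) (at t within {0..T})" by (auto intro!: derivative_eq_intros)
    show ?thesis
      using DERIV_chain'[OF 1 heat_pot_has_derivative_t[OF h(1) Lam(1) \<sigma> h(3), where x=y]] by simp
  qed
  have main: "0 \<le> integral {T - \<tau>..T} A0 - k * \<phi> y (T - \<tau>)" if k: "k = 1 \<or> k = -1" and y: "0 \<le> y" and \<tau>: "0 \<le> \<tau>" "\<tau> \<le> T" for k y \<tau>
  proof (rule max_principle[where T=T and z="\<lambda>x t. integral {T - t..T} A0 - k * \<phi> x (T - t)" and zx="\<lambda>x t. - k * \<phi>x x (T - t)"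
      and zxx="\<lambda>x t. - k * \<phi>xx x (T - t)" and zt="\<lambda>x t. A0 (T - t) + k * \<phi>t x (T - t)" and a="\<sigma>\<^sup>2/2"
      and B="\<lambda>x t. - odd_ext T (1 / s) F x (T - t)" and c="\<lambda>x t. 0" and K="1/2 + U" and K'=0 and Z=B])
    have ic: "continuous_on {0..T} (\<lambda>t. integral {T - t..T} A0)"
      by (rule DERIV_continuous_on[OF integral_reflect_derivative[OF A0_cont]])
    have "continuous_on (strip T) (\<lambda>p. integral {T - snd p..T} A0)"
      by (rule continuous_on_compose2[OF ic]) (auto intro!: continuous_intros)
    moreover have "continuous_on (strip T) (\<lambda>p. \<phi> (fst p) (T - snd p))"
      by (rule bcont_continuous_on[OF bcont_heat_pot[OF hb(1) Lam(1)]]) (intro continuous_intros)+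
    ultimately show "continuous_on (strip T) (\<lambda>(x, t). integral {T - t..T} A0 - k * \<phi> x (T - t))"
      unfolding case_prod_unfold by (intro continuous_on_diff continuous_on_mult continuous_on_const)
    have inn: "0 \<le> integral {T - t..T} A0" if "0 \<le> t" "t \<le> T" for t
      by (rule integral_nonneg[OF integrable_continuous_real[OF A0_cont]]) (use that A0_nonneg in auto)
    show "- B \<le> integral {T - t..T} A0 - k * \<phi> x (T - t)" if "0 \<le> x" "0 \<le> t" "t \<le> T" for x t
    proof -
      have "\<bar>k * \<phi> x (T - t)\<bar> \<le> B" using \<phi>_le[of "T - t" x] that k by (auto simp: abs_mult)
      then show ?thesis using inn[OF that(2,3)] by linarith
    qed
    show "0 \<le> integral {T - t..T} A0 - k * \<phi> 0 (T - t)" if "0 \<le> t" "t \<le> T" for t using inn[OF that] \<phi>_0 by simp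
    show "0 \<le> integral {T - 0..T} A0 - k * \<phi> x (T - 0)" if "0 \<le> x" for x using \<phi>_S[of T x] S by simp
    show "((\<lambda>y. integral {T - t..T} A0 - k * \<phi> y (T - t)) has_real_derivative - k * \<phi>x x (T - t)) (at x)" for x t
      using DERIV_diff[OF DERIV_const DERIV_cmult[OF pd(1)]] by simp
    show "((\<lambda>y. - k * \<phi>x y (T - t)) has_real_derivative - k * \<phi>xx x (T - t)) (at x)" for x t
      by (rule DERIV_cmult[OF pd(2)])
    show "((\<lambda>\<tau>. integral {T - \<tau>..T} A0 - k * \<phi> x (T - \<tau>)) has_real_derivative A0 (T - t) + k * \<phi>t x (T - t)) (at t within {0..T})" if "0 < x" "0 < t" "t \<le> T" for x t
    proof (rule DERIV_cong[OF DERIV_diff[OF integral_reflect_derivative[OF A0_cont, of t T] DERIV_cmult[OF pt[of x t], of k]]])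
      show "A0 (T - t) - k * - \<phi>t x (T - t) = A0 (T - t) + k * \<phi>t x (T - t)" by algebra
    qed (use that in simp)
    show "\<sigma>\<^sup>2/2 * (- k * \<phi>xx x (T - t)) + - odd_ext T (1 / s) F x (T - t) * (- k * \<phi>x x (T - t)) + 0 * (integral {T - t..T} A0 - k * \<phi> x (T - t)) \<le> A0 (T - t) + k * \<phi>t x (T - t)"
      if "0 < x" "0 < t" "t \<le> T" for x t
    proof -
      have "\<bar>\<phi>t x (T - t) + \<sigma>\<^sup>2/2 * \<phi>xx x (T - t) - odd_ext T (1 / s) F x (T - t) * \<phi>x x (T - t)\<bar> \<le> A0 (T - t)"
        by (rule drift) (use that in auto)
      then have "- k * (\<phi>t x (T - t) + \<sigma>\<^sup>2/2 * \<phi>xx x (T - t) - odd_ext T (1 / s) F x (T - t) * \<phi>x x (T - t)) \<le> A0 (T - t)"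
        using k by (elim disjE) (simp_all add: abs_le_iff)
      then show ?thesis by (simp add: algebra_simps)
    qed
    show "\<bar>- odd_ext T (1 / s) F x (T - t)\<bar> \<le> 1/2 + U" if "0 < x" "0 < t" "t \<le> T" for x t
    proof -
      have "\<bar>F x (T - t) * ramp (1 / s) x\<bar> \<le> (1/2 + U) * 1"
        unfolding abs_mult by (rule mult_mono[OF F_bound ramp(1)]) (use that U_nonneg in auto)
      then show ?thesis using that by (simp add: odd_ext_def tclamp(2))
    qed
  qed (use y \<tau> in auto)
  have "T - t \<in> {0..T}" using t by auto
  then have "0 \<le> integral {t..T} A0 - 1 * \<phi> x t" "0 \<le> integral {t..T} A0 - (-1) * \<phi> x t"
    using main[of 1 x "T - t"] main[of "-1" x "T - t"] x by auto
  then show ?thesis using t by (simp add: P1_def tclamp(2) abs_le_iff)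
qed

lemma n_measurable: "n \<in> borel_measurable borel"
  unfolding n_def[abs_def] by (rule SUP_Rats_measurable[OF \<phi>x_bcont])

lemma \<phi>x_le_n:
  assumes t: "t \<ge> 0" shows "\<bar>\<phi>x x t\<bar> \<le> n t"
  unfolding n_def
  by (rule abs_le_SUP_Rats[OF _ \<phi>x_le[OF t]]) (intro bcont_continuous_on[OF \<phi>x_bcont] continuous_intros)

lemma n_bounds: assumes t: "t \<ge> 0" shows "0 \<le> n t" "n t \<le> B"
proof -
  show "0 \<le> n t" using \<phi>x_le_n[OF t, of 0] by simp
  show "n t \<le> B" unfolding n_def by (rule cSUP_least) (use \<phi>x_le[OF t] Rats_0 in auto)
qed

text \<open>The source h read off from the equation: drift equation, damping term and drift term.
  The last one contains the gradient that is to be bounded, with the factor 1/2 + U.\<close>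

definition "H0 t = A0 t + Lam * P1 t + (1/2 + U) * n t"

lemma h_le: assumes t: "t \<in> {0..T}" shows "\<bar>h x t\<bar> \<le> H0 t"
proof -
  have pos: "\<bar>h x t\<bar> \<le> H0 t" if x: "x \<ge> 0" for x
  proof -
    have "h x t = - (\<phi>t x t + \<sigma>\<^sup>2/2 * \<phi>xx x t - odd_ext T (1 / s) F x t * \<phi>x x t) + Lam * \<phi> x t - odd_ext T (1 / s) F x t * \<phi>x x t"
      by simp
    moreover have "\<bar>Lam * \<phi> x t\<bar> \<le> Lam * P1 t" unfolding abs_mult using \<phi>_le_P1[OF x t] Lam(1) by simp
    moreover have "\<bar>odd_ext T (1 / s) F x t * \<phi>x x t\<bar> \<le> (1/2 + U) * n t"
    proof -
      have "\<bar>F x t * ramp (1 / s) x\<bar> \<le> (1/2 + U) * 1"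
        unfolding abs_mult by (rule mult_mono[OF F_bound[OF x t] ramp(1)]) (use U_nonneg in auto)
      then show ?thesis unfolding abs_mult[of _ "\<phi>x x t"]
        using x t U_nonneg by (intro mult_mono \<phi>x_le_n) (auto simp: odd_ext_def tclamp(2))
    qed
    ultimately show ?thesis unfolding H0_def using drift[OF t x] by linarith
  qed
  \<comment> \<open>The potential averages over the whole line; oddness transfers the bound to x <
    0.\<close>
  show ?thesis using pos[of x] pos[of "- x"] h(2)[of x t] by (cases "x \<ge> 0") auto
qed

lemma measurables: "A0 \<in> borel_measurable borel" "P1 \<in> borel_measurable borel" "\<omega> \<in> borel_measurable borel" "\<zeta> \<in> borel_measurable borel"
  by (intro borel_measurable_continuous_onI A0_cont P1_cont \<omega> \<zeta>_cont)+

lemma bounds: obtains W where "W \<ge> 0" "\<And>t. t \<in> {0..T} \<Longrightarrow> \<bar>\<omega> t\<bar> \<le> W" "\<And>t. t \<in> {0..T} \<Longrightarrow> \<bar>A0 t\<bar> \<le> W" "\<And>t. \<bar>P1 t\<bar> \<le> W"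
proof -
  have bd: "\<exists>a. \<forall>t\<in>{0..T}. \<bar>f t\<bar> \<le> a" if "continuous_on UNIV f" for f :: "real \<Rightarrow> real"
    using compact_imp_bounded[OF compact_continuous_image[OF continuous_on_subset[OF that subset_UNIV] compact_Icc, of 0 T]]
    by (simp add: bounded_iff)
  obtain a where a: "\<forall>t\<in>{0..T}. \<bar>\<omega> t\<bar> \<le> a" using bd[OF \<omega>] by blast
  obtain b where b: "\<forall>t\<in>{0..T}. \<bar>A0 t\<bar> \<le> b" using bd[OF A0_cont] by blast
  obtain c where c: "\<forall>t\<in>{0..T}. \<bar>P1 t\<bar> \<le> c" using bd[OF P1_cont] by blast
  have P1: "P1 t = P1 (tclamp T t)" for t by (simp add: P1_def tclamp(2)[OF tclamp(1)[OF T0]])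
  have "0 \<le> \<bar>\<omega> 0\<bar>" "\<bar>\<omega> 0\<bar> \<le> a" using a T by auto
  then have "a \<ge> 0" by linarith
  show ?thesis
  proof (rule that[of "max a (max b c)"])
    show "\<bar>P1 t\<bar> \<le> max a (max b c)" for t using bspec[OF c tclamp(1)[OF T0, of t]] P1[of t] by simp
  qed (use a b \<open>a \<ge> 0\<close> in \<open>auto simp: le_max_iff_disj\<close>)
qed

lemma wnorm_P1:
  assumes l: "l > 0" shows "wnorm T l P1 \<le> (1 / (l / 2))\<^sup>2 * wnorm T l A0"
proof -
  obtain W where W: "\<And>t. t \<in> {0..T} \<Longrightarrow> \<bar>A0 t\<bar> \<le> W" by (rule bounds) (rule that)
  have l2: "l / 2 > 0" using l by simp
  note k = exp_tail[OF l2]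
  show ?thesis
  proof (rule wnorm_Young[where k="\<lambda>\<tau>. indicator {0<..} \<tau> * exp (- (l / 2) * \<tau>)"])
    show "integrable lborel (\<lambda>\<tau>. indicator {0<..} \<tau> * exp (- (l / 2) * \<tau>))" "(LBINT \<tau>. indicator {0<..} \<tau> * exp (- (l / 2) * \<tau>)) = 1 / (l / 2)"
      using k by (auto simp: has_bochner_integral_iff)
    show "A0 t \<le> W" if "t \<in> {0..T}" for t using W[OF that] by simp
    show "exp (l / 2 * \<tau>) * P1 \<tau> \<le> (LBINT \<tau>'. indicator {0<..} \<tau>' * exp (- (l / 2) * \<tau>') * (indicator {0..T} (\<tau> + \<tau>') * (exp (l / 2 * (\<tau> + \<tau>')) * A0 (\<tau> + \<tau>'))))"
      if "\<tau> \<in> {0..T}" for \<tau>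
      using real_integral_tail_affine[OF A0_cont l that] that by (simp add: P1_def tclamp(2))
  qed (use l measurables A0_nonneg P1_nonneg in auto)
qed

text \<open>The gradient at time t is a convolution of \<open>heat_ker\<close> with values of
  \<open>H0\<close> at later times. The increasing weight may be moved to the later time, and
  Young's inequality applies.\<close>

lemma wnorm_n_H0:
  assumes l: "l > 0" shows "wnorm T l n \<le> (sqrt (pi / Lam) / \<sigma>)\<^sup>2 * wnorm T l H0"
proof -
  obtain W where W: "W \<ge> 0" "\<And>t. t \<in> {0..T} \<Longrightarrow> \<bar>A0 t\<bar> \<le> W" "\<And>t. \<bar>P1 t\<bar> \<le> W" by (rule bounds) (rule that)
  define Hm where "Hm = W + Lam * W + (1/2 + U) * B"
  have H0_le: "0 \<le> H0 t" "H0 t \<le> Hm" if t: "t \<in> {0..T}" for t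
  proof -
    show "0 \<le> H0 t" using h_le[OF t, of 0] by simp
    have "A0 t \<le> W" using W(2)[OF t] by simp
    moreover have "Lam * P1 t \<le> Lam * W" using W(3)[of t] Lam(1) by (intro mult_left_mono) auto
    moreover have "(1/2 + U) * n t \<le> (1/2 + U) * B" using n_bounds(2)[of t] t U_nonneg by (intro mult_left_mono) auto
    ultimately show "H0 t \<le> Hm" unfolding H0_def Hm_def by linarith
  qed
  have Hm0: "Hm \<ge> 0" using H0_le[of 0] T by simp
  have H0_meas: "H0 \<in> borel_measurable borel" unfolding H0_def[abs_def] using measurables n_measurable by simp
  let ?G = "\<lambda>t. indicator {0..T} t * H0 t"
  let ?G2 = "\<lambda>t. indicator {0..T} t * (exp (l / 2 * t) * H0 t)"
  have G: "?G \<in> borel_measurable borel" "\<bar>?G t\<bar> \<le> Hm" for t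
    using H0_meas H0_le[of t] Hm0 by (auto simp: indicator_def)
  have G2: "?G2 \<in> borel_measurable borel" "\<bar>?G2 t\<bar> \<le> exp (\<bar>l / 2\<bar> * \<bar>T\<bar>) * Hm" for t
  proof -
    show "?G2 \<in> borel_measurable borel" using H0_meas by simp
    show "\<bar>?G2 t\<bar> \<le> exp (\<bar>l / 2\<bar> * \<bar>T\<bar>) * Hm"
    proof (cases "t \<in> {0..T}")
      case True
      have "exp (l / 2 * t) * H0 t \<le> exp (\<bar>l / 2\<bar> * \<bar>T\<bar>) * Hm"
        by (rule mult_mono[OF exp_arg_le[OF True] H0_le(2)[OF True]]) (use H0_le[OF True] in auto)
      then show ?thesis using True H0_le(1)[OF True] by simp
    qed (use Hm0 in simp)
  qed
  have hk: "integrable lborel (heat_ker \<sigma> Lam)" "(LBINT \<tau>. heat_ker \<sigma> Lam \<tau>) = sqrt (pi / Lam) / \<sigma>"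
    using heat_ker_integral[OF Lam(1), of \<sigma>] by (auto simp: has_bochner_integral_iff)
  show ?thesis
  proof (rule wnorm_Young[where k="heat_ker \<sigma> Lam", OF heat_ker_nonneg[OF \<sigma>] hk])
    show "0 < sqrt (pi / Lam) / \<sigma>" using Lam(1) \<sigma> by simp
    show "exp (l / 2 * t) * n t \<le> (LBINT \<tau>. heat_ker \<sigma> Lam \<tau> * ?G2 (t + \<tau>))" if t: "t \<in> {0..T}" for t
    proof -
      have "\<bar>\<phi>x x t\<bar> \<le> (LBINT \<tau>. heat_ker \<sigma> Lam \<tau> * ?G (t + \<tau>))" for x
      proof (rule heat_pot_bound_deriv[OF hb(1,2) hd \<sigma> Lam(1) G])
        \<comment> \<open>The source vanishes after T because S \<le> T, so cutting the majorant at
          T loses nothing.\<close>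
        show "\<bar>h y t'\<bar> \<le> ?G t'" if "t \<le> t'" for y t'
          using h_le[of t' y] that t h(3)[of t' y] S by (cases "t' \<le> T") auto
      qed
      then have "n t \<le> (LBINT \<tau>. heat_ker \<sigma> Lam \<tau> * ?G (t + \<tau>))"
        unfolding n_def by (intro cSUP_least) (use Rats_0 in auto)
      then have "exp (l / 2 * t) * n t \<le> exp (l / 2 * t) * (LBINT \<tau>. heat_ker \<sigma> Lam \<tau> * ?G (t + \<tau>))"
        by (intro mult_left_mono) auto
      also have "\<dots> = (LBINT \<tau>. exp (l / 2 * t) * (heat_ker \<sigma> Lam \<tau> * ?G (t + \<tau>)))" by simp
      also have "\<dots> \<le> (LBINT \<tau>. heat_ker \<sigma> Lam \<tau> * ?G2 (t + \<tau>))"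
      proof (rule integral_mono)
        show "integrable lborel (\<lambda>\<tau>. exp (l / 2 * t) * (heat_ker \<sigma> Lam \<tau> * ?G (t + \<tau>)))"
          by (rule integrable_mult_right[OF integrable_heat_ker_mult[OF Lam(1) G]])
        show "integrable lborel (\<lambda>\<tau>. heat_ker \<sigma> Lam \<tau> * ?G2 (t + \<tau>))"
          by (rule integrable_heat_ker_mult[OF Lam(1) G2])
        fix \<tau> :: real
        show "exp (l / 2 * t) * (heat_ker \<sigma> Lam \<tau> * ?G (t + \<tau>)) \<le> heat_ker \<sigma> Lam \<tau> * ?G2 (t + \<tau>)"
        proof (cases "\<tau> > 0 \<and> t + \<tau> \<in> {0..T}")
          case True
          have "exp (l / 2 * t) * (heat_ker \<sigma> Lam \<tau> * H0 (t + \<tau>)) \<le> exp (l / 2 * (t + \<tau>)) * (heat_ker \<sigma> Lam \<tau> * H0 (t + \<tau>))"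
            using True l H0_le(1)[of "t + \<tau>"] heat_ker_nonneg[OF \<sigma>, of Lam \<tau>] by (intro mult_right_mono) auto
          then show ?thesis using True by (simp add: mult_ac)
        next
          case False
          then show ?thesis by (auto simp: heat_ker_def)
        qed
      qed
      finally show ?thesis .
    qed
  qed (use H0_meas H0_le n_measurable n_bounds in auto)
qed

text \<open>\<open>Lam\<close> makes the kernel mass c so small that c (1/2 + U) \<le> 1/4, and the
  gradient returns on the right with the factor 1/8 only. Absorbing it is legitimate since n is
  bounded by B, a constant that enters the result only together with the factor s.\<close>

lemma gradient_estimate:
  assumes l: "0 < l0" "l0 \<le> l"
  shows "wnorm T l n \<le> dual_const l0 * wnorm T l \<omega> + s * ((2 + 8 * Lam\<^sup>2 / l0\<^sup>2) * (4 * U\<^sup>2 * CE l0 * C3 + 4) * wnorm T l (\<lambda>t. 1))"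
proof -
  have lp: "l > 0" using l by simp
  obtain W where W: "W \<ge> 0" "\<And>t. t \<in> {0..T} \<Longrightarrow> \<bar>\<omega> t\<bar> \<le> W" "\<And>t. t \<in> {0..T} \<Longrightarrow> \<bar>A0 t\<bar> \<le> W" "\<And>t. \<bar>P1 t\<bar> \<le> W" by (rule bounds) (rule that)
  define c where "c = sqrt (pi / Lam) / \<sigma>"
  define Q where "Q = wnorm T l (\<lambda>t. 1)"
  have Q: "Q \<ge> 0" unfolding Q_def by (rule wnorm_nonneg)
  have K: "1/2 + 3 / 2 * U > 0" using U_nonneg by simp
  have c: "c \<ge> 0" "c \<le> 1 / 2" "c * (1/2 + U) \<le> 1 / 4"
    unfolding c_def Lam(2) using U_nonneg by (simp_all add: divide_simps)
  have A: "wnorm T l A0 \<le> 2 * wnorm T l \<omega> + 4 * U\<^sup>2 * wnorm T l \<zeta> + 4 * s * Q"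
  proof -
    have z: "\<bar>\<bar>\<zeta> t\<bar>\<bar> \<le> B / 2" "\<bar>U * \<bar>\<zeta> t\<bar>\<bar> \<le> U * (B / 2)" "\<bar>U * \<bar>\<zeta> t\<bar> + s\<bar> \<le> U * (B / 2) + s" if "t \<in> {0..T}" for t
    proof -
      have "0 \<le> U * \<bar>\<zeta> t\<bar>" using U_nonneg by simp
      moreover have "U * \<bar>\<zeta> t\<bar> \<le> U * (B / 2)" using \<zeta>_le[of t] that U_nonneg by (intro mult_left_mono) auto
      ultimately show "\<bar>\<bar>\<zeta> t\<bar>\<bar> \<le> B / 2" "\<bar>U * \<bar>\<zeta> t\<bar>\<bar> \<le> U * (B / 2)" "\<bar>U * \<bar>\<zeta> t\<bar> + s\<bar> \<le> U * (B / 2) + s"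
        using \<zeta>_le[of t] that s by auto
    qed
    have "wnorm T l (\<lambda>t. \<omega> t + (U * \<bar>\<zeta> t\<bar> + s)) \<le> 2 * wnorm T l \<omega> + 2 * wnorm T l (\<lambda>t. U * \<bar>\<zeta> t\<bar> + s)"
      by (rule wnorm_le_add[OF _ W(2) _ z(3)]) (use measurables in simp_all)
    also have "wnorm T l (\<lambda>t. U * \<bar>\<zeta> t\<bar> + s) \<le> 2 * wnorm T l (\<lambda>t. U * \<bar>\<zeta> t\<bar>) + 2 * wnorm T l (\<lambda>t. s)"
      by (rule wnorm_le_add[OF _ z(2), where B=s]) (use measurables s in simp_all)
    also have "\<dots> = 2 * (U\<^sup>2 * wnorm T l (\<lambda>t. \<bar>\<zeta> t\<bar>)) + 2 * (s\<^sup>2 * Q)"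
      using wnorm_cmult[of T l s "\<lambda>t. 1"] unfolding wnorm_cmult[of T l U] Q_def by simp
    also have "wnorm T l (\<lambda>t. \<bar>\<zeta> t\<bar>) = wnorm T l \<zeta>" by (simp add: wnorm_def)
    finally have "wnorm T l (\<lambda>t. \<omega> t + (U * \<bar>\<zeta> t\<bar> + s)) \<le> 2 * wnorm T l \<omega> + 2 * (2 * (U\<^sup>2 * wnorm T l \<zeta>) + 2 * (s\<^sup>2 * Q))" by simp
    moreover have "s\<^sup>2 * Q \<le> s * Q" using s Q by (intro mult_right_mono) (simp_all add: power2_eq_square mult_left_le)
    moreover have "(\<lambda>t. \<omega> t + (U * \<bar>\<zeta> t\<bar> + s)) = A0" by (rule ext) (simp add: A0_def)
    ultimately show ?thesis by simp
  qed
  have AP: "wnorm T l (\<lambda>t. A0 t + Lam * P1 t) \<le> (2 + 8 * Lam\<^sup>2 / l0\<^sup>2) * wnorm T l A0"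
  proof -
    have "\<bar>Lam * P1 t\<bar> \<le> Lam * W" for t using W(4)[of t] Lam(1) by (simp add: abs_mult)
    then have "wnorm T l (\<lambda>t. A0 t + Lam * P1 t) \<le> 2 * wnorm T l A0 + 2 * wnorm T l (\<lambda>t. Lam * P1 t)"
      by (intro wnorm_le_add[OF measurables(1) W(3)]) (use measurables in simp_all)
    also have "\<dots> \<le> 2 * wnorm T l A0 + 2 * (Lam\<^sup>2 * ((1 / (l / 2))\<^sup>2 * wnorm T l A0))"
      unfolding wnorm_cmult by (intro add_left_mono mult_left_mono wnorm_P1 lp) auto
    also have "\<dots> = (2 + 8 * Lam\<^sup>2 / l\<^sup>2) * wnorm T l A0" using lp by (simp add: field_simps power2_eq_square)
    also have "\<dots> \<le> (2 + 8 * Lam\<^sup>2 / l0\<^sup>2) * wnorm T l A0"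
    proof (intro mult_right_mono add_left_mono wnorm_nonneg divide_left_mono)
      show "l0\<^sup>2 \<le> l\<^sup>2" using l by (intro power_mono) auto
    qed (use l lp in auto)
    finally show ?thesis .
  qed
  have n: "wnorm T l n \<le> wnorm T l (\<lambda>t. A0 t + Lam * P1 t)"
  proof -
    have b1: "\<bar>A0 t + Lam * P1 t\<bar> \<le> W + Lam * W" if "t \<in> {0..T}" for t
    proof -
      have "\<bar>Lam * P1 t\<bar> \<le> Lam * W" using W(4)[of t] Lam(1) by (simp add: abs_mult)
      then show ?thesis using W(3)[OF that] by linarith
    qed
    have b2: "\<bar>(1/2 + U) * n t\<bar> \<le> (1/2 + U) * B" if "t \<in> {0..T}" for t
      unfolding abs_mult using n_bounds[of t] that U_nonneg by (intro mult_mono) auto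
    have "wnorm T l H0 \<le> 2 * wnorm T l (\<lambda>t. A0 t + Lam * P1 t) + 2 * wnorm T l (\<lambda>t. (1/2 + U) * n t)"
      unfolding H0_def[abs_def] by (rule wnorm_le_add[OF _ b1 _ b2]) (use measurables n_measurable in simp_all)
    then have "c\<^sup>2 * wnorm T l H0 \<le> c\<^sup>2 * (2 * wnorm T l (\<lambda>t. A0 t + Lam * P1 t) + 2 * ((1/2 + U)\<^sup>2 * wnorm T l n))"
      unfolding wnorm_cmult by (rule mult_left_mono) simp
    also have "\<dots> = 2 * (c\<^sup>2 * wnorm T l (\<lambda>t. A0 t + Lam * P1 t)) + 2 * ((c * (1/2 + U))\<^sup>2 * wnorm T l n)"
      unfolding power_mult_distrib[of c] by (simp only: distrib_left mult_ac)
    also have "\<dots> \<le> 2 * ((1/2)\<^sup>2 * wnorm T l (\<lambda>t. A0 t + Lam * P1 t)) + 2 * ((1/4)\<^sup>2 * wnorm T l n)"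
      using c U_nonneg by (intro add_mono mult_left_mono mult_right_mono power_mono wnorm_nonneg) auto
    finally have "c\<^sup>2 * wnorm T l H0 \<le> 1 / 2 * wnorm T l (\<lambda>t. A0 t + Lam * P1 t) + 1 / 8 * wnorm T l n"
      by (simp add: power2_eq_square)
    then show ?thesis using wnorm_n_H0[OF lp] wnorm_nonneg[of T l "\<lambda>t. A0 t + Lam * P1 t"] wnorm_nonneg[of T l n] unfolding c_def by linarith
  qed
  have Z: "wnorm T l \<zeta> \<le> CE l0 * (wnorm T l \<omega> / l0 + s * C3 * Q)"
  proof -
    have "wnorm T l \<zeta> \<le> CE l0 * (wnorm T l \<omega> / l + s * C3 * Q)" unfolding Q_def by (rule \<zeta>_wnorm[OF l])
    also have "\<dots> \<le> CE l0 * (wnorm T l \<omega> / l0 + s * C3 * Q)"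
    proof (intro mult_left_mono add_right_mono divide_left_mono wnorm_nonneg)
      show "0 \<le> CE l0" by (simp add: CE_def)
    qed (use l lp in auto)
    finally show ?thesis .
  qed
  define k where "k = 2 + 8 * Lam\<^sup>2 / l0\<^sup>2"
  have k: "k \<ge> 0" by (simp add: k_def)
  have "wnorm T l n \<le> k * wnorm T l A0" using order_trans[OF n AP] by (simp add: k_def)
  also have "\<dots> \<le> k * (2 * wnorm T l \<omega> + 4 * U\<^sup>2 * (CE l0 * (wnorm T l \<omega> / l0 + s * C3 * Q)) + 4 * s * Q)"
    by (intro mult_left_mono k order_trans[OF A] add_mono Z order_refl) simp
  also have "\<dots> = dual_const l0 * wnorm T l \<omega> + s * (k * (4 * U\<^sup>2 * CE l0 * C3 + 4) * Q)"
    using l(1) by (simp add: dual_const_def k_def[symmetric] field_simps)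
  finally show ?thesis unfolding k_def Q_def .
qed

end

context mfg begin

text \<open>What the duality argument uses of an approximate dual solution. B and C come first in
  the choice of constants and are uniform as s tends to 0.\<close>

definition "dual_pair l l0 S \<psi> \<omega> B C s \<phi> \<phi>x \<phi>xx \<phi>t n \<longleftrightarrow> C21 T \<phi> \<phi>x \<phi>xx \<phi>t \<and>
    (\<forall>t. \<phi> 0 t = 0) \<and> (\<forall>x t. S \<le> t \<longrightarrow> \<phi> x t = 0) \<and> n \<in> borel_measurable borel \<and>
    (\<forall>x\<ge>0. \<forall>t\<in>{0..T}. \<bar>\<phi>x x t\<bar> \<le> n t) \<and> (\<forall>t\<in>{0..T}. 0 \<le> n t \<and> n t \<le> B) \<and> wnorm T l n \<le> dual_const l0 * wnorm T l \<omega> + s * C \<and>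
    (\<forall>x\<ge>0. \<forall>t\<in>{0..T}. \<bar>\<phi>t x t + \<sigma>\<^sup>2/2 * \<phi>xx x t - F x t * \<phi>x x t + \<psi> x t - 1/2 * (\<beta> t * E t (\<lambda>x. \<phi>x x t)) * D_x u x t\<bar>
       \<le> s + (1/2 + 3/2 * U) * B * (1 - ramp (1 / s) x))"

lemma dual_exists:
  assumes \<psi>: "bcont \<psi>" "ucont_x \<psi>" "\<And>x t. \<psi> (- x) t = - \<psi> x t" "\<And>x t. S \<le> t \<Longrightarrow> \<psi> x t = 0" "\<And>x t. 0 \<le> x \<Longrightarrow> t \<in> {0..T} \<Longrightarrow> \<bar>\<psi> x t\<bar> \<le> \<omega> t"
    and \<omega>: "continuous_on UNIV \<omega>" and S: "S \<le> T" and l: "0 < l0" "l0 \<le> l"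
  obtains B C s0 where "B \<ge> 0" "C \<ge> 0" "s0 > 0" "\<And>s. 0 < s \<Longrightarrow> s \<le> s0 \<Longrightarrow> \<exists>\<phi> \<phi>x \<phi>xx \<phi>t n. dual_pair l l0 S \<psi> \<omega> B C s \<phi> \<phi>x \<phi>xx \<phi>t n"
proof -
  obtain V where V: "\<And>x t. 0 \<le> x \<Longrightarrow> t \<in> {0..T} \<Longrightarrow> \<bar>D_xx u x t\<bar> \<le> V" using bounded_stripD[OF u_bdd(3)] by metis
  obtain Mm where Mm: "\<And>x t. 0 \<le> x \<Longrightarrow> t \<in> {0..T} \<Longrightarrow> \<bar>m x t\<bar> \<le> Mm" using bounded_stripD[OF m_bdd(1)] by metis
  obtain B where B: "B \<ge> 0" and ex: "\<And>s. 0 < s \<Longrightarrow> s \<le> 1 \<Longrightarrow> \<exists>h h1 h2. approx_dual S \<psi> s B h h1 h2"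
    by (rule ex_dual[OF \<psi>(1-4)]) (assumption | rule that)+
  define C2 where "C2 = 1 + (1/2 + 3/2 * U) * B * Mm + B / 2 * V"
  define C3 where "C3 = 2 * (B + T * (B / 2) * U) * (C2 + T * (B / 2) * (V\<^sup>2 / 4))"
  define C where "C = (2 + 8 * Lam\<^sup>2 / l0\<^sup>2) * (4 * U\<^sup>2 * CE l0 * C3 + 4) * wnorm T l (\<lambda>t. 1)"
  \<comment> \<open>Ensures U s V^2 T \<le> 2; the summand 1 keeps the denominator positive when U
    or V is 0.\<close>
  define s0 where "s0 = min 1 (2 / (U * V\<^sup>2 * T + 1))"
  have V0: "V \<ge> 0" "Mm \<ge> 0" using V[of 0 0] Mm[of 0 0] T by auto
  have UVT: "U * V\<^sup>2 * T \<ge> 0" using U_nonneg T by simp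
  have s0: "s0 > 0" using UVT by (simp add: s0_def)
  have "C \<ge> 0" unfolding C_def C3_def C2_def CE_def using V0 B U_nonneg T wnorm_nonneg l by simp
  show ?thesis
  proof (rule that[OF B \<open>C \<ge> 0\<close> s0])
    fix s :: real assume s: "0 < s" "s \<le> s0"
    have s1: "s \<le> 1" using s by (simp add: s0_def)
    have "s * (U * V\<^sup>2 * T + 1) \<le> 2" using s UVT by (simp add: s0_def pos_le_divide_eq)
    then have small: "U * s * V\<^sup>2 * T \<le> 2" using s by (simp add: algebra_simps)
    from ex[OF s(1) s1] obtain h h1 h2 where "approx_dual S \<psi> s B h h1 h2" by blast
    note h = this[unfolded approx_dual_def]
    interpret D: dual_approx \<sigma> r T \<xi> m\<^sub>0 u\<^sub>T \<epsilon> u m s S V B Mm \<psi> h h1 h2 \<omega>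
      by unfold_locales (use s s1 small V Mm \<psi> \<omega> S h in auto)
    have C3: "D.C3 = C3" by (simp add: D.C3_def D.C2_def C3_def C2_def)
    show "\<exists>\<phi> \<phi>x \<phi>xx \<phi>t n. dual_pair l l0 S \<psi> \<omega> B C s \<phi> \<phi>x \<phi>xx \<phi>t n"
      unfolding dual_pair_def
    proof (intro exI conjI allI impI ballI)
      show "C21 T D.\<phi> D.\<phi>x D.\<phi>xx D.\<phi>t" by (rule D.\<phi>_C21)
      show "D.\<phi> 0 t = 0" for t by (rule D.\<phi>_0)
      show "D.\<phi> x t = 0" if "S \<le> t" for x t by (rule D.\<phi>_S[OF that])
      show "D.n \<in> borel_measurable borel" by (rule D.n_measurable)
      show "\<bar>D.\<phi>x x t\<bar> \<le> D.n t" if "t \<in> {0..T}" for x t using D.\<phi>x_le_n[of t x] that by simp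
      show "0 \<le> D.n t" "D.n t \<le> B" if "t \<in> {0..T}" for t using D.n_bounds[of t] that by simp_all
      show "wnorm T l D.n \<le> dual_const l0 * wnorm T l \<omega> + s * C" using D.gradient_estimate[OF l] unfolding C3 C_def .
      show "\<bar>D.\<phi>t x t + \<sigma>\<^sup>2/2 * D.\<phi>xx x t - F x t * D.\<phi>x x t + \<psi> x t - 1/2 * (\<beta> t * E t (\<lambda>x. D.\<phi>x x t)) * D_x u x t\<bar>
         \<le> s + (1/2 + 3/2 * U) * B * (1 - ramp (1 / s) x)" if "x \<ge> 0" "t \<in> {0..T}" for x t
        using D.residual[OF that] that by (simp add: Jop_def tclamp(2))
    qed
  qed
qed

end

section \<open>Testing the linear equation\<close>

lemma pos_part_power_derivative:
  fixes z :: real assumes k: "k > 0"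
  shows "((\<lambda>z. max 0 z ^ Suc k) has_real_derivative real (Suc k) * max 0 z ^ k) (at z)"
proof (cases z "0::real" rule: linorder_cases)
  case less
  have "((\<lambda>z. max 0 z ^ Suc k) has_real_derivative 0) (at z)"
    by (rule has_field_derivative_transform_within_open[of "\<lambda>z. 0" _ _ "{..<0}"]) (use less in auto)
  then show ?thesis by (rule DERIV_cong) (use less k in simp)
next
  case equal
  have "\<exists>g. (\<forall>x. max 0 x ^ Suc k - max 0 z ^ Suc k = g x * (x - z)) \<and> isCont g z \<and> g z = real (Suc k) * max 0 z ^ k"
  proof (intro exI[of _ "\<lambda>x. max 0 x ^ k"] conjI allI)
    show "isCont (\<lambda>x. max 0 x ^ k) z" by (intro continuous_power continuous_max continuous_const continuous_ident)
  qed (use equal k in \<open>auto simp: max_def\<close>)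
  then show ?thesis by (simp only: CARAT_DERIV)
next
  case greater
  have "((\<lambda>z. z ^ Suc k) has_real_derivative real (Suc k) * z ^ k) (at z)"
    using DERIV_pow[of "Suc k" z UNIV] by simp
  then have "((\<lambda>z. max 0 z ^ Suc k) has_real_derivative real (Suc k) * z ^ k) (at z)"
    by (rule has_field_derivative_transform_within_open[of _ _ _ "{0<..}"]) (use greater in auto)
  then show ?thesis using greater by (simp add: max_def)
qed

definition bump :: "real \<Rightarrow> real \<Rightarrow> real" where "bump R x = max 0 (1 - (x / R)\<^sup>2)"
text \<open>The third power is the lowest power of a positive part with two continuous derivatives,
  as a test function requires.\<close>

definition cutoff :: "real \<Rightarrow> real \<Rightarrow> real \<Rightarrow> real" where "cutoff R x t = bump R x ^ 3"
definition cutoff_x :: "real \<Rightarrow> real \<Rightarrow> real \<Rightarrow> real" where "cutoff_x R x t = 3 * bump R x ^ 2 * (- 2 * x / R\<^sup>2)"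
definition cutoff_xx :: "real \<Rightarrow> real \<Rightarrow> real \<Rightarrow> real" where
  "cutoff_xx R x t = 3 * (2 * bump R x * (- 2 * x / R\<^sup>2)) * (- 2 * x / R\<^sup>2) + (- 2 / R\<^sup>2) * (3 * bump R x ^ 2)"

lemma bump: "0 \<le> bump R x" "bump R x \<le> 1" "R > 0 \<Longrightarrow> R \<le> x \<Longrightarrow> bump R x = 0"
proof -
  show "R > 0 \<Longrightarrow> R \<le> x \<Longrightarrow> bump R x = 0" using power_mono[of 1 "x / R" 2] by (simp add: bump_def)
qed (simp_all add: bump_def)

lemma bump_abs: "bump R \<bar>x\<bar> = bump R x" by (simp add: bump_def power_divide)

lemma bump_mult_le: assumes "R > 0" "k > 0" shows "\<bar>bump R x ^ k * x\<bar> \<le> R"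
proof (cases "\<bar>x\<bar> \<le> R")
  case True
  have "bump R x ^ k \<le> 1" using bump by (intro power_le_one) auto
  then have "\<bar>bump R x ^ k\<bar> * \<bar>x\<bar> \<le> 1 * R" using True bump by (intro mult_mono) auto
  then show ?thesis by (simp add: abs_mult)
next
  case False
  then have "bump R x = 0" using bump(3)[OF assms(1), of "\<bar>x\<bar>"] by (simp add: bump_abs)
  then show ?thesis using assms by (simp add: zero_power)
qed

lemma cutoff_bounds:
  assumes R: "R \<ge> 1"
  shows "\<bar>cutoff R x t\<bar> \<le> 1" "\<bar>cutoff_x R x t\<bar> \<le> 6 / R" "\<bar>cutoff_xx R x t\<bar> \<le> 30 / R"
proof -
  have Rp: "R > 0" using R by simp
  show "\<bar>cutoff R x t\<bar> \<le> 1" unfolding cutoff_def using bump[of R x] by (simp add: power_le_one)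
  have b: "\<bar>bump R x ^ 2 * x\<bar> \<le> R" "\<bar>x\<bar> \<le> R \<or> bump R x = 0" "bump R x ^ 2 \<le> 1"
    using bump_mult_le[OF Rp, of 2 x] bump(3)[OF Rp, of "\<bar>x\<bar>"] linear[of "\<bar>x\<bar>" R] bump(1,2)[of R x]
    by (auto simp: bump_abs intro!: power_le_one)
  have b1: "\<bar>bump R x * x\<bar> \<le> R" using bump_mult_le[OF Rp, of 1 x] by simp
  have "\<bar>cutoff_x R x t\<bar> = 6 * \<bar>bump R x ^ 2 * x\<bar> / R\<^sup>2" by (simp add: cutoff_x_def abs_mult)
  also have "\<dots> \<le> 6 * R / R\<^sup>2" using b(1) by (intro divide_right_mono mult_left_mono) auto
  also have "\<dots> = 6 / R" using Rp by (simp add: power2_eq_square)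
  finally show "\<bar>cutoff_x R x t\<bar> \<le> 6 / R" .
  have xx: "\<bar>bump R x * x * x\<bar> \<le> R * R"
  proof (cases "bump R x = 0")
    case False
    then show ?thesis unfolding abs_mult[of "bump R x * x"] using b1 b(2) Rp by (intro mult_mono) auto
  qed (use Rp in simp)
  have "\<bar>cutoff_xx R x t\<bar> \<le> 24 * \<bar>bump R x * x * x\<bar> / (R\<^sup>2 * R\<^sup>2) + 6 * bump R x ^ 2 / R\<^sup>2"
  proof -
    have "cutoff_xx R x t = 24 * (bump R x * x * x) / (R\<^sup>2 * R\<^sup>2) + (- (6 * bump R x ^ 2 / R\<^sup>2))"
      by (simp add: cutoff_xx_def)
    then have "\<bar>cutoff_xx R x t\<bar> \<le> \<bar>24 * (bump R x * x * x) / (R\<^sup>2 * R\<^sup>2)\<bar> + \<bar>- (6 * bump R x ^ 2 / R\<^sup>2)\<bar>" by (simp only: abs_triangle_ineq)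
    then show ?thesis by (simp add: abs_mult)
  qed
  also have "\<dots> \<le> 24 * (R * R) / (R\<^sup>2 * R\<^sup>2) + 6 * 1 / R\<^sup>2"
    using xx b(3) by (intro add_mono divide_right_mono mult_left_mono) auto
  also have "\<dots> = 30 / R / R" using Rp by (simp add: power2_eq_square field_simps)
  also have "\<dots> \<le> 30 / R / 1" using R by (intro divide_left_mono) auto
  finally show "\<bar>cutoff_xx R x t\<bar> \<le> 30 / R" by simp
qed

lemma C21_cutoff:
  assumes R: "R \<ge> 1" shows "C21 T (cutoff R) (cutoff_x R) (cutoff_xx R) (\<lambda>x t. 0)"
proof -
  have b: "((\<lambda>y. 1 - (y / R)\<^sup>2) has_real_derivative - 2 * x / R\<^sup>2) (at x)" for x
    using R by (auto intro!: derivative_eq_intros simp: power2_eq_square)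
  have p3: "((\<lambda>y. bump R y ^ 3) has_real_derivative 3 * bump R x ^ 2 * (- 2 * x / R\<^sup>2)) (at x)" for x
    using DERIV_chain2[OF pos_part_power_derivative[of 2] b] by (simp add: bump_def numeral_eq_Suc)
  have p2: "((\<lambda>y. bump R y ^ 2) has_real_derivative 2 * bump R x * (- 2 * x / R\<^sup>2)) (at x)" for x
    using DERIV_chain2[OF pos_part_power_derivative[of 1] b] by (simp add: bump_def numeral_eq_Suc)
  have c: "((\<lambda>y. - 2 * y / R\<^sup>2) has_real_derivative - 2 / R\<^sup>2) (at x)" for x
    by (rule DERIV_cong[OF DERIV_cdivide[OF DERIV_cmult[OF DERIV_ident]]]) simp
  have p2x: "((\<lambda>y. 3 * bump R y ^ 2 * (- 2 * y / R\<^sup>2)) has_real_derivative 3 * (2 * bump R x * (- 2 * x / R\<^sup>2)) * (- 2 * x / R\<^sup>2) + (- 2 / R\<^sup>2) * (3 * bump R x ^ 2)) (at x)" for x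
    by (rule DERIV_mult[OF DERIV_cmult[OF p2] c])
  have bc: "continuous_on A (\<lambda>p. bump R (f p))" if "continuous_on A f" for A :: "(real \<times> real) set" and f
    unfolding bump_def using that R by (auto intro!: continuous_intros)
  have R0: "R\<^sup>2 \<noteq> 0" using R by simp
  note cis = continuous_on_add continuous_on_mult continuous_on_divide continuous_on_power continuous_on_const continuous_on_fst[OF continuous_on_id] bc[OF continuous_on_fst[OF continuous_on_id]]
  show ?thesis unfolding C21_def
  proof (intro conjI allI impI ballI)
    show "bstrip T (cutoff R)"
      by (rule bstripI[OF _ cutoff_bounds(1)[OF R]]) (unfold cutoff_def, intro cis)
    show "bstrip T (cutoff_x R)"
      by (rule bstripI[OF _ cutoff_bounds(2)[OF R]]) (unfold cutoff_x_def, intro cis ballI R0)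
    show "bstrip T (cutoff_xx R)"
      by (rule bstripI[OF _ cutoff_bounds(3)[OF R]]) (unfold cutoff_xx_def, intro cis ballI R0)
    show "((\<lambda>y. cutoff R y t) has_real_derivative cutoff_x R x t) (at x within {0..})" for x t
      unfolding cutoff_def cutoff_x_def by (rule has_field_derivative_at_within[OF p3])
    show "((\<lambda>y. cutoff_x R y t) has_real_derivative cutoff_xx R x t) (at x within {0..})" for x t
      unfolding cutoff_x_def cutoff_xx_def by (rule has_field_derivative_at_within[OF p2x])
    show "((\<lambda>s. cutoff R x s) has_real_derivative 0) (at t within {0..T})" for x t
      unfolding cutoff_def by simp
  qed (rule bstrip_const)
qed

lemma C21_D:
  assumes f: "C21 T f fx fxx ft" and T: "T > 0" and x: "x \<ge> 0" "t \<in> {0..T}"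
  shows "D_x f x t = fx x t" "D_xx f x t = fxx x t" "D_t T f x t = ft x t"
    and "(\<lambda>y. f y t) differentiable (at x within {0..})" "(\<lambda>y. D_x f y t) differentiable (at x within {0..})" "(\<lambda>s. f x s) differentiable (at t within {0..T})"
proof -
  have d: "((\<lambda>y. f y t) has_real_derivative fx x t) (at x within {0..})" "((\<lambda>y. fx y t) has_real_derivative fxx x t) (at x within {0..})"
    "((\<lambda>s. f x s) has_real_derivative ft x t) (at t within {0..T})" if "x \<ge> 0" for x
    using f that x(2) by (auto simp: C21_def)
  have dI: "g differentiable (at z within S)" if "(g has_real_derivative d) (at z within S)" for g d z S
    using that unfolding differentiable_def has_field_derivative_def by blast
  have D1: "D_x f y t = fx y t" if "y \<ge> 0" for y by (rule D_x_eqI) (rule d(1)[OF that], rule that)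
  show "D_x f x t = fx x t" by (rule D1[OF x(1)])
  have d2: "((\<lambda>y. D_x f y t) has_real_derivative fxx x t) (at x within {0..})"
    by (rule has_field_derivative_transform_within[OF d(2)[OF x(1)] zero_less_one]) (use x D1 in simp_all)
  show "D_xx f x t = fxx x t" by (rule D_x_eqI) (rule d2, rule x(1))
  show "D_t T f x t = ft x t" by (rule D_t_eqI) (rule d(3)[OF x(1)], rule x(2), rule T)
  show "(\<lambda>y. f y t) differentiable (at x within {0..})" "(\<lambda>y. D_x f y t) differentiable (at x within {0..})" "(\<lambda>s. f x s) differentiable (at t within {0..T})"
    by (rule dI[OF d(1)[OF x(1)]], rule dI[OF d2], rule dI[OF d(3)[OF x(1)]])
qed

lemma C21_test_function:
  assumes f: "C21 T f fx fxx ft" and T: "T > 0" and 0: "\<And>t. t \<in> {0..T} \<Longrightarrow> f 0 t = 0"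
    and S: "S < T" and z: "\<And>x t. 0 \<le> x \<Longrightarrow> t \<in> {0..T} \<Longrightarrow> R \<le> x \<or> S \<le> t \<Longrightarrow> f x t = 0"
  shows "test_function T f"
proof -
  have c: "continuous_on (strip T) (\<lambda>(x, t). g x t)" if h: "bstrip T h" and e: "\<And>x t. x \<ge> 0 \<Longrightarrow> t \<in> {0..T} \<Longrightarrow> g x t = h x t" for g h
  proof (rule continuous_on_eq)
    show "continuous_on (strip T) (\<lambda>(x, t). h x t)" using h by (simp add: bstrip_def)
    show "(case p of (x, t) \<Rightarrow> h x t) = (case p of (x, t) \<Rightarrow> g x t)" if "p \<in> strip T" for p
      using that e[of "fst p" "snd p"] by (simp add: case_prod_unfold mem_Times_iff)
  qed
  have b: "bstrip T f" "bstrip T fx" "bstrip T fxx" "bstrip T ft" using f by (auto simp: C21_def)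
  have c': "continuous_on (strip T) (\<lambda>(x, t). f x t)" "continuous_on (strip T) (\<lambda>(x, t). D_x f x t)"
    "continuous_on (strip T) (\<lambda>(x, t). D_xx f x t)" "continuous_on (strip T) (\<lambda>(x, t). D_t T f x t)"
    by (rule c[OF b(1) refl], rule c[OF b(2) C21_D(1)[OF f T]], assumption+, rule c[OF b(3) C21_D(2)[OF f T]], assumption+, rule c[OF b(4) C21_D(3)[OF f T]], assumption+)
  have "\<exists>R S. S < T \<and> (\<forall>x\<ge>0. \<forall>t\<in>{0..T}. R \<le> x \<or> S \<le> t \<longrightarrow> f x t = 0)" using S z by blast
  then show ?thesis unfolding test_function_def differentiable_21_def using c' 0 C21_D(4,5,6)[OF f T] by simp
qed

section \<open>Weak solutions, restriction to the strip and Fubini\<close>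

abbreviation "Omega T \<equiv> {0<..} \<times> {0<..<T::real} :: (real \<times> real) set"

text \<open>Extension by zero from the open strip: all integrals then run over the whole plane or
  line, and sections and Fubini need no domains.\<close>

definition res :: "real \<Rightarrow> (real \<Rightarrow> real \<Rightarrow> real) \<Rightarrow> real \<times> real \<Rightarrow> real" where
  "res T f p = indicator (Omega T) p * f (fst p) (snd p)"

lemma res_cong: "(\<And>x t. x \<ge> 0 \<Longrightarrow> t \<in> {0..T} \<Longrightarrow> f x t = g x t) \<Longrightarrow> res T f = res T g"
  by (rule ext) (auto simp: res_def indicator_def)

lemma Omega_sets: "Omega T \<in> sets borel"
  by (intro borel_open open_Times) auto

lemma bstrip_res:
  assumes g: "bstrip T g"
  shows "res T g \<in> borel_measurable borel" "\<exists>B. \<forall>p. \<bar>res T g p\<bar> \<le> B"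
proof -
  have "continuous_on (Omega T) (\<lambda>p. g (fst p) (snd p))"
    by (rule continuous_on_subset[OF bstrip_cont[OF g]]) auto
  from borel_measurable_continuous_on_indicator[OF Omega_sets this]
  show "res T g \<in> borel_measurable borel" by (simp add: res_def[abs_def])
  obtain C where C: "C \<ge> 0" "\<And>x t. 0 \<le> x \<Longrightarrow> t \<in> {0..T} \<Longrightarrow> \<bar>g x t\<bar> \<le> C" using g by (elim bstripD) (rule that)
  show "\<exists>B. \<forall>p. \<bar>res T g p\<bar> \<le> B"
    by (rule exI[of _ C]) (use C in \<open>auto simp: res_def indicator_def\<close>)
qed

lemma set_integral_res:
  "set_lebesgue_integral lborel (Omega T) (\<lambda>(x, t). f x t * g x t) = (LBINT p. res T f p * res T g p)"
  unfolding set_lebesgue_integral_def res_def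
  by (rule Bochner_Integration.integral_cong) (auto simp: indicator_def)

lemma set_integrable_res: "set_integrable lborel (Omega T) (\<lambda>(x, t). f x t) \<longleftrightarrow> integrable lborel (res T f)"
  by (simp add: set_integrable_def res_def[abs_def] case_prod_unfold)

lemma tendsto_integral_mult_bounded:
  fixes g :: "'a \<Rightarrow> real"
  assumes g: "integrable M g" and a: "\<And>n. a n \<in> borel_measurable M" "b \<in> borel_measurable M"
    and B: "\<And>n x. \<bar>a n x\<bar> \<le> B" and lim: "AE x in M. (\<lambda>n. a n x) \<longlonglongrightarrow> b x"
  shows "(\<lambda>n. \<integral>x. g x * a n x \<partial>M) \<longlonglongrightarrow> (\<integral>x. g x * b x \<partial>M)"
proof (rule integral_dominated_convergence[where w="\<lambda>x. B * norm (g x)"])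
  show "integrable M (\<lambda>x. B * norm (g x))" using g by simp
  show "AE x in M. norm (g x * a n x) \<le> B * norm (g x)" for n
  proof (rule AE_I2)
    fix x show "norm (g x * a n x) \<le> B * norm (g x)"
      using mult_right_mono[OF B[of n x], of "\<bar>g x\<bar>"] by (simp add: abs_mult mult.commute)
  qed
  show "AE x in M. (\<lambda>n. g x * a n x) \<longlonglongrightarrow> g x * b x"
    using lim by eventually_elim (intro tendsto_mult tendsto_const)
qed (use g a in auto)

text \<open>Test functions have compact support, dual solutions need not decay in x. Cutting off at
  R costs derivatives of the cutoff; these are of order 1/R and multiply bounded functions, while
  the integrability of \<mu> and q dominates the limit.\<close>

lemma FP_identity:
  assumes sol: "FP_solution \<sigma> T F q \<mu>" and F: "bstrip T F" and \<phi>: "C21 T \<phi> \<phi>x \<phi>xx \<phi>t" and T: "T > 0"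
    and 0: "\<And>t. \<phi> 0 t = 0" and S: "S < T" and z: "\<And>x t. S \<le> t \<Longrightarrow> \<phi> x t = 0"
  shows "(LBINT p. res T \<mu> p * res T (\<lambda>x t. \<phi>t x t + \<sigma>\<^sup>2/2 * \<phi>xx x t - F x t * \<phi>x x t) p) = (LBINT p. res T q p * res T \<phi>x p)"
proof -
  define R where "R = (\<lambda>n. real n + 1)"
  have R: "R n \<ge> 1" for n by (simp add: R_def)
  define f where "f = (\<lambda>n x t. \<phi> x t * cutoff (R n) x t)"
  define fx where "fx = (\<lambda>n x t. \<phi>x x t * cutoff (R n) x t + cutoff_x (R n) x t * \<phi> x t)"
  define fxx where "fxx = (\<lambda>n x t. (\<phi>xx x t * cutoff (R n) x t + cutoff_x (R n) x t * \<phi>x x t) + (cutoff_xx (R n) x t * \<phi> x t + \<phi>x x t * cutoff_x (R n) x t))"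
  define ft where "ft = (\<lambda>n x t. \<phi>t x t * cutoff (R n) x t + 0 * \<phi> x t)"
  have C: "C21 T (f n) (fx n) (fxx n) (ft n)" for n
    unfolding f_def fx_def fxx_def ft_def by (rule C21_mult[OF \<phi> C21_cutoff[OF R]])
  define A where "A = (\<lambda>n x t. ft n x t + \<sigma>\<^sup>2/2 * fxx n x t - F x t * fx n x t)"
  define A' where "A' = (\<lambda>x t. \<phi>t x t + \<sigma>\<^sup>2/2 * \<phi>xx x t - F x t * \<phi>x x t)"
  have id: "(LBINT p. res T \<mu> p * res T (A n) p) = (LBINT p. res T q p * res T (fx n) p)" for n
  proof -
    have "test_function T (f n)"
    proof (rule C21_test_function[OF C T _ S])
      show "f n x t = 0" if "R n \<le> x \<or> S \<le> t" for x t
        using that z[of t x] bump(3)[of "R n" x] R[of n] by (auto simp: f_def cutoff_def)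
    qed (simp add: f_def 0)
    then have "set_lebesgue_integral lborel (Omega T) (\<lambda>(x, t). \<mu> x t * (D_t T (f n) x t + \<sigma>\<^sup>2/2 * D_xx (f n) x t - F x t * D_x (f n) x t)) =
        set_lebesgue_integral lborel (Omega T) (\<lambda>(x, t). q x t * D_x (f n) x t)"
      using sol unfolding FP_solution_def by blast
    then have "(LBINT p. res T \<mu> p * res T (\<lambda>x t. D_t T (f n) x t + \<sigma>\<^sup>2/2 * D_xx (f n) x t - F x t * D_x (f n) x t) p) = (LBINT p. res T q p * res T (D_x (f n)) p)"
      unfolding set_integral_res .
    moreover have "res T (\<lambda>x t. D_t T (f n) x t + \<sigma>\<^sup>2/2 * D_xx (f n) x t - F x t * D_x (f n) x t) = res T (A n)"
      unfolding A_def by (rule res_cong) (simp only: C21_D(1,2,3)[OF C T])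
    moreover have "res T (D_x (f n)) = res T (fx n)" by (rule res_cong) (rule C21_D(1)[OF C T])
    ultimately show ?thesis by simp
  qed
  have bs: "bstrip T \<phi>" "bstrip T \<phi>x" "bstrip T \<phi>xx" "bstrip T \<phi>t" using \<phi> by (auto simp: C21_def)
  have bn: "bstrip T (fx n)" "bstrip T (fxx n)" "bstrip T (ft n)" for n using C[of n] by (auto simp: C21_def)
  have bA: "bstrip T (A n)" "bstrip T A'" for n unfolding A_def A'_def by (intro bstrip_diff bstrip_add bstrip_cmult bstrip_mult F bs bn)+
  obtain K where K: "K \<ge> 0" "\<And>x t. 0 \<le> x \<Longrightarrow> t \<in> {0..T} \<Longrightarrow> \<bar>F x t\<bar> \<le> K" using F by (elim bstripD) (rule that)
  obtain K0 where K0: "K0 \<ge> 0" "\<And>x t. 0 \<le> x \<Longrightarrow> t \<in> {0..T} \<Longrightarrow> \<bar>\<phi> x t\<bar> \<le> K0" using bs(1) by (elim bstripD) (rule that)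
  obtain K1 where K1: "K1 \<ge> 0" "\<And>x t. 0 \<le> x \<Longrightarrow> t \<in> {0..T} \<Longrightarrow> \<bar>\<phi>x x t\<bar> \<le> K1" using bs(2) by (elim bstripD) (rule that)
  obtain K2 where K2: "K2 \<ge> 0" "\<And>x t. 0 \<le> x \<Longrightarrow> t \<in> {0..T} \<Longrightarrow> \<bar>\<phi>xx x t\<bar> \<le> K2" using bs(3) by (elim bstripD) (rule that)
  obtain K3 where K3: "K3 \<ge> 0" "\<And>x t. 0 \<le> x \<Longrightarrow> t \<in> {0..T} \<Longrightarrow> \<bar>\<phi>t x t\<bar> \<le> K3" using bs(4) by (elim bstripD) (rule that)
  have cb: "\<bar>cutoff (R n) x t\<bar> \<le> 1" "\<bar>cutoff_x (R n) x t\<bar> \<le> 6" "\<bar>cutoff_xx (R n) x t\<bar> \<le> 30" for n x t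
  proof -
    have "6 / R n \<le> 6 / 1" "30 / R n \<le> 30 / 1" using R[of n] by (intro divide_left_mono; simp)+
    then show "\<bar>cutoff (R n) x t\<bar> \<le> 1" "\<bar>cutoff_x (R n) x t\<bar> \<le> 6" "\<bar>cutoff_xx (R n) x t\<bar> \<le> 30"
      using cutoff_bounds[OF R[of n], of x t] by linarith+
  qed
  have mb: "\<bar>a * b\<bar> \<le> c * d" if "\<bar>a\<bar> \<le> c" "\<bar>b\<bar> \<le> d" for a b c d :: real
    unfolding abs_mult using that by (intro mult_mono) auto
  have fxb: "\<bar>fx n x t\<bar> \<le> K1 * 1 + 6 * K0" if "x \<ge> 0" "t \<in> {0..T}" for n x t
    unfolding fx_def using mb[OF K1(2)[OF that] cb(1)[of n x t]] mb[OF cb(2)[of n x t] K0(2)[OF that]] by linarith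
  have Ab: "\<bar>A n x t\<bar> \<le> K3 * 1 + \<sigma>\<^sup>2/2 * ((K2 * 1 + 6 * K1) + (30 * K0 + K1 * 6)) + K * (K1 * 1 + 6 * K0)" if "x \<ge> 0" "t \<in> {0..T}" for n x t
  proof -
    have "\<bar>fxx n x t\<bar> \<le> (K2 * 1 + 6 * K1) + (30 * K0 + K1 * 6)"
      unfolding fxx_def using mb[OF K2(2)[OF that] cb(1)[of n x t]] mb[OF cb(2)[of n x t] K1(2)[OF that]] mb[OF cb(3)[of n x t] K0(2)[OF that]] mb[OF K1(2)[OF that] cb(2)[of n x t]] by linarith
    then have "\<bar>\<sigma>\<^sup>2/2 * fxx n x t\<bar> \<le> \<sigma>\<^sup>2/2 * ((K2 * 1 + 6 * K1) + (30 * K0 + K1 * 6))" by (intro mb) auto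
    moreover have "\<bar>ft n x t\<bar> \<le> K3 * 1" unfolding ft_def using mb[OF K3(2)[OF that] cb(1)[of n x t]] by simp
    ultimately show ?thesis unfolding A_def using mb[OF K(2)[OF that] fxb[OF that, of n]] by linarith
  qed
  have Rlim: "(\<lambda>n. c / R n) \<longlonglongrightarrow> 0" for c
    unfolding R_def by real_asymp
  have l1: "(\<lambda>n. cutoff (R n) x t) \<longlonglongrightarrow> 1" for x t
  proof -
    have "(\<lambda>n. max 0 (1 - (x / R n)\<^sup>2) ^ 3) \<longlonglongrightarrow> max 0 (1 - 0\<^sup>2) ^ 3" by (intro tendsto_intros Rlim)
    then show ?thesis by (simp add: cutoff_def bump_def)
  qed
  have l2: "(\<lambda>n. cutoff_x (R n) x t) \<longlonglongrightarrow> 0" for x t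
    by (rule Lim_null_comparison[OF always_eventually Rlim[of 6]]) (use cutoff_bounds(2)[OF R] in auto)
  have l3: "(\<lambda>n. cutoff_xx (R n) x t) \<longlonglongrightarrow> 0" for x t
    by (rule Lim_null_comparison[OF always_eventually Rlim[of 30]]) (use cutoff_bounds(3)[OF R] in auto)
  have lfx: "(\<lambda>n. fx n x t) \<longlonglongrightarrow> \<phi>x x t" for x t
    unfolding fx_def using tendsto_add[OF tendsto_mult[OF tendsto_const l1] tendsto_mult[OF l2 tendsto_const]] by simp
  have lA: "(\<lambda>n. A n x t) \<longlonglongrightarrow> A' x t" for x t
  proof -
    have "(\<lambda>n. fxx n x t) \<longlonglongrightarrow> (\<phi>xx x t * 1 + 0 * \<phi>x x t) + (0 * \<phi> x t + \<phi>x x t * 0)"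
      unfolding fxx_def by (intro tendsto_intros l1 l2 l3)
    moreover have "(\<lambda>n. ft n x t) \<longlonglongrightarrow> \<phi>t x t * 1 + 0 * \<phi> x t" unfolding ft_def by (intro tendsto_intros l1)
    ultimately have "(\<lambda>n. A n x t) \<longlonglongrightarrow> (\<phi>t x t * 1 + 0 * \<phi> x t) + \<sigma>\<^sup>2/2 * ((\<phi>xx x t * 1 + 0 * \<phi>x x t) + (0 * \<phi> x t + \<phi>x x t * 0)) - F x t * \<phi>x x t"
      unfolding A_def by (intro tendsto_intros lfx)
    then show ?thesis by (simp add: A'_def)
  qed
  have int: "integrable lborel (res T \<mu>)" "integrable lborel (res T q)"
    using sol unfolding FP_solution_def set_integrable_res by auto
  have rb: "\<bar>res T g p\<bar> \<le> c" if "\<And>x t. 0 \<le> x \<Longrightarrow> t \<in> {0..T} \<Longrightarrow> \<bar>g x t\<bar> \<le> c" "c \<ge> 0" for g c p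
    using that by (auto simp: res_def indicator_def)
  have rl: "(\<lambda>n. res T (g n) p) \<longlonglongrightarrow> res T g' p" if "\<And>x t. (\<lambda>n. g n x t) \<longlonglongrightarrow> g' x t" for g g' p
    unfolding res_def by (intro tendsto_intros that)
  have "(\<lambda>n. \<integral>p. res T \<mu> p * res T (A n) p \<partial>lborel) \<longlonglongrightarrow> (LBINT p. res T \<mu> p * res T A' p)"
    by (rule tendsto_integral_mult_bounded[OF int(1) _ _ rb[OF Ab]])
       (use bstrip_res(1)[OF bA(1)] bstrip_res(1)[OF bA(2)] rl[OF lA] K K0 K1 K2 K3 in \<open>auto intro!: add_nonneg_nonneg mult_nonneg_nonneg\<close>)
  moreover have "(\<lambda>n. \<integral>p. res T q p * res T (fx n) p \<partial>lborel) \<longlonglongrightarrow> (LBINT p. res T q p * res T \<phi>x p)"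
    by (rule tendsto_integral_mult_bounded[OF int(2) _ _ rb[OF fxb]])
       (use bstrip_res(1)[OF bn(1)] bstrip_res(1)[OF bs(2)] rl[OF lfx] K0 K1 in \<open>auto intro!: add_nonneg_nonneg mult_nonneg_nonneg\<close>)
  ultimately show ?thesis unfolding id A'_def by (rule LIMSEQ_unique)
qed

lemma lborel_snd:
  fixes H :: "real \<times> real \<Rightarrow> real"
  assumes H: "integrable lborel H"
  shows "AE t in lborel. integrable lborel (\<lambda>x. H (x, t))" "integrable lborel (\<lambda>t. \<integral>x. H (x, t) \<partial>lborel)"
    "(LBINT p. H p) = (LBINT t. (LBINT x. H (x, t)))"
proof -
  have 1: "integrable (lborel \<Otimes>\<^sub>M lborel) (case_prod (\<lambda>x y. H (x, y)))" using H by (simp add: lborel_prod)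
  show "AE t in lborel. integrable lborel (\<lambda>x. H (x, t))" by (rule lborel_pair.AE_integrable_snd[OF 1])
  show "integrable lborel (\<lambda>t. \<integral>x. H (x, t) \<partial>lborel)" by (rule lborel_pair.integrable_snd[OF 1])
  show "(LBINT p. H p) = (LBINT t. (LBINT x. H (x, t)))"
    using lborel_pair.integral_snd[OF 1] by (simp add: lborel_prod)
qed

lemma lborel_nn_snd:
  assumes "H \<in> borel_measurable (borel :: (real \<times> real) measure)"
  shows "(\<integral>\<^sup>+t. (\<integral>\<^sup>+x. H (x, t) \<partial>lborel) \<partial>lborel) = (\<integral>\<^sup>+p. H p \<partial>lborel)"
  using lborel_pair.nn_integral_snd[of H] assms by (simp add: lborel_prod)

lemma section_measurable:
  assumes "H \<in> borel_measurable (borel :: (real \<times> real) measure)" shows "(\<lambda>x. H (x, t)) \<in> borel_measurable borel"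
  using assms by (rule measurable_compose_rev) (simp add: borel_prod[symmetric])

lemma res_simps: "res T f (x, t) = (if 0 < x \<and> 0 < t \<and> t < T then f x t else 0)"
  by (simp add: res_def indicator_def)

lemma res_mult: "res T (\<lambda>x t. f x t * g x t) p = res T f p * res T g p"
  by (simp add: res_def indicator_def)

section \<open>The linearised equation with its nonlocal term split off\<close>

locale mfg_linear = mfg +
  fixes \<Phi> w \<mu> :: "real \<Rightarrow> real \<Rightarrow> real"
  assumes \<Phi>: "LinfL1 T \<Phi>" and lin: "linear_FP_solution \<sigma> T \<xi> \<epsilon> u m \<Phi> w \<mu>"
begin

definition "q x t = \<Phi> x t + 1/2 * (lin_G \<epsilon> \<xi> u m w \<mu> t - D_x w x t) * m x t"
definition "I t = (LBINT x. res T (\<lambda>x t. D_x u x t * \<mu> x t) (x, t))"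
definition "f t = (LBINT x. \<bar>res T \<mu> (x, t)\<bar>)"
definition "bI t = 1/2 * (\<beta> (tclamp T t) * I t)"
text \<open>Of \<mu> only integrability over the strip is known, so \<open>I\<close> is merely
  integrable in time and the removed part could not be put into a weighted L^2 norm.\<close>

definition "q0 p = res T q p - bI (snd p) * res T m p"
definition "g t = (LBINT x. \<bar>q0 (x, t)\<bar>)"

lemma FP: "FP_solution \<sigma> T F q \<mu>" using lin unfolding linear_FP_solution_def q_def[abs_def] by blast

lemma \<mu>_int: "integrable lborel (res T \<mu>)" and q_int: "integrable lborel (res T q)"
  using FP unfolding FP_solution_def set_integrable_res by auto

lemma bstrip_mult_int:
  assumes k: "integrable lborel k" and h: "bstrip T h" shows "integrable lborel (\<lambda>p. k p * res T h p)"
proof -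
  obtain B where "\<And>p. \<bar>res T h p\<bar> \<le> B" using bstrip_res(2)[OF h] by blast
  then show ?thesis by (rule integrable_mult_bounded[OF k, rotated]) (use bstrip_res(1)[OF h] in simp)
qed

lemma u\<mu>_int: "integrable lborel (res T (\<lambda>x t. D_x u x t * \<mu> x t))"
  using bstrip_mult_int[OF \<mu>_int bu(2)] by (simp add: res_mult[abs_def] mult.commute)

lemma I_int: "integrable lborel I" unfolding I_def[abs_def] by (rule lborel_snd(2)[OF u\<mu>_int])

lemma bI_meas: "bI \<in> borel_measurable borel" and bI_le: "\<bar>bI t\<bar> \<le> \<bar>I t\<bar>"
proof -
  have "continuous_on UNIV (\<lambda>t. \<beta> (tclamp T t))"
    by (rule continuous_on_compose2[OF continuous_\<beta>(1)]) (use tclamp(1)[OF T0] in \<open>auto intro!: continuous_tclamp continuous_intros\<close>)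
  then have "(\<lambda>t. \<beta> (tclamp T t)) \<in> borel_measurable borel" by (rule borel_measurable_continuous_onI)
  moreover have "I \<in> borel_measurable borel" using borel_measurable_integrable[OF I_int] by simp
  ultimately show "bI \<in> borel_measurable borel" unfolding bI_def[abs_def] by simp
  have "\<bar>\<beta> (tclamp T t)\<bar> * \<bar>I t\<bar> \<le> 1 * \<bar>I t\<bar>" using \<beta>[OF tclamp(1)[OF T0]] by (intro mult_right_mono) auto
  then show "\<bar>bI t\<bar> \<le> \<bar>I t\<bar>" by (simp add: bI_def abs_mult)
qed

lemma integrable_m: "integrable lborel (\<lambda>x. res T m (x, t))" and mass_res: "(LBINT x. res T m (x, t)) \<le> 1"
  and E_res: "bstrip T h \<Longrightarrow> (LBINT x. res T m (x, t) * res T h (x, t)) = (if t \<in> {0<..<T} then E t (\<lambda>x. h x t) else 0)"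
proof -
  have eq: "res T m (x, t) = (if t \<in> {0<..<T} then indicator {0..} x * m x t else 0)" for x
    using m_0[of t] by (auto simp: res_simps indicator_def)
  show "integrable lborel (\<lambda>x. res T m (x, t))" unfolding eq using m_integrable[of t] by (cases "t \<in> {0<..<T}") auto
  have "(LBINT x. res T m (x, t)) = (if t \<in> {0<..<T} then E t (\<lambda>x. 1) else 0)" unfolding eq E_def by (cases "t \<in> {0<..<T}") auto
  then show "(LBINT x. res T m (x, t)) \<le> 1" using mass_le[of t] by auto
  have eq2: "res T m (x, t) * res T h (x, t) = (if t \<in> {0<..<T} then indicator {0..} x * (h x t * m x t) else 0)" for x
    using m_0[of t] by (auto simp: res_simps indicator_def)
  show "(LBINT x. res T m (x, t) * res T h (x, t)) = (if t \<in> {0<..<T} then E t (\<lambda>x. h x t) else 0)"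
    unfolding eq2 E_def by (cases "t \<in> {0<..<T}") auto
qed

lemma res_m_nonneg: "res T m p \<ge> 0"
  using m_nonneg by (auto simp: res_def indicator_def)

lemma nn_m_le: "(\<integral>\<^sup>+x. ennreal (res T m (x, t)) \<partial>lborel) \<le> 1"
proof -
  have "(\<integral>\<^sup>+x. ennreal (res T m (x, t)) \<partial>lborel) = ennreal (LBINT x. res T m (x, t))"
    by (rule nn_integral_eq_integral[OF integrable_m]) (use res_m_nonneg in simp)
  also have "\<dots> \<le> ennreal 1" by (rule ennreal_leI[OF mass_res])
  finally show ?thesis by simp
qed

lemma bIm_int: "integrable lborel (\<lambda>p. bI (snd p) * res T m p)"
proof (rule integrableI_bounded)
  have [measurable]: "bI \<in> borel_measurable borel" "res T m \<in> borel_measurable borel" "I \<in> borel_measurable borel"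
    using bI_meas bstrip_res(1)[OF bm(1)] borel_measurable_integrable[OF I_int] by simp_all
  have b: "(\<lambda>p. bI (snd p)) \<in> borel_measurable (borel :: (real \<times> real) measure)" by (simp add: borel_prod[symmetric])
  then show "(\<lambda>p. bI (snd p) * res T m p) \<in> borel_measurable lborel" by simp
  have "(\<integral>\<^sup>+p. ennreal (norm (bI (snd p) * res T m p)) \<partial>lborel) = (\<integral>\<^sup>+t. (\<integral>\<^sup>+x. ennreal (norm (bI t * res T m (x, t))) \<partial>lborel) \<partial>lborel)"
    using lborel_nn_snd[of "\<lambda>p. ennreal (norm (bI (snd p) * res T m p))"] b by simp
  also have "\<dots> \<le> (\<integral>\<^sup>+t. ennreal (norm (I t)) \<partial>lborel)"
  proof (rule nn_integral_mono)
    fix t :: real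
    have "(\<integral>\<^sup>+x. ennreal (norm (bI t * res T m (x, t))) \<partial>lborel) = (\<integral>\<^sup>+x. ennreal \<bar>bI t\<bar> * ennreal (res T m (x, t)) \<partial>lborel)"
      using res_m_nonneg by (intro nn_integral_cong) (simp add: abs_mult ennreal_mult[symmetric])
    also have "\<dots> = ennreal \<bar>bI t\<bar> * (\<integral>\<^sup>+x. ennreal (res T m (x, t)) \<partial>lborel)"
      by (rule nn_integral_cmult) (use section_measurable[OF bstrip_res(1)[OF bm(1)]] in simp)
    also have "\<dots> \<le> ennreal \<bar>I t\<bar> * 1" by (intro mult_mono ennreal_leI bI_le nn_m_le) auto
    finally show "(\<integral>\<^sup>+x. ennreal (norm (bI t * res T m (x, t))) \<partial>lborel) \<le> ennreal (norm (I t))" by simp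
  qed
  also have "\<dots> < \<infinity>" using I_int by (simp add: integrable_iff_bounded)
  finally show "(\<integral>\<^sup>+p. ennreal (norm (bI (snd p) * res T m p)) \<partial>lborel) < \<infinity>" .
qed

lemma q0_int: "integrable lborel q0"
  unfolding q0_def[abs_def] by (rule Bochner_Integration.integrable_diff[OF q_int bIm_int])

lemma g_int: "integrable lborel g" unfolding g_def[abs_def] by (rule lborel_snd(2)) (use q0_int in simp)
lemma f_int: "integrable lborel f" unfolding f_def[abs_def] by (rule lborel_snd(2)) (use \<mu>_int in simp)
lemma g_nonneg: "g t \<ge> 0" and f_nonneg: "f t \<ge> 0"
  unfolding g_def f_def by (intro Bochner_Integration.integral_nonneg; simp)+

text \<open>The nonlocal term of \<open>q\<close> and the nonlocal term of the dual equation cancel.\<close>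

lemma nonlocal_cancel:
  assumes h: "bstrip T h"
  shows "(LBINT p. bI (snd p) * res T m p * res T h p) = (LBINT p. res T \<mu> p * res T (\<lambda>x t. 1/2 * (\<beta> t * E t (\<lambda>x. h x t)) * D_x u x t) p)"
proof -
  have b: "bstrip T (\<lambda>x t. 1/2 * (\<beta> t * E t (\<lambda>x. h x t)) * D_x u x t)"
    by (intro bstrip_mult bstrip_cmult bstrip_time continuous_on_mult continuous_\<beta> E_continuous h bu)
  have "(LBINT p. bI (snd p) * res T m p * res T h p) = (LBINT t. (LBINT x. bI t * res T m (x, t) * res T h (x, t)))"
    using lborel_snd(3)[OF bstrip_mult_int[OF bIm_int h]] by simp
  also have "\<dots> = (LBINT t. (LBINT x. res T \<mu> (x, t) * res T (\<lambda>x t. 1/2 * (\<beta> t * E t (\<lambda>x. h x t)) * D_x u x t) (x, t)))"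
  proof (rule Bochner_Integration.integral_cong[OF refl])
    fix t :: real
    have "(LBINT x. bI t * res T m (x, t) * res T h (x, t)) = bI t * (if t \<in> {0<..<T} then E t (\<lambda>x. h x t) else 0)"
      unfolding mult.assoc by (simp add: E_res[OF h])
    also have "\<dots> = (if t \<in> {0<..<T} then 1/2 * (\<beta> t * E t (\<lambda>x. h x t)) else 0) * I t"
      by (simp add: bI_def tclamp(2))
    also have "\<dots> = (LBINT x. (if t \<in> {0<..<T} then 1/2 * (\<beta> t * E t (\<lambda>x. h x t)) else 0) * res T (\<lambda>x t. D_x u x t * \<mu> x t) (x, t))"
      by (simp add: I_def)
    also have "\<dots> = (LBINT x. res T \<mu> (x, t) * res T (\<lambda>x t. 1/2 * (\<beta> t * E t (\<lambda>x. h x t)) * D_x u x t) (x, t))"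
      by (rule Bochner_Integration.integral_cong[OF refl]) (simp add: res_simps)
    finally show "(LBINT x. bI t * res T m (x, t) * res T h (x, t)) = (LBINT x. res T \<mu> (x, t) * res T (\<lambda>x t. 1/2 * (\<beta> t * E t (\<lambda>x. h x t)) * D_x u x t) (x, t))" .
  qed
  also have "\<dots> = (LBINT p. res T \<mu> p * res T (\<lambda>x t. 1/2 * (\<beta> t * E t (\<lambda>x. h x t)) * D_x u x t) p)"
    by (rule lborel_snd(3)[OF bstrip_mult_int[OF \<mu>_int b], symmetric])
  finally show ?thesis .
qed

definition "Y l = (LBINT t. indicator {0..T} t * (exp (- l * t) * (g t)\<^sup>2))"

lemma weak_bound:
  assumes \<psi>: "bcont \<psi>" "ucont_x \<psi>" "\<And>x t. \<psi> (- x) t = - \<psi> x t" "\<And>x t. S \<le> t \<Longrightarrow> \<psi> x t = 0" "\<And>x t. 0 \<le> x \<Longrightarrow> t \<in> {0..T} \<Longrightarrow> \<bar>\<psi> x t\<bar> \<le> \<omega> t"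
    and \<omega>: "continuous_on UNIV \<omega>" and S: "S < T" and l: "0 < l0" "l0 \<le> l"
    and Y: "integrable lborel (\<lambda>t. indicator {0..T} t * (exp (- l * t) * (g t)\<^sup>2))"
  shows "(LBINT p. res T \<mu> p * res T \<psi> p) \<le> 1/2 * wnorm T l \<omega> + dual_const l0 / 2 * Y l"
proof -
  \<comment> \<open>The product inequality below is balanced with the loss of the dual estimate, so
    that \<omega> comes out with the factor 1/2, ready for absorption.\<close>
  define D where "D = dual_const l0"
  have CE0: "CE l0 \<ge> 0" by (simp add: CE_def)
  have D: "D > 0" unfolding D_def dual_const_def using l CE0
    by (intro mult_pos_pos add_pos_nonneg divide_nonneg_nonneg mult_nonneg_nonneg) auto
  obtain B C s0 where B: "B \<ge> 0" and C: "C \<ge> 0" and s0: "s0 > 0" and dual: "\<And>s. 0 < s \<Longrightarrow> s \<le> s0 \<Longrightarrow> \<exists>\<phi> \<phi>x \<phi>xx \<phi>t n. dual_pair l l0 S \<psi> \<omega> B C s \<phi> \<phi>x \<phi>xx \<phi>t n"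
    by (rule dual_exists[OF \<psi> \<omega> less_imp_le[OF S] l]) (assumption | rule that)+
  define K where "K = (1/2 + 3/2 * U) * B"
  have K: "K \<ge> 0" using U_nonneg B by (simp add: K_def)
  \<comment> \<open>Not small near x = 0, but convergent to 0 for each fixed x > 0 as s tends to 0.
    Together with a uniform bound this is enough against the integrable \<mu>.\<close>
  define er where "er = (\<lambda>s x (t::real). s + K * (1 - ramp (1 / s) x) :: real)"
  have er_b: "bstrip T (er s)" for s
  proof (rule bstripI)
    show "continuous_on (strip T) (\<lambda>p. er s (fst p) (snd p))" unfolding er_def
      by (intro continuous_on_add continuous_on_mult continuous_on_diff continuous_on_const continuous_ramp continuous_on_fst continuous_on_id)
    show "\<bar>er s x t\<bar> \<le> \<bar>s\<bar> + K * 2" for x t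
    proof -
      have "\<bar>K * (1 - ramp (1 / s) x)\<bar> \<le> K * 2" unfolding abs_mult using ramp(1)[of "1 / s" x] K by (intro mult_mono) auto
      then show ?thesis unfolding er_def by linarith
    qed
  qed
  have step: "(LBINT p. res T \<mu> p * res T \<psi> p) \<le> (LBINT p. \<bar>res T \<mu> p\<bar> * res T (er s) p) + (1 / (2 * D)) * (D * wnorm T l \<omega> + s * C) + D / 2 * Y l"
    if s: "0 < s" "s \<le> s0" for s
  proof -
    from dual[OF s, unfolded dual_pair_def] obtain \<phi> \<phi>x \<phi>xx \<phi>t n where \<phi>: "C21 T \<phi> \<phi>x \<phi>xx \<phi>t" "\<forall>t. \<phi> 0 t = 0" "\<forall>x t. S \<le> t \<longrightarrow> \<phi> x t = 0"
      and n: "n \<in> borel_measurable borel" "\<forall>x\<ge>0. \<forall>t\<in>{0..T}. \<bar>\<phi>x x t\<bar> \<le> n t" "\<forall>t\<in>{0..T}. 0 \<le> n t \<and> n t \<le> B" "wnorm T l n \<le> dual_const l0 * wnorm T l \<omega> + s * C"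
      and e: "\<forall>x\<ge>0. \<forall>t\<in>{0..T}. \<bar>\<phi>t x t + \<sigma>\<^sup>2/2 * \<phi>xx x t - F x t * \<phi>x x t + \<psi> x t - 1/2 * (\<beta> t * E t (\<lambda>x. \<phi>x x t)) * D_x u x t\<bar> \<le> s + (1/2 + 3/2 * U) * B * (1 - ramp (1 / s) x)"
      by (elim exE conjE) (rule that)
    define z where "z = (\<lambda>x t. 1/2 * (\<beta> t * E t (\<lambda>x. \<phi>x x t)) * D_x u x t)"
    define A where "A = (\<lambda>x t. \<phi>t x t + \<sigma>\<^sup>2/2 * \<phi>xx x t - F x t * \<phi>x x t)"
    define e' where "e' = (\<lambda>x t. A x t + \<psi> x t - z x t)"
    have bs: "bstrip T \<phi>x" "bstrip T \<phi>xx" "bstrip T \<phi>t" using \<phi>(1) by (auto simp: C21_def)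
    have bz: "bstrip T z" unfolding z_def
      by (intro bstrip_mult bstrip_cmult bstrip_time continuous_on_mult continuous_\<beta> E_continuous bs bu)
    have bA: "bstrip T A" unfolding A_def by (intro bstrip_diff bstrip_add bstrip_cmult bstrip_mult F_bstrip bs)
    have b\<psi>: "bstrip T \<psi>" by (rule bcont_bstrip[OF \<psi>(1)])
    have be: "bstrip T e'" unfolding e'_def by (intro bstrip_diff bstrip_add bA bz b\<psi>)
    have "(LBINT p. res T \<mu> p * res T A p) = (LBINT p. res T q p * res T \<phi>x p)"
      unfolding A_def by (rule FP_identity[OF FP F_bstrip \<phi>(1) T _ S]) (use \<phi> in auto)
    also have "\<dots> = (LBINT p. q0 p * res T \<phi>x p + bI (snd p) * res T m p * res T \<phi>x p)"
      by (rule Bochner_Integration.integral_cong) (simp_all add: q0_def algebra_simps)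
    also have "\<dots> = (LBINT p. q0 p * res T \<phi>x p) + (LBINT p. bI (snd p) * res T m p * res T \<phi>x p)"
      by (rule Bochner_Integration.integral_add[OF bstrip_mult_int[OF q0_int bs(1)] bstrip_mult_int[OF bIm_int bs(1)]])
    also have "(LBINT p. bI (snd p) * res T m p * res T \<phi>x p) = (LBINT p. res T \<mu> p * res T z p)"
      unfolding z_def by (rule nonlocal_cancel[OF bs(1)])
    finally have id: "(LBINT p. res T \<mu> p * res T A p) = (LBINT p. q0 p * res T \<phi>x p) + (LBINT p. res T \<mu> p * res T z p)" .
    have "(\<lambda>p. res T \<mu> p * res T \<psi> p) = (\<lambda>p. res T \<mu> p * res T e' p - res T \<mu> p * res T A p + res T \<mu> p * res T z p)"
      by (rule ext) (simp add: e'_def res_def algebra_simps)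
    then have "(LBINT p. res T \<mu> p * res T \<psi> p) = (LBINT p. res T \<mu> p * res T e' p) - (LBINT p. res T \<mu> p * res T A p) + (LBINT p. res T \<mu> p * res T z p)"
      using bstrip_mult_int[OF \<mu>_int be] bstrip_mult_int[OF \<mu>_int bA] bstrip_mult_int[OF \<mu>_int bz] by simp
    also have "\<dots> = (LBINT p. res T \<mu> p * res T e' p) + (LBINT p. - (q0 p * res T \<phi>x p))" unfolding id by simp
    finally have main: "(LBINT p. res T \<mu> p * res T \<psi> p) = (LBINT p. res T \<mu> p * res T e' p) + (LBINT p. - (q0 p * res T \<phi>x p))" .
    have 1: "(LBINT p. res T \<mu> p * res T e' p) \<le> (LBINT p. \<bar>res T \<mu> p\<bar> * res T (er s) p)"
    proof (rule integral_mono[OF bstrip_mult_int[OF \<mu>_int be] bstrip_mult_int[OF _ er_b]])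
      show "integrable lborel (\<lambda>p. \<bar>res T \<mu> p\<bar>)" using \<mu>_int by simp
      fix p :: "real \<times> real"
      have "\<bar>res T e' p\<bar> \<le> res T (er s) p"
        using e by (cases p) (auto simp: res_simps e'_def A_def z_def er_def K_def)
      then have "\<bar>res T \<mu> p * res T e' p\<bar> \<le> \<bar>res T \<mu> p\<bar> * res T (er s) p" unfolding abs_mult by (rule mult_left_mono) simp
      then show "res T \<mu> p * res T e' p \<le> \<bar>res T \<mu> p\<bar> * res T (er s) p" by linarith
    qed
    let ?n = "\<lambda>t. indicator {0..T} t * n t"
    have n_b: "?n \<in> borel_measurable borel" "\<bar>?n t\<bar> \<le> B" for t using n(1,3) B by (auto simp: indicator_def)
    have 2: "(LBINT p. - (q0 p * res T \<phi>x p)) \<le> (LBINT t. ?n t * g t)"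
    proof -
      have nb: "(\<lambda>p. ?n (snd p)) \<in> borel_measurable (borel :: (real \<times> real) measure)" using n_b(1) by (simp add: borel_prod[symmetric])
      have i: "integrable lborel (\<lambda>p. \<bar>q0 p\<bar> * ?n (snd p))"
        by (rule integrable_mult_bounded[where B=B]) (use q0_int nb n_b(2) in simp_all)
      have "(LBINT p. - (q0 p * res T \<phi>x p)) \<le> (LBINT p. \<bar>q0 p\<bar> * ?n (snd p))"
      proof (rule integral_mono[OF _ i])
        show "integrable lborel (\<lambda>p. - (q0 p * res T \<phi>x p))" using bstrip_mult_int[OF q0_int bs(1)] by simp
        fix p :: "real \<times> real"
        have "\<bar>res T \<phi>x p\<bar> \<le> ?n (snd p)" using n(2,3) by (cases p) (auto simp: res_simps indicator_def)
        then have "\<bar>q0 p * res T \<phi>x p\<bar> \<le> \<bar>q0 p\<bar> * ?n (snd p)" unfolding abs_mult by (rule mult_left_mono) simp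
        then show "- (q0 p * res T \<phi>x p) \<le> \<bar>q0 p\<bar> * ?n (snd p)" by linarith
      qed
      also have "\<dots> = (LBINT t. (LBINT x. \<bar>q0 (x, t)\<bar> * ?n t))" using lborel_snd(3)[OF i] by simp
      also have "\<dots> = (LBINT t. ?n t * g t)"
        by (rule Bochner_Integration.integral_cong[OF refl]) (simp add: g_def mult.commute)
      finally show ?thesis .
    qed
    have 3: "(LBINT t. ?n t * g t) \<le> (LBINT t. (1 / (2 * D)) * (indicator {0..T} t * (exp (l * t) * (n t)\<^sup>2)) + D / 2 * (indicator {0..T} t * (exp (- l * t) * (g t)\<^sup>2)))"
    proof (rule integral_mono)
      show "integrable lborel (\<lambda>t. ?n t * g t)"
        using integrable_mult_bounded[OF g_int, of ?n B] n_b by (simp add: mult.commute)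
      show "integrable lborel (\<lambda>t. (1 / (2 * D)) * (indicator {0..T} t * (exp (l * t) * (n t)\<^sup>2)) + D / 2 * (indicator {0..T} t * (exp (- l * t) * (g t)\<^sup>2)))"
      proof (intro Bochner_Integration.integrable_add integrable_mult_right Y)
        show "integrable lborel (\<lambda>t. indicator {0..T} t * (exp (l * t) * (n t)\<^sup>2))"
          by (rule wnorm_integrable[OF n(1), of T B]) (use n(3) in auto)
      qed
      fix t :: real
      \<comment> \<open>Young's inequality for a product, with 1 split into exp(l t/2) exp(-l
        t/2).\<close>
      have "0 \<le> (1 / (2 * D)) * (exp (l * t / 2) * n t - D * exp (- (l * t / 2)) * g t)\<^sup>2" using D by simp
      also have "\<dots> = (1 / (2 * D)) * ((exp (l * t / 2))\<^sup>2 * (n t)\<^sup>2) + D / 2 * ((exp (- (l * t / 2)))\<^sup>2 * (g t)\<^sup>2) - (exp (l * t / 2) * exp (- (l * t / 2))) * (n t * g t)"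
        using D by (simp add: power2_eq_square field_simps)
      also have "(exp (l * t / 2))\<^sup>2 = exp (l * t)" by (simp add: exp_double[symmetric])
      also have "(exp (- (l * t / 2)))\<^sup>2 = exp (- l * t)" by (simp add: exp_double[symmetric])
      also have "exp (l * t / 2) * exp (- (l * t / 2)) = 1" by (simp add: exp_add[symmetric])
      finally show "?n t * g t \<le> (1 / (2 * D)) * (indicator {0..T} t * (exp (l * t) * (n t)\<^sup>2)) + D / 2 * (indicator {0..T} t * (exp (- l * t) * (g t)\<^sup>2))"
        by (cases "t \<in> {0..T}") simp_all
    qed
    also have "\<dots> = (1 / (2 * D)) * wnorm T l n + D / 2 * Y l"
      unfolding wnorm_def Y_def using Y wnorm_integrable[OF n(1), of T B l] n(3) by simp
    also have "\<dots> \<le> (1 / (2 * D)) * (D * wnorm T l \<omega> + s * C) + D / 2 * Y l"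
      using n(4) D unfolding D_def[symmetric] by (intro add_right_mono mult_left_mono) auto
    finally show ?thesis using main 1 2 by linarith
  qed
  define sn where "sn = (\<lambda>k. s0 / (real k + 1))"
  have sn: "0 < sn k" "sn k \<le> s0" for k using s0 by (auto simp: sn_def divide_le_eq)
  have sn0: "sn \<longlonglongrightarrow> 0" unfolding sn_def by real_asymp
  have lim: "(\<lambda>k. \<integral>p. \<bar>res T \<mu> p\<bar> * res T (er (sn k)) p \<partial>lborel) \<longlonglongrightarrow> (LBINT p. \<bar>res T \<mu> p\<bar> * 0)"
  proof (rule tendsto_integral_mult_bounded[where B="s0 + K * 2"])
    show "\<bar>res T (er (sn k)) p\<bar> \<le> s0 + K * 2" for k p
    proof -
      have "\<bar>er (sn k) x t\<bar> \<le> s0 + K * 2" for x t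
      proof -
        have "\<bar>K * (1 - ramp (1 / sn k) x)\<bar> \<le> K * 2" unfolding abs_mult using ramp(1)[of "1 / sn k" x] K by (intro mult_mono) auto
        then show ?thesis using sn[of k] unfolding er_def by linarith
      qed
      then show ?thesis using s0 K by (cases p) (simp add: res_simps)
    qed
    show "AE p in lborel. (\<lambda>k. res T (er (sn k)) p) \<longlonglongrightarrow> 0"
    proof (rule AE_I2)
      fix p :: "real \<times> real"
      show "(\<lambda>k. res T (er (sn k)) p) \<longlonglongrightarrow> 0"
      proof (cases "p \<in> Omega T")
        case True
        then have x: "fst p > 0" by (auto simp: mem_Times_iff)
        have "eventually (\<lambda>k. sn k < fst p) sequentially" using order_tendstoD(2)[OF sn0 x] .
        then have "eventually (\<lambda>k. sn k = res T (er (sn k)) p) sequentially"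
        proof eventually_elim
          case (elim k)
          have "ramp (1 / sn k) (fst p) = 1" by (rule ramp_eq_1) (use sn(1)[of k] elim in auto)
          then show ?case using True by (simp add: res_def er_def)
        qed
        from tendsto_cong[OF this] sn0 show ?thesis by simp
      qed (simp add: res_def)
    qed
  qed (use \<mu>_int bstrip_res(1)[OF er_b] in simp_all)
  have "(\<lambda>k. (LBINT p. \<bar>res T \<mu> p\<bar> * res T (er (sn k)) p) + (1 / (2 * D)) * (D * wnorm T l \<omega> + sn k * C) + D / 2 * Y l)
      \<longlonglongrightarrow> (LBINT p. \<bar>res T \<mu> p\<bar> * 0) + (1 / (2 * D)) * (D * wnorm T l \<omega> + 0 * C) + D / 2 * Y l"
    by (intro tendsto_intros lim sn0)
  from LIMSEQ_le_const[OF this] step[OF sn] have "(LBINT p. res T \<mu> p * res T \<psi> p) \<le> (LBINT p. \<bar>res T \<mu> p\<bar> * 0) + (1 / (2 * D)) * (D * wnorm T l \<omega> + 0 * C) + D / 2 * Y l"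
    by blast
  then show ?thesis using D unfolding D_def[symmetric] by simp
qed

end

section \<open>Approximating the sign of \<mu> by test densities\<close>

lemma compact_support_extension:
  fixes G :: "real \<times> real \<Rightarrow> real"
  assumes G: "continuous_on UNIV G" and z: "\<And>x t. R \<le> \<bar>x\<bar> \<Longrightarrow> G (x, t) = 0" and T: "T \<ge> 0"
  shows "bcont (\<lambda>x t. G (x, tclamp T t))" "ucont_x (\<lambda>x t. G (x, tclamp T t))"
proof -
  define K where "K = {- (\<bar>R\<bar> + 1)..\<bar>R\<bar> + 1} \<times> {0..T}"
  have K: "compact K" unfolding K_def by (intro compact_Times compact_Icc)
  have "bounded (G ` K)" by (intro compact_imp_bounded compact_continuous_image[OF continuous_on_subset[OF G] K]) simp
  then obtain B where B: "\<And>p. p \<in> K \<Longrightarrow> \<bar>G p\<bar> \<le> B" by (auto simp: bounded_iff)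
  have le: "\<bar>G (x, tclamp T t)\<bar> \<le> max B 0" for x t
  proof (cases "\<bar>x\<bar> \<le> \<bar>R\<bar> + 1")
    case True
    then have "(x, tclamp T t) \<in> K" using tclamp(1)[OF T, of t] by (auto simp: K_def)
    then show ?thesis using B by (simp add: le_max_iff_disj)
  qed (use z[of x "tclamp T t"] in auto)
  show "bcont (\<lambda>x t. G (x, tclamp T t))"
    by (rule bcontI[OF _ le]) (intro continuous_on_compose2[OF G] continuous_on_Pair continuous_tclamp continuous_on_fst continuous_on_snd continuous_on_id subset_UNIV)
  have u: "uniformly_continuous_on K G" by (rule compact_uniformly_continuous[OF continuous_on_subset[OF G subset_UNIV] K])
  show "ucont_x (\<lambda>x t. G (x, tclamp T t))"
    unfolding ucont_x_def
  proof (intro allI impI)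
    fix e :: real assume "e > 0"
    then obtain d where d: "d > 0" "\<And>p p'. p \<in> K \<Longrightarrow> p' \<in> K \<Longrightarrow> dist p' p < d \<Longrightarrow> dist (G p') (G p) < e"
      using u unfolding uniformly_continuous_on_def by metis
    have "\<bar>G (x, tclamp T t) - G (y, tclamp T t)\<bar> < e" if xy: "\<bar>x - y\<bar> < min d 1" for x y t
    proof (cases "\<bar>x\<bar> \<le> \<bar>R\<bar> + 1 \<and> \<bar>y\<bar> \<le> \<bar>R\<bar> + 1")
      case True
      then have "(x, tclamp T t) \<in> K" "(y, tclamp T t) \<in> K" using tclamp(1)[OF T, of t] by (auto simp: K_def)
      moreover have "dist (x, tclamp T t) (y, tclamp T t) < d" using xy by (simp add: dist_Pair_Pair dist_real_def)
      ultimately show ?thesis using d(2)[of "(y, tclamp T t)" "(x, tclamp T t)"] by (simp add: dist_real_def)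
    next
      case False
      then have "\<bar>R\<bar> \<le> \<bar>x\<bar>" "\<bar>R\<bar> \<le> \<bar>y\<bar>" using xy by auto
      then have "G (x, tclamp T t) = 0" "G (y, tclamp T t) = 0" using z by auto
      then show ?thesis using \<open>e > 0\<close> by simp
    qed
    then show "\<exists>d>0. \<forall>x y t. \<bar>x - y\<bar> < d \<longrightarrow> \<bar>G (x, tclamp T t) - G (y, tclamp T t)\<bar> < e"
      using d(1) by (intro exI[of _ "min d 1"]) auto
  qed
qed

text \<open>Continuous functions that converge off a null set are clipped to [a, b]; the limit is
  undisturbed because v takes its values there.\<close>

lemma continuous_AE_approx:
  fixes v :: "'a::euclidean_space \<Rightarrow> real"
  assumes v: "v \<in> borel_measurable borel" and b: "\<And>x. a \<le> v x" "\<And>x. v x \<le> b"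
  obtains k where "\<And>n. continuous_on UNIV (k n)" "\<And>n x. a \<le> k n x" "\<And>n x. k n x \<le> b" "AE x in lborel. (\<lambda>n. k n x) \<longlonglongrightarrow> v x"
proof -
  have "v measurable_on UNIV"
    by (rule lebesgue_measurable_imp_measurable_on_real) (use v in \<open>auto intro: measurable_completion\<close>)
  then obtain N h where N: "negligible N" and h: "\<And>n. continuous_on UNIV (h n)" "\<And>x. x \<notin> N \<Longrightarrow> (\<lambda>n. h n x) \<longlonglongrightarrow> v x"
    unfolding measurable_on_def by auto
  have "AE x in lebesgue. x \<notin> N" using N by (simp add: AE_not_in negligible_iff_null_sets)
  then have ae: "AE x in lborel. x \<notin> N" by (simp add: AE_completion_iff)
  have ab: "a \<le> b" using b[of undefined] by linarith
  show ?thesis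
  proof (rule that[of "\<lambda>n x. max a (min b (h n x))"])
    show "continuous_on UNIV (\<lambda>x. max a (min b (h n x)))" for n by (intro continuous_on_max continuous_on_min continuous_on_const h(1))
    show "AE x in lborel. (\<lambda>n. max a (min b (h n x))) \<longlonglongrightarrow> v x"
      using ae
    proof eventually_elim
      case (elim x)
      have "(\<lambda>n. max a (min b (h n x))) \<longlonglongrightarrow> max a (min b (v x))" by (intro tendsto_max tendsto_min tendsto_const h(2) elim)
      then show ?case using b[of x] by simp
    qed
  qed (use ab in auto)
qed

lemma eventually_real_ge: "eventually (\<lambda>n. c \<le> real n) sequentially"
  using filterlim_real_sequentially by (simp add: filterlim_at_top)

lemma AE_snd:
  assumes "AE t in (lborel :: real measure). P t"
  shows "AE p in (lborel :: (real \<times> real) measure). P (snd p)"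
proof -
  obtain N where N: "{t \<in> space lborel. \<not> P t} \<subseteq> N" "emeasure lborel N = 0" "N \<in> sets (lborel :: real measure)"
    using assms by (rule AE_E)
  show ?thesis
  proof (rule AE_I[where N="UNIV \<times> N"])
    have "emeasure (lborel \<Otimes>\<^sub>M lborel) ((UNIV :: real set) \<times> N) = emeasure lborel (UNIV :: real set) * emeasure lborel N"
      using N(3) by (intro lborel.emeasure_pair_measure_Times) auto
    then show "emeasure lborel ((UNIV :: real set) \<times> N) = 0" using N(2) by (simp add: lborel_prod)
    have "(UNIV :: real set) \<times> N \<in> sets (lborel \<Otimes>\<^sub>M lborel)" using N(3) by (intro pair_measureI) auto
    then show "(UNIV :: real set) \<times> N \<in> sets lborel" by (simp only: lborel_prod)
  qed (use N(1) in auto)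
qed

context mfg_linear begin

text \<open>Time profile of the test density. Without truncation the pairing with |\<mu>| would be
  the quantity to be bounded itself, which might be infinite, and then half of it could not be
  subtracted.\<close>

definition "trunc l N t = indicator {0<..<T} t * (exp (- l * t) * min (f t) N)"

lemma f_meas: "f \<in> borel_measurable borel" and g_meas: "g \<in> borel_measurable borel"
  using borel_measurable_integrable[OF f_int] borel_measurable_integrable[OF g_int] by simp_all

lemma trunc_bounds:
  assumes "l > 0" "N \<ge> 0" shows "0 \<le> trunc l N t" "trunc l N t \<le> N" "trunc l N \<in> borel_measurable borel"
proof -
  show "0 \<le> trunc l N t" using f_nonneg[of t] assms by (simp add: trunc_def)
  have "exp (- l * t) * min (f t) N \<le> 1 * N" if "t > 0"
    using that assms f_nonneg[of t] by (intro mult_mono) auto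
  then show "trunc l N t \<le> N" using assms by (simp add: trunc_def indicator_def)
  show "trunc l N \<in> borel_measurable borel" unfolding trunc_def[abs_def] using f_meas by simp
qed

text \<open>Pairing \<mu> with sgn \<mu> times the profile dominates the weighted norm of the
  profile, and half of that norm returns from \<open>weak_bound\<close>. Being finite, it can be
  subtracted.\<close>

lemma truncated_bound:
  assumes l: "0 < l0" "l0 \<le> l" and N: "N \<ge> 0"
    and Y: "integrable lborel (\<lambda>t. indicator {0..T} t * (exp (- l * t) * (g t)\<^sup>2))"
  shows "wnorm T l (trunc l N) \<le> dual_const l0 * Y l"
proof -
  have lp: "l > 0" using l by simp
  note W = trunc_bounds[OF lp N]
  obtain \<omega> where \<omega>: "\<And>n. continuous_on UNIV (\<omega> n)" "\<And>n x. 0 \<le> \<omega> n x" "\<And>n x. \<omega> n x \<le> N" "AE x in lborel. (\<lambda>n. \<omega> n x) \<longlonglongrightarrow> trunc l N x"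
    by (rule continuous_AE_approx[OF W(3,1,2)]) (rule that)
  have \<mu>m: "res T \<mu> \<in> borel_measurable borel" using borel_measurable_integrable[OF \<mu>_int] by simp
  obtain k where k: "\<And>n. continuous_on UNIV (k n)" "\<And>n x. - 1 \<le> k n x" "\<And>n x. k n x \<le> 1" "AE x in lborel. (\<lambda>n. k n x) \<longlonglongrightarrow> sgn (res T \<mu> x)"
    by (rule continuous_AE_approx[of "\<lambda>p. sgn (res T \<mu> p)" "-1" 1]) (use \<mu>m in \<open>auto simp: sgn_real_def intro: that\<close>)
  define R where "R = (\<lambda>n. real n + 1)"
  have R: "R n > 0" for n by (simp add: R_def)
  define cx where "cx = (\<lambda>n x. max 0 (min 1 (R n - \<bar>x\<bar>)))"
  define ct where "ct = (\<lambda>n t. max 0 (min 1 (R n * (T - t) - 1)))"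
  \<comment> \<open>An odd ramp, cutoffs at infinity and before T, an approximation of the sign and
    one of the profile. The sign is evaluated at |x|, so that it is even and oddness comes from
    \<open>ramp\<close> alone.\<close>
  define H where "H = (\<lambda>n p. ramp (R n) (fst p) * cx n (fst p) * ct n (snd p) * k n (\<bar>fst p\<bar>, snd p) * \<omega> n (snd p))"
  define \<psi> where "\<psi> = (\<lambda>n x t. H n (x, tclamp T t))"
  have ra: "\<bar>ramp (R n) x * cx n x * ct n t * k n p\<bar> \<le> 1" for n x t p
  proof -
    have "\<bar>ramp (R n) x\<bar> * \<bar>cx n x\<bar> * \<bar>ct n t\<bar> * \<bar>k n p\<bar> \<le> 1 * 1 * 1 * 1"
      using ramp(1)[of "R n" x] k(2,3)[of n p] by (intro mult_mono mult_nonneg_nonneg) (auto simp: cx_def ct_def abs_le_iff)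
    then show ?thesis by (simp add: abs_mult)
  qed
  have H_le: "\<bar>H n p\<bar> \<le> \<omega> n (snd p)" for n p
    using mult_right_mono[OF ra[of n "fst p" "snd p" "(\<bar>fst p\<bar>, snd p)"] \<omega>(2)[of n "snd p"]] \<omega>(2)[of n "snd p"] by (simp add: H_def abs_mult)
  have H_cont: "continuous_on UNIV (H n)" for n
    unfolding H_def cx_def ct_def
    by (intro continuous_on_mult continuous_ramp continuous_on_max continuous_on_min continuous_on_diff continuous_on_const continuous_on_fst continuous_on_snd continuous_on_id continuous_on_rabs
      continuous_on_compose2[OF k(1)] continuous_on_compose2[OF \<omega>(1)] continuous_on_Pair subset_UNIV)
  have H0: "H n (x, t) = 0" if "R n \<le> \<bar>x\<bar>" for n x t using that by (simp add: H_def cx_def)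
  note \<psi>c = compact_support_extension[OF H_cont H0 T0]
  have odd: "\<psi> n (- x) t = - \<psi> n x t" for n x t by (simp add: \<psi>_def H_def ramp(2) cx_def)
  define S where "S = (\<lambda>n. T - 1 / R n)"
  have S: "S n < T" for n using R[of n] by (simp add: S_def)
  have zero: "\<psi> n x t = 0" if "S n \<le> t" for n x t
  proof -
    have "S n \<le> tclamp T t" using that S[of n] T by (auto simp: tclamp_def)
    then have "R n * (T - tclamp T t) \<le> R n * (1 / R n)" using R[of n] by (intro mult_left_mono) (auto simp: S_def)
    then have "ct n (tclamp T t) = 0" using R[of n] by (simp add: ct_def)
    then show ?thesis by (simp add: \<psi>_def H_def)
  qed
  have le: "\<bar>\<psi> n x t\<bar> \<le> \<omega> n t" if "t \<in> {0..T}" for n x t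
    using H_le[of n "(x, tclamp T t)"] that by (simp add: \<psi>_def tclamp(2))
  have step: "(LBINT p. res T \<mu> p * res T (\<psi> n) p) \<le> 1/2 * wnorm T l (\<omega> n) + dual_const l0 / 2 * Y l" for n
  proof (rule weak_bound[where S="S n"])
    show "bcont (\<psi> n)" unfolding \<psi>_def by (rule \<psi>c(1))
    show "ucont_x (\<psi> n)" unfolding \<psi>_def by (rule \<psi>c(2))
  qed (fact odd zero le \<omega>(1) S l Y | rule zero le; assumption)+
  have Wm: "(\<lambda>p. trunc l N (snd p)) \<in> borel_measurable (borel :: (real \<times> real) measure)"
    using W(3) by (simp add: borel_prod[symmetric])
  have 1: "(\<lambda>n. \<integral>p. res T \<mu> p * res T (\<psi> n) p \<partial>lborel) \<longlonglongrightarrow> (LBINT p. res T \<mu> p * (sgn (res T \<mu> p) * trunc l N (snd p)))"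
  proof (rule tendsto_integral_mult_bounded[OF \<mu>_int, where B=N])
    show "res T (\<psi> n) \<in> borel_measurable lborel" for n
      using bstrip_res(1)[OF bcont_bstrip[OF \<psi>c(1)]] by (simp add: \<psi>_def)
    show "(\<lambda>p. sgn (res T \<mu> p) * trunc l N (snd p)) \<in> borel_measurable lborel" using \<mu>m Wm by simp
    show "\<bar>res T (\<psi> n) p\<bar> \<le> N" for n p
      using order_trans[OF le \<omega>(3)] N by (cases p) (auto simp: res_simps)
    show "AE p in lborel. (\<lambda>n. res T (\<psi> n) p) \<longlonglongrightarrow> sgn (res T \<mu> p) * trunc l N (snd p)"
      using k(4) AE_snd[OF \<omega>(4)]
    proof eventually_elim
      case (elim p)
      show ?case
      proof (cases "p \<in> Omega T")
        case True
        obtain x t where p: "p = (x, t)" by (cases p)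
        have x: "x > 0" "t > 0" "t < T" using True by (auto simp: p)
        have c1: "(\<lambda>n. ramp (R n) x) \<longlonglongrightarrow> 1"
        proof (rule tendsto_eventually)
          have "eventually (\<lambda>n. 1 / x \<le> real n) sequentially" by (rule eventually_real_ge)
          then show "eventually (\<lambda>n. ramp (R n) x = 1) sequentially"
          proof eventually_elim
            case (elim n)
            then have "1 / x \<le> R n" by (simp add: R_def)
            then have "1 / R n \<le> x" using R[of n] x by (simp add: field_simps)
            then show ?case by (rule ramp_eq_1[OF R])
          qed
        qed
        have c2: "(\<lambda>n. cx n x) \<longlonglongrightarrow> 1"
        proof (rule tendsto_eventually)
          have "eventually (\<lambda>n. x + 1 \<le> real n) sequentially" by (rule eventually_real_ge)
          then show "eventually (\<lambda>n. cx n x = 1) sequentially" by eventually_elim (use x in \<open>auto simp: cx_def R_def\<close>)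
        qed
        have c3: "(\<lambda>n. ct n t) \<longlonglongrightarrow> 1"
        proof (rule tendsto_eventually)
          have "eventually (\<lambda>n. 2 / (T - t) \<le> real n) sequentially" by (rule eventually_real_ge)
          then show "eventually (\<lambda>n. ct n t = 1) sequentially"
          proof eventually_elim
            case (elim n)
            then have "2 / (T - t) \<le> R n" by (simp add: R_def)
            then have "2 \<le> R n * (T - t)" using x by (simp add: field_simps)
            then show ?case by (simp add: ct_def)
          qed
        qed
        have "(\<lambda>n. ramp (R n) x * cx n x * ct n t * k n p * \<omega> n t) \<longlonglongrightarrow> 1 * 1 * 1 * sgn (res T \<mu> p) * trunc l N t"
          by (intro tendsto_mult c1 c2 c3) (use elim p in auto)
        moreover have "res T (\<psi> n) p = ramp (R n) x * cx n x * ct n t * k n p * \<omega> n t" for n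
          using x by (simp add: p res_simps \<psi>_def H_def tclamp(2))
        ultimately show ?thesis by (simp add: p)
      qed (simp add: res_def)
    qed
  qed
  have wn: "wnorm T l h = (LBINT t. (indicator {0..T} t * exp (l * t)) * (h t)\<^sup>2)" for h
    by (simp add: wnorm_def mult.assoc)
  have 2: "(\<lambda>n. wnorm T l (\<omega> n)) \<longlonglongrightarrow> wnorm T l (trunc l N)"
    unfolding wn
  proof (rule tendsto_integral_mult_bounded[where B="N\<^sup>2"])
    show "integrable lborel (\<lambda>t. indicator {0..T} t * exp (l * t))" using wnorm_integrable[of "\<lambda>t. 1" T 1 l] by simp
    show "\<bar>(\<omega> n t)\<^sup>2\<bar> \<le> N\<^sup>2" for n t using power_mono[OF \<omega>(3,2)] by simp
    show "AE t in lborel. (\<lambda>n. (\<omega> n t)\<^sup>2) \<longlonglongrightarrow> (trunc l N t)\<^sup>2" using \<omega>(4) by eventually_elim (rule tendsto_power)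
  qed (use borel_measurable_continuous_onI[OF \<omega>(1)] W(3) in simp_all)
  have "(LBINT p. res T \<mu> p * (sgn (res T \<mu> p) * trunc l N (snd p))) \<le> 1/2 * wnorm T l (trunc l N) + dual_const l0 / 2 * Y l"
    by (rule LIMSEQ_le[OF 1 tendsto_add[OF tendsto_mult[OF tendsto_const 2] tendsto_const]]) (use step in auto)
  \<comment> \<open>On (0, T), exp(l t) times the profile is min (f t) N, which is at most f
    t.\<close>
  moreover have "wnorm T l (trunc l N) \<le> (LBINT p. res T \<mu> p * (sgn (res T \<mu> p) * trunc l N (snd p)))"
  proof -
    have i: "integrable lborel (\<lambda>p. \<bar>res T \<mu> p\<bar> * trunc l N (snd p))"
      by (rule integrable_mult_bounded[where B=N]) (use \<mu>_int Wm W in simp_all)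
    have s: "r * (sgn r * c) = \<bar>r\<bar> * c" for r c :: real by (simp add: abs_sgn)
    have "(LBINT p. res T \<mu> p * (sgn (res T \<mu> p) * trunc l N (snd p))) = (LBINT t. (LBINT x. \<bar>res T \<mu> (x, t)\<bar> * trunc l N t))"
      unfolding s using lborel_snd(3)[OF i] by simp
    also have "\<dots> = (LBINT t. f t * trunc l N t)"
      by (rule Bochner_Integration.integral_cong[OF refl]) (simp add: f_def)
    finally have e: "(LBINT p. res T \<mu> p * (sgn (res T \<mu> p) * trunc l N (snd p))) = (LBINT t. f t * trunc l N t)" .
    show ?thesis unfolding e wnorm_def
    proof (rule integral_mono)
      show "integrable lborel (\<lambda>t. indicator {0..T} t * (exp (l * t) * (trunc l N t)\<^sup>2))"
        by (rule wnorm_integrable[OF W(3), of _ N]) (use W in auto)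
      show "integrable lborel (\<lambda>t. f t * trunc l N t)"
        by (rule integrable_mult_bounded[OF f_int, where B=N]) (use W in simp_all)
      fix t :: real
      show "indicator {0..T} t * (exp (l * t) * (trunc l N t)\<^sup>2) \<le> f t * trunc l N t"
      proof (cases "t \<in> {0<..<T}")
        case True
        have "exp (l * t) * exp (- l * t) = 1" by (simp add: exp_add[symmetric])
        then have "exp (l * t) * trunc l N t = min (f t) N" using True by (simp add: trunc_def mult.assoc[symmetric])
        then have "exp (l * t) * (trunc l N t)\<^sup>2 = min (f t) N * trunc l N t" by (simp add: power2_eq_square mult.assoc[symmetric])
        also have "\<dots> \<le> f t * trunc l N t" by (rule mult_right_mono[OF _ W(1)]) simp
        finally show ?thesis using True by simp
      qed (simp add: trunc_def)
    qed
  qed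
  ultimately show ?thesis by simp
qed

text \<open>Connects the extended integral of the claim with the real-valued f: for almost every t
  the section of \<mu> is integrable, and the point x = 0 is a null set.\<close>

lemma section_AE: "AE t in lborel. (\<integral>\<^sup>+x\<in>{0..}. ennreal \<bar>\<mu> x t\<bar> \<partial>lborel) * indicator {0<..<T} t = ennreal (f t) * indicator {0<..<T} t"
  using lborel_snd(1)[OF \<mu>_int]
proof eventually_elim
  case (elim t)
  show ?case
  proof (cases "t \<in> {0<..<T}")
    case True
    have "(\<integral>\<^sup>+x\<in>{0..}. ennreal \<bar>\<mu> x t\<bar> \<partial>lborel) = (\<integral>\<^sup>+x. ennreal \<bar>res T \<mu> (x, t)\<bar> \<partial>lborel)"
    proof (rule nn_integral_cong_AE)
      have "AE x in lborel. x \<noteq> (0::real)" by (rule AE_lborel_singleton)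
      then show "AE x in lborel. ennreal \<bar>\<mu> x t\<bar> * indicator {0..} x = ennreal \<bar>res T \<mu> (x, t)\<bar>"
        by eventually_elim (use True in \<open>auto simp: res_simps indicator_def\<close>)
    qed
    also have "\<dots> = ennreal (f t)" unfolding f_def by (rule nn_integral_eq_integral) (use elim in auto)
    finally show ?thesis by simp
  qed simp
qed

lemma weighted_L1_sq_eq: "weighted_L1_sq l T \<mu> = (\<integral>\<^sup>+t. ennreal (indicator {0<..<T} t * (exp (- l * t) * (f t)\<^sup>2)) \<partial>lborel)"
  unfolding weighted_L1_sq_def
proof (rule nn_integral_cong_AE)
  have "AE t in lborel. t \<noteq> (0::real)" "AE t in lborel. t \<noteq> T" by (rule AE_lborel_singleton)+
  with section_AE show "AE t in lborel. ennreal (exp (- l * t)) * (\<integral>\<^sup>+x\<in>{0..}. ennreal \<bar>\<mu> x t\<bar> \<partial>lborel)\<^sup>2 * indicator {0..T} t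
      = ennreal (indicator {0<..<T} t * (exp (- l * t) * (f t)\<^sup>2))"
  proof eventually_elim
    case (elim t)
    then show ?case using f_nonneg[of t]
      by (cases "t \<in> {0<..<T}") (auto simp: ennreal_mult ennreal_power indicator_def)
  qed
qed

text \<open>Monotone convergence in the truncation level, since the bound is the same for every
  N.\<close>

lemma weighted_L1_sq_le:
  assumes l: "0 < l0" "l0 \<le> l"
    and Y: "integrable lborel (\<lambda>t. indicator {0..T} t * (exp (- l * t) * (g t)\<^sup>2))"
  shows "weighted_L1_sq l T \<mu> \<le> ennreal (dual_const l0 * Y l)"
proof -
  have lp: "l > 0" using l by simp
  define X where "X = (\<lambda>n t. ennreal (indicator {0<..<T} t * (exp (- l * t) * (min (f t) (real n))\<^sup>2)))"
  have tr: "indicator {0..T} t * (exp (l * t) * (trunc l N t)\<^sup>2) = indicator {0<..<T} t * (exp (- l * t) * (min (f t) N)\<^sup>2)" for N t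
  proof (cases "t \<in> {0<..<T}")
    case True
    have "exp (l * t) * (exp (- l * t) * exp (- l * t)) = exp (- l * t)" by (simp add: exp_add[symmetric])
    then have "exp (l * t) * (exp (- l * t) * min (f t) N)\<^sup>2 = exp (- l * t) * (min (f t) N)\<^sup>2" by (simp add: power2_eq_square mult_ac)
    then show ?thesis using True by (simp add: trunc_def)
  qed (simp add: trunc_def)
  have X_le: "(\<integral>\<^sup>+t. X n t \<partial>lborel) \<le> ennreal (dual_const l0 * Y l)" for n
  proof -
    have "(\<integral>\<^sup>+t. X n t \<partial>lborel) = ennreal (wnorm T l (trunc l (real n)))"
      unfolding X_def tr[symmetric] wnorm_def
    proof (rule nn_integral_eq_integral)
      show "integrable lborel (\<lambda>t. indicator {0..T} t * (exp (l * t) * (trunc l (real n) t)\<^sup>2))"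
        by (rule wnorm_integrable[of _ _ "real n"]) (use trunc_bounds[OF lp, of "real n"] in auto)
    qed simp
    also have "\<dots> \<le> ennreal (dual_const l0 * Y l)" by (intro ennreal_leI truncated_bound l Y) simp
    finally show ?thesis .
  qed
  have lim: "(\<lambda>n. \<integral>\<^sup>+t. X n t \<partial>lborel) \<longlonglongrightarrow> (\<integral>\<^sup>+t. ennreal (indicator {0<..<T} t * (exp (- l * t) * (f t)\<^sup>2)) \<partial>lborel)"
  proof (rule nn_integral_LIMSEQ)
    show "incseq X" unfolding X_def
      by (intro incseq_SucI le_funI ennreal_leI mult_left_mono power_mono) (use f_nonneg in auto)
    show "X n \<in> borel_measurable lborel" for n unfolding X_def using f_meas by simp
    show "(\<lambda>n. X n t) \<longlonglongrightarrow> ennreal (indicator {0<..<T} t * (exp (- l * t) * (f t)\<^sup>2))" for t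
    proof (rule tendsto_eventually)
      have "eventually (\<lambda>n. f t \<le> real n) sequentially" by (rule eventually_real_ge)
      then show "eventually (\<lambda>n. X n t = ennreal (indicator {0<..<T} t * (exp (- l * t) * (f t)\<^sup>2))) sequentially"
        by eventually_elim (simp add: X_def)
    qed
  qed
  have "(\<integral>\<^sup>+t. ennreal (indicator {0<..<T} t * (exp (- l * t) * (f t)\<^sup>2)) \<partial>lborel) \<le> ennreal (dual_const l0 * Y l)"
    by (rule LIMSEQ_le_const2[OF lim]) (use X_le in auto)
  then show ?thesis by (simp only: weighted_L1_sq_eq)
qed

end

section \<open>The remaining flux in terms of the data\<close>

lemma nn_integral_exp_le:
  assumes "l > 0" shows "(\<integral>\<^sup>+t. ennreal (indicator {0<..<T} t * exp (- l * t)) \<partial>lborel) \<le> ennreal (1 / l)"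
proof -
  have "(\<integral>\<^sup>+t. ennreal (indicator {0<..<T} t * exp (- l * t)) \<partial>lborel) \<le> (\<integral>\<^sup>+t. ennreal (indicator {0<..} t * exp (- l * t)) \<partial>lborel)"
    by (intro nn_integral_mono ennreal_leI mult_right_mono) (auto simp: indicator_def)
  also have "\<dots> = ennreal (LBINT t. indicator {0<..} t * exp (- l * t))"
    by (rule nn_integral_eq_integral) (use exp_tail[OF assms] in \<open>auto simp: has_bochner_integral_iff\<close>)
  also have "\<dots> = ennreal (1 / l)" using exp_tail[OF assms] by (simp add: has_bochner_integral_iff)
  finally show ?thesis .
qed

lemma ennreal_square_add_le:
  fixes a b :: ennreal shows "(a + b)\<^sup>2 \<le> 2 * a\<^sup>2 + 2 * b\<^sup>2"
proof (cases a; cases b)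
  fix x y assume xy: "a = ennreal x" "0 \<le> x" "b = ennreal y" "0 \<le> y"
  have "(x + y)\<^sup>2 \<le> 2 * x\<^sup>2 + 2 * y\<^sup>2" using zero_le_power2[of "x - y"] by (simp add: power2_eq_square algebra_simps)
  then have "ennreal ((x + y)\<^sup>2) \<le> ennreal (2 * x\<^sup>2 + 2 * y\<^sup>2)" by (rule ennreal_leI)
  moreover have "ennreal ((x + y)\<^sup>2) = (a + b)\<^sup>2" using xy by (simp add: ennreal_power[symmetric] ennreal_plus)
  moreover have "ennreal (2 * x\<^sup>2 + 2 * y\<^sup>2) = 2 * a\<^sup>2 + 2 * b\<^sup>2"
    using xy by (simp add: ennreal_power[symmetric] ennreal_plus ennreal_mult)
  ultimately show ?thesis by simp
qed (auto simp: power2_eq_square ennreal_mult_top ennreal_top_mult)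

lemma diff_quot_LIMSEQ:
  assumes "(h has_real_derivative d) (at x)"
  shows "(\<lambda>n. (h (x + inverse (real (Suc n))) - h x) * real (Suc n)) \<longlonglongrightarrow> d"
proof -
  have 1: "((\<lambda>e. (h (x + e) - h x) / e) \<longlongrightarrow> d) (at 0)" using assms by (simp add: DERIV_def)
  have 2: "filterlim (\<lambda>n. inverse (real (Suc n))) (at 0) sequentially"
    by (rule filterlim_atI[OF LIMSEQ_inverse_real_of_nat]) simp
  have "(\<lambda>n. (h (x + inverse (real (Suc n))) - h x) / inverse (real (Suc n))) \<longlonglongrightarrow> d"
    by (rule filterlim_compose[OF 1 2])
  then show ?thesis by (simp add: divide_inverse)
qed

lemma weighted_energy_antimono:
  assumes "l \<le> l'" shows "weighted_energy l' T w m \<le> weighted_energy l T w m"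
  unfolding weighted_energy_def
proof (rule nn_integral_mono)
  fix t :: real
  show "ennreal (exp (- l' * t)) * (\<integral>\<^sup>+x\<in>{0..}. ennreal ((D_x w x t)\<^sup>2 * m x t) \<partial>lborel) * indicator {0..T} t
      \<le> ennreal (exp (- l * t)) * (\<integral>\<^sup>+x\<in>{0..}. ennreal ((D_x w x t)\<^sup>2 * m x t) \<partial>lborel) * indicator {0..T} t"
  proof (cases "t \<in> {0..T}")
    case True
    then have "- l' * t \<le> - l * t" using assms by (simp add: mult_right_mono)
    then show ?thesis by (intro mult_right_mono ennreal_leI) auto
  qed simp
qed

context mfg_linear begin

lemma res_\<Phi>_meas: "res T \<Phi> \<in> borel_measurable borel"
  using \<Phi> unfolding LinfL1_def set_borel_measurable_def by (simp add: res_def[abs_def] case_prod_unfold)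

text \<open>Measurability is given for w only. Its derivative is a pointwise limit of difference
  quotients to the right, which stay inside the strip.\<close>

lemma D_x_w_meas: "res T (D_x w) \<in> borel_measurable borel"
proof -
  have w: "res T w \<in> borel_measurable borel"
    using lin unfolding linear_FP_solution_def set_borel_measurable_def by (simp add: res_def[abs_def] case_prod_unfold)
  define k where "k = (\<lambda>n p. indicator (Omega T) p * ((res T w (fst p + inverse (real (Suc n)), snd p) - res T w p) * real (Suc n)))"
  have sh: "(\<lambda>p. res T w (fst p + c, snd p)) \<in> borel_measurable borel" for c
  proof -
    have "(\<lambda>p. (fst p + c, snd p)) \<in> borel_measurable (borel :: (real \<times> real) measure)"
      by (intro borel_measurable_continuous_onI continuous_intros)
    then show ?thesis using w by (rule measurable_compose)
  qed
  show ?thesis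
  proof (rule borel_measurable_LIMSEQ_real)
    show "k n \<in> borel_measurable borel" for n
      unfolding k_def using sh w Omega_sets[of T] by simp
    show "(\<lambda>n. k n p) \<longlonglongrightarrow> res T (D_x w) p" for p
    proof (cases "p \<in> Omega T")
      case True
      obtain x t where p: "p = (x, t)" by (cases p)
      have x: "x > 0" "t > 0" "t < T" using True by (auto simp: p)
      have "(\<lambda>y. w y t) differentiable (at x)" using lin x unfolding linear_FP_solution_def by auto
      then have "((\<lambda>y. w y t) has_vector_derivative vector_derivative (\<lambda>y. w y t) (at x)) (at x)"
        by (simp add: vector_derivative_works)
      then have "((\<lambda>y. w y t) has_real_derivative D_x w x t) (at x)"
        using at_within_pos[OF x(1)] by (simp add: D_x_def has_real_derivative_iff_has_vector_derivative)
      from diff_quot_LIMSEQ[OF this] show ?thesis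
        using x by (simp add: p k_def res_simps add_pos_pos)
    qed (simp add: k_def res_def)
  qed
qed

definition "En t = (\<integral>\<^sup>+x. ennreal ((res T (D_x w) (x, t))\<^sup>2 * res T m (x, t)) \<partial>lborel)"

lemma En_meas: "En \<in> borel_measurable borel"
proof -
  define H where "H = (\<lambda>p. ennreal ((res T (D_x w) p)\<^sup>2 * res T m p))"
  have "H \<in> borel_measurable borel" unfolding H_def using D_x_w_meas bstrip_res(1)[OF bm(1)] by simp
  then have H: "H \<in> borel_measurable (lborel \<Otimes>\<^sub>M lborel)" by (simp add: lborel_prod)
  have "(\<lambda>z. H (case z of (t, x) \<Rightarrow> (x, t))) \<in> borel_measurable (lborel \<Otimes>\<^sub>M lborel)"
    by (rule measurable_compose[OF measurable_pair_swap' H])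
  moreover have "(\<lambda>z. H (case z of (t, x) \<Rightarrow> (x, t))) = case_prod (\<lambda>t x. H (x, t))" by (auto simp: fun_eq_iff)
  ultimately have "case_prod (\<lambda>t x. H (x, t)) \<in> borel_measurable (lborel \<Otimes>\<^sub>M lborel)" by (simp only:)
  from lborel.borel_measurable_nn_integral[OF this] show ?thesis unfolding En_def[abs_def] H_def by simp
qed

lemma En_eq: "t \<in> {0<..<T} \<Longrightarrow> En t = (\<integral>\<^sup>+x\<in>{0..}. ennreal ((D_x w x t)\<^sup>2 * m x t) \<partial>lborel)"
  unfolding En_def by (rule nn_integral_cong) (use m_0[of t] in \<open>auto simp: res_simps indicator_def\<close>)

text \<open>Cauchy-Schwarz for |w_x| sqrt m and sqrt m, with the mass of m at most 1.\<close>

lemma mDw_le: "(\<integral>\<^sup>+x. ennreal (\<bar>res T (D_x w) (x, t)\<bar> * res T m (x, t)) \<partial>lborel)\<^sup>2 \<le> En t"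
proof -
  have [measurable]: "(\<lambda>x. res T (D_x w) (x, t)) \<in> borel_measurable borel" "(\<lambda>x. res T m (x, t)) \<in> borel_measurable borel"
    by (rule section_measurable[OF D_x_w_meas], rule section_measurable[OF bstrip_res(1)[OF bm(1)]])
  let ?s = "\<lambda>x. sqrt (res T m (x, t))"
  have s: "?s x * ?s x = res T m (x, t)" "?s x \<ge> 0" for x using res_m_nonneg by simp_all
  have "(\<integral>\<^sup>+x. ennreal (\<bar>res T (D_x w) (x, t)\<bar> * res T m (x, t)) \<partial>lborel) = (\<integral>\<^sup>+x. ennreal (\<bar>res T (D_x w) (x, t)\<bar> * ?s x) * ennreal (?s x) \<partial>lborel)"
  proof (rule nn_integral_cong)
    fix x :: real
    have "\<bar>res T (D_x w) (x, t)\<bar> * res T m (x, t) = (\<bar>res T (D_x w) (x, t)\<bar> * ?s x) * ?s x" by (simp only: mult.assoc s(1))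
    then show "ennreal (\<bar>res T (D_x w) (x, t)\<bar> * res T m (x, t)) = ennreal (\<bar>res T (D_x w) (x, t)\<bar> * ?s x) * ennreal (?s x)"
      using s(2)[of x] by (simp only: ennreal_mult[symmetric] mult_nonneg_nonneg abs_ge_zero)
  qed
  then have "(\<integral>\<^sup>+x. ennreal (\<bar>res T (D_x w) (x, t)\<bar> * res T m (x, t)) \<partial>lborel)\<^sup>2
      \<le> (\<integral>\<^sup>+x. (ennreal (\<bar>res T (D_x w) (x, t)\<bar> * ?s x))\<^sup>2 \<partial>lborel) * (\<integral>\<^sup>+x. (ennreal (?s x))\<^sup>2 \<partial>lborel)"
    using Cauchy_Schwarz_nn_integral[of "\<lambda>x. ennreal (\<bar>res T (D_x w) (x, t)\<bar> * ?s x)" lborel "\<lambda>x. ennreal (?s x)"] by simp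
  also have "(\<integral>\<^sup>+x. (ennreal (\<bar>res T (D_x w) (x, t)\<bar> * ?s x))\<^sup>2 \<partial>lborel) = En t"
    unfolding En_def by (rule nn_integral_cong) (use s in \<open>simp add: ennreal_power power_mult_distrib\<close>)
  also have "(\<integral>\<^sup>+x. (ennreal (?s x))\<^sup>2 \<partial>lborel) = (\<integral>\<^sup>+x. ennreal (res T m (x, t)) \<partial>lborel)"
    by (rule nn_integral_cong) (use s in \<open>simp add: ennreal_power\<close>)
  also have "En t * \<dots> \<le> En t * 1" by (rule mult_left_mono[OF nn_m_le]) simp
  finally show ?thesis by simp
qed

text \<open>Once \<open>I\<close> is removed, the nonlocal term is \<beta>/2 times m times the
  integral of m w_x. Since \<beta> and the mass of m are at most 1, this term and the local one each
  contribute at most half the integral of |w_x| m.\<close>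

lemma g_le: "AE t in lborel. t \<in> {0<..<T} \<longrightarrow> ennreal (g t) \<le> LinfL1_norm T \<Phi> + (\<integral>\<^sup>+x. ennreal (\<bar>res T (D_x w) (x, t)\<bar> * res T m (x, t)) \<partial>lborel)"
proof -
  have a: "AE t in lborel. t \<in> {0<..<T} \<longrightarrow> (\<integral>\<^sup>+x\<in>{0..}. ennreal \<bar>\<Phi> x t\<bar> \<partial>lborel) \<le> LinfL1_norm T \<Phi>"
    using esssup_AE[of "\<lambda>t. \<integral>\<^sup>+x\<in>{0..}. ennreal \<bar>\<Phi> x t\<bar> \<partial>lborel" "restrict_space lborel {0<..<T}"]
    unfolding LinfL1_norm_def[symmetric] by (subst (asm) AE_restrict_space_iff) auto
  have b: "AE t in lborel. t \<in> {0<..<T} \<longrightarrow> set_integrable lborel {0..} (\<lambda>x. D_x u x t * \<mu> x t + m x t * D_x w x t)"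
    using lin unfolding linear_FP_solution_def by blast
  show ?thesis
    using a b lborel_snd(1)[OF u\<mu>_int] lborel_snd(1)[OF q0_int]
  proof eventually_elim
    case (elim t)
    show ?case
    proof
      assume t: "t \<in> {0<..<T}"
      have tI: "t \<in> {0..T}" using t by auto
      define V where "V = (\<integral>\<^sup>+x. ennreal (\<bar>res T (D_x w) (x, t)\<bar> * res T m (x, t)) \<partial>lborel)"
      have [measurable]: "(\<lambda>x. res T (D_x w) (x, t)) \<in> borel_measurable borel" "(\<lambda>x. res T m (x, t)) \<in> borel_measurable borel" "(\<lambda>x. res T \<Phi> (x, t)) \<in> borel_measurable borel"
        by (rule section_measurable[OF D_x_w_meas], rule section_measurable[OF bstrip_res(1)[OF bm(1)]], rule section_measurable[OF res_\<Phi>_meas])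
      let ?k = "\<lambda>x. res T m (x, t) * res T (D_x w) (x, t)"
      let ?a = "\<lambda>x. res T (\<lambda>x t. D_x u x t * \<mu> x t) (x, t)"
      let ?s = "\<lambda>x. indicator {0..} x * (D_x u x t * \<mu> x t + m x t * D_x w x t)"
      have si: "integrable lborel ?s" using elim(2) t by (simp add: set_integrable_def)
      have eq: "?s x = ?a x + ?k x" if "x \<notin> {0}" for x using that t by (auto simp: res_simps indicator_def)
      \<comment> \<open>The integrability clause concerns the sum. As u_x \<mu> is integrable for
        almost every t, so is m w_x, and the integral in G may be split.\<close>
      have "integrable lborel (\<lambda>x. ?a x + ?k x)"
        using integrable_discrete_difference[of "{0}" lborel ?s "\<lambda>x. ?a x + ?k x"] si eq by simp
      from Bochner_Integration.integrable_diff[OF this elim(3)] have ki: "integrable lborel ?k" by simp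
      define Ew where "Ew = (LBINT x. ?k x)"
      have "(LBINT x:{0..}. D_x u x t * \<mu> x t + m x t * D_x w x t) = (LBINT x. ?a x + ?k x)"
        using integral_discrete_difference[of "{0}" lborel ?s "\<lambda>x. ?a x + ?k x"] eq by (simp add: set_lebesgue_integral_def)
      also have "\<dots> = I t + Ew" unfolding I_def Ew_def by (rule Bochner_Integration.integral_add[OF elim(3) ki])
      finally have G: "lin_G \<epsilon> \<xi> u m w \<mu> t = \<beta> t * (I t + Ew)" by (simp add: lin_G_def \<beta>_def)
      have Ew_le: "ennreal \<bar>Ew\<bar> \<le> V"
      proof -
        have "ennreal (norm Ew) \<le> (\<integral>\<^sup>+x. ennreal (norm (?k x)) \<partial>lborel)" unfolding Ew_def by (rule integral_norm_bound_ennreal[OF ki])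
        also have "\<dots> = V" unfolding V_def using res_m_nonneg by (intro nn_integral_cong) (simp add: abs_mult mult.commute)
        finally show ?thesis by simp
      qed
      have pt: "\<bar>q0 (x, t)\<bar> \<le> \<bar>res T \<Phi> (x, t)\<bar> + (1/2 * \<bar>Ew\<bar> * res T m (x, t) + 1/2 * (\<bar>res T (D_x w) (x, t)\<bar> * res T m (x, t)))" for x
      proof (cases "x > 0")
        case True
        have "q0 (x, t) = \<Phi> x t + 1/2 * (\<beta> t * Ew) * m x t - 1/2 * (D_x w x t * m x t)"
          using True t tI by (simp add: q0_def res_simps q_def bI_def tclamp(2) G algebra_simps)
        moreover have "\<bar>1/2 * (\<beta> t * Ew) * m x t\<bar> \<le> 1/2 * (1 * \<bar>Ew\<bar>) * m x t"
          unfolding abs_mult using \<beta>[OF tI] m_nonneg[OF less_imp_le[OF True] tI] by (intro mult_mono) auto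
        moreover have "\<bar>1/2 * (D_x w x t * m x t)\<bar> = 1/2 * (\<bar>D_x w x t\<bar> * m x t)"
          unfolding abs_mult using m_nonneg[OF less_imp_le[OF True] tI] by simp
        ultimately show ?thesis using True t by (simp add: res_simps)
      qed (simp add: q0_def res_simps)
      have "ennreal (g t) = (\<integral>\<^sup>+x. ennreal \<bar>q0 (x, t)\<bar> \<partial>lborel)"
        unfolding g_def by (rule nn_integral_eq_integral[symmetric]) (use elim(4) in auto)
      also have "\<dots> \<le> (\<integral>\<^sup>+x. ennreal \<bar>res T \<Phi> (x, t)\<bar> + (ennreal (1/2 * \<bar>Ew\<bar>) * ennreal (res T m (x, t)) + ennreal (1/2) * ennreal (\<bar>res T (D_x w) (x, t)\<bar> * res T m (x, t))) \<partial>lborel)"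
      proof (rule nn_integral_mono)
        fix x :: real
        have "ennreal \<bar>q0 (x, t)\<bar> \<le> ennreal (\<bar>res T \<Phi> (x, t)\<bar> + (1/2 * \<bar>Ew\<bar> * res T m (x, t) + 1/2 * (\<bar>res T (D_x w) (x, t)\<bar> * res T m (x, t))))"
          by (rule ennreal_leI[OF pt])
        also have "\<dots> = ennreal \<bar>res T \<Phi> (x, t)\<bar> + (ennreal (1/2 * \<bar>Ew\<bar> * res T m (x, t)) + ennreal (1/2 * (\<bar>res T (D_x w) (x, t)\<bar> * res T m (x, t))))"
          using res_m_nonneg by (simp add: ennreal_plus)
        also have "\<dots> = ennreal \<bar>res T \<Phi> (x, t)\<bar> + (ennreal (1/2 * \<bar>Ew\<bar>) * ennreal (res T m (x, t)) + ennreal (1/2) * ennreal (\<bar>res T (D_x w) (x, t)\<bar> * res T m (x, t)))"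
          using ennreal_mult[of "1/2 * \<bar>Ew\<bar>" "res T m (x, t)"] ennreal_mult[of "1/2" "\<bar>res T (D_x w) (x, t)\<bar> * res T m (x, t)"] res_m_nonneg by simp
        finally show "ennreal \<bar>q0 (x, t)\<bar> \<le> ennreal \<bar>res T \<Phi> (x, t)\<bar> + (ennreal (1/2 * \<bar>Ew\<bar>) * ennreal (res T m (x, t)) + ennreal (1/2) * ennreal (\<bar>res T (D_x w) (x, t)\<bar> * res T m (x, t)))" .
      qed
      also have "\<dots> = (\<integral>\<^sup>+x. ennreal \<bar>res T \<Phi> (x, t)\<bar> \<partial>lborel) + (ennreal (1/2 * \<bar>Ew\<bar>) * (\<integral>\<^sup>+x. ennreal (res T m (x, t)) \<partial>lborel) + ennreal (1/2) * V)"
        unfolding V_def by (simp add: nn_integral_add nn_integral_cmult)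
      also have "\<dots> \<le> LinfL1_norm T \<Phi> + (ennreal (1/2 * \<bar>Ew\<bar>) * 1 + ennreal (1/2) * V)"
      proof (intro add_mono mult_left_mono nn_m_le order_refl)
        have "(\<integral>\<^sup>+x. ennreal \<bar>res T \<Phi> (x, t)\<bar> \<partial>lborel) \<le> (\<integral>\<^sup>+x\<in>{0..}. ennreal \<bar>\<Phi> x t\<bar> \<partial>lborel)"
          by (rule nn_integral_mono) (use t in \<open>auto simp: res_simps indicator_def\<close>)
        then show "(\<integral>\<^sup>+x. ennreal \<bar>res T \<Phi> (x, t)\<bar> \<partial>lborel) \<le> LinfL1_norm T \<Phi>" using elim(1) t by auto
      qed simp_all
      also have "\<dots> \<le> LinfL1_norm T \<Phi> + (ennreal (1/2) * V + ennreal (1/2) * V)"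
      proof -
        have "ennreal (1/2 * \<bar>Ew\<bar>) = ennreal (1/2) * ennreal \<bar>Ew\<bar>" by (rule ennreal_mult) auto
        then have "ennreal (1/2 * \<bar>Ew\<bar>) * 1 \<le> ennreal (1/2) * V" using mult_left_mono[OF Ew_le, of "ennreal (1/2)"] by simp
        then show ?thesis by (intro add_left_mono add_right_mono)
      qed
      also have "\<dots> = LinfL1_norm T \<Phi> + V"
      proof -
        have "ennreal (1/2) + ennreal (1/2) = ennreal (1/2 + 1/2)" by (rule ennreal_plus[symmetric]) auto
        then have "ennreal (1/2) + ennreal (1/2) = 1" by simp
        then show ?thesis by (simp only: distrib_right[symmetric] mult_1_left)
      qed
      finally show "ennreal (g t) \<le> LinfL1_norm T \<Phi> + (\<integral>\<^sup>+x. ennreal (\<bar>res T (D_x w) (x, t)\<bar> * res T m (x, t)) \<partial>lborel)"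
        unfolding V_def .
    qed
  qed
qed

text \<open>The norm of \<Phi> is constant in time, and exp(-l t) has integral at most 1/l; the 2 is
  from the square of a sum.\<close>

lemma flux_term_le:
  assumes l: "l > 0"
  shows "(\<integral>\<^sup>+t. ennreal (indicator {0..T} t * (exp (- l * t) * (g t)\<^sup>2)) \<partial>lborel) \<le> 2 * (LinfL1_norm T \<Phi>)\<^sup>2 * ennreal (1 / l) + 2 * weighted_energy l T w m"
proof -
  define N where "N = LinfL1_norm T \<Phi>"
  let ?e = "\<lambda>t. ennreal (indicator {0<..<T} t * exp (- l * t))"
  have "(\<integral>\<^sup>+t. ennreal (indicator {0..T} t * (exp (- l * t) * (g t)\<^sup>2)) \<partial>lborel) \<le> (\<integral>\<^sup>+t. 2 * N\<^sup>2 * ?e t + 2 * (?e t * En t) \<partial>lborel)"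
  proof (rule nn_integral_mono_AE)
    have "AE t in lborel. t \<noteq> (0::real)" "AE t in lborel. t \<noteq> T" by (rule AE_lborel_singleton)+
    with g_le show "AE t in lborel. ennreal (indicator {0..T} t * (exp (- l * t) * (g t)\<^sup>2)) \<le> 2 * N\<^sup>2 * ?e t + 2 * (?e t * En t)"
    proof eventually_elim
      case (elim t)
      show ?case
      proof (cases "t \<in> {0<..<T}")
        case True
        have "(ennreal (g t))\<^sup>2 \<le> (N + (\<integral>\<^sup>+x. ennreal (\<bar>res T (D_x w) (x, t)\<bar> * res T m (x, t)) \<partial>lborel))\<^sup>2"
          using elim True by (intro power_mono) (auto simp: N_def)
        also have "\<dots> \<le> 2 * N\<^sup>2 + 2 * (\<integral>\<^sup>+x. ennreal (\<bar>res T (D_x w) (x, t)\<bar> * res T m (x, t)) \<partial>lborel)\<^sup>2" by (rule ennreal_square_add_le)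
        also have "\<dots> \<le> 2 * N\<^sup>2 + 2 * En t" by (intro add_left_mono mult_left_mono mDw_le) auto
        finally have "ennreal (exp (- l * t)) * (ennreal (g t))\<^sup>2 \<le> ennreal (exp (- l * t)) * (2 * N\<^sup>2 + 2 * En t)" by (rule mult_left_mono) simp
        moreover have "ennreal (exp (- l * t)) * (ennreal (g t))\<^sup>2 = ennreal (exp (- l * t) * (g t)\<^sup>2)"
          using g_nonneg[of t] by (simp add: ennreal_power ennreal_mult)
        ultimately show ?thesis using True by (simp add: distrib_left mult_ac)
      next
        case False
        then show ?thesis using elim by (auto simp: indicator_def)
      qed
    qed
  qed
  also have "\<dots> = 2 * N\<^sup>2 * (\<integral>\<^sup>+t. ?e t \<partial>lborel) + 2 * (\<integral>\<^sup>+t. ?e t * En t \<partial>lborel)"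
    using En_meas by (simp add: nn_integral_add nn_integral_cmult)
  also have "\<dots> \<le> 2 * N\<^sup>2 * ennreal (1 / l) + 2 * weighted_energy l T w m"
  proof (intro add_mono mult_left_mono nn_integral_exp_le l)
    show "(\<integral>\<^sup>+t. ?e t * En t \<partial>lborel) \<le> weighted_energy l T w m"
      unfolding weighted_energy_def by (rule nn_integral_mono) (auto simp: En_eq indicator_def)
  qed auto
  finally show ?thesis by (simp add: N_def)
qed

text \<open>On [0, T] one has exp(-l t) \<le> 1 \<le> exp(2 c T) exp(-2 c t). This carries the
  estimate from the rate 2 c, which lies above the threshold c, to small rates.\<close>

lemma weighted_L1_sq_low:
  assumes "0 < l" "0 < c"
  shows "weighted_L1_sq l T \<mu> \<le> ennreal (exp (2 * c * T)) * weighted_L1_sq (2 * c) T \<mu>"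
proof -
  have "(\<integral>\<^sup>+t. ennreal (indicator {0<..<T} t * (exp (- l * t) * (f t)\<^sup>2)) \<partial>lborel)
      \<le> (\<integral>\<^sup>+t. ennreal (exp (2 * c * T)) * ennreal (indicator {0<..<T} t * (exp (- (2 * c) * t) * (f t)\<^sup>2)) \<partial>lborel)"
  proof (rule nn_integral_mono)
    fix t :: real
    show "ennreal (indicator {0<..<T} t * (exp (- l * t) * (f t)\<^sup>2)) \<le> ennreal (exp (2 * c * T)) * ennreal (indicator {0<..<T} t * (exp (- (2 * c) * t) * (f t)\<^sup>2))"
    proof (cases "t \<in> {0<..<T}")
      case True
      have "- l * t \<le> 0" "c * t \<le> c * T" using True assms by simp_all
      then have "- l * t \<le> 2 * c * T + (- (2 * c) * t)" by simp
      then have "exp (- l * t) \<le> exp (2 * c * T) * exp (- (2 * c) * t)" unfolding exp_add[symmetric] by simp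
      then have "exp (- l * t) * (f t)\<^sup>2 \<le> (exp (2 * c * T) * exp (- (2 * c) * t)) * (f t)\<^sup>2" by (rule mult_right_mono) simp
      then have "ennreal (exp (- l * t) * (f t)\<^sup>2) \<le> ennreal (exp (2 * c * T) * (exp (- (2 * c) * t) * (f t)\<^sup>2))"
        by (intro ennreal_leI) (simp only: mult.assoc)
      then show ?thesis using True by (simp add: ennreal_mult)
    qed simp
  qed
  also have "\<dots> = ennreal (exp (2 * c * T)) * (\<integral>\<^sup>+t. ennreal (indicator {0<..<T} t * (exp (- (2 * c) * t) * (f t)\<^sup>2)) \<partial>lborel)"
    by (rule nn_integral_cmult) (use f_meas in simp)
  finally show ?thesis by (simp only: weighted_L1_sq_eq)
qed

lemma linear_estimate:
  assumes l: "0 < l0" "l0 \<le> l"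
  shows "weighted_L1_sq l T \<mu> \<le> ennreal (2 * dual_const l0) * (LinfL1_norm T \<Phi>)\<^sup>2 / ennreal l0 + ennreal (2 * dual_const l0) * weighted_energy l T w m"
proof -
  have lp: "l > 0" using l by simp
  have "CE l0 \<ge> 0" by (simp add: CE_def)
  then have D: "dual_const l0 > 0" unfolding dual_const_def using l
    by (intro mult_pos_pos add_pos_nonneg divide_nonneg_nonneg mult_nonneg_nonneg) auto
  define Z where "Z = (\<integral>\<^sup>+t. ennreal (indicator {0..T} t * (exp (- l * t) * (g t)\<^sup>2)) \<partial>lborel)"
  have "weighted_L1_sq l T \<mu> \<le> ennreal (dual_const l0) * Z"
  \<comment> \<open>An infinite weighted norm of g makes the bound trivial; otherwise the duality
    argument has the integrability it needs.\<close>
  proof (cases "Z = \<infinity>")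
    case True
    then show ?thesis using D by (simp add: ennreal_mult_top)
  next
    case False
    have m: "(\<lambda>t. indicator {0..T} t * (exp (- l * t) * (g t)\<^sup>2)) \<in> borel_measurable lborel" using g_meas by simp
    have i: "integrable lborel (\<lambda>t. indicator {0..T} t * (exp (- l * t) * (g t)\<^sup>2))"
      using False m unfolding Z_def by (intro integrableI_nonneg) (auto simp: less_top)
    have "Z = ennreal (Y l)" unfolding Z_def Y_def by (rule nn_integral_eq_integral[OF i]) simp
    moreover have "Y l \<ge> 0" unfolding Y_def by (intro Bochner_Integration.integral_nonneg) simp
    ultimately show ?thesis using weighted_L1_sq_le[OF l i] D by (simp add: ennreal_mult)
  qed
  also have "\<dots> \<le> ennreal (dual_const l0) * (2 * (LinfL1_norm T \<Phi>)\<^sup>2 * ennreal (1 / l0) + 2 * weighted_energy l T w m)"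
  proof (rule mult_left_mono)
    have "ennreal (1 / l) \<le> ennreal (1 / l0)" using l by (intro ennreal_leI divide_left_mono) auto
    then have "2 * (LinfL1_norm T \<Phi>)\<^sup>2 * ennreal (1 / l) \<le> 2 * (LinfL1_norm T \<Phi>)\<^sup>2 * ennreal (1 / l0)" by (rule mult_left_mono) simp
    then show "Z \<le> 2 * (LinfL1_norm T \<Phi>)\<^sup>2 * ennreal (1 / l0) + 2 * weighted_energy l T w m"
      using flux_term_le[OF lp] unfolding Z_def[symmetric] by (meson add_right_mono order_trans)
  qed simp
  also have "\<dots> = ennreal (2 * dual_const l0) * (LinfL1_norm T \<Phi>)\<^sup>2 / ennreal l0 + ennreal (2 * dual_const l0) * weighted_energy l T w m"
  proof -
    have "ennreal (2 * dual_const l0) = 2 * ennreal (dual_const l0)" using D by (simp add: ennreal_mult)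
    moreover have "ennreal (1 / l0) = inverse (ennreal l0)" using l by (simp add: inverse_ennreal divide_inverse)
    ultimately show ?thesis by (simp add: distrib_left mult_ac divide_ennreal_def)
  qed
  finally show ?thesis .
qed

end

section \<open>The constants of the theorem\<close>

text \<open>\<open>dual_const\<close> at \<open>l0\<close> = \<open>C\<^sub>0 \<sigma> U\<close>,
  written out in \<sigma> and U, because the constants of the theorem are fixed before T, u and
  m.\<close>

definition drift_const :: "real \<Rightarrow> real \<Rightarrow> real" where
  "drift_const \<sigma> U = (2 + 8 * (pi * (4 * (1/2 + 3 / 2 * U) / \<sigma>)\<^sup>2)\<^sup>2 / (C\<^sub>0 \<sigma> U)\<^sup>2) *
     (2 + 4 * U\<^sup>2 * (exp (2 * (1 / (\<sigma>\<^sup>2 * C\<^sub>0 \<sigma> U)) * (3 * U\<^sup>2 + 1)) / \<sigma>\<^sup>2) / C\<^sub>0 \<sigma> U)"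

lemma C\<^sub>0_pos: "\<sigma> > 0 \<Longrightarrow> C\<^sub>0 \<sigma> U > 0"
  unfolding C\<^sub>0_def heat_const_def by (intro mult_pos_pos zero_less_power) (auto simp: add_pos_nonneg)

lemma drift_const_pos: "\<sigma> > 0 \<Longrightarrow> drift_const \<sigma> U > 0"
  unfolding drift_const_def using C\<^sub>0_pos[of \<sigma> U]
  by (intro mult_pos_pos add_pos_nonneg divide_nonneg_nonneg mult_nonneg_nonneg) auto

lemma (in mfg) dual_const_C\<^sub>0: "dual_const (C\<^sub>0 \<sigma> U) = drift_const \<sigma> U"
  by (simp add: dual_const_def drift_const_def CE_def Lam_def)

theorem proposition2p2:
  fixes \<sigma> :: real
  assumes "\<sigma> > 0"
  shows "\<exists>C\<^sub>1 C\<^sub>2 :: real \<Rightarrow> real. (\<forall>U. C\<^sub>1 U > 0 \<and> C\<^sub>2 U > 0) \<and>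
    (\<forall>r T \<xi> m\<^sub>0 u\<^sub>T \<epsilon> u m \<Phi> w \<mu> U.
       mfg_data r T \<xi> m\<^sub>0 u\<^sub>T \<epsilon> \<longrightarrow>
       mfg_unique_solution \<sigma> r T \<xi> m\<^sub>0 u\<^sub>T \<epsilon> u m \<longrightarrow>
       LinfL1 T \<Phi> \<longrightarrow>
       linear_FP_solution \<sigma> T \<xi> \<epsilon> u m \<Phi> w \<mu> \<longrightarrow>
       U = sup_norm T (D_x u) \<longrightarrow>
       (\<forall>l. l > C\<^sub>0 \<sigma> U \<longrightarrow>
          weighted_L1_sq l T \<mu> \<le>
            ennreal (C\<^sub>1 U) * (LinfL1_norm T \<Phi>)\<^sup>2 / ennreal (C\<^sub>0 \<sigma> U)
            + ennreal (C\<^sub>2 U) * weighted_energy l T w m) \<and>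
       (\<forall>l. 0 < l \<and> l \<le> C\<^sub>0 \<sigma> U \<longrightarrow>
          weighted_L1_sq l T \<mu> \<le>
            ennreal (C\<^sub>1 U) * (LinfL1_norm T \<Phi>)\<^sup>2 * ennreal (exp (2 * C\<^sub>0 \<sigma> U * T)) / ennreal (C\<^sub>0 \<sigma> U)
            + ennreal (C\<^sub>2 U) * ennreal (exp (2 * C\<^sub>0 \<sigma> U * T)) * weighted_energy l T w m))"
proof -
  \<comment> \<open>The factor 2 is the one from \<open>flux_term_le\<close>; the same function
    serves as \<open>C\<^sub>1\<close> and as \<open>C\<^sub>2\<close>.\<close>
  define C where "C U = 2 * drift_const \<sigma> U" for U
  have pos: "C U > 0" for U using drift_const_pos[OF assms] by (simp add: C_def)
  have main: "weighted_L1_sq l T \<mu> \<le> ennreal (C U) * (LinfL1_norm T \<Phi>)\<^sup>2 / ennreal (C\<^sub>0 \<sigma> U) + ennreal (C U) * weighted_energy l T w m"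
    if "mfg_data r T \<xi> m\<^sub>0 u\<^sub>T \<epsilon>" "mfg_unique_solution \<sigma> r T \<xi> m\<^sub>0 u\<^sub>T \<epsilon> u m" "LinfL1 T \<Phi>" "linear_FP_solution \<sigma> T \<xi> \<epsilon> u m \<Phi> w \<mu>"
      and U: "U = sup_norm T (D_x u)" and l: "l > C\<^sub>0 \<sigma> U" for r T \<xi> m\<^sub>0 u\<^sub>T \<epsilon> u m \<Phi> w \<mu> U l
  proof -
    interpret L: mfg_linear \<sigma> r T \<xi> m\<^sub>0 u\<^sub>T \<epsilon> u m \<Phi> w \<mu>
      by unfold_locales (use that assms in \<open>auto simp: mfg_unique_solution_def\<close>)
    have "L.U = U" by (simp add: L.U_def U)
    then show ?thesis
      using L.linear_estimate[OF C\<^sub>0_pos[OF assms, of U] less_imp_le[OF l]] L.dual_const_C\<^sub>0 by (simp add: C_def)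
  qed
  have low: "weighted_L1_sq l T \<mu> \<le> ennreal (C U) * (LinfL1_norm T \<Phi>)\<^sup>2 * ennreal (exp (2 * C\<^sub>0 \<sigma> U * T)) / ennreal (C\<^sub>0 \<sigma> U)
      + ennreal (C U) * ennreal (exp (2 * C\<^sub>0 \<sigma> U * T)) * weighted_energy l T w m"
    if "mfg_data r T \<xi> m\<^sub>0 u\<^sub>T \<epsilon>" "mfg_unique_solution \<sigma> r T \<xi> m\<^sub>0 u\<^sub>T \<epsilon> u m" "LinfL1 T \<Phi>" "linear_FP_solution \<sigma> T \<xi> \<epsilon> u m \<Phi> w \<mu>"
      and U: "U = sup_norm T (D_x u)" and l: "0 < l" "l \<le> C\<^sub>0 \<sigma> U" for r T \<xi> m\<^sub>0 u\<^sub>T \<epsilon> u m \<Phi> w \<mu> U l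
  proof -
    interpret L: mfg_linear \<sigma> r T \<xi> m\<^sub>0 u\<^sub>T \<epsilon> u m \<Phi> w \<mu>
      by unfold_locales (use that assms in \<open>auto simp: mfg_unique_solution_def\<close>)
    define c where "c = C\<^sub>0 \<sigma> U"
    have c: "0 < c" "l \<le> 2 * c" "2 * c > c" using l by (simp_all add: c_def)
    \<comment> \<open>The first estimate at the rate 2 c > c. Returning to the rate l costs exp(2 c
      T) on the left, while the energy on the right only grows when the rate is lowered.\<close>
    have "weighted_L1_sq (2 * c) T \<mu> \<le> ennreal (C U) * (LinfL1_norm T \<Phi>)\<^sup>2 / ennreal c + ennreal (C U) * weighted_energy (2 * c) T w m"
      unfolding c_def by (rule main[OF that(1-5)]) (use c in \<open>simp add: c_def\<close>)
    also have "\<dots> \<le> ennreal (C U) * (LinfL1_norm T \<Phi>)\<^sup>2 / ennreal c + ennreal (C U) * weighted_energy l T w m"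
      by (intro add_left_mono mult_left_mono weighted_energy_antimono c) simp
    finally have "ennreal (exp (2 * c * T)) * weighted_L1_sq (2 * c) T \<mu>
        \<le> ennreal (exp (2 * c * T)) * (ennreal (C U) * (LinfL1_norm T \<Phi>)\<^sup>2 / ennreal c + ennreal (C U) * weighted_energy l T w m)"
      by (rule mult_left_mono) simp
    with L.weighted_L1_sq_low[OF l(1) c(1)] have "weighted_L1_sq l T \<mu> \<le> ennreal (exp (2 * c * T)) * (ennreal (C U) * (LinfL1_norm T \<Phi>)\<^sup>2 / ennreal c + ennreal (C U) * weighted_energy l T w m)"
      by (rule order_trans)
    then show ?thesis by (simp add: c_def[symmetric] distrib_left divide_ennreal_def mult_ac)
  qed
  show ?thesis
    by (intro exI[of _ C] conjI allI impI pos)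
      ((rule main, assumption+)[1], rule low, assumption+, erule conjunct1, erule conjunct2)
qed

end
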